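(* Let $K/k$ be a finite abelian $p$-extension with Galois group $\mathrm{Gal}(K/k)=G\cong G_1\times\cdots\times G_s$ with $G_i\cong\mathbb{Z}/p^{\alpha_i}\mathbb{Z}$, $1\le i\le s$. Let $K$ be the composite $K=K_1\cdots K_s$ with $\mathrm{Gal}(K_i/k)\cong G_i$. Let $P_1,\dots,P_r$ be the finite primes of $k$ ramified in $K/k$. Let $K_i=k(\vec w_i)$ be given by the equation $$\vec w_i^{\,p}\stackrel{\bullet}{-}\vec w_i=\vec\xi_i,\qquad 1\le i\le s,$$ where $\vec\xi_i$ is a Witt vector (of some finite length $v_i$) over $k$. Write each $\vec\xi_i$ as $$\vec\xi_i=\vec\delta_{i,1}\stackrel{\bullet}{+}\cdots\stackrel{\bullet}{+}\vec\delta_{i,r}\stackrel{\bullet}{+}\vec\gamma_i,$$ such that all the components of $\vec\delta_{i,j}$ are written so that the degree of the numerator is less than the degree of the denominator and the support of the denominator is at most $\{P_j\}$, and the components of $\vec\gamma_i$ are polynomials. Let $$\vec w_{i,j}^{\,p}\stackrel{\bullet}{-}\vec w_{i,j}=\vec\delta_{i,j},\quad 1\le i\le s,\ 1\le j\le r,\qquad\text{and}\qquad \vec z_i^{\,p}\stackrel{\bullet}{-}\vec z_i=\vec\gamma_i,\quad 1\le i\le s.$$ Then $$K_{\mathfrak{ge}}=k\big(\vec w_{i,j},\vec z_i\mid 1\le i\le s,\ 1\le j\le r\big).$$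
   Context: $k=\mathbb{F}_q(T)$ is a global rational function field of characteristic $p$; finite primes of $k$ are identified with monic irreducible polynomials in $\mathbb{F}_q[T]$, and $P_\infty$ (the infinite prime) is the pole of $T$ in $k$. Witt vectors are $p$-typical, with Witt addition and subtraction $\stackrel{\bullet}{+}$, $\stackrel{\bullet}{-}$; $\vec w^{\,p}$ is obtained by raising each component to the $p$-th power, and $k(\vec w)$ is the field generated over $k$ by the components of $\vec w$ (taken in an algebraic closure of $k$). The support of a denominator is the set of monic irreducible polynomials dividing it. The genus field $F_{\mathfrak{ge}}$ of a finite abelian extension $F/k$ is the maximal extension of $F$ that is abelian over $k$ and contained in the Hilbert class field of $F$, the latter being (Rosen) the maximal abelian extension of $F$ that is unramified at every prime and in which every prime of $F$ above $P_\infty$ decomposes fully. *)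

theory Defs
  imports
    "HOL-Algebra.Algebraic_Closure_Type"
    "HOL-Algebra.Bij"
    "HOL-Algebra.Elementary_Groups"
    "HOL-Algebra.Product_Groups"
    "HOL-Algebra.Generated_Fields"
    "HOL-Library.Poly_Mapping"
begin

section \<open>Witt vectors of finite length\<close>

text \<open>
  Integer polynomials in the indeterminates \<open>X\<^sub>i\<close> (index \<open>Inl i\<close>) and \<open>Y\<^sub>i\<close> (index \<open>Inr i\<close>).
\<close>

type_synonym witt_mpoly = "((nat + nat) \<Rightarrow>\<^sub>0 nat) \<Rightarrow>\<^sub>0 int"

definition mpoly_var :: "nat + nat \<Rightarrow> witt_mpoly" where
  "mpoly_var v = Poly_Mapping.single (Poly_Mapping.single v 1) 1"

definition mpoly_eval :: "(nat + nat \<Rightarrow> 'b::comm_ring_1) \<Rightarrow> witt_mpoly \<Rightarrow> 'b" where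
  "mpoly_eval \<rho> P =
     (\<Sum>m\<in>Poly_Mapping.keys P. of_int (Poly_Mapping.lookup P m) *
        (\<Prod>v\<in>Poly_Mapping.keys m. \<rho> v ^ Poly_Mapping.lookup m v))"

definition ghost :: "nat \<Rightarrow> nat \<Rightarrow> (nat \<Rightarrow> 'b::comm_ring_1) \<Rightarrow> 'b" where
  "ghost p n x = (\<Sum>i\<le>n. of_nat (p ^ i) * x i ^ (p ^ (n - i)))"

text \<open>
  \<open>ghost_solve p f\<close> is the sequence \<open>U\<close> of polynomials with \<open>ghost p n U = f n\<close> for all \<open>n\<close>,
  obtained by solving for the leading term \<open>p ^ n * U n\<close>. The coefficientwise integer division
  is exact in the two cases used below; this is Witt's integrality theorem.
\<close>

fun ghost_solve :: "nat \<Rightarrow> (nat \<Rightarrow> witt_mpoly) \<Rightarrow> nat \<Rightarrow> witt_mpoly" where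
  "ghost_solve p f n =
     Poly_Mapping.map (\<lambda>c. c div int (p ^ n))
       (f n - (\<Sum>i<n. of_nat (p ^ i) * ghost_solve p f i ^ (p ^ (n - i))))"

declare ghost_solve.simps [simp del]

definition witt_add_poly :: "nat \<Rightarrow> nat \<Rightarrow> witt_mpoly" where
  "witt_add_poly p =
     ghost_solve p (\<lambda>n. ghost p n (\<lambda>i. mpoly_var (Inl i)) + ghost p n (\<lambda>i. mpoly_var (Inr i)))"

definition witt_diff_poly :: "nat \<Rightarrow> nat \<Rightarrow> witt_mpoly" where
  "witt_diff_poly p =
     ghost_solve p (\<lambda>n. ghost p n (\<lambda>i. mpoly_var (Inl i)) - ghost p n (\<lambda>i. mpoly_var (Inr i)))"

text \<open>A Witt vector of length \<open>v\<close> is the list of its \<open>v\<close> components.\<close>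

definition witt_op :: "(nat \<Rightarrow> witt_mpoly) \<Rightarrow> 'b::comm_ring_1 list \<Rightarrow> 'b list \<Rightarrow> 'b list" where
  "witt_op S x y =
     map (\<lambda>n. mpoly_eval (case_sum ((!) x) ((!) y)) (S n)) [0..<min (length x) (length y)]"

definition witt_add :: "nat \<Rightarrow> 'b::comm_ring_1 list \<Rightarrow> 'b list \<Rightarrow> 'b list" where
  "witt_add p = witt_op (witt_add_poly p)"

definition witt_diff :: "nat \<Rightarrow> 'b::comm_ring_1 list \<Rightarrow> 'b list \<Rightarrow> 'b list" where
  "witt_diff p = witt_op (witt_diff_poly p)"

definition witt_frob :: "nat \<Rightarrow> 'b::comm_ring_1 list \<Rightarrow> 'b list" where
  "witt_frob p x = map (\<lambda>c. c ^ p) x"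


section \<open>Field extensions inside a fixed field\<close>

text \<open>All fields are subfields of one ambient field, given as a type \<open>'b\<close>.\<close>

abbreviation ambient :: "'b::field ring" where
  "ambient \<equiv> ring_of_type_algebra"

definition field_ext :: "'b::field set \<Rightarrow> 'b set \<Rightarrow> bool" where
  "field_ext F L \<longleftrightarrow> subfield F ambient \<and> subfield L ambient \<and> F \<subseteq> L"

definition adjoin :: "'b::field set \<Rightarrow> 'b set \<Rightarrow> 'b set" where
  "adjoin F A = generate_field ambient (F \<union> A)"

definition galois_group :: "'b::field set \<Rightarrow> 'b set \<Rightarrow> ('b \<Rightarrow> 'b) monoid" where
  "galois_group F L = (BijGroup L)\<lparr>carrier :=
     {\<sigma> \<in> Bij L. \<sigma> \<in> ring_hom (ambient\<lparr>carrier := L\<rparr>) (ambient\<lparr>carrier := L\<rparr>) \<and>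
                 (\<forall>x\<in>F. \<sigma> x = x)}\<rparr>"

text \<open>Galois extensions are algebraic but need not be finite.\<close>

definition galois_ext :: "'b::field set \<Rightarrow> 'b set \<Rightarrow> bool" where
  "galois_ext F L \<longleftrightarrow> field_ext F L \<and> (\<forall>x\<in>L. \<not> ring.transcendental ambient F x) \<and>
     {x \<in> L. \<forall>\<sigma>\<in>carrier (galois_group F L). \<sigma> x = x} = F"

definition abelian_ext :: "'b::field set \<Rightarrow> 'b set \<Rightarrow> bool" where
  "abelian_ext F L \<longleftrightarrow> galois_ext F L \<and> comm_group (galois_group F L)"


section \<open>The rational function field and the primes of its algebraic extensions\<close>

text \<open>
  For a finite field \<open>'a\<close>, the type \<open>'a poly fract\<close> is the rational function field over \<open>'a\<close>;
  \<open>ratfun_field\<close> is its copy inside its algebraic closure, and \<open>constants\<close> is the copy of \<open>'a\<close>.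
\<close>

definition ratfun_field :: "'a::field poly fract alg_closure set" where
  "ratfun_field = range to_ac"

definition constants :: "'a::field poly fract alg_closure set" where
  "constants = range (\<lambda>c. to_ac (Fract [:c:] 1))"

text \<open>
  A prime of \<open>L\<close> is given by its valuation ring. For \<open>L\<close> finite over the rational function field
  these valuation rings are automatically discrete.
\<close>

definition is_prime_of ::
  "'a::field poly fract alg_closure set \<Rightarrow> 'a poly fract alg_closure set \<Rightarrow> bool" where
  "is_prime_of L \<O> \<longleftrightarrow> subring \<O> ambient \<and> constants \<subset> \<O> \<and> \<O> \<subset> L \<and>
     (\<forall>x\<in>L. x \<in> \<O> \<or> inverse x \<in> \<O>)"

definition max_ideal :: "'b::field set \<Rightarrow> 'b set" where
  "max_ideal \<O> = {x \<in> \<O>. x = 0 \<or> inverse x \<notin> \<O>}"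

definition finite_prime :: "'a::field poly \<Rightarrow> 'a poly fract alg_closure set" where
  "finite_prime Q = {to_ac (Fract a b) | a b. b \<noteq> 0 \<and> \<not> Q dvd b}"

definition infinite_prime :: "'a::field poly fract alg_closure set" where
  "infinite_prime = {to_ac (Fract a b) | a b. b \<noteq> 0 \<and> Polynomial.degree a \<le> Polynomial.degree b}"

text \<open>
  \<open>\<O>\<close> is a prime of an extension of \<open>F\<close>; the prime of \<open>F\<close> below it is \<open>\<O> \<inter> F\<close>.
  Ramification index one: \<open>\<O>\<close> and \<open>\<O> \<inter> F\<close> have the same value group.
  No separability condition on the residue extension is needed to define unramified primes, as all
  residue fields are algebraic over a finite field.
\<close>

definition ram_index_one :: "'b::field set \<Rightarrow> 'b set \<Rightarrow> 'b set \<Rightarrow> bool" where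
  "ram_index_one F L \<O> \<longleftrightarrow>
     (\<forall>x\<in>L - {0}. \<exists>y\<in>F - {0}. x * inverse y \<in> \<O> \<and> y * inverse x \<in> \<O>)"

text \<open>Residue degree one: every residue class of \<open>\<O>\<close> has a representative in \<open>\<O> \<inter> F\<close>.\<close>

definition res_degree_one :: "'b::field set \<Rightarrow> 'b set \<Rightarrow> bool" where
  "res_degree_one F \<O> \<longleftrightarrow> (\<forall>x\<in>\<O>. \<exists>y\<in>\<O> \<inter> F. x - y \<in> max_ideal \<O>)"

definition ramified_in ::
  "'a::field poly \<Rightarrow> 'a poly fract alg_closure set \<Rightarrow> bool" where
  "ramified_in Q L \<longleftrightarrow>
     (\<exists>\<O>. is_prime_of L \<O> \<and> \<O> \<inter> ratfun_field = finite_prime Q \<and> \<not> ram_index_one ratfun_field L \<O>)"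

definition unramified_ext ::
  "'a::field poly fract alg_closure set \<Rightarrow> 'a poly fract alg_closure set \<Rightarrow> bool" where
  "unramified_ext F L \<longleftrightarrow> (\<forall>\<O>. is_prime_of L \<O> \<longrightarrow> ram_index_one F L \<O>)"

text \<open>
  Every prime of \<open>F\<close> above the pole of \<open>T\<close> decomposes fully in \<open>L\<close>: all primes of \<open>L\<close> above it
  have ramification index and residue degree one over \<open>F\<close>.
\<close>

definition infinity_splits ::
  "'a::field poly fract alg_closure set \<Rightarrow> 'a poly fract alg_closure set \<Rightarrow> bool" where
  "infinity_splits F L \<longleftrightarrow>
     (\<forall>\<O>. is_prime_of L \<O> \<and> \<O> \<inter> ratfun_field = infinite_prime \<longrightarrow>
        ram_index_one F L \<O> \<and> res_degree_one F \<O>)"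


section \<open>Hilbert class field and genus field\<close>

text \<open>
  Both fields are characterised as greatest elements for inclusion. The competing extensions are
  not required to be finite; that the Hilbert class field is finite is a theorem.
\<close>

definition is_hilbert_class_field ::
  "'a::field poly fract alg_closure set \<Rightarrow> 'a poly fract alg_closure set \<Rightarrow> bool" where
  "is_hilbert_class_field F H \<longleftrightarrow>
     (let \<E> = {L. abelian_ext F L \<and> unramified_ext F L \<and> infinity_splits F L}
      in H \<in> \<E> \<and> (\<forall>L\<in>\<E>. L \<subseteq> H))"

definition is_genus_field ::
  "'a::field poly fract alg_closure set \<Rightarrow> 'a poly fract alg_closure set \<Rightarrow> bool" where
  "is_genus_field F G \<longleftrightarrow>
     (\<exists>H. is_hilbert_class_field F H \<and>
        (let \<E> = {L. F \<subseteq> L \<and> L \<subseteq> H \<and> abelian_ext ratfun_field L}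
         in G \<in> \<E> \<and> (\<forall>L\<in>\<E>. L \<subseteq> G)))"


section \<open>Shape of the Witt vector components\<close>

text \<open>
  The degree of the zero polynomial counts as smaller than every degree here, so that \<open>0 = 0/1\<close>
  is admitted.
\<close>

definition proper_fraction_at :: "'a::field poly \<Rightarrow> 'a poly fract \<Rightarrow> bool" where
  "proper_fraction_at P c \<longleftrightarrow>
     (\<exists>a b. b \<noteq> 0 \<and> c = Fract a b \<and>
        (a = 0 \<or> Polynomial.degree a < Polynomial.degree b) \<and>
        {Q. Factorial_Ring.irreducible Q \<and> Polynomial.lead_coeff Q = 1 \<and> Q dvd b} \<subseteq> {P})"

definition is_polynomial :: "'a::field poly fract \<Rightarrow> bool" where
  "is_polynomial c \<longleftrightarrow> (\<exists>a. c = Fract a 1)"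

end

(*
  Let G be the field generated over k by all w_ij and z_i, and represent the elements of Galois
  groups by automorphisms of an algebraic closure of k. If s is such an automorphism and the Witt
  vector w satisfies w^p - w = x with x over k, then s w - w is a Witt vector over the prime field.
  If s is in the inertia group of a prime at which x is integral, or in the decomposition group of
  a prime at which the components of x vanish, the components of s w - w also lie in the maximal
  ideal, so s fixes w. Hence inertia at a finite prime Q fixes all z_i and all w_ij with P_j
  distinct from Q, and decomposition at infinity fixes all w_ij. The w_ij (all j) and z_i add up to
  w_i up to a vector over the prime field, so over K the remaining generator is fixed as well:
  G/K is unramified and the infinite primes of K split.

  Conversely let E be finite abelian over k, contain G and lie in the Hilbert class field of K. The
  subgroup of Gal(E/k) generated by the inertia groups at P_1, ..., P_r and the decomposition group
  at infinity is everything, for its fixed field M is unramified everywhere over k and split at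
  infinity, and such a field is k: a basis over the polynomial ring of the integral elements of M
  which minimises the sum of the sizes at infinity is reduced, the basis dual to it for the
  (unimodular) trace form is again integral and has the opposite sizes, so all sizes vanish and all
  basis elements are constants. Now if an automorphism fixes G, decompose it into elements of these
  subgroups. Each factor moves only one family of generators of G, so every factor fixes G, hence
  K; being in the inertia (decomposition) group of E/K, it is trivial. Thus E = G.
*)
theory Submission
  imports Defs
begin

text \<open>All Galois theory takes place in the automorphism group of one algebraic closure;
  passing between k, K, G and E changes only the field on which maps are compared. One tool supplies
  both these automorphisms and the places of the closure: a homomorphism from a subring into an
  algebraically closed field that admits no extension has a valuation ring as its domain
  (Chevalley).

  The Hilbert class field is only a greatest element among possibly infinite extensions, whereas
  discrete valuations, traces and norms need finite ones. Hence statements about it are tested on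
  fields generated by the orbits of finitely many elements.

  Inertia is controlled on E but needed on the fixed field of the generated subgroup. The passage
  uses an element whose residue class generates a suitable finite field. Commutativity makes this
  fixed field stable under all automorphisms, so one place above each prime suffices.

  The trace form is unimodular because of Dedekind's independence of characters modulo a maximal
  ideal: without inertia, decomposition automorphisms stay distinct on residues.\<close>

type_synonym 'a ac = "'a poly fract alg_closure"

abbreviation "pdeg \<equiv> Polynomial.degree"
abbreviation "coef \<equiv> Polynomial.coeff"
abbreviation "lcoeff \<equiv> Polynomial.lead_coeff"
abbreviation "irred \<equiv> Factorial_Ring.irreducible"
abbreviation "pkeys \<equiv> Poly_Mapping.keys"
abbreviation "plookup \<equiv> Poly_Mapping.lookup"
abbreviation "psingle \<equiv> Poly_Mapping.single"
abbreviation "mm \<equiv> max_ideal"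
abbreviation "kk \<equiv> ratfun_field"

section \<open>Ring homomorphisms and evaluation of integer polynomials\<close>

definition is_rhom :: "('b::comm_ring_1 => 'c::comm_ring_1) => bool" where
  "is_rhom h \<longleftrightarrow> h 1 = 1 \<and> (\<forall>x y. h (x + y) = h x + h y) \<and> (\<forall>x y. h (x * y) = h x * h y)"

lemma rhom_1: "is_rhom h ==> h 1 = 1"
  and rhom_add: "is_rhom h ==> h (x + y) = h x + h y"
  and rhom_mult: "is_rhom h ==> h (x * y) = h x * h y"
  by (auto simp: is_rhom_def)

lemma rhom_0: assumes "is_rhom h" shows "h 0 = 0"
  using rhom_add[OF assms, of 0 0] by simp

lemma rhom_minus: assumes "is_rhom h" shows "h (- x) = - h x"
  using rhom_add[OF assms, of x "- x"] rhom_0[OF assms] by (simp add: eq_neg_iff_add_eq_0 add.commute)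

lemma rhom_diff: assumes "is_rhom h" shows "h (x - y) = h x - h y"
  using rhom_add[OF assms, of x "- y"] rhom_minus[OF assms, of y] by simp

lemma rhom_power: assumes "is_rhom h" shows "h (x ^ n) = h x ^ n"
  by (induction n) (simp_all add: rhom_1[OF assms] rhom_mult[OF assms])

lemma rhom_sum: assumes "is_rhom h" shows "h (\<Sum>x\<in>A. f x) = (\<Sum>x\<in>A. h (f x))"
  by (induction A rule: infinite_finite_induct) (simp_all add: rhom_0[OF assms] rhom_add[OF assms])

lemma rhom_prod: assumes "is_rhom h" shows "h (\<Prod>x\<in>A. f x) = (\<Prod>x\<in>A. h (f x))"
  by (induction A rule: infinite_finite_induct) (simp_all add: rhom_1[OF assms] rhom_mult[OF assms])

lemma rhom_of_nat: assumes "is_rhom h" shows "h (of_nat n) = of_nat n"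
  by (induction n) (simp_all add: rhom_0[OF assms] rhom_1[OF assms] rhom_add[OF assms])

lemma rhom_of_int: assumes "is_rhom h" shows "h (of_int n) = of_int n"
  by (cases n rule: int_diff_cases) (simp add: rhom_diff[OF assms] rhom_of_nat[OF assms])

lemmas rhom_simps = rhom_0 rhom_1 rhom_add rhom_mult rhom_minus rhom_diff rhom_power rhom_sum
  rhom_prod rhom_of_nat rhom_of_int

definition monom_val :: "('v => 'b::comm_ring_1) => ('v \<Rightarrow>\<^sub>0 nat) => 'b" where
  "monom_val \<rho> m = (\<Prod>v\<in>pkeys m. \<rho> v ^ plookup m v)"

lemma monom_val_superset:
  assumes "finite A" "pkeys m \<subseteq> A"
  shows "monom_val \<rho> m = (\<Prod>v\<in>A. \<rho> v ^ plookup m v)"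
  unfolding monom_val_def by (rule prod.mono_neutral_left) (use assms in "auto simp: in_keys_iff")

lemma monom_val_add: "monom_val \<rho> (m + n) = monom_val \<rho> m * monom_val \<rho> n"
proof -
  let ?A = "pkeys m \<union> pkeys n"
  have "pkeys (m + n) \<subseteq> ?A"
    by (rule Poly_Mapping.keys_add)
  hence "monom_val \<rho> (m + n) = (\<Prod>v\<in>?A. \<rho> v ^ plookup (m + n) v)"
    by (intro monom_val_superset) auto
  also have "\<dots> = (\<Prod>v\<in>?A. \<rho> v ^ plookup m v) * (\<Prod>v\<in>?A. \<rho> v ^ plookup n v)"
    by (simp add: lookup_add power_add prod.distrib)
  also have "\<dots> = monom_val \<rho> m * monom_val \<rho> n"
    by (subst (1 2) monom_val_superset[of ?A]) auto
  finally show ?thesis .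
qed

lemma mpoly_eval_monom_val:
  "mpoly_eval \<rho> P = (\<Sum>m\<in>pkeys P. of_int (plookup P m) * monom_val \<rho> m)"
  by (simp add: mpoly_eval_def monom_val_def)

lemma mpoly_eval_superset:
  assumes "finite A" "pkeys P \<subseteq> A"
  shows "mpoly_eval \<rho> P = (\<Sum>m\<in>A. of_int (plookup P m) * monom_val \<rho> m)"
  unfolding mpoly_eval_monom_val
  by (rule sum.mono_neutral_left) (use assms in "auto simp: in_keys_iff")

lemma mpoly_eval_add: "mpoly_eval \<rho> (P + Q) = mpoly_eval \<rho> P + mpoly_eval \<rho> Q"
proof -
  let ?A = "pkeys P \<union> pkeys Q"
  have "pkeys (P + Q) \<subseteq> ?A"
    by (rule Poly_Mapping.keys_add)
  hence "mpoly_eval \<rho> (P + Q) = (\<Sum>m\<in>?A. of_int (plookup (P + Q) m) * monom_val \<rho> m)"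
    by (intro mpoly_eval_superset) auto
  also have "\<dots> = mpoly_eval \<rho> P + mpoly_eval \<rho> Q"
    by (subst (1 2) mpoly_eval_superset[of ?A]) (auto simp: lookup_add sum.distrib algebra_simps)
  finally show ?thesis .
qed

lemma mpoly_eval_0 [simp]: "mpoly_eval \<rho> 0 = 0"
  by (simp add: mpoly_eval_def)

lemma mpoly_eval_sum: "mpoly_eval \<rho> (\<Sum>x\<in>A. f x) = (\<Sum>x\<in>A. mpoly_eval \<rho> (f x))"
  by (induction A rule: infinite_finite_induct) (simp_all add: mpoly_eval_add)

lemma mpoly_eval_single: "mpoly_eval \<rho> (psingle m c) = of_int c * monom_val \<rho> m"
  by (subst mpoly_eval_superset[of "{m}"]) auto

lemma poly_mapping_eq_sum_single:
  "P = (\<Sum>m\<in>pkeys P. psingle m (plookup P m))"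
  by (rule poly_mapping_eqI)
    (auto simp: lookup_sum lookup_single when_def in_keys_iff sum.If_cases sum.delta)

lemma mpoly_eval_mult: "mpoly_eval \<rho> (P * Q) = mpoly_eval \<rho> P * mpoly_eval \<rho> Q"
proof -
  let ?s = "\<lambda>P m. psingle m (plookup P m)"
  have "P * Q = (\<Sum>m\<in>pkeys P. ?s P m) * (\<Sum>n\<in>pkeys Q. ?s Q n)"
    using poly_mapping_eq_sum_single[of P] poly_mapping_eq_sum_single[of Q] by simp
  also have "\<dots> = (\<Sum>m\<in>pkeys P. \<Sum>n\<in>pkeys Q.
      psingle (m + n) (plookup P m * plookup Q n))"
    by (simp add: sum_product mult_single)
  finally have eq: "P * Q = \<dots>" .
  have "mpoly_eval \<rho> (P * Q) = (\<Sum>m\<in>pkeys P. \<Sum>n\<in>pkeys Q.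
      of_int (plookup P m * plookup Q n) * monom_val \<rho> (m + n))"
    unfolding eq by (simp add: mpoly_eval_sum mpoly_eval_single)
  thus ?thesis
    by (simp add: monom_val_add mpoly_eval_monom_val sum_product algebra_simps)
qed

lemma mpoly_eval_1: "mpoly_eval \<rho> 1 = 1"
  using mpoly_eval_single[of \<rho> 0 1] by (simp add: monom_val_def)

lemma rhom_mpoly_eval: "is_rhom (mpoly_eval \<rho>)"
  by (simp add: is_rhom_def mpoly_eval_add mpoly_eval_mult mpoly_eval_1)

lemma mpoly_eval_var [simp]: "mpoly_eval \<rho> (mpoly_var v) = \<rho> v"
  by (simp add: mpoly_var_def mpoly_eval_single monom_val_def)

lemma rhom_comp_mpoly_eval:
  assumes "is_rhom h" shows "h (mpoly_eval \<rho> P) = mpoly_eval (\<lambda>v. h (\<rho> v)) P"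
  by (simp add: mpoly_eval_def rhom_simps[OF assms])

lemma mpoly_eval_mpoly_var: "mpoly_eval mpoly_var P = P"
proof -
  have s: "psingle v (1::nat) = psingle v 1" for v :: "nat + nat" ..
  have pw: "mpoly_var v ^ k = psingle (psingle v k) 1" for v k
    by (induction k) (simp_all add: mpoly_var_def mult_single flip: single_add)
  have pr: "(\<Prod>v\<in>A. psingle (f v) (1::int)) = psingle (\<Sum>v\<in>A. f v) 1"
    for A and f :: "nat + nat => (nat + nat) \<Rightarrow>\<^sub>0 nat"
    by (induction A rule: infinite_finite_induct) (simp_all add: mult_single)
  have mv: "monom_val mpoly_var m = psingle m 1" for m
    unfolding monom_val_def pw pr using poly_mapping_eq_sum_single[of m] by simp
  have "of_int c * psingle m 1 = psingle m c" for c :: int and m :: "(nat + nat) \<Rightarrow>\<^sub>0 nat"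
  proof -
    have "of_int c = (psingle 0 c :: witt_mpoly)"
      by (metis id_apply of_int_eq_id single_of_int)
    thus ?thesis by (simp add: mult_single)
  qed
  thus ?thesis
    using poly_mapping_eq_sum_single[of P] by (simp add: mpoly_eval_monom_val mv)
qed

lemma mpoly_eval_closed:
  assumes "0 \<in> R" "1 \<in> R" "\<And>x y. x \<in> R ==> y \<in> R ==> x + y \<in> R" "\<And>x. x \<in> R ==> - x \<in> R"
    "\<And>x y. x \<in> R ==> y \<in> R ==> x * y \<in> R" and \<rho>: "\<And>v. \<rho> v \<in> R"
  shows "mpoly_eval \<rho> P \<in> R"
proof -
  have nat: "of_nat n \<in> R" for n by (induction n) (use assms in auto)
  have int: "of_int n \<in> R" for n
    by (cases n rule: int_cases2) (use nat assms(4) in auto)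
  have pow: "x ^ n \<in> R" if "x \<in> R" for x n by (induction n) (use assms that in auto)
  have prod: "(\<Prod>v\<in>A. f v) \<in> R" if "\<And>v. f v \<in> R" for A :: "(nat + nat) set" and f
    by (induction A rule: infinite_finite_induct) (use assms that in auto)
  have sum: "(\<Sum>v\<in>A. f v) \<in> R" if "\<And>v. f v \<in> R" for A :: "((nat + nat) \<Rightarrow>\<^sub>0 nat) set" and f
    by (induction A rule: infinite_finite_induct) (use assms that in auto)
  show ?thesis
    unfolding mpoly_eval_def by (intro sum assms(5) int prod pow \<rho>)
qed

text \<open>The polynomials with property \<open>Q\<close> form a subring containing the variables,
  and every polynomial is its own evaluation at the variables.\<close>

lemma mpoly_induct:
  assumes "Q 1" "\<And>x y. Q x ==> Q y ==> Q (x + y)" "\<And>x. Q x ==> Q (- x)"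
    "\<And>x y. Q x ==> Q y ==> Q (x * y)" and "\<And>v. Q (mpoly_var v)"
  shows "Q P"
proof -
  have "Q 0" using assms(2)[OF assms(1) assms(3)[OF assms(1)]] by simp
  hence "mpoly_eval mpoly_var P \<in> {x. Q x}"
    by (intro mpoly_eval_closed) (use assms in auto)
  thus ?thesis by (simp add: mpoly_eval_mpoly_var)
qed

section \<open>Witt's integrality theorem\<close>

lemma of_nat_mpoly: "(of_nat N :: witt_mpoly) = psingle 0 (int N)"
  by (metis of_nat_id single_of_nat)

lemma lookup_of_nat_mult:
  "plookup (of_nat N * (P :: witt_mpoly)) k = int N * plookup P k"
  unfolding of_nat_mpoly mult_map_scale_conv_mult[symmetric]
  by (simp add: Poly_Mapping.map.rep_eq when_def)

lemma mpoly_of_nat_mult_cancel: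
  assumes "N > 0" "of_nat N * P = of_nat N * (Q :: witt_mpoly)" shows "P = Q"
proof (rule poly_mapping_eqI)
  fix k
  show "plookup P k = plookup Q k"
    using assms lookup_of_nat_mult[of N P k] lookup_of_nat_mult[of N Q k] by simp
qed

text \<open>Turns the coefficientwise \<open>div\<close> of \<open>ghost_solve\<close> into genuine
  division once divisibility in the polynomial ring is known.\<close>

lemma mpoly_exact_division:
  assumes "N > 0" "of_nat N dvd (P :: witt_mpoly)"
  shows "of_nat N * Poly_Mapping.map (\<lambda>c. c div int N) P = P"
proof -
  obtain Q where Q: "P = of_nat N * Q" using assms(2) by (auto elim: dvdE)
  show ?thesis
    by (rule poly_mapping_eqI)
      (use assms(1) in "simp add: lookup_of_nat_mult Q Poly_Mapping.map.rep_eq when_def")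
qed

text \<open>A lift to the integers of the Frobenius of the polynomials modulo \<open>p\<close>.
  Dwork's criterion uses it: \<open>f\<close> consists of ghost components of integral polynomials
  when \<open>f (Suc n)\<close> agrees with the image of \<open>f n\<close> modulo
  \<open>p ^ Suc n\<close>.\<close>

definition frob_lift :: "nat => witt_mpoly => witt_mpoly" where
  "frob_lift p = mpoly_eval (\<lambda>v. mpoly_var v ^ p)"

lemma rhom_frob_lift: "is_rhom (frob_lift p)"
  by (simp add: frob_lift_def rhom_mpoly_eval)

lemma prime_dvd_power_add:
  fixes x y :: "'b::comm_ring_1"
  assumes "prime p"
  shows "of_nat p dvd (x + y) ^ p - (x ^ p + y ^ p)"
proof -
  have p: "p > 0" "p > 1" using assms prime_gt_1_nat prime_gt_0_nat by auto
  have "(x + y) ^ p = (\<Sum>k\<le>p. of_nat (p choose k) * x ^ k * y ^ (p - k))"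
    by (rule binomial_ring)
  also have "{..p} = insert 0 (insert p {0<..<p})" using p by auto
  also have "(\<Sum>k\<in>\<dots>. of_nat (p choose k) * x ^ k * y ^ (p - k)) - (x ^ p + y ^ p)
      = (\<Sum>k\<in>{0<..<p}. of_nat (p choose k) * x ^ k * y ^ (p - k))"
    using p by simp
  also have "of_nat p dvd \<dots>"
  proof (rule dvd_sum)
    fix k assume "k \<in> {0<..<p}"
    hence "p dvd (p choose k)"
      using dvd_choose_prime[of k p] assms by simp
    hence "(of_nat p :: 'b) dvd of_nat (p choose k)" by (metis dvdE dvd_triv_left of_nat_mult)
    thus "of_nat p dvd of_nat (p choose k) * x ^ k * y ^ (p - k)"
      by (simp add: dvd_mult2)
  qed
  finally show ?thesis .
qed

lemma frob_lift_cong: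
  assumes "prime p"
  shows "of_nat p dvd frob_lift p U - U ^ p"
proof (induction U rule: mpoly_induct)
  case 1
  show ?case by (simp add: rhom_1[OF rhom_frob_lift])
next
  case (2 x y)
  have "frob_lift p (x + y) - (x + y) ^ p
    = (frob_lift p x - x ^ p) + (frob_lift p y - y ^ p) - ((x + y) ^ p - (x ^ p + y ^ p))"
    by (simp add: rhom_add[OF rhom_frob_lift])
  also have "of_nat p dvd \<dots>"
    by (intro dvd_add dvd_diff 2 prime_dvd_power_add assms)
  finally show ?case .
next
  case (3 x)
  have "p > 0" using assms prime_gt_0_nat by auto
  \<comment> \<open>The binomial congruence for \<open>x\<close> and \<open>- x\<close> avoids
    distinguishing \<open>p = 2\<close> from odd \<open>p\<close>.\<close>
  hence "of_nat p dvd x ^ p + (- x) ^ p"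
    using prime_dvd_power_add[OF assms, of x "- x"] by (simp add: zero_power) (metis dvd_minus_iff minus_add_distrib add.commute uminus_add_conv_diff)
  hence "of_nat p dvd - (frob_lift p x - x ^ p) - (x ^ p + (- x) ^ p)"
    by (intro dvd_diff) (use 3 dvd_minus_iff in blast)+
  thus ?case by (simp add: rhom_minus[OF rhom_frob_lift])
next
  case (4 x y)
  have "frob_lift p (x * y) - (x * y) ^ p
    = frob_lift p x * (frob_lift p y - y ^ p) + (frob_lift p x - x ^ p) * y ^ p"
    by (simp add: rhom_mult[OF rhom_frob_lift] algebra_simps power_mult_distrib)
  also have "of_nat p dvd \<dots>"
    by (intro dvd_add dvd_mult dvd_mult2 4)
  finally show ?case .
next
  case (5 v)
  show ?case by (simp add: frob_lift_def)
qed

text \<open>In \<open>a ^ p - b ^ p = (a - b) * S\<close> the cofactor \<open>S\<close> is congruent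
  modulo \<open>p\<close> to \<open>p * b ^ (p - 1)\<close>, so it contributes one more factor
  \<open>p\<close>.\<close>

lemma dvd_power_diff_step:
  fixes a b :: "'b::comm_ring_1"
  assumes "of_nat (p ^ Suc k) dvd a - b"
  shows "of_nat (p ^ Suc (Suc k)) dvd a ^ p - b ^ p"
proof -
  have eq: "a ^ p - b ^ p = (a - b) * (\<Sum>i<p. b ^ (p - Suc i) * a ^ i)"
    by (rule power_diff_sumr2)
  have pd: "of_nat p dvd a - b"
    using assms by (auto elim: dvd_mult_left simp: dvd_def mult.assoc)
  have ab: "of_nat p dvd a ^ i - b ^ i" for i
    by (subst power_diff_sumr2) (use pd in "rule dvd_mult2")
  have "(\<Sum>i<p. b ^ (p - Suc i) * a ^ i)
      = (\<Sum>i<p. b ^ (p - Suc i) * (a ^ i - b ^ i)) + (\<Sum>i<p. b ^ (p - Suc i) * b ^ i)"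
    by (simp add: algebra_simps flip: sum.distrib)
  also have "(\<Sum>i<p. b ^ (p - Suc i) * b ^ i) = (\<Sum>i<p. b ^ (p - 1))"
    by (intro sum.cong) (auto simp flip: power_add)
  also have "of_nat p dvd (\<Sum>i<p. b ^ (p - Suc i) * (a ^ i - b ^ i)) + (\<Sum>i<p. b ^ (p - 1))"
    by (rule dvd_add) (intro dvd_sum dvd_mult ab, simp)
  finally have "of_nat (p ^ Suc k) * of_nat p dvd a ^ p - b ^ p"
    unfolding eq by (intro mult_dvd_mono assms)
  thus ?thesis by (simp add: mult_ac)
qed

lemma dvd_power_prime_power_diff:
  fixes a b :: "'b::comm_ring_1"
  assumes "of_nat p dvd a - b"
  shows "of_nat (p ^ Suc m) dvd a ^ (p ^ m) - b ^ (p ^ m)"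
proof (induction m)
  case 0 thus ?case using assms by simp
next
  case (Suc m)
  from dvd_power_diff_step[OF this] show ?case by (simp flip: power_mult add: mult.commute)
qed

text \<open>Holds term by term: the coefficient gives \<open>p ^ i\<close>, and raising the
  congruence between \<open>U i ^ p\<close> and \<open>frob_lift p (U i)\<close> to the power
  \<open>p ^ (n - 1 - i)\<close> gives the remaining \<open>p ^ (n - i)\<close>.\<close>

lemma frob_lift_sum_cong:
  assumes "prime p"
  shows "of_nat (p ^ n) dvd (\<Sum>i<n. of_nat (p ^ i) * U i ^ (p ^ (n - i)))
     - frob_lift p (\<Sum>i<n. of_nat (p ^ i) * U i ^ (p ^ (n - 1 - i)))"
proof -
  have "(\<Sum>i<n. of_nat (p ^ i) * U i ^ (p ^ (n - i))) - frob_lift p (\<Sum>i<n. of_nat (p ^ i) * U i ^ (p ^ (n - 1 - i)))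
    = (\<Sum>i<n. of_nat (p ^ i) * (U i ^ (p ^ (n - i)) - frob_lift p (U i) ^ (p ^ (n - 1 - i))))"
    by (simp only: rhom_simps[OF rhom_frob_lift] right_diff_distrib sum_subtractf)
  also have "of_nat (p ^ n) dvd \<dots>"
  proof (rule dvd_sum)
    fix i assume "i \<in> {..<n}"
    then obtain m where m: "n = Suc (m + i)" by (metis lessThan_iff less_imp_Suc_add add.commute)
    have "of_nat p dvd U i ^ p - frob_lift p (U i)"
      using frob_lift_cong[OF assms, of "U i"] by (metis dvd_minus_iff minus_diff_eq)
    from dvd_power_prime_power_diff[OF this, of m]
    have "of_nat (p ^ i) * of_nat (p ^ Suc m) dvd
       of_nat (p ^ i) * (U i ^ (p ^ (n - i)) - frob_lift p (U i) ^ (p ^ (n - 1 - i)))"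
      by (intro mult_dvd_mono dvd_refl) (simp add: m power_mult[symmetric])
    thus "of_nat (p ^ n) dvd of_nat (p ^ i) * (U i ^ (p ^ (n - i)) - frob_lift p (U i) ^ (p ^ (n - 1 - i)))"
      by (simp add: m power_add mult_ac)
  qed
  finally show ?thesis .
qed

text \<open>Both \<open>f (Suc n)\<close> and the sum of the known lower terms are congruent to
  \<open>frob_lift p (f n)\<close> modulo \<open>p ^ Suc n\<close>, so the division that defines the
  next polynomial is exact.\<close>

lemma ghost_ghost_solve:
  assumes p: "prime p" and f: "\<And>n. of_nat (p ^ Suc n) dvd f (Suc n) - frob_lift p (f n)"
  shows "ghost p n (ghost_solve p f) = f n"
proof (induction n)
  case 0
  have "Poly_Mapping.map (\<lambda>c. c div int (p ^ 0)) (f 0) = f 0"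
    using mpoly_exact_division[of 1 "f 0"] by simp
  thus ?case by (simp add: ghost_def ghost_solve.simps[of p f 0])
next
  case (Suc n)
  let ?U = "ghost_solve p f"
  have "(\<Sum>i\<le>n. of_nat (p ^ i) * ?U i ^ (p ^ (n - i))) = f n"
    using Suc by (simp add: ghost_def)
  hence "of_nat (p ^ Suc n) dvd (\<Sum>i<Suc n. of_nat (p ^ i) * ?U i ^ (p ^ (Suc n - i))) - frob_lift p (f n)"
    using frob_lift_sum_cong[OF p, of "Suc n" ?U] by (simp only: lessThan_Suc_atMost diff_Suc_1)
  hence "of_nat (p ^ Suc n) dvd f (Suc n) - (\<Sum>i<Suc n. of_nat (p ^ i) * ?U i ^ (p ^ (Suc n - i)))"
    using dvd_diff[OF f[of n], of "(\<Sum>i<Suc n. of_nat (p ^ i) * ?U i ^ (p ^ (Suc n - i))) - frob_lift p (f n)"]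
    by (simp del: sum.lessThan_Suc)
  hence "of_nat (p ^ Suc n) * ?U (Suc n) = f (Suc n) - (\<Sum>i<Suc n. of_nat (p ^ i) * ?U i ^ (p ^ (Suc n - i)))"
    unfolding ghost_solve.simps[of p f "Suc n"]
    by (rule mpoly_exact_division[rotated]) (use p prime_gt_0_nat in auto)
  thus ?case
    by (simp add: ghost_def lessThan_Suc_atMost)
qed

lemma ghost_hom: "is_rhom h ==> h (ghost p n x) = ghost p n (\<lambda>i. h (x i))"
  by (simp add: ghost_def rhom_simps)

text \<open>Raising the variables to the power \<open>p\<close> turns the ghost component of index
  \<open>n\<close> into that of index \<open>Suc n\<close> without its last term, and this term is a
  multiple of \<open>p ^ Suc n\<close>.\<close>

lemma ghost_frob_lift_vars:
  "of_nat (p ^ Suc n) dvd ghost p (Suc n) (\<lambda>i. mpoly_var (g i)) - frob_lift p (ghost p n (\<lambda>i. mpoly_var (g i)))"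
proof -
  have "frob_lift p (ghost p n (\<lambda>i. mpoly_var (g i))) = (\<Sum>i\<le>n. of_nat (p ^ i) * (mpoly_var (g i) ^ p) ^ (p ^ (n - i)))"
    by (simp add: ghost_hom[OF rhom_frob_lift]) (simp add: ghost_def frob_lift_def)
  also have "\<dots> = (\<Sum>i\<le>n. of_nat (p ^ i) * mpoly_var (g i) ^ (p ^ (Suc n - i)))"
    by (intro sum.cong) (auto simp: Suc_diff_le simp flip: power_mult)
  finally have "ghost p (Suc n) (\<lambda>i. mpoly_var (g i)) - frob_lift p (ghost p n (\<lambda>i. mpoly_var (g i)))
     = of_nat (p ^ Suc n) * mpoly_var (g (Suc n))"
    by (simp add: ghost_def)
  thus ?thesis by simp
qed

text \<open>Witt operations on infinite sequences, for which identities are free of length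
  conditions; lists are recovered as initial segments by \<open>witt_op_map\<close>.\<close>

definition wop :: "(nat => witt_mpoly) => (nat => 'b) => (nat => 'b) => nat => 'b::comm_ring_1" where
  "wop S a b n = mpoly_eval (case_sum a b) (S n)"

abbreviation "wadd p \<equiv> wop (witt_add_poly p)"
abbreviation "wdiff p \<equiv> wop (witt_diff_poly p)"

lemma wop_hom:
  assumes "is_rhom h" shows "h (wop S a b n) = wop S (\<lambda>i. h (a i)) (\<lambda>i. h (b i)) n"
proof -
  have "(\<lambda>v. h (case_sum a b v)) = case_sum (\<lambda>i. h (a i)) (\<lambda>i. h (b i))"
    by (auto split: sum.splits)
  thus ?thesis by (simp add: wop_def rhom_comp_mpoly_eval[OF assms])
qed

text \<open>The sign \<open>e\<close> covers addition (\<open>1\<close>) and subtraction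
  (\<open>-1\<close>) at once. Only the ghost equation is kept, not the recursive construction of
  \<open>S\<close>.\<close>

locale witt_operation =
  fixes p :: nat and e :: int and S :: "nat => witt_mpoly"
  assumes p: "prime p"
    and S: "ghost p n S = ghost p n (\<lambda>i. mpoly_var (Inl i)) + of_int e * ghost p n (\<lambda>i. mpoly_var (Inr i))"

lemma witt_operation_ghost_solve:
  assumes "prime p"
  shows "witt_operation p e (ghost_solve p
    (\<lambda>n. ghost p n (\<lambda>i. mpoly_var (Inl i)) + of_int e * ghost p n (\<lambda>i. mpoly_var (Inr i))))"
proof (rule witt_operation.intro[OF assms ghost_ghost_solve[OF assms]])
  show "of_nat (p ^ Suc n) dvd ghost p (Suc n) (\<lambda>i. mpoly_var (Inl i)) + of_int e * ghost p (Suc n) (\<lambda>i. mpoly_var (Inr i)) -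
     frob_lift p (ghost p n (\<lambda>i. mpoly_var (Inl i)) + of_int e * ghost p n (\<lambda>i. mpoly_var (Inr i)))" for n
    using dvd_add[OF ghost_frob_lift_vars[of p n Inl] dvd_mult[OF ghost_frob_lift_vars[of p n Inr], of "of_int e"]]
    by (simp add: rhom_simps[OF rhom_frob_lift] algebra_simps)
qed

lemma witt_operation_add: "prime p ==> witt_operation p 1 (witt_add_poly p)"
  and witt_operation_diff: "prime p ==> witt_operation p (-1) (witt_diff_poly p)"
  using witt_operation_ghost_solve[of p 1] witt_operation_ghost_solve[of p "-1"]
  by (simp_all add: witt_add_poly_def witt_diff_poly_def)

section \<open>The group of Witt vectors\<close>

text \<open>The system is triangular with diagonal entries \<open>p ^ k\<close>, which can be
  cancelled because integer polynomials have no torsion.\<close>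

lemma ghost_inj_upto:
  fixes x y :: "nat => witt_mpoly"
  assumes "p > 0" "\<And>k. k \<le> n ==> ghost p k x = ghost p k y"
  shows "k \<le> n ==> x k = y k"
proof (induction k rule: less_induct)
  case (less k)
  have "(\<Sum>i<k. of_nat (p ^ i) * x i ^ (p ^ (k - i))) = (\<Sum>i<k. of_nat (p ^ i) * y i ^ (p ^ (k - i)))"
    by (intro sum.cong) (use less in auto)
  moreover have "ghost p k x = ghost p k y" using assms less by auto
  ultimately have "of_nat (p ^ k) * x k = of_nat (p ^ k) * y k"
    by (simp add: ghost_def lessThan_Suc_atMost[symmetric])
  thus ?case
    by (rule mpoly_of_nat_mult_cancel[rotated]) (use assms(1) in simp)
qed

text \<open>
  Identities between Witt vectors over any ring follow from the torsion-free ring of integer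
  polynomials, where the ghost map is injective, by specialising three generic Witt vectors.
\<close>

definition gen_var :: "nat => nat => witt_mpoly" where
  "gen_var j i = mpoly_var (Inl (3 * i + j))"

definition gen_eval :: "(nat => 'b) => (nat => 'b) => (nat => 'b) => witt_mpoly => 'b::comm_ring_1" where
  "gen_eval a b c = mpoly_eval (case_sum
     (\<lambda>k. if k mod 3 = 0 then a (k div 3) else if k mod 3 = 1 then b (k div 3) else c (k div 3)) (\<lambda>_. 0))"

lemma rhom_gen_eval: "is_rhom (gen_eval a b c)"
  by (simp add: gen_eval_def rhom_mpoly_eval)

lemma gen_eval_var [simp]:
  "gen_eval a b c (gen_var 0 i) = a i" "gen_eval a b c (gen_var (Suc 0) i) = b i"
  "gen_eval a b c (gen_var 2 i) = c i"
proof -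
  have "Suc (3 * i) div 3 = i" "Suc (3 * i) mod 3 = 1" "Suc (Suc (3 * i)) div 3 = i"
    "Suc (Suc (3 * i)) mod 3 = 2" by presburger+
  thus "gen_eval a b c (gen_var 0 i) = a i" "gen_eval a b c (gen_var (Suc 0) i) = b i"
    "gen_eval a b c (gen_var 2 i) = c i"
    by (simp_all add: gen_eval_def gen_var_def)
qed

definition trunc :: "nat => (nat => 'b) => nat => 'b::zero" where
  "trunc n a i = (if i < n then a i else 0)"

lemma gen_eval_trunc: "gen_eval a b c (trunc m x i) = trunc m (\<lambda>i. gen_eval a b c (x i)) i"
  by (simp add: trunc_def rhom_0[OF rhom_gen_eval])

context witt_operation
begin

lemma ghost_wop: "ghost p n (wop S a b) = ghost p n a + of_int e * ghost p n b"
proof -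
  note E = rhom_mpoly_eval[of "case_sum a b"]
  have "ghost p n (wop S a b) = mpoly_eval (case_sum a b) (ghost p n S)"
    by (simp add: ghost_hom[OF E] wop_def[abs_def])
  thus ?thesis by (simp add: S rhom_simps[OF E] ghost_hom[OF E])
qed

lemma mpoly_wop_cong:
  fixes a :: "nat => witt_mpoly"
  assumes "\<And>i. i \<le> n ==> a i = a' i" "\<And>i. i \<le> n ==> b i = b' i"
  shows "wop S a b n = wop S a' b' n"
proof (rule ghost_inj_upto[of p n _ _ n])
  fix k assume k: "k \<le> n"
  hence "ghost p k a = ghost p k a'" "ghost p k b = ghost p k b'"
    by (auto simp: ghost_def assms intro!: sum.cong)
  thus "ghost p k (wop S a b) = ghost p k (wop S a' b')"
    by (simp add: ghost_wop)
qed (use p prime_gt_0_nat in auto)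

lemma wop_trunc:
  fixes a :: "nat => 'b::comm_ring_1"
  shows "wop S a b n = wop S (trunc (Suc n) a) (trunc (Suc n) b) n"
proof -
  have "wop S (gen_var 0) (gen_var 1) n = wop S (trunc (Suc n) (gen_var 0)) (trunc (Suc n) (gen_var 1)) n"
    by (rule mpoly_wop_cong) (auto simp: trunc_def)
  from arg_cong[OF this, of "gen_eval a b b"]
  show ?thesis by (simp add: wop_hom[OF rhom_gen_eval] gen_eval_trunc)
qed

lemma wop_cong:
  assumes "\<And>i. i \<le> n ==> a i = a' i" "\<And>i. i \<le> n ==> b i = b' i"
  shows "wop S a b n = wop S a' b' n"
proof -
  have "trunc (Suc n) a = trunc (Suc n) a'" "trunc (Suc n) b = trunc (Suc n) b'"
    using assms by (auto simp: trunc_def fun_eq_iff)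
  thus ?thesis using wop_trunc[of a b n] wop_trunc[of a' b' n] by simp
qed

text \<open>Compare the ghost components of index \<open>n\<close> for the full and the truncated
  vectors: the components below \<open>n\<close> agree, so only the terms with factor
  \<open>p ^ n\<close> remain. This form makes every component of an Artin-Schreier-Witt equation an
  ordinary Artin-Schreier equation over the earlier ones.\<close>

lemma wop_leading:
  fixes a b :: "nat => 'b::comm_ring_1"
  shows "wop S a b n = a n + of_int e * b n + wop S (trunc n a) (trunc n b) n"
proof -
  let ?X = "gen_var 0" and ?Y = "gen_var 1"
  let ?X' = "trunc n ?X" and ?Y' = "trunc n ?Y"
  have low: "wop S ?X ?Y i = wop S ?X' ?Y' i" if "i < n" for i
    by (rule mpoly_wop_cong) (use that in "auto simp: trunc_def")
  have split: "ghost p n x = (\<Sum>i<n. of_nat (p ^ i) * x i ^ (p ^ (n - i))) + of_nat (p ^ n) * x n"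
    for x :: "nat => witt_mpoly"
    by (simp add: ghost_def lessThan_Suc_atMost[symmetric])
  have gt: "ghost p n (trunc n x) = ghost p n x - of_nat (p ^ n) * x n" for x :: "nat => witt_mpoly"
    unfolding split by (simp add: trunc_def cong: sum.cong_simp)
  have "(\<Sum>i<n. of_nat (p ^ i) * wop S ?X ?Y i ^ (p ^ (n - i))) = (\<Sum>i<n. of_nat (p ^ i) * wop S ?X' ?Y' i ^ (p ^ (n - i)))"
    by (intro sum.cong refl) (simp only: low lessThan_iff)
  hence "of_nat (p ^ n) * wop S ?X ?Y n - of_nat (p ^ n) * wop S ?X' ?Y' n
     = ghost p n (wop S ?X ?Y) - ghost p n (wop S ?X' ?Y')"
    unfolding split by simp
  also have "\<dots> = of_nat (p ^ n) * ?X n + of_int e * (of_nat (p ^ n) * ?Y n)"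
    by (simp add: ghost_wop gt algebra_simps)
  finally have "of_nat (p ^ n) * wop S ?X ?Y n = of_nat (p ^ n) * (?X n + of_int e * ?Y n + wop S ?X' ?Y' n)"
    by (simp add: algebra_simps)
  hence "wop S ?X ?Y n = ?X n + of_int e * ?Y n + wop S ?X' ?Y' n"
    by (rule mpoly_of_nat_mult_cancel[rotated]) (use prime_gt_0_nat[OF p] in simp)
  from arg_cong[OF this, of "gen_eval a b b"] show ?thesis
    by (simp add: rhom_simps[OF rhom_gen_eval] wop_hom[OF rhom_gen_eval] gen_eval_trunc)
qed

lemma nth_witt_op: "n < length x ==> n < length y ==> witt_op S x y ! n = wop S ((!) x) ((!) y) n"
  by (simp add: witt_op_def wop_def)

lemma witt_op_map: "witt_op S (map a [0..<v]) (map b [0..<v]) = map (wop S a b) [0..<v]"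
  by (rule nth_equalityI) (auto simp: witt_op_def wop_def[symmetric] intro!: wop_cong)

lemma map_witt_op:
  assumes "is_rhom h" "length x = length y"
  shows "map h (witt_op S x y) = witt_op S (map h x) (map h y)"
proof -
  have "x = map ((!) x) [0..<length x]" "y = map ((!) y) [0..<length x]"
    using map_nth[of x] map_nth[of y] assms(2) by simp_all
  then obtain a b v where "x = map a [0..<v]" "y = map b [0..<v]" by blast
  thus ?thesis by (simp add: witt_op_map wop_hom[OF assms(1)] comp_def)
qed

end

lemmas nth_witt_add = witt_operation.nth_witt_op[OF witt_operation_add, folded witt_add_def]
  and nth_witt_diff = witt_operation.nth_witt_op[OF witt_operation_diff, folded witt_diff_def]
  and map_witt_add = witt_operation.map_witt_op[OF witt_operation_add, folded witt_add_def]
  and map_witt_diff = witt_operation.map_witt_op[OF witt_operation_diff, folded witt_diff_def]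
  and witt_add_map = witt_operation.witt_op_map[OF witt_operation_add, folded witt_add_def]
  and witt_diff_map = witt_operation.witt_op_map[OF witt_operation_diff, folded witt_diff_def]

lemma length_witt_add [simp]: "length (witt_add p x y) = min (length x) (length y)"
  and length_witt_diff [simp]: "length (witt_diff p x y) = min (length x) (length y)"
  and length_witt_frob [simp]: "length (witt_frob p x) = length x"
  by (simp_all add: witt_add_def witt_diff_def witt_frob_def witt_op_def)

context
  fixes p :: nat
  assumes p: "prime p"
begin

lemma wadd_identities:
  shows "wadd p a b = wadd p b a" "wadd p (wadd p a b) c = wadd p a (wadd p b c)"
    "wadd p a (\<lambda>_. 0) = a" "wadd p (wdiff p a b) b = a" "wdiff p (wadd p a b) b = a"
proof -
  let ?X = "gen_var 0" and ?Y = "gen_var 1" and ?Z = "gen_var 2"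
  have I: "gen_eval a b c (x n) = gen_eval a b c (y n)" if "\<And>n. ghost p n x = ghost p n y" for x y n
    using ghost_inj_upto[of p n x y n] that prime_gt_0_nat[OF p] by simp
  note G = I[of "wadd p ?X ?Y" "wadd p ?Y ?X"] I[of "wadd p (wadd p ?X ?Y) ?Z" "wadd p ?X (wadd p ?Y ?Z)"]
    I[of "wadd p ?X (\<lambda>_. 0)" ?X] I[of "wadd p (wdiff p ?X ?Y) ?Y" ?X] I[of "wdiff p (wadd p ?X ?Y) ?Y" ?X]
  have Z: "ghost p n (\<lambda>_. 0 :: witt_mpoly) = 0" for n
    using prime_gt_0_nat[OF p] by (auto simp: ghost_def power_0_left)
  note E = fun_eq_iff witt_operation.ghost_wop[OF witt_operation_add[OF p]] Z
    witt_operation.ghost_wop[OF witt_operation_diff[OF p]] wop_hom[OF rhom_gen_eval] rhom_0[OF rhom_gen_eval]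
  show "wadd p a b = wadd p b a" using G(1) by (simp add: E add.commute)
  show "wadd p (wadd p a b) c = wadd p a (wadd p b c)" using G(2) by (simp add: E add.assoc)
  show "wadd p a (\<lambda>_. 0) = a" "wadd p (wdiff p a b) b = a" "wdiff p (wadd p a b) b = a"
    using G(3-5) by (simp_all add: E)
qed

lemma list_mapE:
  assumes "length x = v" obtains a where "x = map a [0..<v]"
  using assms map_nth by metis

lemma witt_add_commute: "length x = v ==> length y = v ==> witt_add p x y = witt_add p y x"
  by (elim list_mapE) (simp add: witt_add_map[OF p] wadd_identities(1)[of _ a for a])

lemma witt_add_assoc:
  "length x = v ==> length y = v ==> length z = v ==>
    witt_add p (witt_add p x y) z = witt_add p x (witt_add p y z)"
  by (elim list_mapE) (simp add: witt_add_map[OF p] wadd_identities(2))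

lemma witt_add_zero: "length x = v ==> witt_add p (replicate v 0) x = x"
  by (elim list_mapE) (simp add: witt_add_map[OF p] wadd_identities(1)[of "\<lambda>_. 0"] wadd_identities(3)
    flip: map_replicate_trivial)

lemma witt_add_diff: "length x = v ==> length y = v ==> witt_add p (witt_diff p x y) y = x"
  and witt_diff_add: "length x = v ==> length y = v ==> witt_diff p (witt_add p x y) y = x"
  by (elim list_mapE; simp add: witt_add_map[OF p] witt_diff_map[OF p] wadd_identities(4,5))+

lemma witt_add_right_cancel:
  assumes "length x = v" "length y = v" "length z = v" "witt_add p x z = witt_add p y z"
  shows "x = y"
  using witt_diff_add[of x v z] witt_diff_add[of y v z] assms by metis

lemma witt_add_left_commute:
  assumes "length x = v" "length y = v" "length z = v"
  shows "witt_add p x (witt_add p y z) = witt_add p y (witt_add p x z)"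
  using witt_add_assoc[of x v y z] witt_add_assoc[of y v x z] witt_add_commute[of x v y] assms by simp

lemma witt_diff_self: "length x = v ==> witt_diff p x x = replicate v 0"
  using witt_diff_add[of "replicate v 0" v x] by (simp add: witt_add_zero)

end

section \<open>Witt operations over subrings and modulo ideals\<close>

definition tsubring :: "'b::comm_ring_1 set => bool" where
  "tsubring R \<longleftrightarrow> 0 \<in> R \<and> 1 \<in> R \<and> (\<forall>x\<in>R. \<forall>y\<in>R. x + y \<in> R) \<and> (\<forall>x\<in>R. - x \<in> R) \<and>
     (\<forall>x\<in>R. \<forall>y\<in>R. x * y \<in> R)"

lemma tsubringD:
  assumes "tsubring R"
  shows "0 \<in> R" "1 \<in> R" "x \<in> R ==> y \<in> R ==> x + y \<in> R" "x \<in> R ==> - x \<in> R"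
    "x \<in> R ==> y \<in> R ==> x * y \<in> R"
  using assms unfolding tsubring_def by blast+

lemma mpoly_eval_trunc_closed:
  assumes R: "tsubring R" and "\<And>i. i < n ==> a i \<in> R" "\<And>i. i < n ==> b i \<in> R"
  shows "mpoly_eval (case_sum (trunc n a) (trunc n b)) P \<in> R"
proof (rule mpoly_eval_closed[OF tsubringD[OF R]])
  show "case_sum (trunc n a) (trunc n b) w \<in> R" for w
    using assms(2,3) tsubringD(1)[OF R] by (cases w) (simp_all add: trunc_def)
qed

lemma (in witt_operation) wop_closed:
  assumes "tsubring R" "\<And>i. i \<le> n ==> a i \<in> R" "\<And>i. i \<le> n ==> b i \<in> R"
  shows "wop S a b n \<in> R"
  unfolding wop_trunc[of a b n] unfolding wop_def
  by (rule mpoly_eval_trunc_closed) (use assms in auto)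

lemma witt_add_closed:
  assumes "prime p" "tsubring R" "set x \<subseteq> R" "set y \<subseteq> R"
  shows "set (witt_add p x y) \<subseteq> R"
proof
  fix c assume "c \<in> set (witt_add p x y)"
  then obtain i where i: "i < length x" "i < length y" "c = wadd p ((!) x) ((!) y) i"
    by (auto simp: in_set_conv_nth nth_witt_add[OF assms(1)])
  show "c \<in> R" unfolding i(3)
    by (rule witt_operation.wop_closed[OF witt_operation_add[OF assms(1)] assms(2)]) (use i assms(3,4) in force)+
qed

definition tideal :: "'b::comm_ring_1 set => 'b set => bool" where
  "tideal R m \<longleftrightarrow> 0 \<in> m \<and> m \<subseteq> R \<and> (\<forall>x\<in>m. \<forall>y\<in>m. x + y \<in> m) \<and> (\<forall>r\<in>R. \<forall>x\<in>m. r * x \<in> m)"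

lemma tidealD:
  assumes "tideal R m"
  shows "0 \<in> m" "x \<in> m ==> y \<in> m ==> x + y \<in> m" "r \<in> R ==> x \<in> m ==> r * x \<in> m"
  using assms unfolding tideal_def by blast+

lemma mpoly_eval_cong_ideal:
  assumes R: "tsubring R" and m: "tideal R m"
    and \<rho>: "\<And>v. \<rho> v \<in> R" "\<And>v. \<rho>' v \<in> R" "\<And>v. \<rho> v - \<rho>' v \<in> m"
  shows "mpoly_eval \<rho> P - mpoly_eval \<rho>' P \<in> m"
proof -
  have cl: "0 \<in> R" "1 \<in> R" "\<And>x y. x \<in> R ==> y \<in> R ==> x + y \<in> R" "\<And>x. x \<in> R ==> - x \<in> R"
    "\<And>x y. x \<in> R ==> y \<in> R ==> x * y \<in> R"
    using R unfolding tsubring_def by blast+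
  have R': "mpoly_eval \<rho> Q \<in> R" "mpoly_eval \<rho>' Q \<in> R" for Q
    using mpoly_eval_closed[OF cl \<rho>(1)] mpoly_eval_closed[OF cl \<rho>(2)] by auto
  show ?thesis
  proof (induction P rule: mpoly_induct)
    case 1 show ?case by (simp add: mpoly_eval_1 tidealD(1)[OF m])
  next
    case (2 x y)
    have "mpoly_eval \<rho> (x + y) - mpoly_eval \<rho>' (x + y)
      = (mpoly_eval \<rho> x - mpoly_eval \<rho>' x) + (mpoly_eval \<rho> y - mpoly_eval \<rho>' y)"
      by (simp add: mpoly_eval_add)
    thus ?case using tidealD(2)[OF m 2] by simp
  next
    case (3 x)
    from tidealD(3)[OF m cl(4)[OF cl(2)] 3] show ?case by (simp add: rhom_minus[OF rhom_mpoly_eval])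
  next
    case (4 x y)
    have "mpoly_eval \<rho> (x * y) - mpoly_eval \<rho>' (x * y)
      = mpoly_eval \<rho> x * (mpoly_eval \<rho> y - mpoly_eval \<rho>' y)
        + mpoly_eval \<rho>' y * (mpoly_eval \<rho> x - mpoly_eval \<rho>' x)"
      by (simp add: mpoly_eval_mult algebra_simps)
    thus ?case
      using tidealD(2)[OF m tidealD(3)[OF m R'(1) 4(2)] tidealD(3)[OF m R'(2) 4(1)]] by simp
  next
    case (5 v) thus ?case by (simp add: \<rho>(3))
  qed
qed

lemma (in witt_operation) wop_cong_ideal:
  assumes R: "tsubring R" and m: "tideal R m"
    and ab: "\<And>i. i \<le> n ==> a i \<in> R \<and> a' i \<in> R \<and> b i \<in> R \<and> b' i \<in> R \<and> a i - a' i \<in> m \<and> b i - b' i \<in> m"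
  shows "wop S a b n - wop S a' b' n \<in> m"
proof -
  let ?N = "Suc n"
  have "0 \<in> R" "0 \<in> m" using R m by (auto simp: tsubring_def tideal_def)
  hence "case_sum (trunc ?N a) (trunc ?N b) w \<in> R" "case_sum (trunc ?N a') (trunc ?N b') w \<in> R"
    "case_sum (trunc ?N a) (trunc ?N b) w - case_sum (trunc ?N a') (trunc ?N b') w \<in> m" for w
    using ab by (cases w; simp add: trunc_def)+
  thus ?thesis unfolding wop_trunc[of a b n] wop_trunc[of a' b' n] unfolding wop_def
    by (rule mpoly_eval_cong_ideal[OF R m])
qed

section \<open>Subrings and subfields of a field\<close>

lemma tsubring_diff: "tsubring R ==> x \<in> R ==> y \<in> R ==> x - y \<in> R"
  using tsubringD(3)[of R x "- y"] tsubringD(4)[of R y] by simp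

lemma tsubring_power: "tsubring R ==> x \<in> R ==> x ^ n \<in> R"
  by (induction n) (simp_all add: tsubringD(2,5))

lemma tsubring_sum: "tsubring R ==> (\<And>i. i \<in> I ==> f i \<in> R) ==> (\<Sum>i\<in>I. f i) \<in> R"
  by (induction I rule: infinite_finite_induct) (simp_all add: tsubringD(1,3))

lemma tsubring_prod: "tsubring R ==> (\<And>i. i \<in> I ==> f i \<in> R) ==> (\<Prod>i\<in>I. f i) \<in> R"
  by (induction I rule: infinite_finite_induct) (simp_all add: tsubringD(2,5))

lemma tsubring_of_nat: "tsubring R ==> of_nat n \<in> R"
  by (induction n) (simp_all add: tsubringD(1,2,3))

lemma tsubring_Int: "tsubring R ==> tsubring S ==> tsubring (R \<inter> S)"
  by (simp add: tsubring_def)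

definition tfield :: "'b::field set => bool" where
  "tfield F \<longleftrightarrow> tsubring F \<and> (\<forall>x\<in>F. inverse x \<in> F)"

lemma tfieldD: "tfield F ==> tsubring F" "tfield F ==> x \<in> F ==> inverse x \<in> F"
  by (auto simp: tfield_def)

lemma tfield_divide: "tfield F ==> x \<in> F ==> y \<in> F ==> x / y \<in> F"
  by (simp add: tfieldD tsubringD(5) divide_inverse)

lemma field_ambient: "Ring.field (ambient :: 'b::field ring)"
  by (rule field_from_type_algebra)

lemma ambient_simps [simp]:
  "carrier (ambient :: 'b::field ring) = UNIV" "\<one>\<^bsub>(ambient :: 'b ring)\<^esub> = 1"
  "\<zero>\<^bsub>(ambient :: 'b ring)\<^esub> = 0" "x \<oplus>\<^bsub>(ambient :: 'b ring)\<^esub> y = x + y"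
  "x \<otimes>\<^bsub>(ambient :: 'b ring)\<^esub> y = x * y"
  by (simp_all add: ring_of_type_algebra_def)

lemma ambient_a_inv [simp]: "\<ominus>\<^bsub>(ambient :: 'b::field ring)\<^esub> x = - x"
proof -
  interpret Ring.field "ambient :: 'b ring" by (rule field_ambient)
  have "\<ominus>\<^bsub>(ambient :: 'b ring)\<^esub> x + x = 0"
    using l_neg[of x] by simp
  thus ?thesis by (simp add: add_eq_0_iff2)
qed

lemma ambient_m_inv [simp]: "x \<noteq> 0 ==> inv\<^bsub>(ambient :: 'b::field ring)\<^esub> x = inverse x"
proof -
  assume x: "x \<noteq> 0"
  interpret Ring.field "ambient :: 'b ring" by (rule field_ambient)
  have "x \<in> Units (ambient :: 'b ring)" using x field_Units by simp
  hence "inv\<^bsub>(ambient :: 'b ring)\<^esub> x * x = 1"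
    using Units_l_inv[of x] by simp
  thus ?thesis using x by (simp add: field_simps nonzero_eq_divide_eq inverse_eq_divide)
qed

lemma subring_ambient: "subring R (ambient :: 'b::field ring) \<longleftrightarrow> tsubring R"
proof
  assume "subring R (ambient :: 'b ring)"
  from subringE[OF this] show "tsubring R" by (simp add: tsubring_def)
next
  interpret Ring.field "ambient :: 'b ring" by (rule field_ambient)
  assume "tsubring R"
  thus "subring R (ambient :: 'b ring)"
    by (intro subringI) (simp_all add: tsubringD)
qed

lemma subfield_ambient: "subfield F (ambient :: 'b::field ring) \<longleftrightarrow> tfield F"
proof
  interpret Ring.field "ambient :: 'b ring" by (rule field_ambient)
  assume F: "subfield F (ambient :: 'b ring)"
  have t: "tsubring F" using subfieldE(1)[OF F] subring_ambient by blast
  moreover have "inverse x \<in> F" if "x \<in> F" for x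
    using subfield_m_inv(1)[OF F, of x] that tsubringD(1)[OF t] by (cases "x = 0") simp_all
  ultimately show "tfield F" by (simp add: tfield_def)
next
  interpret Ring.field "ambient :: 'b ring" by (rule field_ambient)
  assume "tfield F"
  thus "subfield F (ambient :: 'b ring)"
    by (intro subfieldI') (simp_all add: subring_ambient tfieldD)
qed

lemma tfield_adjoin: "tfield (adjoin F A :: 'b::field set)"
proof -
  interpret Ring.field "ambient :: 'b ring" by (rule field_ambient)
  show ?thesis
    unfolding adjoin_def subfield_ambient[symmetric] by (rule generate_field_is_subfield) simp
qed

lemma adjoin_incl: "F \<subseteq> adjoin F A" "A \<subseteq> adjoin F A"
  by (auto simp: adjoin_def intro: generate_field.incl)

lemma adjoin_minimal: "tfield E ==> F \<subseteq> E ==> A \<subseteq> E ==> adjoin F A \<subseteq> (E :: 'b::field set)"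
proof -
  interpret Ring.field "ambient :: 'b ring" by (rule field_ambient)
  assume "tfield E" "F \<subseteq> E" "A \<subseteq> E"
  thus ?thesis
    unfolding adjoin_def by (intro generate_field_min_subfield1) (auto simp: subfield_ambient)
qed

lemma adjoin_mono: "A \<subseteq> B ==> adjoin F A \<subseteq> adjoin F B"
  by (rule adjoin_minimal[OF tfield_adjoin]) (use adjoin_incl in blast)+

text \<open>The elements reached from finite subsets already form a field. This reduces questions
  about infinite composita to finitely many generators.\<close>

lemma adjoin_finite_support:
  assumes "c \<in> adjoin F A"
  shows "\<exists>S. finite S \<and> S \<subseteq> A \<and> c \<in> adjoin F S"
proof -
  let ?E = "{c. \<exists>S. finite S \<and> S \<subseteq> A \<and> c \<in> adjoin F S}"
  have un: "\<exists>S. finite S \<and> S \<subseteq> A \<and> x \<in> adjoin F S \<and> y \<in> adjoin F S" if xy: "x \<in> ?E" "y \<in> ?E" for x y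
  proof -
    from xy obtain S T where "finite S" "S \<subseteq> A" "x \<in> adjoin F S" "finite T" "T \<subseteq> A" "y \<in> adjoin F T"
      by auto
    hence "finite (S \<union> T) \<and> S \<union> T \<subseteq> A \<and> x \<in> adjoin F (S \<union> T) \<and> y \<in> adjoin F (S \<union> T)"
      using adjoin_mono[of S "S \<union> T" F] adjoin_mono[of T "S \<union> T" F] by auto
    thus ?thesis by blast
  qed
  note t = tfield_adjoin tfieldD(1)[OF tfield_adjoin]
  have "tfield ?E"
    unfolding tfield_def tsubring_def
  proof (intro conjI ballI)
    show "0 \<in> ?E" "1 \<in> ?E"
      using tsubringD(1,2)[OF t(2)[of F "{}"]] by auto
  next
    fix x y assume "x \<in> ?E" "y \<in> ?E"
    from un[OF this] show "x + y \<in> ?E" using tsubringD(3)[OF t(2)] by blast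
  next
    fix x y assume "x \<in> ?E" "y \<in> ?E"
    from un[OF this] show "x * y \<in> ?E" using tsubringD(5)[OF t(2)] by blast
  next
    fix x assume "x \<in> ?E"
    thus "- x \<in> ?E" using tsubringD(4)[OF t(2)] by blast
  next
    fix x assume "x \<in> ?E"
    thus "inverse x \<in> ?E" using tfieldD(2)[OF t(1)] by blast
  qed
  moreover have "F \<subseteq> ?E" using adjoin_incl(1)[of F "{}"] by auto
  moreover have "A \<subseteq> ?E"
  proof
    fix a assume "a \<in> A"
    hence "finite {a} \<and> {a} \<subseteq> A \<and> a \<in> adjoin F {a}" using adjoin_incl(2)[of "{a}" F] by auto
    thus "a \<in> ?E" by blast
  qed
  ultimately have "adjoin F A \<subseteq> ?E" by (rule adjoin_minimal)
  with assms show ?thesis by blast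
qed

definition poly_over :: "'b::comm_ring_1 set => 'b poly => bool" where
  "poly_over F f \<longleftrightarrow> (\<forall>i. coef f i \<in> F)"

lemma poly_over_mono: "F \<subseteq> E ==> poly_over F f ==> poly_over E f"
  by (auto simp: poly_over_def)

lemma poly_eval_closed:
  assumes "tsubring R" "poly_over R f" "x \<in> R" shows "poly f x \<in> R"
  unfolding poly_altdef
  by (intro tsubring_sum tsubringD(5) tsubring_power assms) (use assms in "auto simp: poly_over_def")

lemma poly_over_0: "tsubring F ==> poly_over F 0"
  and poly_over_const: "tsubring F ==> c \<in> F ==> poly_over F [:c:]"
  by (auto simp: poly_over_def coeff_pCons tsubringD(1) split: nat.splits)

lemma poly_over_add: "tsubring F ==> poly_over F f ==> poly_over F g ==> poly_over F (f + g)"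
  and poly_over_diff: "tsubring F ==> poly_over F f ==> poly_over F g ==> poly_over F (f - g)"
  and poly_over_minus: "tsubring F ==> poly_over F f ==> poly_over F (- f)"
  and poly_over_smult: "tsubring F ==> c \<in> F ==> poly_over F f ==> poly_over F (smult c f)"
  by (simp_all add: poly_over_def tsubringD tsubring_diff)

lemma poly_over_mult: "tsubring F ==> poly_over F f ==> poly_over F g ==> poly_over F (f * g)"
  unfolding poly_over_def coeff_mult by (intro allI tsubring_sum tsubringD(5)) auto

lemma poly_over_monom: "tsubring F ==> c \<in> F ==> poly_over F (Polynomial.monom c n)"
  by (auto simp: poly_over_def tsubringD(1))

lemma poly_over_pCons: "tsubring F ==> c \<in> F ==> poly_over F f ==> poly_over F (pCons c f)"
  by (auto simp: poly_over_def coeff_pCons split: nat.splits)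

lemma degree_cancel:
  fixes f g :: "'b::field poly"
  assumes "g \<noteq> 0" "pdeg g \<le> pdeg f"
  defines "k \<equiv> f - Polynomial.monom (lcoeff f / lcoeff g) (pdeg f - pdeg g) * g"
  shows "k = 0 \<or> pdeg k < pdeg f"
proof -
  have "pdeg k \<le> pdeg f"
    unfolding k_def using degree_mult_le[of "Polynomial.monom (lcoeff f / lcoeff g) (pdeg f - pdeg g)" g]
      degree_monom_le[of "lcoeff f / lcoeff g" "pdeg f - pdeg g"] assms(2) by (intro degree_diff_le) auto
  moreover have "coef k (pdeg f) = 0" using assms(1,2) by (simp add: k_def coeff_monom_mult)
  ultimately show ?thesis by (metis leading_coeff_0_iff order_le_less)
qed

text \<open>Division with remainder in a form that does not need inverses of coefficients.\<close>

lemma min_degree_dvd: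
  fixes I :: "'b::field poly set"
  assumes step: "\<And>f. f \<in> I ==> pdeg g \<le> pdeg f ==>
      smult (lcoeff g) f - Polynomial.monom (lcoeff f) (pdeg f - pdeg g) * g \<in> I"
    and g: "g \<noteq> 0" and min: "\<And>f. f \<in> I ==> f \<noteq> 0 ==> pdeg g \<le> pdeg f"
    and "f \<in> I"
  shows "g dvd f"
  using \<open>f \<in> I\<close>
proof (induction "pdeg f" arbitrary: f rule: less_induct)
  case less
  show ?case
  proof (cases "f = 0")
    case False
    define h where "h = smult (lcoeff g) f - Polynomial.monom (lcoeff f) (pdeg f - pdeg g) * g"
    have dg: "pdeg g \<le> pdeg f" using min less.prems False by auto
    have hI: "h \<in> I" unfolding h_def by (rule step[OF less.prems dg])
    have "h = smult (lcoeff g) (f - Polynomial.monom (lcoeff f / lcoeff g) (pdeg f - pdeg g) * g)"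
      using g by (simp add: h_def smult_diff_right smult_monom flip: mult_smult_left)
    hence "h = 0 \<or> pdeg h < pdeg f" using degree_cancel[OF g dg] g by auto
    hence gh: "g dvd h" using less.hyps hI by auto
    have "smult (lcoeff g) f = h + Polynomial.monom (lcoeff f) (pdeg f - pdeg g) * g"
      by (simp add: h_def)
    hence "g dvd smult (lcoeff g) f" using gh by simp
    thus ?thesis using g by (simp add: dvd_smult_iff)
  qed simp
qed

section \<open>Extension of homomorphisms\<close>

text \<open>A ring homomorphism defined on a subring is represented by its graph.\<close>

definition phom :: "('b::field \<times> 'b) set => bool" where
  "phom G \<longleftrightarrow> (1, 1) \<in> G \<and> (\<forall>x a y b. (x, a) \<in> G --> (y, b) \<in> G --> (x + y, a + b) \<in> G \<and> (x * y, a * b) \<in> G) \<and>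
     (\<forall>x a. (x, a) \<in> G --> (- x, - a) \<in> G) \<and> (\<forall>a. (0, a) \<in> G --> a = 0)"

lemma phomD:
  assumes "phom G"
  shows "(1, 1) \<in> G" "(x, a) \<in> G ==> (y, b) \<in> G ==> (x + y, a + b) \<in> G"
    "(x, a) \<in> G ==> (y, b) \<in> G ==> (x * y, a * b) \<in> G" "(x, a) \<in> G ==> (- x, - a) \<in> G"
    "(0, a) \<in> G ==> a = 0"
  using assms unfolding phom_def by blast+

lemma phom_0: "phom G ==> (0, 0) \<in> G"
proof -
  assume G: "phom G"
  show ?thesis using phomD(2)[OF G phomD(1)[OF G] phomD(4)[OF G phomD(1)[OF G]]] by simp
qed

lemma phom_diff: "phom G ==> (x, a) \<in> G ==> (y, b) \<in> G ==> (x - y, a - b) \<in> G"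
  using phomD(2)[of G x a "- y" "- b"] phomD(4)[of G y b] by simp

lemma phom_unique: "phom G ==> (x, a) \<in> G ==> (x, b) \<in> G ==> a = b"
  using phom_diff[of G x a x b] phomD(5)[of G "a - b"] by simp

lemma phom_sum: "phom G ==> (\<And>i. i \<in> I ==> (f i, g i) \<in> G) ==> (\<Sum>i\<in>I. f i, \<Sum>i\<in>I. g i) \<in> G"
  by (induction I rule: infinite_finite_induct) (simp_all add: phom_0 phomD(2))

lemma phom_power: "phom G ==> (x, a) \<in> G ==> (x ^ n, a ^ n) \<in> G"
  by (induction n) (simp_all add: phomD(1,3))

definition phom_poly :: "('b::field \<times> 'b) set => ('b poly \<times> 'b poly) set" where
  "phom_poly G = {(f, g). \<forall>i. (coef f i, coef g i) \<in> G}"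

definition phom_adjoin :: "('b::field \<times> 'b) set => 'b => 'b => ('b \<times> 'b) set" where
  "phom_adjoin G x y = (\<lambda>(f, g). (poly f x, poly g y)) ` phom_poly G"

lemma phom_poly_add: "phom G ==> (f, g) \<in> phom_poly G ==> (f', g') \<in> phom_poly G ==> (f + f', g + g') \<in> phom_poly G"
  by (simp add: phom_poly_def phomD(2))

lemma phom_poly_minus: "phom G ==> (f, g) \<in> phom_poly G ==> (- f, - g) \<in> phom_poly G"
  by (simp add: phom_poly_def phomD(4))

lemma phom_poly_diff: "phom G ==> (f, g) \<in> phom_poly G ==> (f', g') \<in> phom_poly G ==> (f - f', g - g') \<in> phom_poly G"
  by (simp add: phom_poly_def phom_diff)

lemma phom_poly_mult: "phom G ==> (f, g) \<in> phom_poly G ==> (f', g') \<in> phom_poly G ==> (f * f', g * g') \<in> phom_poly G"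
  by (auto simp: phom_poly_def coeff_mult intro!: phom_sum phomD(3))

lemma phom_poly_const: "phom G ==> (x, a) \<in> G ==> ([:x:], [:a:]) \<in> phom_poly G"
  by (auto simp: phom_poly_def coeff_pCons phom_0 split: nat.splits)

lemma phom_poly_X: "phom G ==> ([:0, 1:], [:0, 1:]) \<in> phom_poly G"
  by (auto simp: phom_poly_def coeff_pCons phom_0 phomD(1) split: nat.splits)

lemma phom_poly_monom: "phom G ==> (x, a) \<in> G ==> (Polynomial.monom x n, Polynomial.monom a n) \<in> phom_poly G"
  by (auto simp: phom_poly_def phom_0)

text \<open>Polynomials over the domain are evaluated at \<open>x\<close> on the left and, after
  mapping their coefficients, at \<open>y\<close> on the right; \<open>wd\<close> says that this
  pairing is single-valued.\<close>

lemma phom_adjoin: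
  assumes G: "phom G" and wd: "\<And>f g. (f, g) \<in> phom_poly G ==> poly f x = 0 ==> poly g y = 0"
  shows "phom (phom_adjoin G x y)" "G \<subseteq> phom_adjoin G x y" "(x, y) \<in> phom_adjoin G x y"
proof -
  have I: "(poly f x, poly g y) \<in> phom_adjoin G x y" if "(f, g) \<in> phom_poly G" for f g
    using that by (force simp: phom_adjoin_def)
  have E: "\<exists>f g. (f, g) \<in> phom_poly G \<and> u = poly f x \<and> v = poly g y" if "(u, v) \<in> phom_adjoin G x y" for u v
    using that by (auto simp: phom_adjoin_def)
  show "G \<subseteq> phom_adjoin G x y"
  proof
    fix z assume "z \<in> G"
    then obtain u v where "z = (u, v)" "(u, v) \<in> G" by (cases z) auto
    thus "z \<in> phom_adjoin G x y" using I[OF phom_poly_const[OF G]] by simp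
  qed
  show "(x, y) \<in> phom_adjoin G x y" using I[OF phom_poly_X[OF G]] by simp
  show "phom (phom_adjoin G x y)"
    unfolding phom_def
  proof (intro conjI allI impI)
    show "(1, 1) \<in> phom_adjoin G x y" using I[OF phom_poly_const[OF G phomD(1)[OF G]]] by simp
  next
    fix u a v b assume "(u, a) \<in> phom_adjoin G x y" "(v, b) \<in> phom_adjoin G x y"
    then obtain f g f' g' where *: "(f, g) \<in> phom_poly G" "u = poly f x" "a = poly g y"
       "(f', g') \<in> phom_poly G" "v = poly f' x" "b = poly g' y" using E by metis
    show "(u + v, a + b) \<in> phom_adjoin G x y" using I[OF phom_poly_add[OF G *(1,4)]] * by simp
    show "(u * v, a * b) \<in> phom_adjoin G x y" using I[OF phom_poly_mult[OF G *(1,4)]] * by simp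
  next
    fix u a assume "(u, a) \<in> phom_adjoin G x y"
    then obtain f g where *: "(f, g) \<in> phom_poly G" "u = poly f x" "a = poly g y" using E by metis
    show "(- u, - a) \<in> phom_adjoin G x y" using I[OF phom_poly_minus[OF G *(1)]] * by simp
  next
    fix a assume "(0, a) \<in> phom_adjoin G x y"
    then obtain f g where *: "(f, g) \<in> phom_poly G" "0 = poly f x" "a = poly g y" using E by metis
    thus "a = 0" using wd[of f g] by simp
  qed
qed

text \<open>The images of the polynomials that vanish at \<open>x\<close> are closed under division
  with remainder after scaling, hence are multiples of one of least degree. Condition
  \<open>nc\<close> keeps that one from being a nonzero constant, and an algebraically closed field
  provides its root.\<close>

lemma phom_common_root:
  fixes G :: "('b::alg_closed_field \<times> 'b) set"
  assumes G: "phom G"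
    and nc: "\<And>f c. (f, [:c:]) \<in> phom_poly G ==> poly f x = 0 ==> c = 0"
  shows "\<exists>y. \<forall>f g. (f, g) \<in> phom_poly G --> poly f x = 0 --> poly g y = 0"
proof -
  define I where "I = {g. \<exists>f. (f, g) \<in> phom_poly G \<and> poly f x = 0}"
  show ?thesis
  proof (cases "\<exists>g\<in>I. g \<noteq> 0")
    case False
    hence "\<forall>f g. (f, g) \<in> phom_poly G --> poly f x = 0 --> poly g 0 = 0"
      by (auto simp: I_def)
    thus ?thesis by blast
  next
    case True
    then obtain g where g: "g \<in> I" "g \<noteq> 0" and min: "\<And>f. f \<in> I ==> f \<noteq> 0 ==> pdeg g \<le> pdeg f"
      using ex_has_least_nat[of "\<lambda>g. g \<in> I \<and> g \<noteq> 0" _ pdeg] by blast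
    obtain f0 where f0: "(f0, g) \<in> phom_poly G" "poly f0 x = 0" using g by (auto simp: I_def)
    have "pdeg g \<noteq> 0"
    proof
      assume "pdeg g = 0"
      then obtain c where "g = [:c:]" by (auto elim: degree_eq_zeroE)
      thus False using nc f0 g by auto
    qed
    then obtain y where y: "poly g y = 0" using alg_closed_imp_poly_has_root[of g] by blast
    have dvd: "g dvd f" if "f \<in> I" for f
    proof (rule min_degree_dvd[of I g f, OF _ g(2) min that])
      fix h assume "h \<in> I"
      then obtain k where k: "(k, h) \<in> phom_poly G" "poly k x = 0" by (auto simp: I_def)
      define d where "d = pdeg h - pdeg g"
      have c: "(coef f0 i, coef g i) \<in> G" "(coef k i, coef h i) \<in> G" for i
        using f0 k by (auto simp: phom_poly_def)
      \<comment> \<open>The coefficient of \<open>f0\<close> at the degree of \<open>g\<close> is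
        used, not the leading one: higher coefficients of \<open>f0\<close> may be mapped to
        zero.\<close>
      have "([:coef f0 (pdeg g):] * k - Polynomial.monom (coef k (pdeg h)) d * f0,
         [:lcoeff g:] * h - Polynomial.monom (lcoeff h) d * g) \<in> phom_poly G"
        by (intro phom_poly_diff[OF G] phom_poly_mult[OF G] phom_poly_const[OF G] phom_poly_monom[OF G] c f0 k)
      moreover have "poly ([:coef f0 (pdeg g):] * k - Polynomial.monom (coef k (pdeg h)) d * f0) x = 0"
        using k f0 by simp
      ultimately show "smult (lcoeff g) h - Polynomial.monom (lcoeff h) (pdeg h - pdeg g) * g \<in> I"
        by (auto simp: I_def d_def[symmetric])
    qed
    have "poly g' y = 0" if "(f, g') \<in> phom_poly G" "poly f x = 0" for f g'
    proof -
      have "g dvd g'" by (rule dvd) (use that in "auto simp: I_def")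
      thus ?thesis using y by (auto elim: dvdE)
    qed
    thus ?thesis by blast
  qed
qed

section \<open>Chevalley's theorem: maximal homomorphisms and valuation rings\<close>

definition maximal_phom :: "('b::field \<times> 'b) set => bool" where
  "maximal_phom G \<longleftrightarrow> phom G \<and> (\<forall>H. phom H --> G \<subseteq> H --> H = G)"

lemma maximal_phom_exists:
  assumes "phom G0" shows "\<exists>G. maximal_phom G \<and> G0 \<subseteq> G"
proof -
  let ?A = "{G. phom G \<and> G0 \<subseteq> G}"
  have "\<exists>M\<in>?A. \<forall>Z\<in>?A. M \<subseteq> Z --> Z = M"
  proof (rule subset_Zorn_nonempty)
    show "?A \<noteq> {}" using assms by auto
  next
    fix C assume C: "C \<noteq> {}" "subset.chain ?A C"
    hence ph: "phom G" "G0 \<subseteq> G" if "G \<in> C" for G using that by (auto simp: subset.chain_def)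
    have two: "\<exists>G\<in>C. u \<in> G \<and> v \<in> G" if uv: "u \<in> \<Union>C" "v \<in> \<Union>C" for u v
    proof -
      obtain G H where "G \<in> C" "u \<in> G" "H \<in> C" "v \<in> H" using uv by blast
      moreover have "G \<subseteq> H \<or> H \<subseteq> G"
        using C(2) \<open>G \<in> C\<close> \<open>H \<in> C\<close> unfolding subset_chain_def by blast
      ultimately show ?thesis by blast
    qed
    have "phom (\<Union>C)"
      unfolding phom_def
    proof (intro conjI allI impI)
      show "(1, 1) \<in> \<Union>C" using C(1) ph(1) phomD(1) by blast
    next
      fix x a y b assume "(x, a) \<in> \<Union>C" "(y, b) \<in> \<Union>C"
      then obtain G where "G \<in> C" "(x, a) \<in> G" "(y, b) \<in> G" using two[of "(x, a)" "(y, b)"] by auto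
      thus "(x + y, a + b) \<in> \<Union>C" "(x * y, a * b) \<in> \<Union>C"
        using phomD(2,3)[OF ph(1)] by blast+
    next
      fix x a assume "(x, a) \<in> \<Union>C"
      thus "(- x, - a) \<in> \<Union>C" using phomD(4)[OF ph(1)] by blast
    next
      fix a assume "(0, a) \<in> \<Union>C"
      thus "a = 0" using phomD(5)[OF ph(1)] by blast
    qed
    moreover obtain G where "G \<in> C" using C(1) by auto
    ultimately show "\<Union>C \<in> ?A" using ph(2)[of G] by auto
  qed
  then obtain M where M: "phom M" "G0 \<subseteq> M" "\<And>Z. phom Z ==> G0 \<subseteq> Z ==> M \<subseteq> Z ==> Z = M" by auto
  hence "maximal_phom M" unfolding maximal_phom_def by auto
  thus ?thesis using M by blast
qed

text \<open>A common root of the transported relations would allow an extension by \<open>x\<close>.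
  Used in contrapositive form: outside the domain there is a relation for \<open>x\<close> whose
  image is a nonzero constant.\<close>

lemma maximal_phom_adjoin:
  fixes G :: "('b::alg_closed_field \<times> 'b) set"
  assumes G: "maximal_phom G"
    and nc: "\<And>f c. (f, [:c:]) \<in> phom_poly G ==> poly f x = 0 ==> c = 0"
  shows "x \<in> Domain G"
proof -
  have ph: "phom G" using G by (simp add: maximal_phom_def)
  obtain y where y: "\<And>f g. (f, g) \<in> phom_poly G ==> poly f x = 0 ==> poly g y = 0"
    using phom_common_root[OF ph, of x] nc by blast
  have *: "phom (phom_adjoin G x y)" "G \<subseteq> phom_adjoin G x y" "(x, y) \<in> phom_adjoin G x y"
    using phom_adjoin[OF ph, of x y] y by blast+
  have "phom_adjoin G x y = G" using G *(1,2) unfolding maximal_phom_def by auto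
  hence "(x, y) \<in> G" using *(3) by simp
  thus ?thesis by (rule DomainI)
qed

text \<open>Multiplying a relation for \<open>inverse a\<close> by \<open>a ^ n\<close> and applying
  the homomorphism leaves only \<open>c * b ^ n = 0\<close>.\<close>

lemma maximal_phom_inverse:
  fixes G :: "('b::alg_closed_field \<times> 'b) set"
  assumes G: "maximal_phom G" and ab: "(a, b) \<in> G" "b \<noteq> 0"
  shows "inverse a \<in> Domain G"
proof (rule maximal_phom_adjoin[OF G])
  have ph: "phom G" using G by (simp add: maximal_phom_def)
  have a0: "a \<noteq> 0" using ab phomD(5)[OF ph] by auto
  fix f c assume f: "(f, [:c:]) \<in> phom_poly G" "poly f (inverse a) = 0"
  define n where "n = pdeg f"
  have "0 = a ^ n * poly f (inverse a)" using f by simp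
  also have "\<dots> = (\<Sum>i\<le>n. coef f i * a ^ (n - i))"
    unfolding poly_altdef n_def sum_distrib_left
    by (intro sum.cong refl) (use a0 in "auto simp: power_diff field_simps")
  finally have "(0, \<Sum>i\<le>n. coef [:c:] i * b ^ (n - i)) \<in> G"
    using phom_sum[OF ph, of "{..n}" "\<lambda>i. coef f i * a ^ (n - i)" "\<lambda>i. coef [:c:] i * b ^ (n - i)"]
      f(1) phomD(3)[OF ph] phom_power[OF ph ab(1)] by (simp add: phom_poly_def)
  hence "(\<Sum>i\<le>n. coef [:c:] i * b ^ (n - i)) = 0" by (rule phomD(5)[OF ph])
  moreover have "(\<Sum>i\<le>n. coef [:c:] i * b ^ (n - i)) = (\<Sum>i\<in>{0}. coef [:c:] i * b ^ (n - i))"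
    by (rule sum.mono_neutral_right) (auto simp: coeff_pCons split: nat.splits)
  ultimately show "c = 0" using ab(2) by simp
qed

text \<open>
  The relations that obstruct adjoining both \<open>x\<close> and \<open>inverse x\<close>: an equation of degree \<open>n\<close> whose
  coefficients are mapped to those of a nonzero constant.
\<close>

definition unit_rel :: "('b::field \<times> 'b) set => 'b => nat => (nat => 'b) => 'b => bool" where
  "unit_rel G x n a c \<longleftrightarrow> c \<noteq> 0 \<and> (a 0, c) \<in> G \<and> (\<forall>i\<in>{1..n}. (a i, 0) \<in> G) \<and> (\<Sum>i\<le>n. a i * x ^ i) = 0"

text \<open>Multiplied by \<open>x ^ Suc n\<close>, the relation for \<open>inverse x\<close>
  becomes one for \<open>x\<close> whose leading coefficient \<open>b 0\<close> is mapped to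
  \<open>d\<close>. It eliminates the leading term of the first relation, and the constant term is
  then mapped to \<open>d * c\<close>, which is nonzero.\<close>

lemma unit_rel_reduce:
  assumes G: "phom G" and x: "x \<noteq> 0" and a: "unit_rel G x (Suc n) a c" and b: "unit_rel G (inverse x) m b d"
    and mn: "m \<le> Suc n"
  shows "\<exists>a'. unit_rel G x n a' (d * c)"
proof -
  let ?N = "Suc n"
  define b' where "b' i = (if i \<le> m then b i else 0)" for i
  have bG: "(b' 0, d) \<in> G" "\<And>i. 0 < i ==> (b' i, 0) \<in> G"
    using b phom_0[OF G] by (auto simp: unit_rel_def b'_def)
  have aG: "(a 0, c) \<in> G" "\<And>i. 0 < i ==> i \<le> ?N ==> (a i, 0) \<in> G"
    using a by (auto simp: unit_rel_def)
  have "(\<Sum>i\<le>?N. b' i * inverse x ^ i) = (\<Sum>i\<le>m. b i * inverse x ^ i)"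
    by (rule sum.mono_neutral_cong_right) (use mn in "auto simp: b'_def")
  hence "0 = x ^ ?N * (\<Sum>i\<le>?N. b' i * inverse x ^ i)" using b by (simp add: unit_rel_def)
  also have "\<dots> = (\<Sum>i\<le>?N. b' i * x ^ (?N - i))"
    unfolding sum_distrib_left by (intro sum.cong refl) (use x in "auto simp: power_diff field_simps")
  also have "\<dots> = (\<Sum>i\<le>?N. b' (?N - i) * x ^ i)"
    by (rule sum.reindex_bij_witness[of _ "\<lambda>i. ?N - i" "\<lambda>i. ?N - i"]) auto
  finally have bs: "(\<Sum>i\<le>?N. b' (?N - i) * x ^ i) = 0" by simp
  define a' where "a' i = b' 0 * a i - a ?N * b' (?N - i)" for i
  have "(\<Sum>i\<le>?N. a' i * x ^ i) = b' 0 * (\<Sum>i\<le>?N. a i * x ^ i) - a ?N * (\<Sum>i\<le>?N. b' (?N - i) * x ^ i)"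
    by (simp only: a'_def sum_distrib_left left_diff_distrib sum_subtractf mult.assoc)
  also have "\<dots> = 0" using a bs by (simp only: unit_rel_def) simp
  finally have s: "(\<Sum>i\<le>n. a' i * x ^ i) = 0" by (simp add: a'_def)
  have "(a' 0, d * c - 0 * 0) \<in> G"
    unfolding a'_def by (intro phom_diff[OF G] phomD(3)[OF G] aG bG) auto
  moreover have "(a' i, d * 0 - 0 * 0) \<in> G" if "i \<in> {1..n}" for i
    unfolding a'_def by (intro phom_diff[OF G] phomD(3)[OF G] aG bG) (use that in auto)
  ultimately have "unit_rel G x n a' (d * c)"
    using a b s by (auto simp: unit_rel_def)
  thus ?thesis by blast
qed

text \<open>Descent on the sum of the degrees: the longer relation is shortened by the other one,
  the two cases being exchanged by inverting \<open>x\<close>. Degree \<open>0\<close> would force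
  \<open>a 0 = 0\<close>, although its image is nonzero.\<close>

lemma no_unit_rel:
  assumes G: "phom G" and x: "x \<noteq> 0"
  shows "unit_rel G x n a c ==> unit_rel G (inverse x) m b d ==> False"
  using x
proof (induction "n + m" arbitrary: n m a b c d x rule: less_induct)
  case less
  show ?case
  proof (cases "m \<le> n")
    case True
    show ?thesis
    proof (cases n)
      case 0
      thus ?thesis using less.prems phomD(5)[OF G] by (auto simp: unit_rel_def)
    next
      case (Suc n')
      obtain a' where "unit_rel G x n' a' (d * c)"
        using unit_rel_reduce[OF G less.prems(3) less.prems(1)[unfolded Suc] less.prems(2)] True Suc by auto
      from less.hyps[OF _ this less.prems(2,3)] Suc show ?thesis by simp
    qed
  next
    case False
    then obtain m' where m': "m = Suc m'" by (cases m) auto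
    have "inverse x \<noteq> 0" using less.prems by simp
    from unit_rel_reduce[OF G this less.prems(2)[unfolded m'], of n a c] less.prems(1) False m'
    obtain b' where "unit_rel G (inverse x) m' b' (c * d)" by auto
    from less.hyps[OF _ less.prems(1) this less.prems(3)] m' show ?thesis by simp
  qed
qed

text \<open>If both failed, \<open>x\<close> and its inverse would each satisfy a relation mapped to
  a nonzero constant, which the descent excludes.\<close>

lemma maximal_phom_valuation:
  fixes G :: "('b::alg_closed_field \<times> 'b) set"
  assumes G: "maximal_phom G"
  shows "x \<in> Domain G \<or> inverse x \<in> Domain G"
proof (rule ccontr)
  assume neg: "\<not> ?thesis"
  have ph: "phom G" using G by (simp add: maximal_phom_def)
  have rel: "\<exists>n a c. unit_rel G y n a c" if "y \<notin> Domain G" for y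
  proof -
    obtain f c where f: "(f, [:c:]) \<in> phom_poly G" "poly f y = 0" "c \<noteq> 0"
      using maximal_phom_adjoin[OF G, of y] \<open>y \<notin> Domain G\<close> by blast
    have *: "(coef f i, coef [:c:] i) \<in> G" for i
      using f(1) by (simp add: phom_poly_def)
    have "(coef f i, 0) \<in> G" if "i \<in> {1..pdeg f}" for i
      using *[of i] that by (cases i) (auto simp: coeff_pCons)
    hence "unit_rel G y (pdeg f) (coef f) c"
      using f(2,3) *[of 0] by (simp add: unit_rel_def poly_altdef)
    thus ?thesis by blast
  qed
  have "x \<noteq> 0" using neg phom_0[OF ph] by auto
  thus False using rel[of x] rel[of "inverse x"] neg no_unit_rel[OF ph] by blast
qed

section \<open>Automorphisms of an algebraic closure\<close>

definition auts :: "'b::field set => ('b => 'b) set" where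
  "auts F = {s. is_rhom s \<and> bij s \<and> (\<forall>x\<in>F. s x = x)}"

definition alg_over :: "'b::field set => bool" where
  "alg_over B \<longleftrightarrow> (\<forall>x. \<exists>f. f \<noteq> 0 \<and> poly_over B f \<and> poly f x = 0)"

lemma autsD:
  assumes "s \<in> auts F"
  shows "is_rhom s" "bij s" "x \<in> F ==> s x = x" "inj s"
  using assms by (auto simp: auts_def bij_def)

lemma auts_mono: "F \<subseteq> E ==> auts E \<subseteq> auts F"
  by (auto simp: auts_def)

lemma auts_id: "id \<in> auts F"
  by (simp add: auts_def is_rhom_def)

lemma auts_comp: "s \<in> auts F ==> t \<in> auts F ==> s \<circ> t \<in> auts F"
  by (simp add: auts_def is_rhom_def bij_comp)

lemma auts_inv:
  assumes "s \<in> auts F" shows "(inv_into UNIV s) \<in> auts F"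
proof -
  note * = autsD[OF assms]
  have s: "s (inv_into UNIV s x) = x" for x using *(2) by (simp add: bij_is_surj surj_f_inv_f)
  have eq: "(inv_into UNIV s) x = y" if "s y = x" for x y using *(4) that by (metis inv_f_f)
  show ?thesis
    unfolding auts_def is_rhom_def
    using *(2,3) by (auto simp: bij_imp_bij_inv rhom_simps[OF *(1)] s intro!: eq)
qed

lemma auts_inv_cancel:
  assumes "s \<in> auts F" shows "s (inv_into UNIV s x) = x" "(inv_into UNIV s) (s x) = x"
  using autsD[OF assms] by (simp_all add: bij_is_surj surj_f_inv_f)

lemma rhom_inverse:
  fixes h :: "'b::field => 'c::field"
  assumes "is_rhom h" shows "h (inverse x) = inverse (h x)"
proof (cases "x = 0")
  case False
  hence "h x * h (inverse x) = 1"
    by (simp flip: rhom_mult[OF assms] add: rhom_1[OF assms])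
  thus ?thesis by (metis inverse_unique)
qed (simp add: rhom_0[OF assms])

lemma rhom_divide:
  fixes h :: "'b::field => 'c::field"
  assumes "is_rhom h" shows "h (x / y) = h x / h y"
  by (simp add: divide_inverse rhom_mult[OF assms] rhom_inverse[OF assms])

lemma rhom_eq_0_iff:
  fixes h :: "'b::field => 'c::field"
  assumes "is_rhom h" shows "h x = 0 \<longleftrightarrow> x = 0"
proof
  assume "h x = 0"
  show "x = 0"
  proof (rule ccontr)
    assume "x \<noteq> 0"
    hence "h x * h (inverse x) = 1"
      by (simp flip: rhom_mult[OF assms] add: rhom_1[OF assms])
    with \<open>h x = 0\<close> show False by simp
  qed
qed (simp add: rhom_0[OF assms])

lemma rhom_inj:
  fixes h :: "'b::field => 'c::field"
  assumes "is_rhom h" shows "inj h"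
proof (rule injI)
  fix x y assume "h x = h y"
  hence "h (x - y) = 0" by (simp add: rhom_diff[OF assms])
  thus "x = y" by (simp add: rhom_eq_0_iff[OF assms])
qed

lemma rhom_poly_fixed:
  assumes "is_rhom h" "\<And>i. h (coef f i) = coef f i"
  shows "h (poly f x) = poly f (h x)"
  by (simp add: poly_altdef rhom_simps[OF assms(1)] assms(2))

lemma auts_poly: "s \<in> auts F ==> poly_over F f ==> s (poly f x) = poly f (s x)"
  by (rule rhom_poly_fixed) (auto simp: autsD poly_over_def)

lemma map_poly_rhom_mult:
  assumes "is_rhom h" shows "map_poly h (f * g) = map_poly h f * map_poly h g"
  by (rule poly_eqI)
    (simp add: coeff_map_poly coeff_mult rhom_simps[OF assms])

lemma map_poly_rhom_prod:
  assumes "is_rhom h" shows "map_poly h (\<Prod>i\<in>I. f i) = (\<Prod>i\<in>I. map_poly h (f i))"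
  by (induction I rule: infinite_finite_induct)
    (simp_all add: map_poly_rhom_mult[OF assms] rhom_1[OF assms])

definition root_poly :: "'b::field set => 'b poly" where
  "root_poly Z = (\<Prod>z\<in>Z. [:- z, 1:])"

lemma poly_root_poly: "finite Z ==> poly (root_poly Z) x = 0 \<longleftrightarrow> x \<in> Z"
  by (auto simp: root_poly_def poly_prod)

lemma root_poly_nonzero: "root_poly Z \<noteq> 0"
  by (cases "finite Z") (auto simp: root_poly_def)

lemma root_poly_fixed:
  assumes h: "is_rhom h" and Z: "h ` Z = Z"
  shows "h (coef (root_poly Z) i) = coef (root_poly Z) i"
proof -
  have "map_poly h (root_poly Z) = (\<Prod>z\<in>Z. [:- h z, 1:])"
    unfolding root_poly_def map_poly_rhom_prod[OF h]
    by (intro prod.cong refl) (simp add: map_poly_pCons rhom_simps[OF h])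
  also have "\<dots> = (\<Prod>z\<in>h ` Z. [:- z, 1:])"
    by (subst prod.reindex) (use rhom_inj[OF h] in "auto intro: inj_on_subset")
  finally have "map_poly h (root_poly Z) = root_poly Z" by (simp add: Z root_poly_def)
  thus ?thesis by (metis coeff_map_poly rhom_0[OF h])
qed

lemma poly_over_prod_linear:
  assumes "tsubring R" "\<And>z. z \<in> Z ==> h z \<in> R" shows "poly_over R (\<Prod>z\<in>Z. [:- h z, 1:])"
  using assms(2)
proof (induction Z rule: infinite_finite_induct)
  case (insert z Z)
  hence "poly_over R ([:- h z, 1:] * (\<Prod>z\<in>Z. [:- h z, 1:]))"
    by (intro poly_over_mult poly_over_pCons poly_over_0 assms(1))
      (simp_all add: tsubringD[OF assms(1)])
  thus ?case unfolding prod.insert[OF insert.hyps] .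
qed (simp_all add: poly_over_pCons[of R 1 0] one_pCons poly_over_0 tsubringD assms(1))

lemma poly_over_root_poly: "tsubring R ==> Z \<subseteq> R ==> poly_over R (root_poly Z)"
  unfolding root_poly_def by (rule poly_over_prod_linear) auto

text \<open>Dividing the monic equation by \<open>x ^ (n - 1)\<close> writes \<open>x\<close> as a
  polynomial in \<open>inverse x\<close>, so \<open>x\<close> lies in \<open>R\<close> as soon as
  \<open>inverse x\<close> does.\<close>

lemma integral_in_valuation:
  fixes x :: "'b::field"
  assumes R: "tsubring R" and a: "\<And>i. i < n ==> a i \<in> R" and x: "x ^ n = (\<Sum>i<n. a i * x ^ i)"
    and v: "x \<in> R \<or> inverse x \<in> R"
  shows "x \<in> R"
proof (cases "x = 0 \<or> x \<in> R")
  case False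
  hence ix: "inverse x \<in> R" "x \<noteq> 0" using v by auto
  obtain k where k: "n = Suc k" using x by (cases n) auto
  have "x = x ^ n * inverse x ^ k" using ix(2) by (simp add: k power_inverse)
  also have "\<dots> = (\<Sum>i<n. a i * inverse x ^ (k - i))"
    unfolding x sum_distrib_right using ix(2) k
    by (intro sum.cong refl) (simp add: power_inverse field_simps flip: power_add)
  also have "\<dots> \<in> R" by (intro tsubring_sum[OF R] tsubringD(5)[OF R] tsubring_power[OF R] ix a) simp
  finally show ?thesis .
qed (use tsubringD(1)[OF R] in auto)

lemma alg_in_valuation:
  fixes x :: "'b::field"
  assumes B: "tfield B" and R: "tsubring R" "B \<subseteq> R" and f: "f \<noteq> 0" "poly_over B f" "poly f x = 0"
    and v: "x \<in> R \<or> inverse x \<in> R"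
  shows "x \<in> R"
proof (rule integral_in_valuation[OF R(1) _ _ v])
  let ?n = "pdeg f"
  have "coef f i \<in> B" for i using f(2) by (simp add: poly_over_def)
  thus "- (coef f i / lcoeff f) \<in> R" for i
    using tsubringD(4)[OF R(1)] tfield_divide[OF B] R(2) by blast
  have "(\<Sum>i<?n. coef f i * x ^ i) + lcoeff f * x ^ ?n = 0"
    using f(3) by (simp add: poly_altdef flip: lessThan_Suc_atMost)
  hence "x ^ ?n = - ((\<Sum>i<?n. coef f i * x ^ i) / lcoeff f)"
    using f(1) by (simp add: field_simps add_eq_0_iff)
  thus "x ^ ?n = (\<Sum>i<?n. - (coef f i / lcoeff f) * x ^ i)"
    by (simp add: sum_divide_distrib sum_negf)
qed

text \<open>A maximal extension of \<open>G0\<close> is defined on a valuation ring containing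
  \<open>B\<close>; everything is algebraic over \<open>B\<close>, so the domain is the whole field.
  Surjectivity holds because the injective map permutes the finitely many roots of each polynomial
  over \<open>B\<close>.\<close>

lemma ext_aut:
  fixes G0 :: "('b::alg_closed_field \<times> 'b) set"
  assumes B: "tfield B" "alg_over B" and G0: "phom G0" "\<And>x. x \<in> B ==> (x, x) \<in> G0"
  shows "\<exists>s\<in>auts B. \<forall>x a. (x, a) \<in> G0 --> s x = a"
proof -
  obtain G where G: "maximal_phom G" "G0 \<subseteq> G" using maximal_phom_exists[OF G0(1)] by blast
  have ph: "phom G" using G by (simp add: maximal_phom_def)
  have D: "tsubring (Domain G)"
    unfolding tsubring_def
    using phom_0[OF ph] phomD(1,2,3,4)[OF ph] by (auto simp: Domain_iff) blast+
  have BD: "B \<subseteq> Domain G" using G0(2) G(2) by blast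
  have U: "x \<in> Domain G" for x
  proof -
    obtain f where "f \<noteq> 0" "poly_over B f" "poly f x = 0" using B(2) by (auto simp: alg_over_def)
    thus ?thesis using alg_in_valuation[OF B(1) D BD] maximal_phom_valuation[OF G(1), of x] by blast
  qed
  define s where "s x = (THE a. (x, a) \<in> G)" for x
  have s: "(x, s x) \<in> G" for x
  proof -
    obtain a where a: "(x, a) \<in> G" using U[of x] by auto
    thus ?thesis unfolding s_def by (rule theI) (rule phom_unique[OF ph _ a])
  qed
  have seq: "s x = a" if "(x, a) \<in> G" for x a using phom_unique[OF ph s that] .
  have rh: "is_rhom s"
    unfolding is_rhom_def using phomD(1,2,3)[OF ph] s by (auto intro!: seq)
  have fix_B: "s x = x" if "x \<in> B" for x using G0(2)[OF that] G(2) by (auto intro!: seq)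
  have "surj s"
    unfolding surj_def
  proof
    fix y
    obtain f where f: "f \<noteq> 0" "poly_over B f" "poly f y = 0" using B(2) by (auto simp: alg_over_def)
    let ?Z = "{z. poly f z = 0}"
    have "s ` ?Z \<subseteq> ?Z"
    proof safe
      fix z assume "poly f z = 0"
      have "s (poly f z) = poly f (s z)"
        by (rule rhom_poly_fixed[OF rh]) (use f(2) fix_B in "auto simp: poly_over_def")
      thus "poly f (s z) = 0" using \<open>poly f z = 0\<close> rhom_0[OF rh] by simp
    qed
    moreover have "inj_on s ?Z" using rhom_inj[OF rh] by (rule inj_on_subset) simp
    ultimately have "s ` ?Z = ?Z" using poly_roots_finite[OF f(1)] by (intro endo_inj_surj) auto
    thus "\<exists>x. y = s x" using f(3) by auto
  qed
  hence "s \<in> auts B" using rh rhom_inj[OF rh] fix_B by (auto simp: auts_def bij_def)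
  thus ?thesis using seq G(2) by blast
qed

lemma auts_conj:
  fixes c c' :: "'b::alg_closed_field"
  assumes B: "tfield B" "alg_over B" and F: "tfield F" "B \<subseteq> F"
    and c: "\<And>f. poly_over F f ==> poly f c = 0 ==> poly f c' = 0"
  shows "\<exists>s\<in>auts F. s c = c'"
proof -
  define G where "G = {(x, x) | x. x \<in> F}"
  have G: "phom G"
    unfolding phom_def G_def using tsubringD[OF tfieldD(1)[OF F(1)]] by auto
  have "f = g \<and> poly_over F f" if "(f, g) \<in> phom_poly G" for f g
    using that by (auto simp: phom_poly_def G_def poly_over_def poly_eq_iff)
  hence "poly g c' = 0" if "(f, g) \<in> phom_poly G" "poly f c = 0" for f g using c that by auto
  hence *: "phom (phom_adjoin G c c')" "G \<subseteq> phom_adjoin G c c'" "(c, c') \<in> phom_adjoin G c c'"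
    using phom_adjoin[OF G, of c c'] by blast+
  have "(x, x) \<in> phom_adjoin G c c'" if "x \<in> F" for x using *(2) that by (auto simp: G_def)
  hence "\<exists>s\<in>auts B. \<forall>x a. (x, a) \<in> phom_adjoin G c c' --> s x = a"
    using F(2) by (intro ext_aut[OF B *(1)]) auto
  then obtain s where s: "s \<in> auts B" "\<And>x a. (x, a) \<in> phom_adjoin G c c' ==> s x = a" by blast
  have "s \<in> auts F"
    using s(1) s(2)[of x x for x] *(2) by (auto simp: auts_def G_def)
  thus ?thesis using s(2)[OF *(3)] by blast
qed

lemma auts_extend:
  fixes L :: "'b::alg_closed_field set"
  assumes B: "tfield B" "alg_over B" and L: "tfield L" "B \<subseteq> L" and t: "\<And>x. x \<in> B ==> t x = x"
    "\<And>x y. x \<in> L ==> y \<in> L ==> t (x + y) = t x + t y" "\<And>x y. x \<in> L ==> y \<in> L ==> t (x * y) = t x * t y"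
  shows "\<exists>s\<in>auts B. \<forall>x\<in>L. s x = t x"
proof -
  define G where "G = {(x, t x) | x. x \<in> L}"
  note LD = tsubringD[OF tfieldD(1)[OF L(1)]] and BD = tsubringD[OF tfieldD(1)[OF B(1)]]
  have t0: "t 0 = 0" "t 1 = 1" using t(1) BD by auto
  have tm: "t (- x) = - t x" if "x \<in> L" for x
    using t(2)[of x "- x"] that LD t0 by (simp add: eq_neg_iff_add_eq_0 add.commute)
  have G: "phom G"
    unfolding phom_def
  proof (intro conjI allI impI)
    show "(1, 1) \<in> G" using t0 LD(2) by (force simp: G_def)
  next
    fix x a y b assume "(x, a) \<in> G" "(y, b) \<in> G"
    thus "(x + y, a + b) \<in> G" "(x * y, a * b) \<in> G"
      using t(2,3)[of x y] LD(3,5)[of x y] by (auto simp: G_def)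
  next
    fix x a assume "(x, a) \<in> G"
    thus "(- x, - a) \<in> G" using tm[of x] LD(4)[of x] by (auto simp: G_def)
  next
    fix a assume "(0, a) \<in> G" thus "a = 0" using t0 by (auto simp: G_def)
  qed
  have "(x, x) \<in> G" if "x \<in> B" for x using that L(2) t(1)[OF that] by (force simp: G_def)
  from ext_aut[OF B G this] obtain s where "s \<in> auts B" "\<forall>x a. (x, a) \<in> G --> s x = a" by blast
  thus ?thesis by (auto simp: G_def)
qed

lemma min_poly_exists:
  fixes c :: "'b::field"
  assumes F: "tfield F" and f0: "f0 \<noteq> 0" "poly_over F f0" "poly f0 c = 0"
  shows "\<exists>g. g \<noteq> 0 \<and> poly_over F g \<and> poly g c = 0 \<and> (\<forall>f. poly_over F f --> poly f c = 0 --> g dvd f)"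
proof -
  define I where "I = {f. poly_over F f \<and> poly f c = 0}"
  note R = tfieldD(1)[OF F]
  obtain g where g: "g \<in> I" "g \<noteq> 0" and min: "\<And>f. f \<in> I ==> f \<noteq> 0 ==> pdeg g \<le> pdeg f"
    using f0 ex_has_least_nat[of "\<lambda>g. g \<in> I \<and> g \<noteq> 0" f0 Polynomial.degree] unfolding I_def by blast
  have "g dvd f" if "f \<in> I" for f
  proof (rule min_degree_dvd[of I g f, OF _ g(2) min that])
    fix h assume "h \<in> I"
    thus "smult (lcoeff g) h - Polynomial.monom (lcoeff h) (pdeg h - pdeg g) * g \<in> I"
      using g(1) unfolding I_def
      by (auto intro!: poly_over_diff[OF R] poly_over_smult[OF R] poly_over_mult[OF R] poly_over_monom[OF R])
         (auto simp: poly_over_def)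
  qed
  thus ?thesis using g by (auto simp: I_def)
qed

text \<open>A nonzero constant coefficient expresses the inverse as a polynomial in
  \<open>y\<close>; a zero one allows a factor \<open>y\<close> to be removed.\<close>

lemma alg_subring_inverse:
  fixes y :: "'b::field"
  assumes F: "tfield F" and R: "tsubring R" "F \<subseteq> R" "y \<in> R"
  shows "f \<noteq> 0 ==> poly_over F f ==> poly f y = 0 ==> inverse y \<in> R"
proof (induction f)
  case (pCons a q)
  have a: "a \<in> F" and q: "poly_over F q"
    using pCons.prems(2) by (auto simp: poly_over_def coeff_pCons split: nat.splits dest: spec[of _ "0::nat"] spec[of _ "Suc _"])
  show ?case
  proof (cases "y = 0 \<or> a = 0")
    case True
    thus ?thesis using pCons R q tsubringD(1)[OF R(1)] by auto
  next
    case False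
    hence "inverse y = - (inverse a * poly q y)"
      using pCons.prems(3) by (simp add: field_simps add_eq_0_iff)
    also have "\<dots> \<in> R"
      using poly_eval_closed[OF R(1) poly_over_mono[OF R(2) q] R(3)] tfieldD(2)[OF F a] R(1,2)
      by (auto intro!: tsubringD(4,5))
    finally show ?thesis .
  qed
qed simp

section \<open>Simple extensions, separable elements and fixed fields\<close>

lemma adjoin_single:
  fixes b :: "'b::field"
  assumes B: "alg_over B" and F: "tfield F" "B \<subseteq> F"
  shows "adjoin F {b} \<subseteq> {poly h b | h. poly_over F h}"
proof (rule adjoin_minimal)
  let ?R = "{poly h b | h. poly_over F h}"
  note Fr = tfieldD(1)[OF F(1)]
  have I: "poly h b \<in> ?R" if "poly_over F h" for h using that by blast
  show FR: "F \<subseteq> ?R"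
  proof
    fix x assume "x \<in> F"
    thus "x \<in> ?R" using I[OF poly_over_const[OF Fr]] by simp
  qed
  show "{b} \<subseteq> ?R"
    using I[of "[:0, 1:]"] by (simp add: poly_over_pCons[OF Fr] poly_over_0[OF Fr] tsubringD[OF Fr])
  have R: "tsubring ?R"
    unfolding tsubring_def
  proof (intro conjI ballI)
    show "0 \<in> ?R" "1 \<in> ?R" using subsetD[OF FR tsubringD(1)[OF Fr]] subsetD[OF FR tsubringD(2)[OF Fr]] by simp_all
  next
    fix x y assume "x \<in> ?R" "y \<in> ?R"
    then obtain f g where *: "x = poly f b" "y = poly g b" "poly_over F f" "poly_over F g" by blast
    show "x + y \<in> ?R" using I[OF poly_over_add[OF Fr *(3,4)]] * by simp
    show "x * y \<in> ?R" using I[OF poly_over_mult[OF Fr *(3,4)]] * by simp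
  next
    fix x assume "x \<in> ?R"
    then obtain f where *: "x = poly f b" "poly_over F f" by blast
    show "- x \<in> ?R" using I[OF poly_over_minus[OF Fr *(2)]] * by simp
  qed
  show "tfield ?R"
    unfolding tfield_def
  proof (intro conjI R ballI)
    fix x assume x: "x \<in> ?R"
    obtain f where "f \<noteq> 0" "poly_over B f" "poly f x = 0" using B by (auto simp: alg_over_def)
    thus "inverse x \<in> ?R"
      using alg_subring_inverse[OF F(1) R FR x] poly_over_mono[OF F(2)] by blast
  qed
qed

text \<open>Separability by means of a polynomial over \<open>F\<close> that splits into distinct
  linear factors, since its roots will be supplied by orbits or by translates under the prime
  field.\<close>

definition sep_elem :: "'b::field set => 'b => bool" where
  "sep_elem F b \<longleftrightarrow> (\<exists>Z. finite Z \<and> b \<in> Z \<and> poly_over F (root_poly Z))"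

lemma sep_elem_mono: "F \<subseteq> E ==> sep_elem F b ==> sep_elem E b"
  unfolding sep_elem_def using poly_over_mono by blast

text \<open>Each \<open>z\<close> in \<open>Z\<close> is a root of \<open>g\<close> or of its
  cofactor, and the cofactor has at most as many roots as its degree.\<close>

lemma degree_le_card_roots:
  fixes g :: "'b::field poly"
  assumes Z: "finite Z" "g dvd root_poly Z"
  shows "pdeg g \<le> card {z\<in>Z. poly g z = 0}"
proof -
  obtain h where h: "root_poly Z = g * h" using Z(2) by (rule dvdE)
  hence nz: "g \<noteq> 0" "h \<noteq> 0" using root_poly_nonzero[of Z] by auto
  have "poly g z * poly h z = 0" if "z \<in> Z" for z
    using that Z(1) poly_root_poly[of Z z] by (simp add: h)
  hence "card Z \<le> card ({z\<in>Z. poly g z = 0} \<union> {z. poly h z = 0})"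
    by (intro card_mono) (use Z(1) poly_roots_finite[OF nz(2)] in auto)
  also have "\<dots> \<le> card {z\<in>Z. poly g z = 0} + pdeg h"
    by (rule order_trans[OF card_Un_le add_left_mono[OF card_poly_roots_bound[OF nz(2)]]])
  finally have "card Z \<le> card {z\<in>Z. poly g z = 0} + pdeg h" .
  moreover have "card Z = pdeg g + pdeg h"
    using degree_mult_eq[OF nz] by (simp flip: h) (simp add: root_poly_def degree_prod_eq_sum_degree)
  ultimately show ?thesis by simp
qed

text \<open>Write \<open>c\<close> as the value at \<open>b\<close> of a polynomial \<open>h\<close>
  of least degree, which is below that of the minimal polynomial \<open>g\<close> of
  \<open>b\<close>. Automorphisms move \<open>b\<close> to every root of \<open>g\<close> and fix
  \<open>c\<close>, so \<open>h - [:c:]\<close> has more roots than its degree and vanishes.\<close>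

lemma sep_step:
  fixes b :: "'b::alg_closed_field"
  assumes B: "tfield B" "alg_over B" and F: "tfield F" "B \<subseteq> F" and b: "sep_elem F b"
    and c: "c \<in> adjoin F {b}" "\<And>s. s \<in> auts F ==> s c = c"
  shows "c \<in> F"
proof -
  note Fr = tfieldD(1)[OF F(1)]
  obtain Z where Z: "finite Z" "b \<in> Z" "poly_over F (root_poly Z)" using b by (auto simp: sep_elem_def)
  have Zb: "poly (root_poly Z) b = 0" using Z by (simp add: poly_root_poly)
  obtain g where g: "g \<noteq> 0" "poly_over F g" "poly g b = 0" "\<And>f. poly_over F f ==> poly f b = 0 ==> g dvd f"
    using min_poly_exists[OF F(1) root_poly_nonzero Z(3) Zb] by blast
  let ?N = "{z\<in>Z. poly g z = 0}"
  have pdeg: "pdeg g \<le> card ?N" by (rule degree_le_card_roots[OF Z(1) g(4)[OF Z(3) Zb]])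
  have "\<exists>h. poly_over F h \<and> c = poly h b" using adjoin_single[OF B(2) F, of b] c(1) by blast
  then obtain h where h: "poly_over F h" "c = poly h b"
    and min: "\<And>k. poly_over F k ==> c = poly k b ==> pdeg h \<le> pdeg k"
    using ex_has_least_nat[of "\<lambda>h. poly_over F h \<and> c = poly h b" _ pdeg] by blast
  have g0: "pdeg g > 0"
  proof (rule ccontr)
    assume "\<not> ?thesis"
    then obtain d where "g = [:d:]" by (auto elim: degree_eq_zeroE)
    thus False using g by simp
  qed
  have hg: "pdeg h < pdeg g"
  proof (rule ccontr)
    assume "\<not> ?thesis"
    hence le: "pdeg g \<le> pdeg h" by simp
    let ?k = "h - Polynomial.monom (lcoeff h / lcoeff g) (pdeg h - pdeg g) * g"
    have "poly_over F ?k"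
      by (intro poly_over_diff[OF Fr] poly_over_mult[OF Fr] poly_over_monom[OF Fr] tfield_divide[OF F(1)] h g)
        (use h g in "auto simp: poly_over_def")
    moreover have "c = poly ?k b" by (simp add: h g)
    ultimately have "pdeg h \<le> pdeg ?k" by (rule min)
    thus False using degree_cancel[OF g(1) le] le g0 by auto
  qed
  have roots: "poly h z = c" if z: "z \<in> ?N" for z
  proof -
    have "poly f z = 0" if "poly_over F f" "poly f b = 0" for f
      using g(4)[OF that] z by (auto elim: dvdE)
    from auts_conj[OF B F this] obtain s where s: "s \<in> auts F" "s b = z" by blast
    hence "poly h z = s (poly h b)" using auts_poly[OF s(1) h(1), of b] by simp
    thus ?thesis using c(2)[OF s(1)] h by simp
  qed
  have "h - [:c:] = 0"
  proof (rule ccontr)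
    assume nz: "h - [:c:] \<noteq> 0"
    have "card ?N \<le> card {x. poly (h - [:c:]) x = 0}"
      by (rule card_mono) (use roots poly_roots_finite[OF nz] in auto)
    also have "\<dots> \<le> pdeg (h - [:c:])" using nz by (rule card_poly_roots_bound)
    also have "\<dots> \<le> pdeg h" by (rule degree_diff_le) auto
    finally show False using pdeg hg by simp
  qed
  hence "c = coef h 0" by (metis coeff_pCons_0 right_minus_eq)
  thus ?thesis using h(1) by (simp add: poly_over_def)
qed

text \<open>Descends the tower one generator at a time. An automorphism over an intermediate field
  is also one over \<open>F\<close>, so \<open>c\<close> stays fixed at each stage.\<close>

lemma sep_tower:
  fixes c :: "'b::alg_closed_field"
  assumes B: "tfield B" "alg_over B" and F: "tfield F" "B \<subseteq> F"
    and sep: "\<And>i. i < length xs ==> sep_elem (adjoin F (set (take i xs))) (xs ! i)"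
    and c: "c \<in> adjoin F (set xs)" "\<And>s. s \<in> auts F ==> s c = c"
  shows "c \<in> F"
  using sep c(1)
proof (induction xs rule: rev_induct)
  case Nil
  thus ?case using adjoin_minimal[OF F(1), of F "{}"] by auto
next
  case (snoc x xs)
  let ?E = "adjoin F (set xs)"
  have "adjoin F (set (xs @ [x])) \<subseteq> adjoin ?E {x}"
    by (rule adjoin_minimal[OF tfield_adjoin])
      (use adjoin_incl(1)[of F "set xs"] adjoin_incl(2)[of "set xs" F] adjoin_incl(1)[of ?E "{x}"]
        adjoin_incl(2)[of "{x}" ?E] in auto)
  hence cE: "c \<in> adjoin ?E {x}" using snoc.prems(2) by blast
  have FE: "F \<subseteq> ?E" by (rule adjoin_incl)
  have "sep_elem ?E x" using snoc.prems(1)[of "length xs"] by simp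
  hence "c \<in> ?E"
    using sep_step[OF B tfield_adjoin _ _ cE] F(2) FE c(2) auts_mono[OF FE] by blast
  moreover have "sep_elem (adjoin F (set (take i xs))) (xs ! i)" if "i < length xs" for i
    using snoc.prems(1)[of i] that by (simp add: nth_append)
  ultimately show ?case by (intro snoc.IH) auto
qed

lemma sep_adjoin:
  fixes c :: "'b::alg_closed_field"
  assumes B: "tfield B" "alg_over B" and F: "tfield F" "B \<subseteq> F"
    and sep: "\<And>x. x \<in> A ==> sep_elem F x" and c: "c \<in> adjoin F A" "\<And>s. s \<in> auts F ==> s c = c"
  shows "c \<in> F"
proof -
  obtain S where S: "finite S" "S \<subseteq> A" "c \<in> adjoin F S" using adjoin_finite_support[OF c(1)] by blast
  obtain xs where xs: "set xs = S" using finite_list[OF S(1)] by blast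
  show ?thesis
  proof (rule sep_tower[of B F xs])
    show "c \<in> adjoin F (set xs)" using S xs by simp
    show "s c = c" if "s \<in> auts F" for s using c(2)[OF that] .
    show "sep_elem (adjoin F (set (take i xs))) (xs ! i)" if "i < length xs" for i
      by (rule sep_elem_mono[OF adjoin_incl(1) sep]) (use that S xs in auto)
  qed (use B F in auto)
qed

lemma rhom_adjoin:
  fixes s :: "'b::field => 'b"
  assumes "is_rhom s" "tfield E" "\<And>x. x \<in> F ==> s x \<in> E" "\<And>x. x \<in> A ==> s x \<in> E" "x \<in> adjoin F A"
  shows "s x \<in> E"
proof -
  have "tfield {x. s x \<in> E}"
    using assms(2) tsubringD[OF tfieldD(1)[OF assms(2)]]
    by (auto simp: tfield_def tsubring_def rhom_simps[OF assms(1)] rhom_inverse[OF assms(1)])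
  from adjoin_minimal[OF this, of F A] show ?thesis using assms(3-5) by blast
qed

lemma rhom_eq_adjoin:
  fixes s :: "'b::field => 'b"
  assumes "is_rhom s" "is_rhom t" "\<And>x. x \<in> F ==> s x = t x" "\<And>x. x \<in> A ==> s x = t x" "x \<in> adjoin F A"
  shows "s x = t x"
proof -
  have "tfield {x. s x = t x}"
    by (auto simp: tfield_def tsubring_def rhom_simps[OF assms(1)] rhom_inverse[OF assms(1)]
        rhom_simps[OF assms(2)] rhom_inverse[OF assms(2)])
  from adjoin_minimal[OF this, of F A] show ?thesis using assms(3-5) by blast
qed

section \<open>Orbits and normal extensions\<close>

definition orb :: "'b::field set => 'b => 'b set" where
  "orb F x = (\<lambda>s. s x) ` auts F"

lemma orb_self: "x \<in> orb F x"
  unfolding orb_def by (rule image_eqI[of _ _ id]) (simp_all add: auts_id)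

lemma orb_aut:
  assumes "s \<in> auts F" shows "s ` orb F x = orb F x"
proof
  have c: "s (t x) \<in> orb F x" if "s \<in> auts F" "t \<in> auts F" for s t
    unfolding orb_def by (rule image_eqI[of _ _ "s \<circ> t"]) (simp_all add: auts_comp that)
  show "s ` orb F x \<subseteq> orb F x" using c[OF assms] by (auto simp: orb_def)
  show "orb F x \<subseteq> s ` orb F x"
  proof
    fix y assume "y \<in> orb F x"
    then obtain t where t: "t \<in> auts F" "y = t x" by (auto simp: orb_def)
    hence "inv_into UNIV s y \<in> orb F x" using c[OF auts_inv[OF assms] t(1)] by simp
    thus "y \<in> s ` orb F x" using auts_inv_cancel(1)[OF assms, of y] by (metis image_eqI)
  qed
qed

lemma finite_orb:
  assumes "alg_over B" "B \<subseteq> F" shows "finite (orb F x)"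
proof -
  obtain f where f: "f \<noteq> 0" "poly_over B f" "poly f x = 0" using assms by (auto simp: alg_over_def)
  have "orb F x \<subseteq> {z. poly f z = 0}"
    using auts_poly[of _ F f x] poly_over_mono[OF assms(2) f(2)] f(3) autsD(1) rhom_0
    by (fastforce simp: orb_def)
  thus ?thesis using poly_roots_finite[OF f(1)] finite_subset by blast
qed

text \<open>The Galois condition in terms of the automorphisms of the whole algebraic closure.\<close>

definition normal_sep :: "'b::field set => 'b set => bool" where
  "normal_sep F L \<longleftrightarrow> tfield F \<and> tfield L \<and> F \<subseteq> L \<and> (\<forall>s\<in>auts F. \<forall>x\<in>L. s x \<in> L) \<and>
     (\<forall>x\<in>L. (\<forall>s\<in>auts F. s x = x) --> x \<in> F)"

definition commuting :: "'b::field set => 'b set => bool" where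
  "commuting F L \<longleftrightarrow> (\<forall>s\<in>auts F. \<forall>t\<in>auts F. \<forall>x\<in>L. s (t x) = t (s x))"

lemma normal_sepD:
  assumes "normal_sep F L"
  shows "tfield F" "tfield L" "F \<subseteq> L" "s \<in> auts F ==> x \<in> L ==> s x \<in> L"
    "x \<in> L ==> (\<And>s. s \<in> auts F ==> s x = x) ==> x \<in> F"
  using assms unfolding normal_sep_def by blast+

text \<open>The polynomial with the orbit of \<open>x\<close> as its roots has coefficients in
  \<open>L\<close> that no automorphism over \<open>F\<close> moves.\<close>

lemma normal_sep_sep_elem:
  assumes B: "alg_over B" "B \<subseteq> F" and L: "normal_sep F L" and x: "x \<in> L"
  shows "sep_elem F x"
proof -
  have sub: "orb F x \<subseteq> L" using normal_sepD(4)[OF L _ x] by (auto simp: orb_def)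
  have "poly_over L (root_poly (orb F x))"
    by (rule poly_over_root_poly[OF tfieldD(1)[OF normal_sepD(2)[OF L]] sub])
  moreover have "s (coef (root_poly (orb F x)) i) = coef (root_poly (orb F x)) i"
    if "s \<in> auts F" for s i
    by (rule root_poly_fixed[OF autsD(1)[OF that] orb_aut[OF that]])
  ultimately have "poly_over F (root_poly (orb F x))"
    unfolding poly_over_def using normal_sepD(5)[OF L] by blast
  thus ?thesis unfolding sep_elem_def using finite_orb[OF B] orb_self by blast
qed

section \<open>Galois and abelian extensions\<close>

lemma ambient_pow [simp]: "x [^]\<^bsub>(ambient :: 'b::field ring)\<^esub> (n::nat) = x ^ n"
proof -
  interpret Ring.field "ambient :: 'b ring" by (rule field_ambient)
  show ?thesis by (induction n) (simp_all add: mult.commute)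
qed

lemma not_transcendental:
  fixes x :: "'b::field"
  assumes f: "f \<noteq> 0" "poly_over F f" "poly f x = 0"
  shows "\<not> ring.transcendental ambient F x"
proof -
  interpret Ring.field "ambient :: 'b ring" by (rule field_ambient)
  \<comment> \<open>Lists in \<open>univ_poly\<close> begin with the leading coefficient.\<close>
  define p where "p = rev (Polynomial.coeffs f)"
  have ev: "eval xs x = poly (Poly (rev xs)) x" for xs
    by (induction xs) (simp_all add: Poly_append poly_monom)
  have "eval p x = 0" using f(3) by (simp add: ev p_def)
  moreover have "p \<noteq> []" using f(1) by (simp add: p_def)
  moreover have "p \<in> carrier (univ_poly ambient F)"
  proof -
    have "set p \<subseteq> F"
      using f(2) by (auto simp: p_def coeffs_def poly_over_def split: if_splits)
    moreover have "hd p \<noteq> 0"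
      using f(1) by (simp add: p_def hd_rev last_coeffs_eq_coeff_degree)
    ultimately have "polynomial\<^bsub>ambient\<^esub> F p" by (simp add: polynomial_def)
    thus ?thesis by (simp only: univ_poly_def partial_object.simps mem_Collect_eq)
  qed
  ultimately have "(algebraic over F) x" by (intro algebraicI) auto
  thus ?thesis by (simp add: over_def)
qed

lemma galois_group_carrier:
  assumes L: "tfield L"
  shows "t \<in> carrier (galois_group F L) \<longleftrightarrow> t \<in> extensional L \<and> bij_betw t L L \<and> t 1 = 1 \<and>
     (\<forall>x\<in>L. \<forall>y\<in>L. t (x + y) = t x + t y \<and> t (x * y) = t x * t y) \<and> (\<forall>x\<in>F. t x = x)"
  by (auto simp: galois_group_def Bij_def ring_hom_def bij_betw_def)

lemma galois_group_mult:
  assumes "s \<in> carrier (galois_group F L)" "t \<in> carrier (galois_group F L)"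
  shows "s \<otimes>\<^bsub>galois_group F L\<^esub> t = compose L s t"
  using assms by (simp add: galois_group_def BijGroup_def)

lemma restrict_galois_group:
  assumes L: "tfield L" "F \<subseteq> L" and stab: "\<forall>s\<in>auts F. \<forall>x\<in>L. s x \<in> L" and s: "s \<in> auts F"
  shows "restrict s L \<in> carrier (galois_group F L)"
proof -
  have "bij_betw (restrict s L) L L"
    by (rule bij_betw_byWitness[of _ "inv_into UNIV s"])
      (use bspec[OF stab s] bspec[OF stab auts_inv[OF s]] auts_inv_cancel[OF s] in auto)
  thus ?thesis
    using L(2) tsubringD[OF tfieldD(1)[OF L(1)]] autsD[OF s]
    by (auto simp: galois_group_carrier[OF L(1)] rhom_simps)
qed

lemma galois_group_extend:
  fixes L :: "'b::alg_closed_field set"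
  assumes B: "tfield B" "alg_over B" "B \<subseteq> F" and L: "tfield L" "F \<subseteq> L"
    and t: "t \<in> carrier (galois_group F L)"
  shows "\<exists>s\<in>auts F. \<forall>x\<in>L. s x = t x"
proof -
  have t': "\<And>x y. x \<in> L ==> y \<in> L ==> t (x + y) = t x + t y" "\<And>x y. x \<in> L ==> y \<in> L ==> t (x * y) = t x * t y"
     "\<And>x. x \<in> F ==> t x = x"
    using t unfolding galois_group_carrier[OF L(1)] by blast+
  obtain s where s: "s \<in> auts B" "\<forall>x\<in>L. s x = t x"
    using auts_extend[OF B(1,2) L(1), of t] B(3) L(2) t' by blast
  hence "s \<in> auts F" using L(2) t'(3) by (auto simp: auts_def)
  thus ?thesis using s(2) by blast
qed

text \<open>Stability of \<open>L\<close> is the main point: the Galois orbit \<open>Z\<close> of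
  \<open>x\<close> is finite, its root polynomial has coefficients in \<open>F\<close>, and every
  automorphism of the closure over \<open>F\<close> permutes the roots of such a polynomial.
  Restriction to \<open>L\<close> then carries commutativity over.\<close>

lemma abelian_ext_imp:
  fixes L :: "'b::alg_closed_field set"
  assumes B: "tfield B" "alg_over B" "B \<subseteq> F" and ab: "abelian_ext F L"
  shows "normal_sep F L" "commuting F L"
proof -
  let ?G = "carrier (galois_group F L)"
  have F: "tfield F" and L: "tfield L" "F \<subseteq> L"
    and fx: "{x \<in> L. \<forall>s\<in>?G. s x = x} = F" and cg: "comm_group (galois_group F L)"
    using ab by (auto simp: abelian_ext_def galois_ext_def field_ext_def subfield_ambient)
  interpret Gal: comm_group "galois_group F L" by (rule cg)
  note ext = galois_group_extend[OF B L]
  have stab: "s x \<in> L" if s: "s \<in> auts F" and x: "x \<in> L" for s x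
  proof -
    define Z where "Z = (\<lambda>t. t x) ` ?G"
    have ZL: "Z \<subseteq> L"
    proof
      fix z assume "z \<in> Z"
      then obtain t where t: "t \<in> ?G" "z = t x" by (auto simp: Z_def)
      hence "bij_betw t L L" using galois_group_carrier[OF L(1)] by blast
      thus "z \<in> L" using x t(2) by (simp add: bij_betwE)
    qed
    have "Z \<subseteq> orb F x"
    proof
      fix z assume "z \<in> Z"
      then obtain t where "t \<in> ?G" "z = t x" by (auto simp: Z_def)
      obtain s' where "s' \<in> auts F" "\<forall>x\<in>L. s' x = t x" using ext[OF \<open>t \<in> ?G\<close>] by blast
      hence "s' \<in> auts F" "z = s' x" using \<open>z = t x\<close> x by simp_all
      thus "z \<in> orb F x" unfolding orb_def by (rule_tac image_eqI)
    qed
    hence finZ: "finite Z" using finite_orb[OF B(2,3)] finite_subset by blast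
    have "poly_over F (root_poly Z)"
      unfolding poly_over_def
    proof
      fix i
      have "coef (root_poly Z) i \<in> L"
        using poly_over_root_poly[OF tfieldD(1)[OF L(1)] ZL] by (simp add: poly_over_def)
      moreover have "t (coef (root_poly Z) i) = coef (root_poly Z) i" if t: "t \<in> ?G" for t
      proof -
        obtain s' where s': "s' \<in> auts F" "\<forall>x\<in>L. s' x = t x" using ext[OF t] by blast
        have "s' ` Z \<subseteq> Z"
        proof safe
          fix z assume "z \<in> Z"
          then obtain t' where t': "t' \<in> ?G" "z = t' x" by (auto simp: Z_def)
          have "compose L t t' \<in> ?G" using Gal.m_closed[OF t t'(1)] galois_group_mult[OF t t'(1)] by simp
          moreover have "s' z = compose L t t' x"
            using s'(2) \<open>z \<in> Z\<close> ZL t' x by (auto simp: compose_def)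
          ultimately show "s' z \<in> Z" by (auto simp: Z_def)
        qed
        hence "s' ` Z = Z"
          by (intro endo_inj_surj finZ inj_on_subset[OF autsD(4)[OF s'(1)]]) auto
        hence "s' (coef (root_poly Z) i) = coef (root_poly Z) i"
          by (rule root_poly_fixed[OF autsD(1)[OF s'(1)]])
        thus ?thesis
          using bspec[OF s'(2) \<open>coef (root_poly Z) i \<in> L\<close>] by (simp only:)
      qed
      ultimately show "coef (root_poly Z) i \<in> F" using fx by blast
    qed
    from auts_poly[OF s this, of x] have "poly (root_poly Z) (s x) = s (poly (root_poly Z) x)" by simp
    also have "x \<in> Z"
      unfolding Z_def by (rule image_eqI[of _ _ "\<one>\<^bsub>galois_group F L\<^esub>"])
        (use Gal.one_closed x in "auto simp: galois_group_def BijGroup_def")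
    hence "poly (root_poly Z) x = 0" by (simp add: poly_root_poly finZ)
    finally have "s x \<in> Z" using rhom_0[OF autsD(1)[OF s]] by (simp add: poly_root_poly finZ)
    thus ?thesis using ZL by blast
  qed
  show "normal_sep F L"
    unfolding normal_sep_def
  proof (intro conjI ballI impI F L)
    show "s x \<in> L" if "s \<in> auts F" "x \<in> L" for s x by (rule stab[OF that])
    fix x assume x: "x \<in> L" "\<forall>s\<in>auts F. s x = x"
    have "t x = x" if "t \<in> ?G" for t using ext[OF that] x by metis
    thus "x \<in> F" using fx x(1) by blast
  qed
  show "commuting F L"
    unfolding commuting_def
  proof (intro ballI)
    fix s t x assume s: "s \<in> auts F" and t: "t \<in> auts F" and x: "x \<in> L"
    have "\<forall>s\<in>auts F. \<forall>x\<in>L. s x \<in> L" using stab by blast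
    note r = restrict_galois_group[OF L this]
    have "compose L (restrict s L) (restrict t L) = compose L (restrict t L) (restrict s L)"
      using Gal.m_comm[OF r[OF s] r[OF t]] galois_group_mult[OF r[OF s] r[OF t]]
        galois_group_mult[OF r[OF t] r[OF s]] by simp
    hence "compose L (restrict s L) (restrict t L) x = compose L (restrict t L) (restrict s L) x" by simp
    thus "s (t x) = t (s x)" using x stab[OF s x] stab[OF t x] by (simp add: compose_def)
  qed
qed

text \<open>Elements of the Galois group extend to the closure, where composition, inverses and
  commutation can be read off.\<close>

lemma abelian_extI:
  fixes L :: "'b::alg_closed_field set"
  assumes B: "tfield B" "alg_over B" "B \<subseteq> F" and nl: "normal_sep F L" "commuting F L"
  shows "abelian_ext F L"
proof -
  let ?G = "carrier (galois_group F L)"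
  note F = normal_sepD(1)[OF nl(1)] and L = normal_sepD(2,3)[OF nl(1)] and stab = normal_sepD(4)[OF nl(1)]
  note ext = galois_group_extend[OF B L]
  have "\<forall>s\<in>auts F. \<forall>x\<in>L. s x \<in> L" using stab by blast
  note r = restrict_galois_group[OF L this]
  have fx: "{x \<in> L. \<forall>s\<in>?G. s x = x} = F"
  proof (intro equalityI subsetI)
    fix x assume x: "x \<in> {x \<in> L. \<forall>s\<in>?G. s x = x}"
    have "s x = x" if "s \<in> auts F" for s
      using r[OF that] x by (auto dest: bspec)
    thus "x \<in> F" using normal_sepD(5)[OF nl(1)] x by blast
  next
    fix x assume "x \<in> F"
    thus "x \<in> {x \<in> L. \<forall>s\<in>?G. s x = x}" using L by (auto simp: galois_group_carrier)
  qed
  have alg: "\<not> ring.transcendental ambient F x" for x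
    using B(2) poly_over_mono[OF B(3)] not_transcendental unfolding alg_over_def by blast
  have into: "s x \<in> L" if "s \<in> ?G" "x \<in> L" for s x
  proof -
    have "bij_betw s L L" using that(1) galois_group_carrier[OF L(1)] by blast
    thus ?thesis using that(2) by (simp add: bij_betwE)
  qed
  have cmp: "compose L s t \<in> ?G" if st: "s \<in> ?G" "t \<in> ?G" for s t
  proof -
    obtain s' t' where *: "s' \<in> auts F" "\<forall>x\<in>L. s' x = s x" "t' \<in> auts F" "\<forall>x\<in>L. t' x = t x"
      using ext[OF st(1)] ext[OF st(2)] by blast
    have "compose L s t = restrict (s' \<circ> t') L"
      using * into[OF st(2)] by (auto simp: compose_def fun_eq_iff)
    thus ?thesis using r[OF auts_comp[OF *(1,3)]] by simp
  qed
  have comm: "compose L s t = compose L t s" if st: "s \<in> ?G" "t \<in> ?G" for s t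
  proof -
    obtain s' t' where *: "s' \<in> auts F" "\<forall>x\<in>L. s' x = s x" "t' \<in> auts F" "\<forall>x\<in>L. t' x = t x"
      using ext[OF st(1)] ext[OF st(2)] by blast
    have "s (t x) = t (s x)" if "x \<in> L" for x
    proof -
      have "s' (t' x) = t' (s' x)" using nl(2) *(1,3) that unfolding commuting_def by blast
      thus ?thesis using * that into st by metis
    qed
    thus ?thesis by (auto simp: compose_def fun_eq_iff)
  qed
  have one: "\<one>\<^bsub>galois_group F L\<^esub> = restrict id L" by (simp add: galois_group_def BijGroup_def id_def)
  have oneG: "restrict id L \<in> ?G" by (rule r[OF auts_id])
  have "comm_group (galois_group F L)"
  proof (rule comm_groupI)
    fix s t assume st: "s \<in> ?G" "t \<in> ?G"
    show "s \<otimes>\<^bsub>galois_group F L\<^esub> t \<in> ?G" using cmp[OF st] galois_group_mult[OF st] by simp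
    show "s \<otimes>\<^bsub>galois_group F L\<^esub> t = t \<otimes>\<^bsub>galois_group F L\<^esub> s"
      using comm[OF st] galois_group_mult[OF st] galois_group_mult[OF st(2,1)] by simp
  next
    show "\<one>\<^bsub>galois_group F L\<^esub> \<in> ?G" using oneG by (simp add: one)
  next
    fix s t \<rho> assume st: "s \<in> ?G" "t \<in> ?G" "\<rho> \<in> ?G"
    show "s \<otimes>\<^bsub>galois_group F L\<^esub> t \<otimes>\<^bsub>galois_group F L\<^esub> \<rho> = s \<otimes>\<^bsub>galois_group F L\<^esub> (t \<otimes>\<^bsub>galois_group F L\<^esub> \<rho>)"
      using st cmp into[OF st(3)] by (auto simp: galois_group_mult compose_def fun_eq_iff)
  next
    fix s assume s: "s \<in> ?G"
    hence "s \<in> extensional L" by (simp add: galois_group_carrier[OF L(1)])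
    thus "\<one>\<^bsub>galois_group F L\<^esub> \<otimes>\<^bsub>galois_group F L\<^esub> s = s"
      unfolding one galois_group_mult[OF oneG s]
      using into[OF s] by (auto simp: compose_def fun_eq_iff extensional_def)
    obtain s' where s': "s' \<in> auts F" "\<forall>x\<in>L. s' x = s x" using ext[OF s] by blast
    let ?t = "restrict (inv_into UNIV s') L"
    have t: "?t \<in> ?G" by (rule r[OF auts_inv[OF s'(1)]])
    have "?t \<otimes>\<^bsub>galois_group F L\<^esub> s = \<one>\<^bsub>galois_group F L\<^esub>"
      unfolding one galois_group_mult[OF t s]
    proof
      fix x
      have "inv_into UNIV s' (s x) = x" if "x \<in> L"
        using auts_inv_cancel(2)[OF s'(1), of x] bspec[OF s'(2) that] by simp
      thus "compose L ?t s x = restrict id L x" using into[OF s] by (simp add: compose_def)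
    qed
    thus "\<exists>t\<in>?G. t \<otimes>\<^bsub>galois_group F L\<^esub> s = \<one>\<^bsub>galois_group F L\<^esub>" using t by blast
  qed
  thus ?thesis
    using F L fx alg by (simp add: abelian_ext_def galois_ext_def field_ext_def subfield_ambient)
qed

section \<open>Finite groups of automorphisms\<close>

text \<open>\<open>A\<close> is typically an infinite group of automorphisms of the whole closure;
  only its restrictions to \<open>L\<close>, collected in \<open>\<Gamma>\<close>, form a finite
  group. Sums and products over \<open>\<Gamma>\<close> are the trace and norm of \<open>L\<close>
  over the fixed field.\<close>

locale fin_auts =
  fixes A :: "('b::field => 'b) set" and L :: "'b set"
  assumes L: "tfield L"
    and rh: "\<And>s. s \<in> A ==> is_rhom s"
    and stab: "\<And>s x. s \<in> A ==> x \<in> L ==> s x \<in> L"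
    and id_A: "id \<in> A"
    and comp_A: "\<And>s t. s \<in> A ==> t \<in> A ==> s \<circ> t \<in> A"
    and inv_A: "\<And>s. s \<in> A ==> \<exists>t\<in>A. \<forall>x. t (s x) = x \<and> s (t x) = x"
    and finite_restr: "finite ((\<lambda>s. restrict s L) ` A)"
begin

definition \<Gamma> :: "('b => 'b) set" where "\<Gamma> = (\<lambda>s. restrict s L) ` A"

definition Fix :: "'b set" where "Fix = {x \<in> L. \<forall>s\<in>A. s x = x}"

lemma finite_\<Gamma>: "finite \<Gamma>"
  using finite_restr by (simp add: \<Gamma>_def)

lemmas Lr = tfieldD(1)[OF L]

lemma \<Gamma>I: "s \<in> A ==> restrict s L \<in> \<Gamma>"
  by (auto simp: \<Gamma>_def)

lemma \<Gamma>E: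
  assumes "g \<in> \<Gamma>" obtains s where "s \<in> A" "g = restrict s L"
  using assms by (auto simp: \<Gamma>_def)

lemma \<Gamma>_in_L: "g \<in> \<Gamma> ==> x \<in> L ==> g x \<in> L"
  by (auto simp: \<Gamma>_def stab)

lemma bij_left:
  assumes "s \<in> A" shows "bij_betw (\<lambda>g. restrict (s \<circ> g) L) \<Gamma> \<Gamma>"
proof -
  obtain t where t: "t \<in> A" "\<And>x. t (s x) = x" "\<And>x. s (t x) = x" using inv_A[OF assms] by blast
  have into: "restrict (\<rho> \<circ> g) L \<in> \<Gamma>" if r: "\<rho> \<in> A" and "g \<in> \<Gamma>" for \<rho> g
  proof -
    obtain \<rho>' where "\<rho>' \<in> A" "g = restrict \<rho>' L" using \<open>g \<in> \<Gamma>\<close> by (rule \<Gamma>E)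
    hence "restrict (\<rho> \<circ> g) L = restrict (\<rho> \<circ> \<rho>') L" by (auto simp: fun_eq_iff)
    thus ?thesis using \<Gamma>I[OF comp_A[OF r \<open>\<rho>' \<in> A\<close>]] by simp
  qed
  show ?thesis
    by (rule bij_betw_byWitness[of _ "\<lambda>g. restrict (t \<circ> g) L"])
      (use into[OF assms] into[OF t(1)] t(2,3) in "auto simp: \<Gamma>_def fun_eq_iff")
qed

lemma bij_right:
  assumes "s \<in> A" shows "bij_betw (\<lambda>g. restrict (g \<circ> s) L) \<Gamma> \<Gamma>"
proof -
  obtain t where t: "t \<in> A" "\<And>x. t (s x) = x" "\<And>x. s (t x) = x" using inv_A[OF assms] by blast
  have into: "restrict (g \<circ> \<rho>) L \<in> \<Gamma>" if r: "\<rho> \<in> A" and "g \<in> \<Gamma>" for \<rho> g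
  proof -
    obtain \<rho>' where "\<rho>' \<in> A" "g = restrict \<rho>' L" using \<open>g \<in> \<Gamma>\<close> by (rule \<Gamma>E)
    hence "restrict (g \<circ> \<rho>) L = restrict (\<rho>' \<circ> \<rho>) L" using stab[OF r] by (auto simp: fun_eq_iff)
    thus ?thesis using \<Gamma>I[OF comp_A[OF \<open>\<rho>' \<in> A\<close> r]] by simp
  qed
  show ?thesis
    by (rule bij_betw_byWitness[of _ "\<lambda>g. restrict (g \<circ> t) L"])
      (use into[OF assms] into[OF t(1)] t stab[OF assms] stab[OF t(1)] in "auto simp: \<Gamma>_def fun_eq_iff")
qed

definition Tr :: "'b => 'b" where "Tr x = (\<Sum>g\<in>\<Gamma>. g x)"

definition Nm :: "'b => 'b" where "Nm x = (\<Prod>g\<in>\<Gamma>. g x)"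

lemma \<Gamma>_rhom:
  assumes "g \<in> \<Gamma>"
  shows "x \<in> L ==> y \<in> L ==> g (x + y) = g x + g y" "x \<in> L ==> y \<in> L ==> g (x * y) = g x * g y"
    "x \<in> Fix ==> g x = x" "x \<in> L ==> g x = 0 \<longleftrightarrow> x = 0"
proof -
  obtain s where s: "s \<in> A" "g = restrict s L" using assms by (rule \<Gamma>E)
  show "x \<in> L ==> y \<in> L ==> g (x + y) = g x + g y" "x \<in> L ==> y \<in> L ==> g (x * y) = g x * g y"
    "x \<in> Fix ==> g x = x" "x \<in> L ==> g x = 0 \<longleftrightarrow> x = 0"
    using s tsubringD(3,5)[OF Lr] rhom_eq_0_iff[OF rh[OF s(1)]]
    by (auto simp: Fix_def rhom_add[OF rh[OF s(1)]] rhom_mult[OF rh[OF s(1)]])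
qed

lemma Tr_in_L: "x \<in> L ==> Tr x \<in> L"
  unfolding Tr_def by (rule tsubring_sum[OF Lr \<Gamma>_in_L])

lemma Nm_in_L: "x \<in> L ==> Nm x \<in> L"
  unfolding Nm_def by (rule tsubring_prod[OF Lr \<Gamma>_in_L])

lemma Tr_Fix:
  assumes "x \<in> L" shows "Tr x \<in> Fix"
proof -
  have "s (Tr x) = Tr x" if s: "s \<in> A" for s
  proof -
    have "s (Tr x) = (\<Sum>g\<in>\<Gamma>. restrict (s \<circ> g) L x)"
      using assms by (simp add: Tr_def rhom_sum[OF rh[OF s]])
    also have "\<dots> = Tr x"
      unfolding Tr_def by (rule sum.reindex_bij_betw[OF bij_left[OF s], of "\<lambda>g. g x"])
    finally show ?thesis .
  qed
  thus ?thesis using Tr_in_L[OF assms] by (simp add: Fix_def)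
qed

lemma Nm_Fix:
  assumes "x \<in> L" shows "Nm x \<in> Fix"
proof -
  have "s (Nm x) = Nm x" if s: "s \<in> A" for s
  proof -
    have "s (Nm x) = (\<Prod>g\<in>\<Gamma>. restrict (s \<circ> g) L x)"
      using assms by (simp add: Nm_def rhom_prod[OF rh[OF s]])
    also have "\<dots> = Nm x"
      unfolding Nm_def by (rule prod.reindex_bij_betw[OF bij_left[OF s], of "\<lambda>g. g x"])
    finally show ?thesis .
  qed
  thus ?thesis using Nm_in_L[OF assms] by (simp add: Fix_def)
qed

lemma Tr_conj:
  assumes "x \<in> L" "s \<in> A" shows "Tr (s x) = Tr x"
proof -
  have "(\<Sum>g\<in>\<Gamma>. restrict (g \<circ> s) L x) = Tr x"
    unfolding Tr_def by (rule sum.reindex_bij_betw[OF bij_right[OF assms(2)], of "\<lambda>g. g x"])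
  thus ?thesis using assms(1) by (simp add: Tr_def)
qed

lemma Tr_add: "x \<in> L ==> y \<in> L ==> Tr (x + y) = Tr x + Tr y"
  by (simp add: Tr_def \<Gamma>_rhom(1) sum.distrib)

lemma Tr_mult:
  assumes "c \<in> Fix" "x \<in> L" shows "Tr (c * x) = c * Tr x"
proof -
  have "c \<in> L" using assms(1) by (simp add: Fix_def)
  hence "g (c * x) = c * g x" if "g \<in> \<Gamma>" for g
    using \<Gamma>_rhom(2)[OF that _ assms(2), of c] \<Gamma>_rhom(3)[OF that assms(1)] by simp
  thus ?thesis by (simp add: Tr_def sum_distrib_left)
qed

text \<open>One factor for each automorphism of \<open>L\<close>, repetitions included: the
  characteristic polynomial, whose degree \<open>card \<Gamma>\<close> is the same for all
  \<open>x\<close>.\<close>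

definition char_poly :: "'b => 'b poly" where "char_poly x = (\<Prod>g\<in>\<Gamma>. [:- g x, 1:])"

lemma char_poly_Fix:
  assumes "x \<in> L" shows "poly_over Fix (char_poly x)"
proof -
  have over_L: "poly_over L (char_poly x)"
    unfolding char_poly_def by (rule poly_over_prod_linear[OF Lr \<Gamma>_in_L[OF _ assms]])
  have "s (coef (char_poly x) i) = coef (char_poly x) i" if s: "s \<in> A" for s i
  proof -
    have "map_poly s (char_poly x) = (\<Prod>g\<in>\<Gamma>. [:- restrict (s \<circ> g) L x, 1:])"
      unfolding char_poly_def map_poly_rhom_prod[OF rh[OF s]]
      by (intro prod.cong refl) (use assms in "simp add: map_poly_pCons rhom_simps[OF rh[OF s]]")
    also have "\<dots> = char_poly x"
      unfolding char_poly_def by (rule prod.reindex_bij_betw[OF bij_left[OF s], of "\<lambda>g. [:- g x, 1:]"])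
    finally show ?thesis by (metis coeff_map_poly rhom_0[OF rh[OF s]])
  qed
  thus ?thesis using over_L by (auto simp: poly_over_def Fix_def)
qed

lemma tfield_Fix: "tfield Fix"
  using tsubringD[OF Lr] tfieldD(2)[OF L]
  by (auto simp: tfield_def tsubring_def Fix_def rhom_simps[OF rh] rhom_inverse[OF rh])

lemma char_poly_root: "x \<in> L ==> poly (char_poly x) x = 0"
proof -
  assume "x \<in> L"
  hence "poly [:- restrict id L x, 1:] x = 0" by simp
  thus ?thesis
    unfolding char_poly_def poly_prod by (intro prod_zero finite_\<Gamma> bexI[OF _ \<Gamma>I[OF id_A]])
qed

lemma degree_char_poly: "pdeg (char_poly x) = card \<Gamma>"
  unfolding char_poly_def by (subst degree_prod_eq_sum_degree) auto

lemma lead_coeff_char_poly: "lcoeff (char_poly x) = 1"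
  unfolding char_poly_def by (simp add: lead_coeff_prod)

end

text \<open>A restriction to \<open>L\<close> is determined by its values on \<open>S\<close>, and
  these lie in finite orbits.\<close>

lemma fin_auts_normal:
  fixes L :: "'b::field set"
  assumes B: "alg_over B" "B \<subseteq> F" and L: "normal_sep F L" and S: "finite S" "L = adjoin F S"
  shows "fin_auts (auts F) L"
proof
  show "tfield L" by (rule normal_sepD(2)[OF L])
  show "id \<in> auts F" by (rule auts_id)
  show "is_rhom s" if "s \<in> auts F" for s using autsD(1)[OF that] .
  show "s x \<in> L" if "s \<in> auts F" "x \<in> L" for s x using normal_sepD(4)[OF L that] .
  show "s \<circ> t \<in> auts F" if "s \<in> auts F" "t \<in> auts F" for s t by (rule auts_comp[OF that])
  show "\<exists>t\<in>auts F. \<forall>x. t (s x) = x \<and> s (t x) = x" if "s \<in> auts F" for s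
    using auts_inv[OF that] auts_inv_cancel[OF that] by blast
  let ?h = "\<lambda>g. restrict g S"
  have "inj_on ?h ((\<lambda>s. restrict s L) ` auts F)"
  proof (rule inj_onI, clarify)
    fix s t assume st: "s \<in> auts F" "t \<in> auts F" and eq: "restrict (restrict s L) S = restrict (restrict t L) S"
    have "S \<subseteq> L" using S(2) adjoin_incl(2) by blast
    hence "s x = t x" if "x \<in> S" for x using fun_cong[OF eq, of x] that by auto
    hence "s x = t x" if "x \<in> L" for x
      using that S(2) rhom_eq_adjoin[OF autsD(1)[OF st(1)] autsD(1)[OF st(2)], of F S x] autsD(3)[OF st(1)] autsD(3)[OF st(2)]
      by simp
    thus "restrict s L = restrict t L" by auto
  qed
  moreover have "?h ` ((\<lambda>s. restrict s L) ` auts F) \<subseteq> PiE S (orb F)"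
    using S(2) adjoin_incl(2)[of S F] by (auto simp: orb_def)
  hence "finite (?h ` ((\<lambda>s. restrict s L) ` auts F))"
    by (rule finite_subset) (intro finite_PiE S finite_orb[OF B])
  ultimately show "finite ((\<lambda>s. restrict s L) ` auts F)" by (metis finite_imageD)
qed

lemma fin_auts_normal_Fix:
  assumes "normal_sep F L" "fin_auts (auts F) L" shows "fin_auts.Fix (auts F) L = F"
  unfolding fin_auts.Fix_def[OF assms(2)]
proof (intro equalityI subsetI)
  fix x assume "x \<in> F"
  thus "x \<in> {x \<in> L. \<forall>s\<in>auts F. s x = x}" using normal_sepD(3)[OF assms(1)] autsD(3) by auto
next
  fix x assume "x \<in> {x \<in> L. \<forall>s\<in>auts F. s x = x}"
  thus "x \<in> F" by (intro normal_sepD(5)[OF assms(1)]) auto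
qed

section \<open>Valuation rings\<close>

text \<open>The trivial ring \<open>V = L\<close> is included; primes are singled out later by
  properness over the base field.\<close>

definition vring :: "'b::field set => 'b set => bool" where
  "vring L V \<longleftrightarrow> tfield L \<and> tsubring V \<and> V \<subseteq> L \<and> (\<forall>x\<in>L. x \<in> V \<or> inverse x \<in> V)"

lemma vringD:
  assumes "vring L V"
  shows "tfield L" "tsubring L" "tsubring V" "x \<in> V ==> x \<in> L" "x \<in> L ==> x \<notin> V ==> inverse x \<in> V"
  using assms tfieldD(1) unfolding vring_def by blast+

lemma mmD:
  assumes "vring L V"
  shows "x \<in> mm V ==> x \<in> V" "0 \<in> mm V" "1 \<notin> mm V"
    "x \<in> V ==> x \<notin> mm V ==> inverse x \<in> V" "x \<in> V ==> x \<notin> mm V ==> x \<noteq> 0"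
    "x \<in> L ==> x \<notin> V ==> inverse x \<in> mm V"
    "x \<in> V ==> x \<noteq> 0 ==> inverse x \<in> V ==> x \<notin> mm V"
  using tsubringD(1,2)[OF vringD(3)[OF assms]] vringD(5)[OF assms] by (auto simp: max_ideal_def)

lemma mm_mult:
  assumes V: "vring L V" and "r \<in> V" "x \<in> mm V" shows "r * x \<in> mm V"
proof -
  note R = vringD(3)[OF V]
  have x: "x \<in> V" using assms(3) by (rule mmD(1)[OF V])
  show ?thesis
  proof (cases "r * x = 0")
    case True thus ?thesis using mmD(2)[OF V] by (simp only:)
  next
    case False
    have "inverse (r * x) \<notin> V"
    proof
      assume "inverse (r * x) \<in> V"
      hence "r * inverse (r * x) \<in> V" using assms(2) tsubringD(5)[OF R] by blast
      also have "r * inverse (r * x) = inverse x" using False by (simp add: field_simps)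
      finally show False using assms(3) False by (simp add: max_ideal_def)
    qed
    thus ?thesis using tsubringD(5)[OF R assms(2) x] by (simp add: max_ideal_def)
  qed
qed

lemma mm_add:
  assumes V: "vring L V" and x: "x \<in> mm V" and y: "y \<in> mm V" shows "x + y \<in> mm V"
proof (cases "x = 0 \<or> y = 0")
  case True thus ?thesis using x y by auto
next
  case False
  note R = vringD(3)[OF V]
  have L: "x \<in> L" "y \<in> L" using x y mmD(1)[OF V] vringD(4)[OF V] by blast+
  hence "x / y \<in> L" by (rule tfield_divide[OF vringD(1)[OF V]])
  hence "x / y \<in> V \<or> y / x \<in> V" using vringD(5)[OF V, of "x / y"] by auto
  thus ?thesis
  proof
    assume "x / y \<in> V"
    hence "(x / y + 1) * y \<in> mm V"
      by (intro mm_mult[OF V _ y] tsubringD(2,3)[OF R])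
    moreover have "(x / y + 1) * y = x + y" using False by (simp add: field_simps)
    ultimately show ?thesis by simp
  next
    assume "y / x \<in> V"
    hence "(y / x + 1) * x \<in> mm V"
      by (intro mm_mult[OF V _ x] tsubringD(2,3)[OF R])
    moreover have "(y / x + 1) * x = x + y" using False by (simp add: field_simps)
    ultimately show ?thesis by simp
  qed
qed

lemma mm_minus: "vring L V ==> x \<in> mm V ==> - x \<in> mm V"
  using mm_mult[of L V "- 1" x] tsubringD(2,4)[OF vringD(3)] by fastforce

lemma mm_diff: "vring L V ==> x \<in> mm V ==> y \<in> mm V ==> x - y \<in> mm V"
  using mm_add[of L V x "- y"] mm_minus[of L V y] by simp

lemma mm_sum: "vring L V ==> (\<And>i. i \<in> I ==> f i \<in> mm V) ==> (\<Sum>i\<in>I. f i) \<in> mm V"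
  by (induction I rule: infinite_finite_induct) (simp_all add: mmD(2) mm_add)

lemma mm_prime:
  assumes V: "vring L V" and "x \<in> V" "y \<in> V" "x * y \<in> mm V"
  shows "x \<in> mm V \<or> y \<in> mm V"
proof (rule ccontr)
  assume "\<not> ?thesis"
  hence i: "inverse x \<in> V" "inverse y \<in> V" "x \<noteq> 0" "y \<noteq> 0" using mmD(4,5)[OF V] assms(2,3) by blast+
  have "inverse (x * y) \<in> V" using i tsubringD(5)[OF vringD(3)[OF V]] by simp
  moreover have "x * y \<in> V" using assms(2,3) tsubringD(5)[OF vringD(3)[OF V]] by simp
  ultimately show False using mmD(7)[OF V, of "x * y"] assms(4) i by simp
qed

lemma mm_power:
  assumes V: "vring L V" and "x \<in> V" "x ^ n \<in> mm V" shows "x \<in> mm V"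
  using assms(3)
proof (induction n)
  case 0 thus ?case using mmD(3)[OF V] by simp
next
  case (Suc n)
  thus ?case
    using mm_prime[OF V assms(2) tsubring_power[OF vringD(3)[OF V] assms(2), of n]] by auto
qed

lemma mm_prod:
  assumes V: "vring L V" and "finite I" "\<And>i. i \<in> I ==> f i \<in> V" "(\<Prod>i\<in>I. f i) \<in> mm V"
  shows "\<exists>i\<in>I. f i \<in> mm V"
  using assms(2-4)
proof (induction I rule: finite_induct)
  case empty thus ?case using mmD(3)[OF V] by simp
next
  case (insert i I)
  have "f i \<in> mm V \<or> (\<Prod>i\<in>I. f i) \<in> mm V"
    by (rule mm_prime[OF V]) (use insert.prems insert.hyps in "auto intro: tsubring_prod[OF vringD(3)[OF V]]")
  thus ?case using insert by auto
qed

lemma tideal_max_ideal: "vring L V ==> tideal V (mm V)"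
  unfolding tideal_def using mmD(1,2) mm_add mm_mult by blast

lemma mm_cong_mult:
  assumes V: "vring L V" and "a \<in> V" "b' \<in> V" "a - a' \<in> mm V" "b - b' \<in> mm V"
  shows "a * b - a' * b' \<in> mm V"
proof -
  have "a * b - a' * b' = a * (b - b') + b' * (a - a')" by (simp add: algebra_simps)
  also have "\<dots> \<in> mm V" by (intro mm_add[OF V] mm_mult[OF V] assms)
  finally show ?thesis .
qed

lemma mm_cong_trans:
  "vring L V ==> a - b \<in> mm V ==> b - c \<in> mm V ==> a - c \<in> mm V"
  using mm_add[of L V "a - b" "b - c"] by simp

lemma mm_cong_sym: "vring L V ==> a - b \<in> mm V ==> b - a \<in> mm V"
  using mm_minus[of L V "a - b"] by simp

lemma mm_cong_power:
  assumes V: "vring L V" and "a \<in> V" "b \<in> V" "a - b \<in> mm V"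
  shows "a ^ n - b ^ n \<in> mm V"
proof (induction n)
  case 0 thus ?case using mmD(2)[OF V] by simp
next
  case (Suc n)
  have "a * a ^ n - b * b ^ n \<in> mm V"
    by (intro mm_cong_mult[OF V] assms Suc tsubring_power[OF vringD(3)[OF V]])
  thus ?case by simp
qed

lemma mm_cong_in: "vring L V ==> a - b \<in> mm V ==> b \<in> mm V ==> a \<in> mm V"
  using mm_add[of L V "a - b" b] by simp

lemma vring_cong_in: "vring L V ==> a - b \<in> mm V ==> b \<in> V ==> a \<in> V"
  using tsubringD(3)[OF vringD(3), of L V "a - b" b] mmD(1)[of L V "a - b"] by simp

lemma vring_restrict:
  assumes "vring L V" "tfield F" "F \<subseteq> L"
  shows "vring F (V \<inter> F)" "mm (V \<inter> F) = mm V \<inter> F"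
proof -
  show "vring F (V \<inter> F)"
    using assms tfieldD[OF assms(2)] by (auto simp: vring_def intro: tsubring_Int)
  show "mm (V \<inter> F) = mm V \<inter> F"
    using tfieldD(2)[OF assms(2)] by (auto simp: max_ideal_def)
qed

lemma vring_least_value:
  assumes V: "vring L V" and "finite I" "I \<noteq> {}" "\<And>i. i \<in> I ==> f i \<in> L \<and> f i \<noteq> 0"
  shows "\<exists>j\<in>I. \<forall>i\<in>I. f i / f j \<in> V"
  using assms(2-4)
proof (induction I rule: finite_ne_induct)
  case (singleton i)
  thus ?case using tsubringD(2)[OF vringD(3)[OF V]] by simp
next
  case (insert k I)
  then obtain j where j: "j \<in> I" "\<forall>i\<in>I. f i / f j \<in> V" by auto
  have "f k / f j \<in> L" by (rule tfield_divide[OF vringD(1)[OF V]]) (use insert.prems j in auto)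
  then consider "f k / f j \<in> V" | "f j / f k \<in> V" using vringD(5)[OF V, of "f k / f j"] by auto
  thus ?case
  proof cases
    case 1
    thus ?thesis using j by auto
  next
    case 2
    have "f i / f k \<in> V" if "i \<in> I" for i
    proof -
      have eq: "f i / f k = (f i / f j) * (f j / f k)" using insert.prems j(1) by simp
      show ?thesis unfolding eq by (rule tsubringD(5)[OF vringD(3)[OF V]]) (use j(2) that 2 in auto)
    qed
    moreover have "f k / f k \<in> V" using insert.prems[of k] tsubringD(2)[OF vringD(3)[OF V]] by simp
    ultimately show ?thesis by (intro bexI[of _ k]) auto
  qed
qed

text \<open>Divide by a term of least value. If no other term had the same value, all remaining
  quotients would lie in the maximal ideal and sum to \<open>- 1\<close>.\<close>

lemma vring_sum_zero:
  assumes V: "vring L V" and fin: "finite I" and f: "\<And>i. i \<in> I ==> f i \<in> L" and s: "(\<Sum>i\<in>I. f i) = 0"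
    and nz: "i0 \<in> I" "f i0 \<noteq> 0"
  shows "\<exists>i\<in>I. \<exists>j\<in>I. i \<noteq> j \<and> f i \<noteq> 0 \<and> f j \<noteq> 0 \<and> f i / f j \<in> V \<and> f j / f i \<in> V"
proof -
  let ?J = "{i\<in>I. f i \<noteq> 0}"
  have "\<exists>j\<in>?J. \<forall>i\<in>?J. f i / f j \<in> V"
    by (rule vring_least_value[OF V]) (use fin f nz in auto)
  then obtain j where j: "j \<in> I" "f j \<noteq> 0" "\<And>i. i \<in> I ==> f i \<noteq> 0 ==> f i / f j \<in> V" by auto
  show ?thesis
  proof (rule ccontr)
    assume neg: "\<not> ?thesis"
    have "f i / f j \<in> mm V" if "i \<in> I - {j}" for i
    proof (cases "f i = 0")
      case True thus ?thesis using mmD(2)[OF V] by simp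
    next
      case False
      hence "f j / f i \<notin> V" using neg that j by blast
      thus ?thesis using j(3)[of i] that False by (simp add: max_ideal_def)
    qed
    hence "(\<Sum>i\<in>I - {j}. f i / f j) \<in> mm V" by (rule mm_sum[OF V])
    moreover have "(\<Sum>i\<in>I - {j}. f i / f j) = - 1"
    proof -
      have "(\<Sum>i\<in>I. f i) = f j + (\<Sum>i\<in>I - {j}. f i)" by (rule sum.remove[OF fin j(1)])
      hence "(\<Sum>i\<in>I - {j}. f i) = - f j" using s by (simp add: eq_neg_iff_add_eq_0 add.commute)
      thus ?thesis using j(2) by (simp flip: sum_divide_distrib)
    qed
    ultimately show False using mm_minus[OF V, of "- 1"] mmD(3)[OF V] by simp
  qed
qed

section \<open>Discrete valuations\<close>

text \<open>Integer-valued but not normalised: the value group may be any nonzero subgroup of the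
  integers. This permits extending a valuation without knowing its ramification index.\<close>

definition zval :: "'b::field set => 'b set => ('b => int) => bool" where
  "zval L V v \<longleftrightarrow> vring L V \<and> (\<forall>x\<in>L - {0}. \<forall>y\<in>L - {0}. v (x * y) = v x + v y) \<and>
     (\<forall>x\<in>L - {0}. x \<in> V \<longleftrightarrow> v x \<ge> 0) \<and> (\<exists>t\<in>L - {0}. v t > 0)"

lemma zvalD:
  assumes "zval L V v"
  shows "vring L V" "x \<in> L ==> x \<noteq> 0 ==> y \<in> L ==> y \<noteq> 0 ==> v (x * y) = v x + v y"
    "x \<in> L ==> x \<noteq> 0 ==> x \<in> V \<longleftrightarrow> v x \<ge> 0"
  using assms unfolding zval_def by blast+

text \<open>Valuations without reference to a ring, to treat several conjugates at once.\<close>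

definition ival :: "'b::field set => ('b => int) => bool" where
  "ival L v \<longleftrightarrow> (\<forall>x\<in>L - {0}. \<forall>y\<in>L - {0}. v (x * y) = v x + v y) \<and>
     (\<forall>x\<in>L - {0}. \<forall>y\<in>L - {0}. x + y \<noteq> 0 --> v (x + y) \<ge> min (v x) (v y))"

lemma ivalD:
  assumes "ival L v"
  shows "x \<in> L ==> x \<noteq> 0 ==> y \<in> L ==> y \<noteq> 0 ==> v (x * y) = v x + v y"
    "x \<in> L ==> x \<noteq> 0 ==> y \<in> L ==> y \<noteq> 0 ==> x + y \<noteq> 0 ==> min (v x) (v y) \<le> v (x + y)"
  using assms unfolding ival_def by blast+

context
  fixes L :: "'b::field set" and v :: "'b => int"
  assumes L: "tfield L" and v: "ival L v"
begin

lemma ival_one: "v 1 = 0"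
  using ivalD(1)[OF v, of 1 1] tsubringD(2)[OF tfieldD(1)[OF L]] by simp

lemma ival_minus: assumes "x \<in> L" "x \<noteq> 0" shows "v (- x) = v x"
proof -
  have m1: "- 1 \<in> L" using tsubringD(2,4)[OF tfieldD(1)[OF L]] by blast
  hence "v (- 1) + v (- 1) = v 1" using ivalD(1)[OF v, of "- 1" "- 1"] by simp
  hence "v (- 1) = 0" using ival_one by simp
  thus ?thesis using ivalD(1)[OF v m1 _ assms] by simp
qed

lemma ival_inverse: assumes "x \<in> L" "x \<noteq> 0" shows "v (inverse x) = - v x"
  using ivalD(1)[OF v, of x "inverse x"] assms tfieldD(2)[OF L] ival_one by simp

lemma ival_power: assumes "x \<in> L" "x \<noteq> 0" shows "v (x ^ n) = int n * v x"
proof (induction n)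
  case 0 thus ?case by (simp add: ival_one)
next
  case (Suc n)
  thus ?case
    using ivalD(1)[OF v assms tsubring_power[OF tfieldD(1)[OF L] assms(1)], of n] assms(2)
    by (simp add: algebra_simps)
qed

lemma ival_add_strict:
  assumes "x \<in> L" "x \<noteq> 0" "y \<in> L" "y \<noteq> 0" "v x < v y" shows "x + y \<noteq> 0" "v (x + y) = v x"
proof -
  note R = tfieldD(1)[OF L]
  show nz: "x + y \<noteq> 0"
  proof
    assume "x + y = 0"
    hence "x = - y" by (simp add: add_eq_0_iff2)
    thus False using ival_minus[of y] assms by simp
  qed
  have ge: "v x \<le> v (x + y)" using ivalD(2)[OF v assms(1-4) nz] assms(5) by simp
  have "min (v (x + y)) (v (- y)) \<le> v ((x + y) + (- y))"
    using ivalD(2)[OF v, of "x + y" "- y"] assms nz tsubringD(3,4)[OF R] by simp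
  thus "v (x + y) = v x" using ge ival_minus[OF assms(3,4)] assms(5) by simp
qed

end

lemma zval_ival:
  assumes v: "zval L V v" shows "ival L v"
  unfolding ival_def
proof (intro conjI ballI impI)
  fix x y assume xy: "x \<in> L - {0}" "y \<in> L - {0}"
  show m: "v (x * y) = v x + v y" using zvalD(2)[OF v] xy by simp
  assume nz: "x + y \<noteq> 0"
  note V = zvalD(1)[OF v]
  note R = vringD(2)[OF V]
  have less: "v a \<le> v (a + b)" if ab: "a \<in> L" "a \<noteq> 0" "b \<in> L" "b \<noteq> 0" "a + b \<noteq> 0" "v a \<le> v b" for a b
  proof -
    have bL: "b / a \<in> L" using tfield_divide[OF vringD(1)[OF V] ab(3,1)] .
    have "v b = v (b / a) + v a" using zvalD(2)[OF v bL _ ab(1,2)] ab by simp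
    hence "b / a \<in> V" using zvalD(3)[OF v bL] ab by simp
    hence "1 + b / a \<in> V" using tsubringD(2,3)[OF vringD(3)[OF V]] by blast
    moreover have eq: "a + b = (1 + b / a) * a" using ab by (simp add: field_simps)
    moreover have "1 + b / a \<noteq> 0" "1 + b / a \<in> L"
      using eq ab(5) tsubringD(2,3)[OF R] bL by auto
    ultimately show ?thesis
      using zvalD(2)[OF v, of "1 + b / a" a] zvalD(3)[OF v, of "1 + b / a"] ab by simp
  qed
  show "min (v x) (v y) \<le> v (x + y)"
    using less[of x y] less[of y x] xy nz by (cases "v x \<le> v y") (auto simp: add.commute)
qed

lemma zval_max_ideal:
  assumes v: "zval L V v" and x: "x \<in> L" "x \<noteq> 0"
  shows "x \<in> mm V \<longleftrightarrow> v x > 0"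
proof -
  note V = zvalD(1)[OF v]
  have "inverse x \<in> L" using tfieldD(2)[OF vringD(1)[OF V] x(1)] .
  hence "inverse x \<in> V \<longleftrightarrow> v x \<le> 0"
    using zvalD(3)[OF v, of "inverse x"] x ival_inverse[OF vringD(1)[OF V] zval_ival[OF v] x] by simp
  thus ?thesis using zvalD(3)[OF v x] x(2) by (auto simp: max_ideal_def)
qed

text \<open>For nonzero elements this is equality of values, expressed by units of \<open>V\<close>
  and hence available before any valuation map exists.\<close>

definition val_equiv :: "'b::field set => 'b => 'b => bool" where
  "val_equiv V x y \<longleftrightarrow> x * inverse y \<in> V \<and> y * inverse x \<in> V"

lemma val_equiv_mult:
  assumes "tsubring V" "val_equiv V x y" "val_equiv V x' y'"
  shows "val_equiv V (x * x') (y * y')"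
proof -
  have "(x * inverse y) * (x' * inverse y') \<in> V" "(y * inverse x) * (y' * inverse x') \<in> V"
    using assms tsubringD(5)[OF assms(1)] unfolding val_equiv_def by blast+
  thus ?thesis by (simp add: val_equiv_def mult_ac)
qed

lemma val_equiv_power:
  assumes "tsubring V" "val_equiv V x y" shows "val_equiv V (x ^ n) (y ^ n)"
proof (induction n)
  case 0 thus ?case using tsubringD(2)[OF assms(1)] by (simp add: val_equiv_def)
next
  case (Suc n) thus ?case using val_equiv_mult[OF assms] by simp
qed

lemma val_equiv_trans:
  assumes "tsubring V" "y \<noteq> 0" "val_equiv V x y" "val_equiv V y z"
  shows "val_equiv V x z"
proof -
  have "(x * inverse y) * (y * inverse z) \<in> V" "(z * inverse y) * (y * inverse x) \<in> V"
    using assms tsubringD(5)[OF assms(1)] unfolding val_equiv_def by blast+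
  moreover have "(x * inverse y) * (y * inverse z) = x * (inverse y * y) * inverse z"
    "(z * inverse y) * (y * inverse x) = z * (inverse y * y) * inverse x"
    by (simp_all only: mult.assoc)
  ultimately show ?thesis using assms(2) by (simp add: val_equiv_def)
qed

lemma val_equiv_zval:
  assumes v: "zval L V v" and x: "x \<in> L" "x \<noteq> 0" "y \<in> L" "y \<noteq> 0"
  shows "val_equiv V x y \<longleftrightarrow> v x = v y"
proof -
  note Lf = vringD(1)[OF zvalD(1)[OF v]] and R = vringD(2)[OF zvalD(1)[OF v]]
  have i: "inverse x \<in> L" "inverse y \<in> L" using tfieldD(2)[OF Lf] x by blast+
  have "x * inverse y \<in> V \<longleftrightarrow> v x \<ge> v y"
    using zvalD(3)[OF v, of "x * inverse y"] tsubringD(5)[OF R x(1) i(2)] x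
      zvalD(2)[OF v x(1,2) i(2)] ival_inverse[OF Lf zval_ival[OF v] x(3,4)] by simp
  moreover have "y * inverse x \<in> V \<longleftrightarrow> v y \<ge> v x"
    using zvalD(3)[OF v, of "y * inverse x"] tsubringD(5)[OF R x(3) i(1)] x
      zvalD(2)[OF v x(3,4) i(1)] ival_inverse[OF Lf zval_ival[OF v] x(1,2)] by simp
  ultimately show ?thesis by (auto simp: val_equiv_def)
qed

text \<open>The value of \<open>x\<close> is defined as that of an element of \<open>K\<close> with
  the same value as \<open>x ^ n\<close>; this is \<open>n\<close> times the extension of
  \<open>v\<close>. The exponent \<open>n\<close> is common to all \<open>x\<close>, which makes the
  new map additive.\<close>

lemma zval_extend:
  assumes V: "vring L V" and K: "tfield K" "K \<subseteq> L" and v: "zval K (V \<inter> K) v" and n: "n > 0"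
    and eq: "\<And>x. x \<in> L ==> x \<noteq> 0 ==> \<exists>c\<in>K - {0}. val_equiv V (x ^ n) c"
  shows "\<exists>w. zval L V w"
proof -
  note R = vringD(3)[OF V] and Kr = tfieldD(1)[OF K(1)]
  define c where "c x = (SOME c. c \<in> K - {0} \<and> val_equiv V (x ^ n) c)" for x
  have c: "c x \<in> K" "c x \<noteq> 0" "val_equiv V (x ^ n) (c x)" if "x \<in> L" "x \<noteq> 0" for x
    using someI_ex[of "\<lambda>c. c \<in> K - {0} \<and> val_equiv V (x ^ n) c"] eq[OF that] unfolding c_def by blast+
  define w where "w x = v (c x)" for x
  have sym: "val_equiv V a b ==> val_equiv V b a" for a b by (simp add: val_equiv_def)
  have vK: "v a = v b" if "a \<in> K" "a \<noteq> 0" "b \<in> K" "b \<noteq> 0" "val_equiv V a b" for a b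
    using val_equiv_zval[OF v that(1-4)] that tfieldD(2)[OF K(1)] tsubringD(5)[OF Kr]
    by (simp add: val_equiv_def)
  have weq: "w x = v d" if "x \<in> L" "x \<noteq> 0" "d \<in> K" "d \<noteq> 0" "val_equiv V (x ^ n) d" for x d
    unfolding w_def
    by (rule vK) (use that c[OF that(1,2)] val_equiv_trans[OF R _ sym[OF c(3)[OF that(1,2)]] that(5)] in auto)
  have "zval L V w"
    unfolding zval_def
  proof (intro conjI ballI V)
    fix x y assume xy: "x \<in> L - {0}" "y \<in> L - {0}"
    have "w (x * y) = v (c x * c y)"
      by (rule weq)
        (use xy c[of x] c[of y] tsubringD(5)[OF vringD(2)[OF V]] tsubringD(5)[OF Kr] val_equiv_mult[OF R] in
          \<open>auto simp: power_mult_distrib\<close>)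
    thus "w (x * y) = w x + w y"
      using zvalD(2)[OF v, of "c x" "c y"] c[of x] c[of y] xy by (simp add: w_def)
  next
    fix x assume x: "x \<in> L - {0}"
    hence cx: "c x \<in> K" "c x \<noteq> 0" "val_equiv V (x ^ n) (c x)" using c by auto
    have xn: "x ^ n \<in> V \<longleftrightarrow> c x \<in> V"
    proof
      assume "x ^ n \<in> V"
      hence "c x * inverse (x ^ n) * x ^ n \<in> V" using cx(3) tsubringD(5)[OF R] by (simp add: val_equiv_def)
      thus "c x \<in> V" using x by (simp add: mult.assoc)
    next
      assume "c x \<in> V"
      hence "x ^ n * inverse (c x) * c x \<in> V" using cx(3) tsubringD(5)[OF R] by (simp add: val_equiv_def)
      thus "x ^ n \<in> V" using cx(2) by (simp add: mult.assoc)
    qed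
    have "x ^ n \<in> V \<longleftrightarrow> x \<in> V"
    proof
      assume xn: "x ^ n \<in> V"
      show "x \<in> V"
      proof (rule ccontr)
        assume "x \<notin> V"
        hence i: "inverse x \<in> mm V" using mmD(6)[OF V] x by blast
        obtain n' where "n = Suc n'" using n by (cases n) auto
        hence "inverse x ^ n \<in> mm V"
          using mm_mult[OF V tsubring_power[OF R mmD(1)[OF V i]] i, of n'] by (simp add: mult.commute)
        hence "x ^ n * inverse x ^ n \<in> mm V" by (rule mm_mult[OF V xn])
        thus False using x mmD(3)[OF V] by (simp flip: power_mult_distrib)
      qed
    qed (rule tsubring_power[OF R])
    thus "x \<in> V \<longleftrightarrow> 0 \<le> w x"
      using xn zvalD(3)[OF v cx(1,2)] cx(1) by (simp add: w_def)
  next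
    obtain t where t: "t \<in> K" "t \<noteq> 0" "v t > 0" using v by (auto simp: zval_def)
    have "w t = v (t ^ n)"
      by (rule weq) (use t K tsubring_power[OF Kr] tsubringD(2)[OF R] in "auto simp: val_equiv_def")
    also have "\<dots> = int n * v t" by (rule ival_power[OF K(1) zval_ival[OF v] t(1,2)])
    finally show "\<exists>t\<in>L - {0}. 0 < w t" using t K n by (intro bexI[of _ t]) auto
  qed
  thus ?thesis by blast
qed

text \<open>Two terms of the vanishing sum \<open>poly f x\<close> have equal value, so some power
  \<open>x ^ (j - i)\<close> has the value of an element of \<open>K\<close>. Raising to the
  exponent \<open>fact N\<close>, a multiple of every possible \<open>j - i\<close>, makes the
  exponent independent of \<open>x\<close>.\<close>

lemma algebraic_val_equiv:
  assumes V: "vring L V" and K: "tfield K" "K \<subseteq> L" and x: "x \<in> L" "x \<noteq> 0"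
    and f: "f \<noteq> 0" "poly_over K f" "poly f x = 0" "pdeg f \<le> N"
  shows "\<exists>c\<in>K - {0}. val_equiv V (x ^ fact N) c"
proof -
  let ?a = "coef f" and ?n = "pdeg f"
  note R = vringD(3)[OF V]
  have aK: "?a i \<in> K" for i using f(2) by (simp add: poly_over_def)
  have "\<exists>i\<in>{..?n}. \<exists>j\<in>{..?n}. i \<noteq> j \<and> ?a i * x ^ i \<noteq> 0 \<and> ?a j * x ^ j \<noteq> 0 \<and>
      (?a i * x ^ i) / (?a j * x ^ j) \<in> V \<and> (?a j * x ^ j) / (?a i * x ^ i) \<in> V"
  proof (rule vring_sum_zero[OF V])
    show "?a i * x ^ i \<in> L" for i
      using aK K(2) x tsubring_power[OF vringD(2)[OF V]] tsubringD(5)[OF vringD(2)[OF V]] by blast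
    show "(\<Sum>i\<le>?n. ?a i * x ^ i) = 0" using f(3) by (simp add: poly_altdef)
    show "?n \<in> {..?n}" "?a ?n * x ^ ?n \<noteq> 0" using f(1) x by auto
  qed simp
  then obtain i j where "i \<le> ?n" "j \<le> ?n" "i \<noteq> j" "?a i \<noteq> 0" "?a j \<noteq> 0" "val_equiv V (?a i * x ^ i) (?a j * x ^ j)"
    by (auto simp: val_equiv_def divide_inverse)
  moreover have "val_equiv V a b ==> val_equiv V b a" for a b by (simp add: val_equiv_def)
  ultimately obtain i j where ij: "i < j" "j \<le> ?n" "?a i \<noteq> 0" "?a j \<noteq> 0" "val_equiv V (?a j * x ^ j) (?a i * x ^ i)"
    by (metis linorder_neqE_nat)
  define d where "d = ?a i / ?a j"
  have d: "d \<in> K" "d \<noteq> 0" unfolding d_def using tfield_divide[OF K(1) aK aK] ij by auto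
  have xx: "x ^ j = x ^ (j - i) * x ^ i" using ij(1) by (simp flip: power_add)
  have "val_equiv V (x ^ (j - i)) d"
    using ij x unfolding val_equiv_def d_def xx by (simp add: field_simps)
  hence "val_equiv V ((x ^ (j - i)) ^ (fact N div (j - i))) (d ^ (fact N div (j - i)))"
    by (rule val_equiv_power[OF R])
  moreover have "(j - i) dvd (fact N :: nat)" using ij f(4) by (intro dvd_fact) auto
  ultimately have "val_equiv V (x ^ fact N) (d ^ (fact N div (j - i)))"
    by (simp flip: power_mult)
  thus ?thesis using d tsubring_power[OF tfieldD(1)[OF K(1)] d(1)] by (intro bexI[of _ "d ^ (fact N div (j - i))"]) auto
qed

text \<open>Induction on \<open>T\<close>: \<open>z\<close> serves for \<open>T\<close> and
  \<open>y\<close> for the new index \<open>j\<close>, and they are combined according to the value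
  of \<open>z\<close> at \<open>j\<close>.\<close>

lemma weak_approximation:
  fixes L :: "'b::field set"
  assumes L: "tfield L" and v: "ival L v" and "finite T" "\<And>i. i \<in> T ==> ival L (w i)"
    and "\<And>i. i \<in> T ==> \<exists>z\<in>L - {0}. v z > 0 \<and> w i z < 0" and "\<exists>z\<in>L - {0}. v z > 0"
  shows "\<exists>z\<in>L - {0}. v z > 0 \<and> (\<forall>i\<in>T. w i z < 0)"
  using assms(3-6)
proof (induction T rule: finite_induct)
  case empty thus ?case by simp
next
  case (insert j T)
  note R = tfieldD(1)[OF L]
  obtain z where z: "z \<in> L" "z \<noteq> 0" "v z > 0" "\<And>i. i \<in> T ==> w i z < 0" using insert by auto
  obtain y where y: "y \<in> L" "y \<noteq> 0" "v y > 0" "w j y < 0" using insert.prems(2)[of j] by auto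
  have wi: "ival L (w i)" if "i \<in> insert j T" for i using insert.prems(1) that by blast
  have large: "\<exists>N0. \<forall>N\<ge>N0. \<forall>i\<in>T. w i y + int N * w i z < 0"
  proof -
    have "\<forall>\<^sub>F N in sequentially. \<forall>i\<in>T. w i y + int N * w i z < 0"
    proof (rule eventually_ball_finite[OF insert.hyps(1)], rule ballI)
      fix i assume "i \<in> T"
      hence iz: "w i z \<le> - 1" using z(4)[of i] by simp
      have "w i y + int N * w i z < 0" if "N \<ge> nat (\<bar>w i y\<bar> + 1)" for N
      proof -
        have "int N * w i z \<le> int N * (- 1)" using iz by (intro mult_left_mono) auto
        thus ?thesis using that by linarith
      qed
      thus "\<forall>\<^sub>F N in sequentially. w i y + int N * w i z < 0"
        unfolding eventually_sequentially by blast
    qed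
    thus ?thesis unfolding eventually_sequentially .
  qed
  then obtain N0 where N0: "\<And>N i. N \<ge> N0 ==> i \<in> T ==> w i y + int N * w i z < 0" by blast
  define N where "N = Suc N0"
  have zN: "z ^ N \<in> L" "z ^ N \<noteq> 0" using z tsubring_power[OF R] by auto
  have one: "1 \<in> L" "(1::'b) \<noteq> 0" using tsubringD(2)[OF R] by auto
  consider "w j z < 0" | "w j z = 0" | "w j z > 0" by linarith
  thus ?case
  proof cases
    case 1 thus ?thesis using z by (intro bexI[of _ z]) auto
  next
    \<comment> \<open>A high power of \<open>z\<close> outweighs \<open>y\<close> on
      \<open>T\<close> and has value \<open>0\<close> at \<open>j\<close>.\<close>
    case 2
    have m: "u (z ^ N * y) = int N * u z + u y" if "ival L u" for u
      using ivalD(1)[OF that zN y(1,2)] ival_power[OF L that z(1,2)] by simp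
    have "v (z ^ N * y) > 0" using m[OF v] z y by (simp add: add_nonneg_pos)
    moreover have "w j (z ^ N * y) < 0" using m[OF wi] 2 y by simp
    moreover have "w i (z ^ N * y) < 0" if "i \<in> T" for i using m[OF wi, of i] N0[of N i] that by (simp add: N_def)
    ultimately show ?thesis using zN y tsubringD(5)[OF R] by (intro bexI[of _ "z ^ N * y"]) auto
  next
    \<comment> \<open>Here \<open>1 + z ^ N\<close> has value \<open>0\<close> for \<open>v\<close>
      and for \<open>w j\<close>, but large negative values on \<open>T\<close>.\<close>
    case 3
    have pos: "1 + z ^ N \<noteq> 0 \<and> u (1 + z ^ N) = 0" if "ival L u" "u z > 0" for u
    proof -
      have "0 < int N * u z" by (rule mult_pos_pos) (use that(2) in "simp_all add: N_def")
      hence "u 1 < u (z ^ N)"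
        using ival_power[OF L that(1) z(1,2), of N] ival_one[OF L that(1)] by simp
      from ival_add_strict[OF L that(1) one zN this] show ?thesis using ival_one[OF L that(1)] by simp
    qed
    have nz: "1 + z ^ N \<noteq> 0" using pos[OF v z(3)] by blast
    have inL: "1 + z ^ N \<in> L" using tsubringD(3)[OF R one(1) zN(1)] .
    have m: "u (y * (1 + z ^ N)) = u y + u (1 + z ^ N)" if "ival L u" for u
      using ivalD(1)[OF that y(1,2) inL nz] .
    have "v (y * (1 + z ^ N)) > 0" using m[OF v] pos[OF v z(3)] y by simp
    moreover have "w j (y * (1 + z ^ N)) < 0" using m[OF wi] pos[OF wi 3] y by simp
    moreover have "w i (y * (1 + z ^ N)) < 0" if i: "i \<in> T" for i
    proof -
      have "int N * w i z < 0" by (rule mult_pos_neg) (use z(4)[OF i] in "simp_all add: N_def")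
      hence "w i (z ^ N) < w i 1"
        using ival_power[OF L wi z(1,2), of i N] ival_one[OF L wi, of i] i by simp
      hence "w i (z ^ N + 1) = w i (z ^ N)" using ival_add_strict(2)[OF L wi zN one] i by blast
      thus ?thesis
        using m[OF wi, of i] ival_power[OF L wi z(1,2), of i N] N0[of N i] i by (simp add: add.commute N_def)
    qed
    ultimately show ?thesis using inL nz y tsubringD(5)[OF R] by (intro bexI[of _ "y * (1 + z ^ N)"]) auto
  qed
qed

section \<open>Decomposition and inertia groups\<close>

locale val_auts = fin_auts +
  fixes V :: "'a set" and v :: "'a => int"
  assumes zv: "zval L V v"
begin

lemmas V = zvalD(1)[OF zv]
lemmas VR = vringD(3)[OF V]
lemmas iv = zval_ival[OF zv]

abbreviation "m \<equiv> mm V"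

definition Dg :: "('a => 'a) set" where "Dg = {s\<in>A. \<forall>x\<in>L. s x \<in> V \<longleftrightarrow> x \<in> V}"

definition Ig :: "('a => 'a) set" where "Ig = {s\<in>A. \<forall>x\<in>V. s x - x \<in> m}"

lemma funpow_A: "s \<in> A ==> s ^^ n \<in> A"
proof (induction n)
  case 0 thus ?case using id_A by (simp add: id_def)
next
  case (Suc n) thus ?case unfolding funpow.simps(2) using comp_A by blast
qed

lemma finite_order:
  assumes s: "s \<in> A" shows "\<exists>n. \<forall>x\<in>L. (s ^^ Suc n) x = x"
proof -
  let ?f = "\<lambda>n. restrict (s ^^ n) L"
  have "range ?f \<subseteq> \<Gamma>" using \<Gamma>I[OF funpow_A[OF s]] by blast
  hence "finite (range ?f)" using finite_\<Gamma> finite_subset by blast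
  hence "\<not> inj ?f" using range_inj_infinite by blast
  then obtain i j where ij: "i < j" "?f i = ?f j" unfolding inj_def by (metis linorder_neqE_nat)
  have "(s ^^ (j - i)) x = x" if x: "x \<in> L" for x
  proof -
    have "(s ^^ i) ((s ^^ (j - i)) x) = (s ^^ j) x"
      using ij(1) by (simp flip: funpow_add[unfolded comp_def fun_eq_iff, rule_format])
    also have "\<dots> = (s ^^ i) x" using fun_cong[OF ij(2), of x] x by simp
    finally show ?thesis using rhom_inj[OF rh[OF funpow_A[OF s]], of i] by (simp add: inj_eq)
  qed
  moreover obtain n where "j - i = Suc n" using ij(1) by (metis Suc_diff_Suc)
  ultimately show ?thesis by metis
qed

lemma DgD: "s \<in> Dg ==> s \<in> A" "s \<in> Dg ==> x \<in> L ==> s x \<in> V \<longleftrightarrow> x \<in> V"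
  by (auto simp: Dg_def)

lemma VL: "x \<in> V ==> x \<in> L" "x \<in> m ==> x \<in> L"
  using vringD(4)[OF V] mmD(1)[OF V] by blast+

text \<open>On \<open>L\<close> the inverse of \<open>s\<close> is a power of \<open>s\<close>, as
  \<open>s\<close> has finite order there; so stability of \<open>V\<close> in one direction is
  enough.\<close>

lemma sub_Dg:
  assumes s: "s \<in> A" and sub: "\<And>x. x \<in> V ==> s x \<in> V" shows "s \<in> Dg"
proof -
  have pw: "(s ^^ n) x \<in> V" if "x \<in> V" for n x using that by (induction n) (simp_all add: sub)
  obtain n where n: "\<forall>x\<in>L. (s ^^ Suc n) x = x" using finite_order[OF s] by blast
  have "x \<in> V" if "x \<in> L" "s x \<in> V" for x
    using pw[OF that(2), of n] bspec[OF n that(1)] by (simp add: funpow_swap1)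
  thus ?thesis using s sub by (auto simp: Dg_def)
qed

lemma Ig_Dg: assumes "s \<in> Ig" shows "s \<in> Dg"
proof (rule sub_Dg)
  show "s \<in> A" using assms by (simp add: Ig_def)
  show "s x \<in> V" if "x \<in> V" for x
    using vring_cong_in[OF V _ that, of "s x"] assms that by (simp add: Ig_def)
qed

lemma Dg_comp: "s \<in> Dg ==> t \<in> Dg ==> s \<circ> t \<in> Dg"
  by (simp add: Dg_def comp_A stab)

lemma Dg_inv:
  assumes "s \<in> Dg" "t \<in> A" "\<And>x. s (t x) = x" shows "t \<in> Dg"
proof -
  have "t x \<in> V \<longleftrightarrow> x \<in> V" if "x \<in> L" for x
    using DgD(2)[OF assms(1) stab[OF assms(2) that]] assms(3) by simp
  thus ?thesis using assms(2) by (simp add: Dg_def)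
qed

lemma rh_simps:
  assumes "s \<in> A"
  shows "s (x + y) = s x + s y" "s (x - y) = s x - s y" "s (x * y) = s x * s y" "s (- x) = - s x"
    "s (inverse x) = inverse (s x)" "s (x / y) = s x / s y" "s (x ^ n) = s x ^ n" "s 0 = 0" "s 1 = 1"
    "s x = 0 \<longleftrightarrow> x = 0"
  using rhom_simps[OF rh[OF assms]] rhom_inverse[OF rh[OF assms]] rhom_divide[OF rh[OF assms]]
    rhom_eq_0_iff[OF rh[OF assms]] by simp_all

lemma Dg_max_ideal:
  assumes "s \<in> Dg" "x \<in> L" shows "s x \<in> m \<longleftrightarrow> x \<in> m"
  using DgD(2)[OF assms(1,2)] DgD(2)[OF assms(1) tfieldD(2)[OF L assms(2)]] rh_simps[OF DgD(1)[OF assms(1)]]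
  by (simp add: max_ideal_def)

text \<open>If \<open>s y / y\<close> were in the maximal ideal, so would be
  \<open>(s ^^ Suc n) y / y\<close> for all \<open>n\<close>, but for a multiple of the order of
  \<open>s\<close> this quotient is \<open>1\<close>.\<close>

lemma Dg_ratio_aux:
  assumes s: "s \<in> Dg" and y: "y \<in> L" "y \<noteq> 0" shows "s y / y \<notin> m"
proof
  assume c: "s y / y \<in> m"
  note sA = DgD(1)[OF s]
  have "(s ^^ Suc n) y / y \<in> m" for n
  proof (induction n)
    case 0 thus ?case using c by simp
  next
    case (Suc n)
    have inL: "(s ^^ Suc n) y / y \<in> L" using VL(2)[OF Suc] .
    have "s ((s ^^ Suc n) y / y) \<in> m" using Dg_max_ideal[OF s inL] Suc by simp
    hence "s ((s ^^ Suc n) y / y) * (s y / y) \<in> m"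
      by (intro mm_mult[OF V _ c] mmD(1)[OF V])
    moreover have "s ((s ^^ Suc n) y / y) * (s y / y) = (s ^^ Suc (Suc n)) y / y"
      using y rh_simps(10)[OF sA, of y] by (simp add: rh_simps(6)[OF sA])
    ultimately show ?case by (simp only:)
  qed
  moreover obtain n where "\<forall>x\<in>L. (s ^^ Suc n) x = x" using finite_order[OF sA] by blast
  ultimately have "y / y \<in> m" using y by metis
  thus False using y mmD(3)[OF V] by simp
qed

text \<open>A quotient outside \<open>V\<close> would give one in the maximal ideal for the inverse
  automorphism. Together with \<open>Dg_ratio_aux\<close>, decomposition automorphisms preserve
  values.\<close>

lemma Dg_ratio:
  assumes s: "s \<in> Dg" and y: "y \<in> L" "y \<noteq> 0" shows "s y / y \<in> V"
proof -
  note sA = DgD(1)[OF s]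
  show "s y / y \<in> V"
  proof (rule ccontr)
    assume neg: "s y / y \<notin> V"
    have "s y / y \<in> L" by (rule tfield_divide[OF L stab[OF sA y(1)] y(1)])
    hence "inverse (s y / y) \<in> m" using mmD(6)[OF V _ neg] by blast
    hence i: "y / s y \<in> m" by simp
    obtain t where t: "t \<in> A" "\<And>x. t (s x) = x" "\<And>x. s (t x) = x" using inv_A[OF sA] by blast
    have tD: "t \<in> Dg" by (rule Dg_inv[OF s t(1,3)])
    have "t (y / s y) \<in> m" using Dg_max_ideal[OF tD VL(2)[OF i]] i by simp
    hence "t y / y \<in> m" by (simp add: rh_simps(6)[OF t(1)] t(2))
    thus False using Dg_ratio_aux[OF tD y] by simp
  qed
qed

lemma conj_ival: assumes "s \<in> A" shows "ival L (\<lambda>x. v (s x))"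
  unfolding ival_def
proof (intro conjI ballI impI)
  fix x y assume xy: "x \<in> L - {0}" "y \<in> L - {0}"
  hence s: "s x \<in> L" "s x \<noteq> 0" "s y \<in> L" "s y \<noteq> 0"
    using stab[OF assms] rh_simps(10)[OF assms] by auto
  show "v (s (x * y)) = v (s x) + v (s y)" using ivalD(1)[OF iv s] rh_simps(3)[OF assms] by simp
  assume "x + y \<noteq> 0"
  hence "s x + s y \<noteq> 0" using rh_simps(10)[OF assms, of "x + y"] rh_simps(1)[OF assms] by simp
  thus "min (v (s x)) (v (s y)) \<le> v (s (x + y))" using ivalD(2)[OF iv s] rh_simps(1)[OF assms] by simp
qed

text \<open>By finite order neither of the two valuation rings contains the other, so there are
  \<open>x\<close> in \<open>V\<close> with \<open>s x\<close> outside and \<open>y\<close> outside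
  \<open>V\<close> with \<open>s y\<close> inside; the quotient of \<open>x\<close> by
  \<open>y\<close> separates.\<close>

lemma separate_conj:
  assumes s: "s \<in> A" "s \<notin> Dg" shows "\<exists>z\<in>L - {0}. v z > 0 \<and> v (s z) < 0"
proof -
  obtain t where t: "t \<in> A" "\<And>x. t (s x) = x" "\<And>x. s (t x) = x" using inv_A[OF s(1)] by blast
  have "t \<notin> Dg" using Dg_inv[OF _ s(1), of t] t s(2) by blast
  then obtain y' where y': "y' \<in> V" "t y' \<notin> V" using sub_Dg[OF t(1)] by blast
  obtain x where x: "x \<in> V" "s x \<notin> V" using sub_Dg[OF s(1)] s(2) by blast
  define y where "y = t y'"
  have y: "y \<in> L" "y \<notin> V" "s y \<in> V" using y' t stab[OF t(1) VL(1)] by (auto simp: y_def)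
  have xL: "x \<in> L" using VL x by blast
  have nz: "x \<noteq> 0" "y \<noteq> 0"
    using x y tsubringD(1)[OF VR] rh_simps(8)[OF s(1)] by auto
  have iy: "inverse y \<in> L" "inverse y \<noteq> 0" using tfieldD(2)[OF L y(1)] nz by auto
  have ineq: "v x \<ge> 0" "v (s x) < 0" "v y < 0" "v (s y) \<ge> 0"
    using zvalD(3)[OF zv] x y xL nz stab[OF s(1)] rh_simps(10)[OF s(1)] by (simp_all flip: not_le)
  have "v (x * inverse y) = v x - v y"
    using ivalD(1)[OF iv xL nz(1) iy] ival_inverse[OF L iv y(1) nz(2)] by simp
  moreover have "v (s (x * inverse y)) = v (s x) - v (s y)"
    using ivalD(1)[OF conj_ival[OF s(1)] xL nz(1) iy] ival_inverse[OF L conj_ival[OF s(1)] y(1) nz(2)] by simp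
  ultimately show ?thesis using ineq nz tsubringD(5)[OF Lr xL iy(1)]
    by (intro bexI[of _ "x * inverse y"]) auto
qed

text \<open>Weak approximation gives \<open>z\<close> of positive value at \<open>V\<close> and
  negative value at every other conjugate; then \<open>inverse (1 + z)\<close> is close to
  \<open>1\<close> at \<open>V\<close> and close to \<open>0\<close> elsewhere.\<close>

lemma approx_unit:
  "\<exists>e\<in>L. e - 1 \<in> m \<and> (\<forall>s\<in>A. s \<notin> Dg --> s e \<in> m)"
proof -
  let ?r = "\<lambda>s. restrict s L"
  have "finite (?r ` (A - Dg))" by (rule finite_subset[OF _ finite_restr]) auto
  \<comment> \<open>Weak approximation needs finitely many valuations, so \<open>T\<close> picks
    automorphisms that represent all restrictions to \<open>L\<close>.\<close>
  then obtain T where T: "T \<subseteq> A - Dg" "finite T" "?r ` (A - Dg) = ?r ` T"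
    using finite_subset_image[of "?r ` (A - Dg)" ?r "A - Dg"] by auto
  have "\<exists>z\<in>L - {0}. v z > 0 \<and> (\<forall>s\<in>T. v (s z) < 0)"
  proof (rule weak_approximation[OF L iv T(2)])
    show "ival L (\<lambda>x. v (s x))" if "s \<in> T" for s using conj_ival T(1) that by blast
    show "\<exists>z\<in>L - {0}. 0 < v z \<and> v (s z) < 0" if "s \<in> T" for s using separate_conj T(1) that by blast
    show "\<exists>z\<in>L - {0}. 0 < v z" using zv by (simp add: zval_def)
  qed
  then obtain z where z: "z \<in> L" "z \<noteq> 0" "v z > 0" "\<And>s. s \<in> T ==> v (s z) < 0" by blast
  have zc: "v (s z) < 0" if "s \<in> A" "s \<notin> Dg" for s
  proof -
    have "?r s \<in> ?r ` T" using T(3) that by blast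
    then obtain t where t: "t \<in> T" "?r s = ?r t" by blast
    have "s z = t z" using fun_cong[OF t(2), of z] z(1) by simp
    thus ?thesis using z(4)[OF t(1)] by simp
  qed
  have one: "1 \<in> L" "(1::'a) \<noteq> 0" using tsubringD(2)[OF Lr] by auto
  have v1: "1 + z \<noteq> 0" "v (1 + z) = 0"
    using ival_add_strict[OF L iv one z(1,2)] z(3) ival_one[OF L iv] by auto
  define e where "e = inverse (1 + z)"
  have zL: "1 + z \<in> L" using tsubringD(3)[OF Lr one(1) z(1)] .
  have eL: "e \<in> L" unfolding e_def by (rule tfieldD(2)[OF L zL])
  have "e - 1 = - (z * e)" using v1(1) by (simp add: e_def field_simps)
  moreover have "z * e \<in> m"
  proof -
    have "v (z * e) = v z"
      using ivalD(1)[OF iv z(1,2) eL] ival_inverse[OF L iv zL v1(1)] v1 by (simp add: e_def)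
    thus ?thesis using zval_max_ideal[OF zv tsubringD(5)[OF Lr z(1) eL]] z v1 by (simp add: e_def)
  qed
  ultimately have e1: "e - 1 \<in> m" using mm_minus[OF V] by simp
  have "s e \<in> m" if s: "s \<in> A" "s \<notin> Dg" for s
  proof -
    have c: "v (s z) < v (s 1)" using zc[OF s] rh_simps(9)[OF s(1)] ival_one[OF L iv] by simp
    have "v (s (z + 1)) = v (s z)" using ival_add_strict(2)[OF L conj_ival[OF s(1)] z(1,2) one c] .
    hence "v (s e) > 0"
      using ival_inverse[OF L conj_ival[OF s(1)] zL v1(1)] zc[OF s] by (simp add: e_def add.commute)
    moreover have "s e \<in> L" "s e \<noteq> 0" using stab[OF s(1) eL] v1(1) rh_simps(10)[OF s(1)] by (simp_all add: e_def)
    ultimately show ?thesis using zval_max_ideal[OF zv] by blast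
  qed
  thus ?thesis using eL e1 by blast
qed

text \<open>Dedekind's independence of characters, modulo the maximal ideal. Subtracting
  \<open>g a\<close> times the relation at \<open>u\<close> from the relation at
  \<open>u * a\<close> removes the term of \<open>g\<close> and multiplies the others by
  \<open>h a - g a\<close>.\<close>

lemma dedekind_mod:
  assumes "finite T"
    and "\<And>h x. h \<in> T ==> x \<in> V ==> h x \<in> V" "\<And>h x y. h \<in> T ==> x \<in> V ==> y \<in> V ==> h (x * y) = h x * h y"
    and "\<And>h. h \<in> T ==> h 1 = 1"
    and "\<And>g h. g \<in> T ==> h \<in> T ==> g \<noteq> h ==> \<exists>a\<in>V. h a - g a \<notin> m"
    and "\<And>h. h \<in> T ==> c h \<in> V" "\<And>u. u \<in> V ==> (\<Sum>h\<in>T. c h * h u) \<in> m"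
  shows "\<forall>h\<in>T. c h \<in> m"
  using assms
proof (induction T arbitrary: c rule: finite_induct)
  case empty thus ?case by simp
next
  case (insert g T)
  note hV = insert.prems(1) and hm = insert.prems(2) and h1 = insert.prems(3) and sep = insert.prems(4)
    and cV = insert.prems(5) and rel = insert.prems(6)
  have cT: "c h \<in> m" if h: "h \<in> T" for h
  proof -
    have "g \<noteq> h" using h insert.hyps by blast
    then obtain a where a: "a \<in> V" "h a - g a \<notin> m" using sep[of g h] h by auto
    have "\<forall>h\<in>T. c h * (h a - g a) \<in> m"
    proof (rule insert.IH)
      show "c h * (h a - g a) \<in> V" if "h \<in> T" for h
        by (rule tsubringD(5)[OF VR cV tsubring_diff[OF VR hV hV]]) (use that a in auto)
      fix u assume u: "u \<in> V"
      have r1: "(\<Sum>h\<in>insert g T. c h * h (u * a)) \<in> m" by (rule rel[OF tsubringD(5)[OF VR u a(1)]])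
      have r2: "g a * (\<Sum>h\<in>insert g T. c h * h u) \<in> m" by (rule mm_mult[OF V hV rel[OF u]]) (use a in auto)
      have "(\<Sum>h\<in>insert g T. c h * h (u * a)) - g a * (\<Sum>h\<in>insert g T. c h * h u)
          = (\<Sum>h\<in>insert g T. c h * (h a - g a) * h u)"
        unfolding sum_distrib_left sum_subtractf[symmetric]
      proof (intro sum.cong refl)
        fix h assume "h \<in> insert g T"
        hence "h (u * a) = h u * h a" by (rule hm[OF _ u a(1)])
        thus "c h * h (u * a) - g a * (c h * h u) = c h * (h a - g a) * h u" by (simp add: algebra_simps)
      qed
      also have "\<dots> = (\<Sum>h\<in>T. c h * (h a - g a) * h u)" using insert.hyps by simp
      finally show "(\<Sum>h\<in>T. c h * (h a - g a) * h u) \<in> m" using mm_diff[OF V r1 r2] by simp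
    qed (use insert.prems in auto)
    hence "c h * (h a - g a) \<in> m" using h by blast
    moreover have "h a - g a \<in> V" by (rule tsubring_diff[OF VR hV hV]) (use h a in auto)
    ultimately show ?thesis using mm_prime[OF V cV, of h "h a - g a"] h a(2) by auto
  qed
  have "(\<Sum>h\<in>insert g T. c h * h 1) \<in> m" using rel tsubringD(2)[OF VR] by blast
  moreover have "(\<Sum>h\<in>insert g T. c h * h 1) = (\<Sum>h\<in>insert g T. c h)"
  proof (intro sum.cong refl)
    fix h assume "h \<in> insert g T"
    hence "h 1 = 1" by (rule h1)
    thus "c h * h 1 = c h" by simp
  qed
  ultimately have "c g + (\<Sum>h\<in>T. c h) \<in> m" using insert.hyps by simp
  moreover have "(\<Sum>h\<in>T. c h) \<in> m" by (rule mm_sum[OF V]) (rule cT)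
  ultimately have "c g + (\<Sum>h\<in>T. c h) - (\<Sum>h\<in>T. c h) \<in> m" by (rule mm_diff[OF V])
  hence "c g \<in> m" by simp
  thus ?case using cT by blast
qed

definition \<Gamma>D :: "('a => 'a) set" where "\<Gamma>D = (\<lambda>s. restrict s L) ` Dg"

lemma \<Gamma>D_sub: "\<Gamma>D \<subseteq> \<Gamma>"
  using DgD(1) by (auto simp: \<Gamma>D_def \<Gamma>_def)

text \<open>A high power of the approximate unit \<open>e\<close> suppresses all conjugates outside
  the decomposition group, so modulo the maximal ideal the trace is the sum over
  \<open>\<Gamma>D\<close>. Dividing by \<open>y\<close> makes the estimate independent of the value
  of \<open>y\<close>.\<close>

lemma trace_approx:
  assumes u0: "u0 \<in> V" and y: "y \<in> L" "y \<noteq> 0"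
  shows "\<exists>u\<in>L. (\<forall>s\<in>A. s u \<in> V) \<and> (\<forall>s\<in>A. s \<notin> Dg --> s u \<in> m) \<and> u - u0 \<in> m \<and>
     Tr (u * y) / y - (\<Sum>g\<in>\<Gamma>D. g u0 * (g y / y)) \<in> m"
proof (cases "u0 = 0")
  \<comment> \<open>Treated apart because the estimate of the other case takes values of conjugates
    of \<open>u0\<close>, which must be nonzero.\<close>
  case True
  have "Tr (0 * y) = 0" using Tr_mult[of 0 y] y tsubringD(1)[OF Lr] rh_simps(8) by (simp add: Fix_def)
  moreover have "(\<Sum>g\<in>\<Gamma>D. g u0 * (g y / y)) = 0"
    using True rh_simps(8)[OF DgD(1)] tsubringD(1)[OF Lr] by (intro sum.neutral) (auto simp: \<Gamma>D_def)
  ultimately show ?thesis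
    using True tsubringD(1)[OF Lr] tsubringD(1)[OF VR] mmD(2)[OF V]
  proof (intro bexI[of _ 0] conjI ballI impI)
    fix s assume "s \<in> A"
    hence "s 0 = 0" by (rule rh_simps(8))
    thus "s 0 \<in> V" "s 0 \<in> m" using tsubringD(1)[OF VR] mmD(2)[OF V] by simp_all
  qed simp_all
next
  case False
  have u0L: "u0 \<in> L" using VL u0 by blast
  obtain e where e: "e \<in> L" "e - 1 \<in> m" "\<And>s. s \<in> A ==> s \<notin> Dg ==> s e \<in> m" using approx_unit by blast
  have eV: "e \<in> V" using vring_cong_in[OF V e(2) tsubringD(2)[OF VR]] .
  have em: "e \<notin> m" using mm_cong_in[OF V mm_cong_sym[OF V e(2)]] mmD(3)[OF V] by blast
  hence e0: "e \<noteq> 0" using mmD(2)[OF V] by blast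
  have "\<exists>N0. \<forall>N\<ge>N0. \<forall>g\<in>\<Gamma> - \<Gamma>D. g u0 * g e ^ N \<in> m \<and> g u0 * g e ^ N * (g y / y) \<in> m"
    unfolding eventually_sequentially[symmetric]
  proof (rule eventually_ball_finite, rule finite_Diff[OF finite_\<Gamma>], rule ballI)
    fix g assume g: "g \<in> \<Gamma> - \<Gamma>D"
    then obtain s where s: "s \<in> A" "g = restrict s L" by (auto elim: \<Gamma>E)
    hence sD: "s \<notin> Dg" using g by (auto simp: \<Gamma>D_def)
    have se: "s e \<in> L" "s e \<noteq> 0" "s e \<in> m" using stab[OF s(1) e(1)] e0 rh_simps(10)[OF s(1)] e(3)[OF s(1) sD] by auto
    hence ve: "v (s e) \<ge> 1" using zval_max_ideal[OF zv se(1,2)] by simp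
    have su: "s u0 \<in> L" "s u0 \<noteq> 0" using stab[OF s(1) u0L] False rh_simps(10)[OF s(1)] by auto
    have sy: "s y / y \<in> L" "s y / y \<noteq> 0"
      using tfield_divide[OF L stab[OF s(1) y(1)] y(1)] y rh_simps(10)[OF s(1)] by auto
    have key: "g u0 * g e ^ N \<in> m \<and> g u0 * g e ^ N * (g y / y) \<in> m"
      if N: "N \<ge> nat (\<bar>v (s u0)\<bar> + \<bar>v (s y / y)\<bar> + 1)" for N
    proof -
      have eN: "s e ^ N \<in> L" "s e ^ N \<noteq> 0" using tsubring_power[OF Lr se(1)] se by auto
      have p: "s u0 * s e ^ N \<in> L" "s u0 * s e ^ N \<noteq> 0" using tsubringD(5)[OF Lr su(1) eN(1)] su eN by auto
      have p': "s u0 * s e ^ N * (s y / y) \<in> L" "s u0 * s e ^ N * (s y / y) \<noteq> 0"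
        using tsubringD(5)[OF Lr p(1) sy(1)] p sy by auto
      have "v (s u0 * s e ^ N) = v (s u0) + int N * v (s e)"
        using ivalD(1)[OF iv su eN] ival_power[OF L iv se(1,2)] by simp
      moreover have "v (s u0 * s e ^ N * (s y / y)) = v (s u0 * s e ^ N) + v (s y / y)"
        using ivalD(1)[OF iv p sy] .
      moreover have "int N * v (s e) \<ge> int N * 1" using ve by (intro mult_left_mono) auto
      ultimately have "v (s u0 * s e ^ N) > 0" "v (s u0 * s e ^ N * (s y / y)) > 0" using N by linarith+
      hence "s u0 * s e ^ N \<in> m" "s u0 * s e ^ N * (s y / y) \<in> m"
        using zval_max_ideal[OF zv p] zval_max_ideal[OF zv p'] by blast+
      thus ?thesis using s u0L e(1) y by simp
    qed
    thus "\<forall>\<^sub>F N in sequentially. g u0 * g e ^ N \<in> m \<and> g u0 * g e ^ N * (g y / y) \<in> m"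
      unfolding eventually_sequentially by blast
  qed
  then obtain N where N: "\<And>g. g \<in> \<Gamma> - \<Gamma>D ==> g u0 * g e ^ N \<in> m \<and> g u0 * g e ^ N * (g y / y) \<in> m" by blast
  define u where "u = u0 * e ^ N"
  have eN: "e ^ N \<in> L" using tsubring_power[OF Lr e(1)] .
  have uL: "u \<in> L" unfolding u_def by (rule tsubringD(5)[OF Lr u0L eN])
  have uV: "u \<in> V" unfolding u_def by (rule tsubringD(5)[OF VR u0 tsubring_power[OF VR eV]])
  have gu: "g u = g u0 * g e ^ N" if "g \<in> \<Gamma>" for g
    using that by (rule \<Gamma>E) (use uL u0L e(1) rh_simps in "simp add: u_def")
  have um: "s u \<in> m" if s: "s \<in> A" "s \<notin> Dg" for s
  proof (cases "restrict s L \<in> \<Gamma>D")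
    case True
    then obtain t where t: "t \<in> Dg" "restrict s L = restrict t L" by (auto simp: \<Gamma>D_def)
    have "s x = t x" if "x \<in> L" for x using fun_cong[OF t(2), of x] that by simp
    hence "s \<in> Dg" using DgD(2)[OF t(1)] s(1) by (simp add: Dg_def)
    thus ?thesis using s(2) by blast
  next
    case False
    thus ?thesis using N[of "restrict s L"] gu[OF \<Gamma>I[OF s(1)]] \<Gamma>I[OF s(1)] uL by auto
  qed
  have uu: "u - u0 \<in> m"
  proof -
    have "e ^ N - 1 ^ N \<in> m" by (rule mm_cong_power[OF V eV tsubringD(2)[OF VR] e(2)])
    hence "u0 * (e ^ N - 1) \<in> m" using mm_mult[OF V u0] by simp
    thus ?thesis by (simp add: u_def algebra_simps)
  qed
  have uA: "s u \<in> V" if "s \<in> A" for s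
    using um[OF that] DgD(2)[of s u] uL uV mmD(1)[OF V] by blast
  have "Tr (u * y) / y = (\<Sum>g\<in>\<Gamma>. g u * (g y / y))"
    unfolding Tr_def sum_divide_distrib by (intro sum.cong refl) (simp add: \<Gamma>_rhom(2) uL y)
  also have "\<dots> = (\<Sum>g\<in>\<Gamma> - \<Gamma>D. g u * (g y / y)) + (\<Sum>g\<in>\<Gamma>D. g u * (g y / y))"
    by (rule sum.subset_diff[OF \<Gamma>D_sub finite_\<Gamma>])
  finally have eq: "Tr (u * y) / y - (\<Sum>g\<in>\<Gamma>D. g u0 * (g y / y))
      = (\<Sum>g\<in>\<Gamma> - \<Gamma>D. g u * (g y / y)) + (\<Sum>g\<in>\<Gamma>D. (g u - g u0) * (g y / y))"
    by (simp only: left_diff_distrib sum_subtractf add_diff_eq)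
  have "(\<Sum>g\<in>\<Gamma> - \<Gamma>D. g u * (g y / y)) \<in> m" by (rule mm_sum[OF V]) (use N gu in auto)
  moreover have "(\<Sum>g\<in>\<Gamma>D. (g u - g u0) * (g y / y)) \<in> m"
  proof (rule mm_sum[OF V])
    fix g assume "g \<in> \<Gamma>D"
    then obtain s where s: "s \<in> Dg" "g = restrict s L" by (auto simp: \<Gamma>D_def)
    have "s (u - u0) \<in> m" using Dg_max_ideal[OF s(1) VL(2)[OF uu]] uu by simp
    hence "(s y / y) * s (u - u0) \<in> m" by (rule mm_mult[OF V Dg_ratio[OF s(1) y]])
    thus "(g u - g u0) * (g y / y) \<in> m"
      using s uL u0L y rh_simps(2)[OF DgD(1)[OF s(1)], of u u0] by (simp add: mult.commute)
  qed
  ultimately have "Tr (u * y) / y - (\<Sum>g\<in>\<Gamma>D. g u0 * (g y / y)) \<in> m"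
    unfolding eq by (rule mm_add[OF V])
  thus ?thesis using uL uA um uu by blast
qed

text \<open>Trivial inertia keeps decomposition automorphisms distinct on residues. Independence
  with coefficients \<open>g y / y\<close>, of which that of the identity is \<open>1\<close>,
  yields \<open>u0\<close> with a sum outside the maximal ideal, and \<open>trace_approx\<close>
  realises this sum by a trace.\<close>

lemma trace_unit:
  assumes inertia: "\<forall>s\<in>Ig. \<forall>x\<in>L. s x = x" and y: "y \<in> L" "y \<noteq> 0"
  shows "\<exists>u\<in>L. (\<forall>s\<in>A. s u \<in> V) \<and> Tr (u * y) / y \<in> V - m"
proof -
  have "\<exists>u0\<in>V. (\<Sum>g\<in>\<Gamma>D. (g y / y) * g u0) \<notin> m"
  proof (rule ccontr)
    assume neg: "\<not> ?thesis"
    have "\<forall>g\<in>\<Gamma>D. g y / y \<in> m"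
    proof (rule dedekind_mod)
      show "finite \<Gamma>D" using finite_subset[OF \<Gamma>D_sub finite_\<Gamma>] .
      show "(\<Sum>h\<in>\<Gamma>D. h y / y * h u) \<in> m" if "u \<in> V" for u using neg that by blast
      show "h x \<in> V" if "h \<in> \<Gamma>D" "x \<in> V" for h x
        using that DgD(2) VL by (auto simp: \<Gamma>D_def)
      show "h (x * y) = h x * h y" if "h \<in> \<Gamma>D" "x \<in> V" "y \<in> V" for h x y
        using \<Gamma>_rhom(2)[of h x y] \<Gamma>D_sub VL that by blast
      show "h 1 = 1" if "h \<in> \<Gamma>D" for h
        using that rh_simps(9)[OF DgD(1)] tsubringD(2)[OF Lr] by (auto simp: \<Gamma>D_def)
      show "h y / y \<in> V" if "h \<in> \<Gamma>D" for h
        using that Dg_ratio[OF _ y] y by (auto simp: \<Gamma>D_def)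
      fix g h assume gh: "g \<in> \<Gamma>D" "h \<in> \<Gamma>D" "g \<noteq> h"
      obtain s t where s: "s \<in> Dg" "g = restrict s L" and t: "t \<in> Dg" "h = restrict t L"
        using gh by (auto simp: \<Gamma>D_def)
      show "\<exists>a\<in>V. h a - g a \<notin> m"
      proof (rule ccontr)
        assume neg: "\<not> ?thesis"
        obtain \<rho> where r: "\<rho> \<in> A" "\<And>x. \<rho> (s x) = x" "\<And>x. s (\<rho> x) = x" using inv_A[OF DgD(1)[OF s(1)]] by blast
        have rD: "\<rho> \<in> Dg" by (rule Dg_inv[OF s(1) r(1,3)])
        have "\<rho> \<circ> t \<in> Ig"
          unfolding Ig_def
        proof (intro CollectI conjI ballI)
          show "\<rho> \<circ> t \<in> A" using comp_A r(1) DgD(1)[OF t(1)] by blast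
          fix x assume x: "x \<in> V"
          hence d: "t x - s x \<in> m" using neg s t VL by auto
          have "\<rho> (t x - s x) \<in> m" using Dg_max_ideal[OF rD VL(2)[OF d]] d by simp
          thus "(\<rho> \<circ> t) x - x \<in> m" by (simp add: rh_simps(2)[OF r(1)] r(2))
        qed
        hence "\<rho> (t x) = x" if "x \<in> L" for x using inertia that by fastforce
        hence "t x = s x" if "x \<in> L" for x using r(3)[of "t x"] that by simp
        hence "g = h" using s t by auto
        thus False using gh by simp
      qed
    qed
    moreover have "restrict id L \<in> \<Gamma>D" using id_A by (auto simp: \<Gamma>D_def Dg_def)
    ultimately have "restrict id L y / y \<in> m" by blast
    thus False using y mmD(3)[OF V] by simp
  qed
  then obtain u0 where u0: "u0 \<in> V" "(\<Sum>g\<in>\<Gamma>D. (g y / y) * g u0) \<notin> m" by blast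
  obtain u where u: "u \<in> L" "\<forall>s\<in>A. s u \<in> V" "Tr (u * y) / y - (\<Sum>g\<in>\<Gamma>D. g u0 * (g y / y)) \<in> m"
    using trace_approx[OF u0(1) y] by blast
  let ?s = "\<Sum>g\<in>\<Gamma>D. g u0 * (g y / y)"
  have s: "?s \<notin> m" using u0(2) by (simp add: mult.commute)
  have "?s \<in> V"
  proof (rule tsubring_sum[OF VR])
    fix g assume "g \<in> \<Gamma>D"
    then obtain s where "s \<in> Dg" "g = restrict s L" by (auto simp: \<Gamma>D_def)
    thus "g u0 * (g y / y) \<in> V"
      using tsubringD(5)[OF VR, of "s u0" "s y / y"] DgD(2)[of s u0] VL(1)[OF u0(1)] u0(1) Dg_ratio[of s y] y by simp
  qed
  hence "Tr (u * y) / y \<in> V" by (rule vring_cong_in[OF V u(3)])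
  moreover have "Tr (u * y) / y \<notin> m"
    using s mm_cong_in[OF V mm_cong_sym[OF V u(3)]] by blast
  ultimately show ?thesis using u by blast
qed

text \<open>The trace of \<open>u * x\<close> lies in the fixed field and, for a suitable
  \<open>u\<close>, has the same value as \<open>x\<close>.\<close>

lemma inertia_trivial_imp_unramified:
  assumes inertia: "\<forall>s\<in>Ig. \<forall>x\<in>L. s x = x"
  shows "ram_index_one Fix L V"
  unfolding ram_index_one_def
proof
  fix x assume x: "x \<in> L - {0}"
  then obtain u where u: "u \<in> L" "Tr (u * x) / x \<in> V - m" using trace_unit[OF inertia, of x] by blast
  have "Tr (u * x) \<noteq> 0" using u(2) mmD(2)[OF V] by auto
  moreover have "Tr (u * x) \<in> Fix" using Tr_Fix tsubringD(5)[OF Lr u(1)] x by blast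
  moreover have "x * inverse (Tr (u * x)) \<in> V"
    using mmD(4)[OF V, of "Tr (u * x) / x"] u(2) by (simp add: divide_inverse mult.commute)
  moreover have "Tr (u * x) * inverse x \<in> V" using u(2) by (simp add: divide_inverse)
  ultimately show "\<exists>y\<in>Fix - {0}. x * inverse y \<in> V \<and> y * inverse x \<in> V" by blast
qed

text \<open>The sum over the decomposition group has a single term, so traces approximate every
  element of \<open>V\<close> modulo the maximal ideal.\<close>

lemma decomposition_trivial_imp_split:
  assumes dec: "\<forall>s\<in>Dg. \<forall>x\<in>L. s x = x"
  shows "ram_index_one Fix L V" "res_degree_one Fix V"
proof -
  show "ram_index_one Fix L V"
    by (rule inertia_trivial_imp_unramified) (use dec Ig_Dg in blast)
  show "res_degree_one Fix V"
    unfolding res_degree_one_def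
  proof
    fix x assume x: "x \<in> V"
    have one: "1 \<in> L" "(1::'a) \<noteq> 0" using tsubringD(2)[OF Lr] by auto
    have r: "restrict s L = restrict id L" if "s \<in> Dg" for s
      using bspec[OF dec that] by auto
    have "id \<in> Dg" using id_A by (simp add: Dg_def)
    hence "restrict id L \<in> \<Gamma>D" unfolding \<Gamma>D_def by (rule imageI)
    moreover have "g = restrict id L" if "g \<in> \<Gamma>D" for g
      using that r unfolding \<Gamma>D_def by (elim imageE) simp
    ultimately have "\<Gamma>D = {restrict id L}" by blast
    hence s: "(\<Sum>g\<in>\<Gamma>D. g x * (g 1 / 1)) = x" using VL(1)[OF x] one by simp
    obtain u where u: "u \<in> L" "Tr (u * 1) / 1 - x \<in> m" using trace_approx[OF x one] unfolding s by blast
    hence "Tr u \<in> Fix" "Tr u - x \<in> m" using Tr_Fix by auto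
    moreover hence "Tr u \<in> V" using vring_cong_in[OF V _ x] by blast
    ultimately show "\<exists>y\<in>V \<inter> Fix. x - y \<in> m" using mm_cong_sym[OF V] by blast
  qed
qed

end

section \<open>Residue fields and the Frobenius map\<close>

lemma power_CHAR_diff:
  fixes x y :: "'b::comm_ring_1"
  assumes "prime p" "p = CHAR('b)"
  shows "(x - y) ^ (p ^ n) = x ^ (p ^ n) - y ^ (p ^ n)"
  using freshmans_dream'[of "p ^ n" n "x - y" y] assms by (simp add: eq_diff_eq)

text \<open>A nonzero polynomial over the residue field has finitely many roots, phrased through
  representatives. The unit coefficient may sit at any degree \<open>l\<close>, because the leading
  coefficient may reduce to zero; roots are split off by synthetic division.\<close>

lemma roots_mod_max_ideal:
  fixes f :: "'b::field poly" and s :: "'i => 'b"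
  assumes V: "vring L V"
  shows "poly_over V f ==> coef f l \<notin> mm V ==> infinite I ==>
    (\<And>i. i \<in> I ==> s i \<in> V \<and> poly f (s i) \<in> mm V) ==>
    \<exists>i\<in>I. \<exists>j\<in>I. i \<noteq> j \<and> s i - s j \<in> mm V"
proof (induction "pdeg f" arbitrary: f I l)
  case 0
  then obtain c where c: "f = [:c:]" using degree_eq_zeroE by metis
  obtain i where "i \<in> I" using 0 by (metis finite.emptyI ex_in_conv)
  thus ?case using 0 mmD(2)[OF V] by (cases l) (auto simp: c)
next
  case (Suc d)
  note R = vringD(3)[OF V]
  obtain i0 where i0: "i0 \<in> I" using Suc.prems(3) by (metis finite.emptyI ex_in_conv)
  let ?c = "s i0"
  define g where "g = synthetic_div f ?c"
  have f: "f = smult (- ?c) g + pCons 0 g + [:poly f ?c:]"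
    using synthetic_div_correct'[of ?c f] by (simp add: g_def)
  have c: "?c \<in> V" "poly f ?c \<in> mm V" using Suc.prems(4)[OF i0] by auto
  have "poly_over V f ==> poly_over V (synthetic_div f ?c)" for f
  proof (induction f)
    case (pCons a f)
    hence f: "poly_over V f" using coeff_pCons_Suc[of a f] unfolding poly_over_def by metis
    thus ?case using pCons.IH poly_over_pCons[OF R poly_eval_closed[OF R f c(1)]] by simp
  qed simp
  hence gV: "poly_over V g" using Suc.prems(1) by (simp add: g_def)
  show ?case
  proof (rule ccontr)
    assume neg: "\<not> ?thesis"
    obtain l' where l': "coef g l' \<notin> mm V"
    proof (rule ccontr)
      assume "\<not> thesis"
      hence "coef g i \<in> mm V" for i using that by blast
      hence "- ?c * coef g i + coef (pCons 0 g) i + coef [:poly f ?c:] i \<in> mm V" for i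
        using c mmD(2)[OF V] tsubringD(4)[OF R]
        by (intro mm_add[OF V] mm_mult[OF V]) (auto simp: coeff_pCons split: nat.splits)
      thus False using Suc.prems(2) arg_cong[OF f, of "\<lambda>f. coef f l"] by simp
    qed
    have "poly g (s i) \<in> mm V" if i: "i \<in> I - {i0}" for i
    proof -
      have si: "s i \<in> V" "poly f (s i) \<in> mm V" using Suc.prems(4) i by auto
      have "(s i - ?c) * poly g (s i) = poly f (s i) - poly f ?c"
        using arg_cong[OF f, of "\<lambda>f. poly f (s i)"] by (simp add: algebra_simps)
      hence "(s i - ?c) * poly g (s i) \<in> mm V" using mm_diff[OF V si(2) c(2)] by simp
      thus ?thesis
        using mm_prime[OF V tsubring_diff[OF R si(1) c(1)] poly_eval_closed[OF R gV si(1)]] neg i i0 by blast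
    qed
    moreover have "d = pdeg g" using Suc.hyps(2) by (simp add: g_def degree_synthetic_div)
    ultimately show False
      using Suc.hyps(1)[of g l' "I - {i0}"] gV l' Suc.prems(3,4) neg by auto
  qed
qed

text \<open>
  The residue class of \<open>x\<close> is a root of a polynomial over a finite field, hence so are its iterates under
  Frobenius, up to the action of Frobenius on the finitely many polynomials of the same degree.
\<close>

lemma residue_algebraic:
  fixes x :: "'b::field"
  assumes V: "vring L V" and K: "tfield K" "K \<subseteq> L"
    and C: "finite C" "C \<subseteq> V \<inter> K" "\<And>y. y \<in> V \<inter> K ==> \<exists>c\<in>C. y - c \<in> mm V"
    and p: "prime p" "p = CHAR('b)"
    and x: "x \<in> V" and f: "f \<noteq> 0" "poly_over K f" "poly f x = 0"
  shows "\<exists>n\<ge>1. x ^ (p ^ n) - x \<in> mm V"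
proof -
  let ?m = "mm V" and ?a = "coef f" and ?n = "pdeg f"
  note R = vringD(3)[OF V] and Kr = tfieldD(1)[OF K(1)]
  have VK: "tsubring (V \<inter> K)" by (rule tsubring_Int[OF R Kr])
  have aK: "?a i \<in> K" for i using f(2) by (simp add: poly_over_def)
  \<comment> \<open>Dividing by a coefficient of least value keeps all coefficients in
    \<open>V\<close> and makes one of them \<open>1\<close>.\<close>
  have "\<exists>j\<in>{i. i \<le> ?n \<and> ?a i \<noteq> 0}. \<forall>i\<in>{i. i \<le> ?n \<and> ?a i \<noteq> 0}. ?a i / ?a j \<in> V"
    by (rule vring_least_value[OF V]) (use f(1) aK K(2) in auto)
  then obtain j where j: "j \<le> ?n" "?a j \<noteq> 0" "\<And>i. i \<le> ?n ==> ?a i \<noteq> 0 ==> ?a i / ?a j \<in> V" by auto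
  define g where "g i = ?a i / ?a j" for i
  have gV: "g i \<in> V \<inter> K" for i
    using j(3)[of i] tsubringD(1)[OF R] tfield_divide[OF K(1) aK aK] coeff_eq_0[of f i]
    by (cases "i \<le> ?n \<and> ?a i \<noteq> 0") (auto simp: g_def)
  have "(\<Sum>i\<le>?n. g i * x ^ i) = poly f x / ?a j"
    by (simp add: g_def poly_altdef sum_divide_distrib)
  hence gs: "(\<Sum>i\<le>?n. g i * x ^ i) = 0" using f(3) by simp
  define c where "c k i = (SOME c. c \<in> C \<and> g i ^ (p ^ k) - c \<in> ?m)" for k i
  have c: "c k i \<in> C" "g i ^ (p ^ k) - c k i \<in> ?m" for k i
    using someI_ex[of "\<lambda>c. c \<in> C \<and> g i ^ (p ^ k) - c \<in> ?m"] C(3)[OF tsubring_power[OF VK gV]]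
    unfolding c_def by blast+
  let ?F = "\<lambda>k. restrict (c k) {..?n}"
  have "finite (range ?F)"
    by (rule finite_subset[of _ "PiE {..?n} (\<lambda>_. C)"]) (simp_all add: image_subset_iff restrict_PiE_iff c(1) C(1) finite_PiE)
  \<comment> \<open>For infinitely many exponents the Frobenius images of the equation reduce to the
    same polynomial, so that infinitely many powers of \<open>x\<close> are roots of it.\<close>
  then obtain k0 where k0: "infinite {k. ?F k = ?F k0}" using pigeonhole_infinite[of UNIV ?F] by auto
  define h where "h = (\<Sum>i\<le>?n. Polynomial.monom (c k0 i) i)"
  have ch: "coef h i = (if i \<le> ?n then c k0 i else 0)" for i by (simp add: h_def coeff_sum)
  have root: "poly h (x ^ (p ^ k)) \<in> ?m" if k: "?F k = ?F k0" for k
  proof -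
    have "c k0 i = c k i" if "i \<le> ?n" for i using fun_cong[OF k, of i] that by simp
    hence "poly h (x ^ (p ^ k)) = (\<Sum>i\<le>?n. c k i * (x ^ (p ^ k)) ^ i)"
      by (simp add: h_def poly_sum poly_monom)
    also have "\<dots> = (\<Sum>i\<le>?n. (x ^ (p ^ k)) ^ i * - (g i ^ (p ^ k) - c k i)) + (\<Sum>i\<le>?n. (g i * x ^ i) ^ (p ^ k))"
      by (simp add: algebra_simps power_mult_distrib flip: sum.distrib power_mult)
    also have "(\<Sum>i\<le>?n. (g i * x ^ i) ^ (p ^ k)) = (\<Sum>i\<le>?n. g i * x ^ i) ^ (p ^ k)"
      using freshmans_dream_sum'[of "p ^ k" k "\<lambda>i. g i * x ^ i" "{..?n}"] p by simp
    also have "\<dots> = 0" using prime_gt_0_nat[OF p(1)] by (simp add: gs zero_power)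
    finally show ?thesis
      using mm_sum[OF V, of "{..?n}"] mm_mult[OF V] tsubring_power[OF R] x mm_minus[OF V c(2)] by simp
  qed
  have "1 - c k0 j \<in> ?m" using c(2)[of j k0] j(2) by (simp add: g_def)
  hence cj: "coef h j \<notin> ?m"
    using mm_cong_in[OF V, of 1 "c k0 j"] mmD(3)[OF V] j(1) by (auto simp: ch)
  have "poly_over V h" using c(1) C(2) tsubringD(1)[OF R] by (auto simp: poly_over_def ch)
  from roots_mod_max_ideal[OF V this cj k0, of "\<lambda>k. x ^ (p ^ k)"] root tsubring_power[OF R x]
  obtain i k where "i \<noteq> k" "x ^ (p ^ i) - x ^ (p ^ k) \<in> ?m" by auto
  then obtain i k where ik: "i < k" "x ^ (p ^ k) - x ^ (p ^ i) \<in> ?m"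
    using mm_cong_sym[OF V] linorder_neqE_nat by metis
  note ik(2)
  \<comment> \<open>The difference is a \<open>p ^ i\<close>-th power, and the maximal ideal is
    prime.\<close>
  also have "x ^ (p ^ k) - x ^ (p ^ i) = (x ^ (p ^ (k - i)) - x) ^ (p ^ i)"
    unfolding power_CHAR_diff[OF p] using ik(1) by (simp flip: power_mult power_add)
  finally have "x ^ (p ^ (k - i)) - x \<in> ?m"
    using mm_power[OF V] tsubring_diff[OF R tsubring_power[OF R x] x] by blast
  thus ?thesis using ik(1) by (intro exI[of _ "k - i"]) auto
qed

text \<open>
  Let \<open>\<pi>\<close> be a uniformizer from the base and choose \<open>y\<close> with \<open>s y - y\<close> nonzero of least value. As \<open>y = y ^ q - \<pi> * z\<close>
  for a power \<open>q\<close> of \<open>p\<close> and some integral \<open>z\<close>, the difference equals \<open>(s y - y) ^ q - \<pi> * (s z - z)\<close>.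
\<close>

lemma unramified_imp_inertia_trivial:
  fixes s :: "'b::field => 'b"
  assumes zv: "zval L V v" and K: "tfield K" "K \<subseteq> L" and ram: "ram_index_one K L V"
    and p: "prime p" "p = CHAR('b)"
    and res: "\<And>x. x \<in> V ==> \<exists>n\<ge>1. x ^ (p ^ n) - x \<in> mm V"
    and s: "is_rhom s" "\<And>x. x \<in> L ==> s x \<in> L" "\<And>x. x \<in> K ==> s x = x"
      "\<And>x. x \<in> V ==> s x - x \<in> mm V"
    and x: "x \<in> L"
  shows "s x = x"
proof -
  let ?m = "mm V"
  note V = zvalD(1)[OF zv]
  note R = vringD(3)[OF V] and Lf = vringD(1)[OF V] and Lr = vringD(2)[OF V] and iv = zval_ival[OF zv]
  note sh = rhom_simps[OF s(1)] rhom_inverse[OF s(1)]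
  have VL: "y \<in> V ==> y \<in> L" for y using vringD(4)[OF V] .
  have "\<exists>t. t \<in> L \<and> t \<noteq> 0 \<and> v t > 0" using zv by (auto simp: zval_def)
  then obtain t where t: "t \<in> L" "t \<noteq> 0" "v t > 0"
    and min: "\<And>y. y \<in> L ==> y \<noteq> 0 ==> v y > 0 ==> nat (v t) \<le> nat (v y)"
    using ex_has_least_nat[of "\<lambda>t. t \<in> L \<and> t \<noteq> 0 \<and> v t > 0" _ "\<lambda>t. nat (v t)"] by blast
  obtain \<pi> where pi: "\<pi> \<in> K" "\<pi> \<noteq> 0" "val_equiv V t \<pi>"
    using ram t unfolding ram_index_one_def val_equiv_def by blast
  have piL: "\<pi> \<in> L" using pi K by blast
  have vpi: "v \<pi> = v t" using val_equiv_zval[OF zv t(1,2) piL pi(2)] pi(3) by simp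
  have div: "y / \<pi> \<in> V" if "y \<in> ?m" for y
  proof (cases "y = 0")
    case False
    have yL: "y \<in> L" using VL mmD(1)[OF V that] by blast
    have "v y > 0" using zval_max_ideal[OF zv yL False] that by simp
    hence "v y \<ge> v \<pi>" using min[OF yL False] vpi t(3) by simp
    moreover have q: "y / \<pi> \<in> L" "y / \<pi> \<noteq> 0" using tfield_divide[OF Lf yL piL] False pi(2) by auto
    hence "v y = v (y / \<pi>) + v \<pi>" using ivalD(1)[OF iv q piL pi(2)] pi(2) by simp
    ultimately show ?thesis using zvalD(3)[OF zv q] by simp
  qed (use tsubringD(1)[OF R] in simp)
  have V_fixed: "s y = y" if "y \<in> V" for y
  proof (rule ccontr)
    let ?P = "\<lambda>y. y \<in> V \<and> s y \<noteq> y"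
    have pos: "s y - y \<in> L" "s y - y \<noteq> 0" "v (s y - y) > 0" if "?P y" for y
      using that zval_max_ideal[OF zv, of "s y - y"] s(4)[of y] tsubring_diff[OF Lr s(2) VL, of y y] VL by auto
    assume "s y \<noteq> y"
    then obtain y where y: "?P y" and least: "\<And>z. ?P z ==> nat (v (s y - y)) \<le> nat (v (s z - z))"
      using ex_has_least_nat[of ?P y "\<lambda>y. nat (v (s y - y))"] \<open>y \<in> V\<close> by blast
    let ?d = "s y - y"
    obtain k where k: "k \<ge> 1" "y ^ (p ^ k) - y \<in> ?m" using res y by blast
    define q where "q = p ^ k"
    have "q > 1" unfolding q_def using k(1) by (intro one_less_power prime_gt_1_nat[OF p(1)]) simp
    define z where "z = (y ^ q - y) / \<pi>"
    have zV: "z \<in> V" unfolding z_def q_def by (rule div[OF k(2)])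
    have yz: "y ^ q - \<pi> * z = y" using pi(2) by (simp add: z_def)
    have "s (y ^ q - \<pi> * z) = s y ^ q - \<pi> * s z" using s(3)[OF pi(1)] by (simp add: sh)
    hence sy: "s y ^ q - \<pi> * s z = s y" unfolding yz by (rule sym)
    have "?d = (s y ^ q - \<pi> * s z) - (y ^ q - \<pi> * z)" by (simp only: sy yz)
    also have "\<dots> = ?d ^ q - \<pi> * (s z - z)"
      unfolding q_def power_CHAR_diff[OF p] by (simp add: algebra_simps)
    finally have eq: "?d ^ q = ?d + \<pi> * (s z - z)" by (simp add: eq_diff_eq)
    \<comment> \<open>Either \<open>s z = z\<close>, or \<open>s z - z\<close> has value at least
      that of \<open>?d\<close>, and then the factor \<open>\<pi>\<close> makes the second term
      negligible. The resulting equation \<open>q * v ?d = v ?d\<close> is impossible for positive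
      \<open>v ?d\<close>.\<close>
    have "v (?d + \<pi> * (s z - z)) = v ?d"
    proof (cases "s z = z")
      case False
      hence z: "?P z" using zV by simp
      have "v (\<pi> * (s z - z)) = v \<pi> + v (s z - z)" by (rule ivalD(1)[OF iv piL pi(2) pos(1,2)[OF z]])
      hence "v ?d < v (\<pi> * (s z - z))" using least[OF z] pos(3)[OF y] pos(3)[OF z] vpi t(3) by simp
      thus ?thesis
        using ival_add_strict(2)[OF Lf iv pos(1,2)[OF y] tsubringD(5)[OF Lr piL pos(1)[OF z]]] pos(2)[OF z] pi(2) by simp
    qed simp
    hence "int q * v ?d = v ?d" using ival_power[OF Lf iv pos(1,2)[OF y]] by (simp flip: eq)
    thus False using \<open>q > 1\<close> pos(3)[OF y] by simp
  qed
  show ?thesis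
  proof (cases "x \<in> V")
    case False
    hence "inverse x \<in> V" using vringD(5)[OF V x] by blast
    from V_fixed[OF this] show ?thesis by (simp add: sh)
  qed (rule V_fixed)
qed

text \<open>Each residue class has a representative in \<open>K\<close>, which \<open>s\<close>
  fixes, so \<open>s\<close> acts trivially on residues and belongs to inertia.\<close>

lemma split_imp_decomposition_trivial:
  fixes s :: "'b::field => 'b"
  assumes zv: "zval L V v" and K: "tfield K" "K \<subseteq> L" and ram: "ram_index_one K L V" "res_degree_one K V"
    and p: "prime p" "p = CHAR('b)"
    and res: "\<And>x. x \<in> V ==> \<exists>n\<ge>1. x ^ (p ^ n) - x \<in> mm V"
    and s: "is_rhom s" "\<And>x. x \<in> L ==> s x \<in> L" "\<And>x. x \<in> K ==> s x = x"
      "\<And>x. x \<in> mm V ==> s x \<in> mm V"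
    and x: "x \<in> L"
  shows "s x = x"
proof (rule unramified_imp_inertia_trivial[OF zv K ram(1) p res s(1-3) _ x])
  note V = zvalD(1)[OF zv]
  fix x assume "x \<in> V"
  then obtain y where y: "y \<in> V \<inter> K" "x - y \<in> mm V" using ram(2) by (auto simp: res_degree_one_def)
  have "s (x - y) \<in> mm V" by (rule s(4)[OF y(2)])
  hence "s x - y \<in> mm V" using s(3)[of y] y(1) by (simp add: rhom_diff[OF s(1)])
  thus "s x - x \<in> mm V" using mm_cong_trans[OF V _ mm_cong_sym[OF V y(2)]] by blast
qed

section \<open>Lifting inertia from a fixed field\<close>

lemma finite_subfield_generator:
  fixes E :: "'b::field set"
  assumes E: "tfield E" "finite E"
  shows "\<exists>a\<in>E - {0}. \<forall>b\<in>E - {0}. \<exists>i. b = a ^ i"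
proof -
  interpret Om: Ring.field "ambient :: 'b ring" by (rule field_ambient)
  let ?E = "(ambient :: 'b ring)\<lparr>carrier := E\<rparr>"
  have "subfield E (ambient :: 'b ring)" using E(1) by (simp add: subfield_ambient)
  hence "Ring.field ?E" using Om.subfield_iff(2) by blast
  then interpret Ef: Ring.field ?E .
  obtain a where a: "a \<in> carrier (mult_of ?E)" "carrier (mult_of ?E) = {a [^]\<^bsub>?E\<^esub> i | i::nat. i \<in> UNIV}"
    using Ef.finite_field_mult_group_has_gen E(2) by auto
  have ca: "carrier (mult_of ?E) = E - {0}" by (simp add: carrier_mult_of)
  have "x [^]\<^bsub>?E\<^esub> (i::nat) = x ^ i" for x i
    using Om.nat_pow_consistent[of x i E, symmetric] by simp
  thus ?thesis using a unfolding ca by auto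
qed

context val_auts
begin

text \<open>Up to restriction to \<open>L\<close>, finitely many decomposition automorphisms lie
  outside inertia, and each moves some residue. These residues lie in one finite field, and
  \<open>a\<close> lifts a generator of its multiplicative group, so an automorphism fixing the
  residue of \<open>a\<close> fixes them all. The map \<open>\<phi>\<close> realises the residue
  field inside the type.\<close>

lemma primitive_residue:
  assumes p: "prime p" "p = CHAR('a)"
    and res: "\<And>x. x \<in> V ==> \<exists>n\<ge>1. x ^ (p ^ n) - x \<in> m"
    and \<phi>: "\<And>x y. x \<in> V ==> y \<in> V ==> \<phi> (x + y) = \<phi> x + \<phi> y"
      "\<And>x y. x \<in> V ==> y \<in> V ==> \<phi> (x * y) = \<phi> x * \<phi> y" "\<phi> 1 = (1::'a)"
      "\<And>x. x \<in> V ==> \<phi> x = 0 \<longleftrightarrow> x \<in> m"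
  shows "\<exists>a\<in>V. a \<notin> m \<and> (\<forall>\<gamma>\<in>Dg. \<gamma> a - a \<in> m --> \<gamma> \<in> Ig)"
proof -
  have p0: "\<phi> 0 = 0" using \<phi>(4)[OF tsubringD(1)[OF VR]] mmD(2)[OF V] by simp
  have pm: "\<phi> (- x) = - \<phi> x" if "x \<in> V" for x
    using \<phi>(1)[OF that tsubringD(4)[OF VR that]] p0 by (simp add: eq_neg_iff_add_eq_0 add.commute)
  have pd: "\<phi> (x - y) = \<phi> x - \<phi> y" if "x \<in> V" "y \<in> V" for x y
    using \<phi>(1)[OF that(1) tsubringD(4)[OF VR that(2)]] pm[OF that(2)] by simp
  have pp: "\<phi> (x ^ n) = \<phi> x ^ n" if "x \<in> V" for x n
    by (induction n) (simp_all add: \<phi>(2,3) that tsubring_power[OF VR])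
  have pe: "\<phi> x = \<phi> y \<longleftrightarrow> x - y \<in> m" if "x \<in> V" "y \<in> V" for x y
    using \<phi>(4)[OF tsubring_diff[OF VR that]] pd[OF that] by simp
  let ?r = "\<lambda>s. restrict s L"
  have "finite (?r ` (Dg - Ig))" by (rule finite_subset[OF _ finite_restr]) (auto simp: Dg_def)
  then obtain T where T: "T \<subseteq> Dg - Ig" "finite T" "?r ` (Dg - Ig) = ?r ` T"
    using finite_subset_image[of "?r ` (Dg - Ig)" ?r "Dg - Ig"] by auto
  have "\<exists>b. b \<in> V \<and> \<gamma> b - b \<notin> m" if "\<gamma> \<in> T" for \<gamma>
    using that T(1) by (auto simp: Ig_def Dg_def)
  then obtain b where b: "\<And>\<gamma>. \<gamma> \<in> T ==> b \<gamma> \<in> V \<and> \<gamma> (b \<gamma>) - b \<gamma> \<notin> m" by metis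
  have "\<exists>n. n \<ge> 1 \<and> b \<gamma> ^ (p ^ n) - b \<gamma> \<in> m" if "\<gamma> \<in> T" for \<gamma>
    using res[of "b \<gamma>"] b that by blast
  then obtain n where n: "\<And>\<gamma>. \<gamma> \<in> T ==> n \<gamma> \<ge> 1 \<and> b \<gamma> ^ (p ^ n \<gamma>) - b \<gamma> \<in> m" by metis
  \<comment> \<open>A common multiple of all exponents, so that one power of Frobenius fixes all
    chosen residues.\<close>
  define M where "M = (\<Prod>\<gamma>\<in>T. n \<gamma>)"
  have "M \<noteq> 0" unfolding M_def using n T(2) by fastforce
  define q where "q = p ^ M"
  have q2: "q \<ge> 2"
    unfolding q_def using prime_ge_2_nat[OF p(1)] \<open>M \<noteq> 0\<close>
    by (metis self_le_power le_trans one_le_numeral neq0_conv)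
  have bq: "\<phi> (b \<gamma>) ^ q = \<phi> (b \<gamma>)" if g: "\<gamma> \<in> T" for \<gamma>
  proof -
    have bV: "b \<gamma> \<in> V" using b g by blast
    have one: "\<phi> (b \<gamma>) ^ (p ^ n \<gamma>) = \<phi> (b \<gamma>)"
      using pe[OF tsubring_power[OF VR bV] bV] n[OF g] pp[OF bV] by simp
    have it: "\<phi> (b \<gamma>) ^ (p ^ (n \<gamma> * k)) = \<phi> (b \<gamma>)" for k
    proof (induction k)
      case (Suc k)
      have "\<phi> (b \<gamma>) ^ (p ^ (n \<gamma> * Suc k)) = (\<phi> (b \<gamma>) ^ (p ^ n \<gamma>)) ^ (p ^ (n \<gamma> * k))"
        by (simp add: power_add flip: power_mult)
      thus ?case using one Suc by simp
    qed simp
    have "n \<gamma> dvd M" unfolding M_def using T(2) g by (rule dvd_prodI)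
    then obtain k where "M = n \<gamma> * k" by (auto elim: dvdE)
    thus ?thesis using it[of k] by (simp add: q_def)
  qed
  define E where "E = {z. z ^ q = z} \<inter> \<phi> ` V"
  have EI: "\<phi> x \<in> E" if "x \<in> V" "\<phi> x ^ q = \<phi> x" for x using that by (simp add: E_def)
  have Eq: "z ^ q = z" if "z \<in> E" for z using that by (simp add: E_def)
  have EV: "\<exists>x\<in>V. z = \<phi> x" if "z \<in> E" for z using that by (auto simp: E_def)
  have add_q: "(x + y) ^ q = x ^ q + y ^ q" for x y :: 'a
    unfolding q_def using freshmans_dream'[of "p ^ M" M x y] p by simp
  have E: "tfield E"
    unfolding tfield_def tsubring_def
  proof (intro conjI ballI)
    show "0 \<in> E" using EI[of 0] tsubringD(1)[OF VR] p0 q2 by (simp add: power_0_left)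
    show "1 \<in> E" using EI[of 1] tsubringD(2)[OF VR] \<phi>(3) by simp
  next
    fix x y assume xy: "x \<in> E" "y \<in> E"
    obtain x' y' where x': "x' \<in> V" "x = \<phi> x'" and y': "y' \<in> V" "y = \<phi> y'" using EV xy by blast
    show "x + y \<in> E"
      using EI[of "x' + y'"] tsubringD(3)[OF VR x'(1) y'(1)] \<phi>(1)[OF x'(1) y'(1)] x' y' Eq[OF xy(1)] Eq[OF xy(2)] add_q by simp
    show "x * y \<in> E"
      using EI[of "x' * y'"] tsubringD(5)[OF VR x'(1) y'(1)] \<phi>(2)[OF x'(1) y'(1)] x' y' Eq[OF xy(1)] Eq[OF xy(2)]
      by (simp add: power_mult_distrib)
  next
    fix x assume x: "x \<in> E"
    obtain x' where x': "x' \<in> V" "x = \<phi> x'" using EV x by blast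
    have "(- x) ^ q + x ^ q = 0" using add_q[of "- x" x] q2 by (simp add: power_0_left)
    hence "(- x) ^ q = - x" using Eq[OF x] by (simp add: eq_neg_iff_add_eq_0)
    thus "- x \<in> E" using EI[of "- x'"] tsubringD(4)[OF VR x'(1)] pm[OF x'(1)] x' by simp
    show "inverse x \<in> E"
    proof (cases "x = 0")
      case True thus ?thesis using x by simp
    next
      case False
      hence i: "inverse x' \<in> V" "x' \<noteq> 0" using mmD(4,5)[OF V x'(1)] \<phi>(4)[OF x'(1)] x' by auto
      have "\<phi> x' * \<phi> (inverse x') = 1" using \<phi>(2)[OF x'(1) i(1)] i(2) \<phi>(3) by simp
      hence "\<phi> (inverse x') = inverse x" using x' by (metis inverse_unique)
      thus ?thesis using EI[OF i(1)] Eq[OF x] by (simp add: power_inverse)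
    qed
  qed
  have finE: "finite E"
  proof -
    let ?f = "Polynomial.monom (1::'a) q - [:0, 1:]"
    have "coef ?f q = 1" using q2 by (auto simp: coeff_pCons split: nat.splits)
    hence "?f \<noteq> 0" by (metis coeff_0 zero_neq_one)
    hence "finite {z. poly ?f z = 0}" by (rule poly_roots_finite)
    moreover have "E \<subseteq> {z. poly ?f z = 0}" by (auto simp: E_def poly_monom)
    ultimately show ?thesis using finite_subset by blast
  qed
  obtain z where z: "z \<in> E" "z \<noteq> 0" "\<And>b. b \<in> E ==> b \<noteq> 0 ==> \<exists>i. b = z ^ i"
    using finite_subfield_generator[OF E finE] by blast
  obtain a where a: "a \<in> V" "z = \<phi> a" using EV[OF z(1)] by blast
  have "\<gamma> \<in> Ig" if g: "\<gamma> \<in> Dg" "\<gamma> a - a \<in> m" for \<gamma>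
  proof (rule ccontr)
    assume "\<gamma> \<notin> Ig"
    hence "?r \<gamma> \<in> ?r ` T" using T(3) g by blast
    then obtain t where t: "t \<in> T" "?r \<gamma> = ?r t" by blast
    let ?b = "b t"
    have bV: "?b \<in> V" and bn: "t ?b - ?b \<notin> m" using b[OF t(1)] by auto
    have "t ?b = \<gamma> ?b" using fun_cong[OF t(2), of ?b] VL(1)[OF bV] by simp
    hence bn: "\<gamma> ?b - ?b \<notin> m" using bn by simp
    have gV: "\<gamma> x \<in> V" if "x \<in> V" for x using DgD(2)[OF g(1) VL(1)[OF that]] that by simp
    have "\<phi> ?b \<in> E" by (rule EI[OF bV bq[OF t(1)]])
    have "\<gamma> ?b - ?b \<in> m"
    proof (cases "?b \<in> m")
      case True
      thus ?thesis using Dg_max_ideal[OF g(1) VL(1)[OF bV]] mm_diff[OF V] by blast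
    next
      case False
      then obtain i where "\<phi> ?b = z ^ i" using z(3) \<open>\<phi> ?b \<in> E\<close> \<phi>(4)[OF bV] by blast
      hence "\<phi> ?b = \<phi> (a ^ i)" using pp[OF a(1)] a(2) by simp
      hence d: "?b - a ^ i \<in> m" using pe[OF bV tsubring_power[OF VR a(1)]] by blast
      have "\<gamma> (?b - a ^ i) \<in> m" using Dg_max_ideal[OF g(1) VL(2)[OF d]] d by simp
      hence "\<gamma> ?b - \<gamma> a ^ i \<in> m" by (simp add: rh_simps(2,7)[OF DgD(1)[OF g(1)]])
      moreover have "\<gamma> a ^ i - a ^ i \<in> m" by (rule mm_cong_power[OF V gV[OF a(1)] a(1) g(2)])
      ultimately have "\<gamma> ?b - a ^ i \<in> m" by (rule mm_cong_trans[OF V])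
      thus ?thesis using mm_cong_trans[OF V _ mm_cong_sym[OF V d]] by blast
    qed
    thus False using bn by simp
  qed
  moreover have "a \<notin> m" using z(2) a \<phi>(4) by simp
  ultimately show ?thesis using a(1) by blast
qed

text \<open>Transitivity of \<open>S\<close> on the primes above one prime of its fixed field, by
  norms. If no \<open>s \<circ> t\<close> were a decomposition automorphism, some \<open>w\<close>
  in the maximal ideal would have all \<open>s (t w)\<close> units, and the inverse of its norm
  would violate \<open>h\<close>.\<close>

lemma contracts_to_decomposition:
  assumes S: "S \<subseteq> A" "fin_auts S L" and s: "s \<in> A"
    and h: "\<And>x. x \<in> fin_auts.Fix S L ==> s x \<in> V ==> x \<in> V"
  shows "\<exists>t\<in>S. s \<circ> t \<in> Dg"
proof (rule ccontr)
  assume neg: "\<not> ?thesis"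
  interpret Sg: fin_auts S L by (rule S(2))
  obtain e where e: "e \<in> L" "e - 1 \<in> m" "\<And>s. s \<in> A ==> s \<notin> Dg ==> s e \<in> m" using approx_unit by blast
  define w where "w = 1 - e"
  have wL: "w \<in> L" unfolding w_def by (rule tsubring_diff[OF Lr tsubringD(2)[OF Lr] e(1)])
  have wm: "w \<in> m" unfolding w_def using mm_cong_sym[OF V e(2)] .
  have unit: "\<gamma> w \<in> V \<and> \<gamma> w \<notin> m" if g: "\<gamma> \<in> A" "\<gamma> \<notin> Dg" for \<gamma>
  proof -
    have "\<gamma> w = 1 - \<gamma> e" by (simp add: w_def rh_simps(2,9)[OF g(1)])
    moreover have "1 - \<gamma> e \<in> V" using tsubring_diff[OF VR tsubringD(2)[OF VR] mmD(1)[OF V e(3)[OF g]]] .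
    moreover have "1 - \<gamma> e \<notin> m" using mm_add[OF V _ e(3)[OF g], of "1 - \<gamma> e"] mmD(3)[OF V] by auto
    ultimately show ?thesis by simp
  qed
  have inV: "\<gamma> w \<in> V" if "\<gamma> \<in> A" for \<gamma>
    using unit[OF that] Dg_max_ideal[of \<gamma>, OF _ wL] wm mmD(1)[OF V] by blast
  let ?N = "Sg.Nm w"
  have NF: "?N \<in> Sg.Fix" by (rule Sg.Nm_Fix[OF wL])
  hence NL: "?N \<in> L" by (simp add: Sg.Fix_def)
  have idS: "restrict id L \<in> Sg.\<Gamma>" by (rule Sg.\<Gamma>I[OF Sg.id_A])
  have "?N = w * (\<Prod>g\<in>Sg.\<Gamma> - {restrict id L}. g w)"
    unfolding Sg.Nm_def using prod.remove[OF Sg.finite_\<Gamma> idS, of "\<lambda>g. g w"] wL by simp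
  moreover have "(\<Prod>g\<in>Sg.\<Gamma> - {restrict id L}. g w) \<in> V"
  proof (rule tsubring_prod[OF VR])
    fix g assume "g \<in> Sg.\<Gamma> - {restrict id L}"
    then obtain s' where "s' \<in> S" "g = restrict s' L" by (auto elim: Sg.\<Gamma>E)
    thus "g w \<in> V" using inV S(1) wL by auto
  qed
  ultimately have Nm: "?N \<in> m" using mm_mult[OF V _ wm] mult.commute by metis
  have sN: "s ?N = (\<Prod>g\<in>Sg.\<Gamma>. s (g w))" unfolding Sg.Nm_def by (rule rhom_prod[OF rh[OF s]])
  have fac: "s (g w) \<in> V \<and> s (g w) \<notin> m" if "g \<in> Sg.\<Gamma>" for g
  proof -
    obtain s' where s': "s' \<in> S" "g = restrict s' L" using \<open>g \<in> Sg.\<Gamma>\<close> by (rule Sg.\<Gamma>E)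
    hence "s \<circ> s' \<in> A" "s \<circ> s' \<notin> Dg" using neg comp_A[OF s] S(1) by blast+
    from unit[OF this] show ?thesis using s' wL by simp
  qed
  have "s ?N \<in> V" unfolding sN by (rule tsubring_prod[OF VR]) (use fac in blast)
  moreover have "s ?N \<notin> m" unfolding sN using mm_prod[OF V Sg.finite_\<Gamma>, of "\<lambda>g. s (g w)"] fac by blast
  ultimately have "inverse (s ?N) \<in> V" "s ?N \<noteq> 0" using mmD(4,5)[OF V] by blast+
  hence "s (inverse ?N) \<in> V" "?N \<noteq> 0" using rh_simps(5,8)[OF s] by auto
  moreover have "inverse ?N \<in> Sg.Fix"
    using NF tfieldD(2)[OF L] by (auto simp: Sg.Fix_def rhom_inverse[OF Sg.rh])
  ultimately have "inverse ?N \<in> V" "?N \<noteq> 0" using h by blast+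
  thus False using Nm by (simp add: max_ideal_def)
qed

text \<open>
  If \<open>S\<close> contains the inertia group and \<open>s\<close> acts trivially on the residue field of the fixed field
  of \<open>S\<close>, then \<open>s\<close> lies in \<open>S\<close>: for a suitable element \<open>w\<close>, \<open>s w\<close> is modulo the maximal ideal a root of
  the characteristic polynomial of \<open>w\<close> over the fixed field.
\<close>

lemma inertia_quotient:
  assumes S: "S \<subseteq> A" "fin_auts S L" and IS: "Ig \<subseteq> S" and a: "a \<in> V" "a \<notin> m" "\<forall>\<gamma>\<in>Dg. \<gamma> a - a \<in> m --> \<gamma> \<in> Ig"
    and s: "s \<in> A" and triv: "\<And>x. x \<in> fin_auts.Fix S L ==> x \<in> V ==> s x - x \<in> m"
  shows "s \<in> S"
proof -
  interpret Sg: fin_auts S L by (rule S(2))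
  have contr: "x \<in> V" if x: "x \<in> Sg.Fix" "s x \<in> V" for x
  proof (rule ccontr)
    assume "x \<notin> V"
    moreover have xL: "x \<in> L" using x by (simp add: Sg.Fix_def)
    ultimately have i: "inverse x \<in> m" using mmD(6)[OF V] by blast
    have iF: "inverse x \<in> Sg.Fix" using x tfieldD(2)[OF L] by (auto simp: Sg.Fix_def rhom_inverse[OF Sg.rh])
    have "s (inverse x) \<in> m" using mm_cong_in[OF V triv[OF iF mmD(1)[OF V i]] i] .
    hence "s x = 0 \<or> s x \<notin> V" using rh_simps(5)[OF s] by (simp add: max_ideal_def)
    hence "x = 0" using x(2) rh_simps(10)[OF s] by simp
    thus False using \<open>x \<notin> V\<close> tsubringD(1)[OF VR] by simp
  qed
  \<comment> \<open>Composing with an element of \<open>S\<close> changes nothing on the fixed field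
    of \<open>S\<close>, so \<open>s\<close> may be replaced by the decomposition automorphism
    \<open>s \<circ> s0\<close>.\<close>
  obtain s0 where s0: "s0 \<in> S" "s \<circ> s0 \<in> Dg" using contracts_to_decomposition[OF S s contr] by blast
  define \<delta> where "\<delta> = s \<circ> s0"
  have dD: "\<delta> \<in> Dg" using s0 by (simp add: \<delta>_def)
  note dA = DgD(1)[OF dD]
  have dF: "\<delta> x = s x" if "x \<in> Sg.Fix" for x
  proof -
    have "s0 x = x" using that s0(1) by (auto simp: Sg.Fix_def)
    thus ?thesis by (simp add: \<delta>_def)
  qed
  have one: "1 \<in> L" "(1::'a) \<noteq> 0" using tsubringD(2)[OF Lr] by auto
  \<comment> \<open>\<open>w\<close> has the residue of \<open>a\<close>, but its conjugates outside
    the decomposition group lie in the maximal ideal. This forces the conjugate of \<open>w\<close>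
    that matches \<open>\<delta> w\<close> to come from \<open>Dg\<close>.\<close>
  obtain w where w: "w \<in> L" "\<And>s. s \<in> A ==> s w \<in> V" "\<And>s. s \<in> A ==> s \<notin> Dg ==> s w \<in> m" "w - a \<in> m"
    using trace_approx[OF a(1) one] by blast
  have wV: "w \<in> V" using w(2)[OF id_A] by simp
  let ?f = "Sg.char_poly w" and ?c = "coef (Sg.char_poly w)"
  have gw: "g w \<in> V" if "g \<in> Sg.\<Gamma>" for g
    using that by (rule Sg.\<Gamma>E) (use w(1,2) S(1) in auto)
  have "poly_over V ?f" unfolding Sg.char_poly_def by (rule poly_over_prod_linear[OF VR], rule gw)
  hence fV: "?c i \<in> V" for i by (simp add: poly_over_def)
  have fF: "?c i \<in> Sg.Fix" for i using Sg.char_poly_Fix[OF w(1)] by (simp add: poly_over_def)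
  have "\<delta> (poly ?f w) = (\<Sum>i\<le>pdeg ?f. \<delta> (?c i) * \<delta> w ^ i)"
    by (simp add: poly_altdef rhom_simps[OF rh[OF dA]])
  hence "poly ?f (\<delta> w) = (\<Sum>i\<le>pdeg ?f. \<delta> w ^ i * (?c i - \<delta> (?c i)))"
    using Sg.char_poly_root[OF w(1)] rh_simps(8)[OF dA]
    by (simp add: poly_altdef right_diff_distrib sum_subtractf mult.commute)
  also have "\<dots> \<in> m"
  proof (rule mm_sum[OF V], rule mm_mult[OF V])
    show "\<delta> w ^ i \<in> V" for i by (rule tsubring_power[OF VR w(2)[OF dA]])
    show "?c i - \<delta> (?c i) \<in> m" for i
      using mm_cong_sym[OF V triv[OF fF fV]] dF[OF fF] by simp
  qed
  finally have "(\<Prod>g\<in>Sg.\<Gamma>. \<delta> w - g w) \<in> m" by (simp add: Sg.char_poly_def poly_prod)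
  then obtain g where g: "g \<in> Sg.\<Gamma>" "\<delta> w - g w \<in> m"
    using mm_prod[OF V Sg.finite_\<Gamma>, of "\<lambda>g. \<delta> w - g w"] tsubring_diff[OF VR w(2)[OF dA] gw] by blast
  obtain s' where s': "s' \<in> S" "g = restrict s' L" using g(1) by (rule Sg.\<Gamma>E)
  have s'A: "s' \<in> A" using s' S(1) by blast
  have gs: "\<delta> w - s' w \<in> m" using g(2) s'(2) w(1) by simp
  have s'D: "s' \<in> Dg"
  proof (rule ccontr)
    assume "s' \<notin> Dg"
    hence "\<delta> w \<in> m" using mm_cong_in[OF V gs w(3)[OF s'A]] by blast
    hence "w \<in> m" using Dg_max_ideal[OF dD w(1)] by blast
    thus False using mm_cong_in[OF V mm_cong_sym[OF V w(4)]] a(2) by blast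
  qed
  obtain t where t: "t \<in> S" "\<And>x. t (s' x) = x" "\<And>x. s' (t x) = x" using Sg.inv_A[OF s'(1)] by blast
  have tA: "t \<in> A" using t(1) S(1) by blast
  have tD: "t \<in> Dg" by (rule Dg_inv[OF s'D tA t(3)])
  define \<gamma> where "\<gamma> = t \<circ> \<delta>"
  have gD: "\<gamma> \<in> Dg" unfolding \<gamma>_def by (rule Dg_comp[OF tD dD])
  note gA = DgD(1)[OF gD]
  have "t (\<delta> w - s' w) \<in> m" using Dg_max_ideal[OF tD VL(2)[OF gs]] gs by blast
  hence gw': "\<gamma> w - w \<in> m" by (simp add: rh_simps(2)[OF tA] t(2) \<gamma>_def)
  have "\<gamma> (w - a) \<in> m" using Dg_max_ideal[OF gD VL(2)[OF w(4)]] w(4) by blast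
  hence "\<gamma> w - \<gamma> a \<in> m" by (simp add: rh_simps(2)[OF gA])
  hence "\<gamma> a - w \<in> m" using mm_cong_trans[OF V mm_cong_sym[OF V] gw'] by blast
  hence "\<gamma> a - a \<in> m" using mm_cong_trans[OF V _ w(4)] by blast
  hence "\<gamma> \<in> S" using a(3) gD IS by blast
  moreover have "\<delta> = s' \<circ> \<gamma>" by (simp add: \<gamma>_def fun_eq_iff t(3))
  ultimately have dS: "\<delta> \<in> S" using Sg.comp_A[OF s'(1)] by simp
  obtain \<rho> where r: "\<rho> \<in> S" "\<And>x. \<rho> (s0 x) = x" "\<And>x. s0 (\<rho> x) = x" using Sg.inv_A[OF s0(1)] by blast
  have "s = \<delta> \<circ> \<rho>" by (simp add: \<delta>_def fun_eq_iff r(3))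
  thus ?thesis using Sg.comp_A[OF dS r(1)] by simp
qed

end

section \<open>The rational function field and its primes\<close>

definition emb :: "'a::field poly => 'a ac" where
  "emb f = to_ac (Fract f 1)"

lemma rhom_emb: "is_rhom emb"
  by (auto simp: is_rhom_def emb_def simp flip: to_ac_add to_ac_mult One_fract_def)

lemma emb_eq_0_iff: "emb f = 0 \<longleftrightarrow> f = 0"
  by (simp add: emb_def eq_fract Zero_fract_def)

lemmas emb_simps = rhom_simps[OF rhom_emb]

lemma emb_eq_iff: "emb f = emb g \<longleftrightarrow> f = g"
  using emb_eq_0_iff[of "f - g"] by (simp add: emb_simps)

lemma to_ac_Fract: "to_ac (Fract a b) = emb a / emb b"
  by (cases "b = 0") (simp_all add: emb_def eq_fract(2) flip: to_ac_divide)

lemma ratfun_fieldE: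
  assumes "x \<in> kk" obtains a b where "b \<noteq> 0" "x = emb a / emb b"
proof -
  obtain y where y: "x = to_ac y" using assms by (auto simp: ratfun_field_def)
  obtain a b where "y = Fract a b" "b \<noteq> 0" by (cases y rule: Fract_cases) auto
  thus ?thesis using y that to_ac_Fract by metis
qed

lemma emb_ratfun: "emb a \<in> kk"
  by (simp add: emb_def ratfun_field_def)

lemma tfield_ratfun: "tfield (kk :: 'a::field ac set)"
proof -
  let ?k = "range to_ac :: 'a ac set"
  have "0 \<in> ?k" "1 \<in> ?k" using range_eqI[of _ to_ac 0] range_eqI[of _ to_ac 1] by auto
  moreover have "x + y \<in> ?k" "x * y \<in> ?k" "- x \<in> ?k" "inverse x \<in> ?k" if "x \<in> ?k" "y \<in> ?k" for x y
    using that by (auto simp flip: to_ac_add to_ac_mult to_ac_minus to_ac_inverse)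
  ultimately show ?thesis by (auto simp: tfield_def tsubring_def ratfun_field_def)
qed

lemmas kr = tfieldD(1)[OF tfield_ratfun]

lemma alg_over_ratfun: "alg_over (kk :: 'a::field ac set)"
  unfolding alg_over_def
proof
  fix x :: "'a ac"
  obtain f where "f \<noteq> 0" "poly (map_poly to_ac f) x = 0" by (rule alg_closure_algebraic)
  moreover have "poly_over kk (map_poly to_ac f)"
    by (auto simp: poly_over_def coeff_map_poly ratfun_field_def)
  ultimately show "\<exists>f. f \<noteq> 0 \<and> poly_over kk f \<and> poly f x = 0"
    by (intro exI[of _ "map_poly to_ac f"]) (simp add: map_poly_eq_0_iff)
qed

text \<open>Evaluation at an arbitrary \<open>t\<close>: with \<open>var_T\<close> it is the
  embedding of polynomials, with \<open>inverse var_T\<close> it gives the coordinate at infinity,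
  and with a root of \<open>Q\<close> the residue map at \<open>Q\<close>.\<close>

definition ev :: "'a ac => 'a::field poly => 'a ac" where
  "ev t f = poly (map_poly (\<lambda>c. emb [:c:]) f) t"

lemma coeff_ev_poly: "coef (map_poly (\<lambda>c. emb [:c:]) f) i = emb [:coef f i:]"
  by (simp add: coeff_map_poly emb_eq_0_iff)

lemma const_rhom: "is_rhom (\<lambda>c. emb [:c:])"
  by (auto simp: is_rhom_def emb_simps one_pCons[symmetric] mult.commute
      simp flip: rhom_add[OF rhom_emb] rhom_mult[OF rhom_emb])

lemma rhom_ev: "is_rhom (ev t)"
  unfolding is_rhom_def
proof (intro conjI allI)
  show "ev t 1 = 1" by (simp add: ev_def map_poly_1' one_pCons[symmetric] emb_simps)
  show "ev t (f + g) = ev t f + ev t g" for f g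
  proof -
    have "map_poly (\<lambda>c. emb [:c:]) (f + g) = map_poly (\<lambda>c. emb [:c:]) f + map_poly (\<lambda>c. emb [:c:]) g"
      by (rule poly_eqI) (simp add: coeff_ev_poly rhom_add[OF const_rhom] del: add_pCons)
    thus ?thesis by (simp add: ev_def)
  qed
  show "ev t (f * g) = ev t f * ev t g" for f g
    by (simp add: ev_def map_poly_rhom_mult[OF const_rhom])
qed

lemmas ev_simps = rhom_simps[OF rhom_ev]

lemma ev_const: "ev t [:c:] = emb [:c:]"
  by (cases "c = 0") (simp_all add: ev_def map_poly_pCons emb_simps)

lemma ev_pCons: "ev t (pCons c f) = emb [:c:] + t * ev t f"
  by (cases "pCons c f = 0") (simp_all add: ev_def map_poly_pCons emb_simps ev_simps)

lemma ev_var: "ev (emb [:0, 1:]) f = emb f"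
proof (induction f)
  case 0
  thus ?case by (simp add: emb_simps ev_simps)
next
  case (pCons c f)
  have "pCons c f = [:c:] + [:0, 1:] * f" by simp
  hence "emb (pCons c f) = emb [:c:] + emb [:0, 1:] * emb f" by (metis rhom_add[OF rhom_emb] rhom_mult[OF rhom_emb])
  thus ?case using pCons.IH by (simp add: ev_pCons)
qed

abbreviation var_T :: "'a::field ac" where "var_T \<equiv> emb [:0, 1:]"

lemma var_T_nonzero: "var_T \<noteq> 0"
  by (simp add: emb_eq_0_iff)

lemma ev_reflect_poly:
  assumes "t \<noteq> 0" shows "ev (inverse t) (reflect_poly f) = ev t f / t ^ pdeg f"
proof -
  let ?c = "\<lambda>c. emb [:c::'a:]"
  have "map_poly ?c (reflect_poly f) = reflect_poly (map_poly ?c f)"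
    by (rule poly_eqI) (simp add: coeff_map_poly coeff_reflect_poly emb_eq_0_iff degree_map_poly)
  thus ?thesis
    using assms by (simp add: ev_def poly_reflect_poly_nz degree_map_poly emb_eq_0_iff field_simps)
qed

lemma ev_inverse_var: "ev (inverse var_T) f = emb (reflect_poly f) / var_T ^ pdeg f"
proof -
  let ?c = "\<lambda>c. emb [:c::'a:]"
  have "map_poly ?c (reflect_poly f) = reflect_poly (map_poly ?c f)"
    by (rule poly_eqI) (simp add: coeff_map_poly coeff_reflect_poly emb_eq_0_iff degree_map_poly)
  hence "emb (reflect_poly f) = var_T ^ pdeg f * ev (inverse var_T) f"
    unfolding ev_var[symmetric, of "reflect_poly f"] unfolding ev_def
    by (simp add: poly_reflect_poly_nz var_T_nonzero degree_map_poly emb_eq_0_iff)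
  thus ?thesis by (simp add: var_T_nonzero)
qed

text \<open>\<open>\<pi> powi n\<close> lies in \<open>V\<close> exactly for nonnegative
  \<open>n\<close>, so the exponent attached to an element is unique and additive.\<close>

lemma zval_uniformizer:
  fixes L :: "'b::field set"
  assumes V: "vring L V" and \<pi>: "\<pi> \<in> mm V" "\<pi> \<noteq> 0"
    and eq: "\<And>x. x \<in> L ==> x \<noteq> 0 ==> \<exists>n. val_equiv V x (\<pi> powi n)"
  shows "\<exists>v. zval L V v"
proof -
  note R = vringD(3)[OF V] and L = vringD(1)[OF V]
  have \<pi>V: "\<pi> \<in> V" and \<pi>L: "\<pi> \<in> L" using mmD(1)[OF V \<pi>(1)] vringD(4)[OF V] by auto
  have pos: "\<pi> powi n \<in> V" if "n \<ge> 0" for n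
    using that tsubring_power[OF R \<pi>V] by (simp add: power_int_def)
  have neg: "\<pi> powi n \<notin> V" if "n < 0" for n
  proof
    assume n: "\<pi> powi n \<in> V"
    have "\<pi> powi (- n - 1) * (\<pi> powi n * \<pi>) \<in> mm V"
      using pos[of "- n - 1"] that by (intro mm_mult[OF V] n \<pi>(1)) simp
    also have "\<pi> powi (- n - 1) * (\<pi> powi n * \<pi>) = 1"
      using \<pi>(2) power_int_add[of \<pi> "- n - 1" n] power_int_add[of \<pi> "-1" 1]
      by (simp add: mult.assoc[symmetric])
    finally show False using mmD(3)[OF V] by blast
  qed
  define v where "v x = (SOME n. val_equiv V x (\<pi> powi n))" for x
  have v: "val_equiv V x (\<pi> powi v x)" if "x \<in> L" "x \<noteq> 0" for x
    using someI_ex[OF eq[OF that]] by (simp add: v_def)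
  have uniq: "n = m" if "val_equiv V x (\<pi> powi n)" "val_equiv V x (\<pi> powi m)" "x \<noteq> 0" for x n m
  proof -
    have "\<pi> powi n * inverse (\<pi> powi m) \<in> V" if "val_equiv V x (\<pi> powi n)" "val_equiv V x (\<pi> powi m)" for n m
    proof -
      have "(\<pi> powi n * inverse x) * (x * inverse (\<pi> powi m)) \<in> V"
        by (rule tsubringD(5)[OF R]) (use that in "auto simp: val_equiv_def")
      thus ?thesis using \<open>x \<noteq> 0\<close> by (simp add: field_simps)
    qed
    hence "\<pi> powi (n - m) \<in> V" "\<pi> powi (m - n) \<in> V"
      using that(1,2) \<pi>(2) by (simp_all add: power_int_diff divide_inverse)
    thus ?thesis using neg by (metis diff_ge_0_iff_ge linorder_not_le order_antisym)
  qed
  have "zval L V v"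
    unfolding zval_def
  proof (intro conjI ballI V)
    fix x y assume x: "x \<in> L - {0}" and y: "y \<in> L - {0}"
    have "val_equiv V (x * y) (\<pi> powi v x * \<pi> powi v y)" using val_equiv_mult[OF R v v] x y by blast
    hence "val_equiv V (x * y) (\<pi> powi (v x + v y))" using \<pi>(2) by (simp add: power_int_add)
    moreover have "val_equiv V (x * y) (\<pi> powi v (x * y))"
      by (rule v) (use x y tsubringD(5)[OF tfieldD(1)[OF L]] in auto)
    ultimately show "v (x * y) = v x + v y" using uniq x y by (metis DiffD2 insertI1 mult_eq_0_iff)
  next
    fix x assume x: "x \<in> L - {0}"
    have e: "x * inverse (\<pi> powi v x) \<in> V" "\<pi> powi v x * inverse x \<in> V" using v[of x] x by (auto simp: val_equiv_def)
    show "x \<in> V \<longleftrightarrow> v x \<ge> 0"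
    proof
      assume "v x \<ge> 0"
      hence "x * inverse (\<pi> powi v x) * \<pi> powi v x \<in> V" by (intro tsubringD(5)[OF R] e(1) pos)
      thus "x \<in> V" using \<pi>(2) by (simp add: mult.assoc)
    next
      assume "x \<in> V"
      hence "\<pi> powi v x * inverse x * x \<in> V" by (rule tsubringD(5)[OF R e(2)])
      hence "\<pi> powi v x \<in> V" using x by (simp add: mult.assoc)
      thus "v x \<ge> 0" using neg by (metis linorder_not_le)
    qed
  next
    have "val_equiv V \<pi> (\<pi> powi 1)" using \<pi>(2) tsubringD(2)[OF R] by (simp add: val_equiv_def)
    hence "v \<pi> = 1" using uniq v[OF \<pi>L \<pi>(2)] \<pi>(2) by blast
    thus "\<exists>t\<in>L - {0}. v t > 0" using \<pi>L \<pi>(2) by (intro bexI[of _ \<pi>]) auto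
  qed
  thus ?thesis by blast
qed

lemma finite_degree_less: "finite {f :: 'a::{finite,zero} poly. pdeg f < n}"
proof -
  have "coeffs ` {f :: 'a poly. pdeg f < n} \<subseteq> {xs. set xs \<subseteq> UNIV \<and> length xs \<le> n}"
  proof (intro image_subsetI CollectI conjI subset_UNIV)
    fix f :: "'a poly" assume "f \<in> {f. pdeg f < n}"
    thus "length (coeffs f) \<le> n" by (cases "f = 0") (simp_all add: length_coeffs_degree)
  qed
  moreover have "finite {xs :: 'a list. set xs \<subseteq> UNIV \<and> length xs \<le> n}" by (rule finite_lists_length_le) simp
  ultimately have "finite (coeffs ` {f :: 'a poly. pdeg f < n})" by (rule finite_subset)
  thus ?thesis by (rule finite_imageD) (auto simp: inj_on_def coeffs_eq_iff)
qed

text \<open>\<open>t\<close> is a coordinate that is integral at the place: \<open>T\<close> for the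
  finite primes, its inverse for the infinite one. Both cases then share one argument.\<close>

locale base_place =
  fixes V :: "'a::field ac set" and t :: "'a ac"
  assumes V: "vring kk V" and const: "constants \<subseteq> V" and proper: "V \<noteq> kk" and t: "t \<in> V"
    and gen: "\<And>x. x \<in> kk ==> \<exists>f g. g \<noteq> 0 \<and> x = ev t f / ev t g"
    and tr: "\<And>f. ev t f = 0 ==> f = 0"
begin

lemmas R = vringD(3)[OF V]

lemma cst: "emb [:c:] \<in> V"
  using const by (auto simp: constants_def emb_def)

lemma ev_in: "ev t f \<in> V"
  unfolding ev_def by (rule poly_eval_closed[OF R _ t]) (simp add: poly_over_def coeff_ev_poly cst)

lemma unit: assumes "ev t f \<notin> mm V" shows "inverse (ev t f) \<in> V" "ev t f \<noteq> 0"
  using mmD(4,5)[OF V ev_in assms] .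

text \<open>The polynomials whose values at \<open>t\<close> lie in the maximal ideal form a prime
  ideal, which is nonzero because \<open>V\<close> is proper. A nonzero member of least degree, made
  monic, generates it.\<close>

lemma prime_of_place:
  "\<exists>Q. irred Q \<and> lcoeff Q = 1 \<and> (\<forall>f. ev t f \<in> mm V \<longleftrightarrow> Q dvd f)"
proof -
  let ?m = "mm V"
  let ?S = "\<lambda>f. f \<noteq> 0 \<and> ev t f \<in> ?m"
  have "\<exists>f. ?S f"
  proof (rule ccontr)
    assume "\<not> ?thesis"
    hence "x \<in> V" if "x \<in> kk" for x
      using gen[OF that] unit(1) tsubringD(5)[OF R ev_in] by (metis divide_inverse)
    thus False using proper vringD(4)[OF V] by blast
  qed
  then obtain Q0 where Q0: "?S Q0" "\<And>f. ?S f ==> pdeg Q0 \<le> pdeg f"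
    using ex_has_least_nat[of ?S _ pdeg] by blast
  define Q where "Q = smult (inverse (lcoeff Q0)) Q0"
  have Qn: "Q \<noteq> 0" "pdeg Q = pdeg Q0" "lcoeff Q = 1"
    using Q0(1) by (simp_all add: Q_def)
  have "Q = [:inverse (lcoeff Q0):] * Q0" by (simp add: Q_def)
  hence "ev t Q = emb [:inverse (lcoeff Q0):] * ev t Q0"
    by (metis rhom_mult[OF rhom_ev] ev_const)
  hence Qm: "ev t Q \<in> ?m" using mm_mult[OF V cst] Q0(1) by simp
  have dv: "ev t f \<in> ?m \<longleftrightarrow> Q dvd f" for f
  proof
    assume "Q dvd f"
    then obtain h where "f = h * Q" by (metis dvd_def mult.commute)
    thus "ev t f \<in> ?m" using mm_mult[OF V ev_in Qm] by (simp add: ev_simps)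
  next
    assume f: "ev t f \<in> ?m"
    have "f mod Q = f - (f div Q) * Q" by (simp add: minus_div_mult_eq_mod)
    hence "ev t (f mod Q) = ev t f - ev t (f div Q) * ev t Q" by (simp add: ev_simps)
    hence "ev t (f mod Q) \<in> ?m" using mm_diff[OF V f mm_mult[OF V ev_in Qm]] by simp
    hence "f mod Q = 0" using Q0(2)[of "f mod Q"] degree_mod_less[OF Qn(1), of f] Qn(2) by fastforce
    thus "Q dvd f" by (simp add: dvd_eq_mod_eq_0)
  qed
  have "prime_elem Q"
  proof (rule prime_elemI[OF Qn(1)])
    show "\<not> Q dvd 1" unfolding dv[symmetric] using mmD(3)[OF V] by (simp add: ev_simps)
    show "Q dvd a \<or> Q dvd b" if "Q dvd a * b" for a b
      using mm_prime[OF V ev_in ev_in, of a b] that unfolding dv[symmetric] by (simp add: ev_simps)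
  qed
  thus ?thesis using dv Qn(3) prime_elem_imp_irreducible by blast
qed

context
  fixes Q assumes irr: "irred Q" and dv: "\<And>f. ev t f \<in> mm V \<longleftrightarrow> Q dvd f"
begin

lemma Qne: "Q \<noteq> 0" "pdeg Q > 0"
proof -
  show "Q \<noteq> 0" using irr by (simp add: Factorial_Ring.irreducible_def)
  moreover have "\<not> Q dvd 1" using irr by (simp add: Factorial_Ring.irreducible_def)
  ultimately show "pdeg Q > 0" by (meson is_unit_iff_degree not_gr_zero)
qed

lemma poly_equiv:
  "f \<noteq> 0 ==> \<exists>n. val_equiv V (ev t f) (ev t Q ^ n)"
proof (induction "pdeg f" arbitrary: f rule: less_induct)
  case less
  show ?case
  proof (cases "Q dvd f")
    case True
    then obtain g where g: "f = Q * g" by auto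
    hence "g \<noteq> 0" "pdeg g < pdeg f"
      using less.prems Qne by (auto simp: degree_mult_eq)
    then obtain n where "val_equiv V (ev t g) (ev t Q ^ n)" using less.hyps by blast
    moreover have "ev t Q \<noteq> 0" using Qne(1) tr[of Q] by blast
    hence "val_equiv V (ev t Q) (ev t Q)" using tsubringD(2)[OF R] by (simp add: val_equiv_def)
    ultimately have "val_equiv V (ev t Q * ev t g) (ev t Q * ev t Q ^ n)" by (rule val_equiv_mult[OF R, rotated])
    thus ?thesis unfolding g by (intro exI[of _ "Suc n"]) (simp add: ev_simps)
  next
    case False
    hence "val_equiv V (ev t f) (ev t Q ^ 0)" using unit dv ev_in by (simp add: val_equiv_def)
    thus ?thesis by blast
  qed
qed

lemma base_zval: "\<exists>v. zval kk V v"
proof (rule zval_uniformizer[OF V])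
  show "ev t Q \<in> mm V" using dv by simp
  show Q0: "ev t Q \<noteq> 0" using tr Qne by blast
  fix x :: "'a ac" assume "x \<in> kk" "x \<noteq> 0"
  then obtain f g where x: "g \<noteq> 0" "x = ev t f / ev t g" using gen by blast
  have "f \<noteq> 0" using \<open>x \<noteq> 0\<close> x by (auto simp: ev_simps)
  obtain n where n: "val_equiv V (ev t f) (ev t Q ^ n)" using poly_equiv[OF \<open>f \<noteq> 0\<close>] by blast
  obtain m where m: "val_equiv V (ev t g) (ev t Q ^ m)" using poly_equiv[OF x(1)] by blast
  have "val_equiv V (inverse (ev t g)) (inverse (ev t Q ^ m))" using m by (simp add: val_equiv_def mult.commute)
  from val_equiv_mult[OF R n this] have "val_equiv V x (ev t Q ^ n * inverse (ev t Q ^ m))" by (simp add: x divide_inverse)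
  moreover have "ev t Q ^ n * inverse (ev t Q ^ m) = ev t Q powi (int n - int m)"
    using Q0 by (simp add: power_int_diff divide_inverse)
  ultimately show "\<exists>n. val_equiv V x (ev t Q powi n)" by auto
qed

text \<open>Choose a denominator of least degree; if \<open>Q\<close> divided it, \<open>Q\<close>
  would also divide the numerator and could be cancelled.\<close>

lemma place_rep:
  assumes x: "x \<in> V" shows "\<exists>f g. \<not> Q dvd g \<and> x = ev t f / ev t g"
proof -
  let ?P = "\<lambda>g. g \<noteq> 0 \<and> (\<exists>f. x = ev t f / ev t g)"
  have "\<exists>g. ?P g" using gen[OF vringD(4)[OF V x]] by blast
  then obtain g where g: "?P g" "\<And>h. ?P h ==> pdeg g \<le> pdeg h"
    using ex_has_least_nat[of ?P _ pdeg] by blast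
  obtain f where f: "x = ev t f / ev t g" using g(1) by blast
  have g0: "ev t g \<noteq> 0" using g(1) tr by blast
  have "\<not> Q dvd g"
  proof
    assume "Q dvd g"
    hence "x * ev t g \<in> mm V" using dv mm_mult[OF V x] by blast
    hence "Q dvd f" using f g0 dv by simp
    then obtain f' g' where fg: "f = Q * f'" "g = Q * g'" using \<open>Q dvd g\<close> by (auto elim!: dvdE)
    have "x = ev t f' / ev t g'" using f Qne(1) tr[of Q] by (auto simp: fg ev_simps)
    moreover have "g' \<noteq> 0" "pdeg g' < pdeg g"
      using g(1) Qne by (auto simp: fg degree_mult_eq)
    ultimately show False using g(2)[of g'] by auto
  qed
  thus ?thesis using f by blast
qed

end
end

text \<open>Representatives are the values of the remainders modulo \<open>Q\<close>, of which there
  are finitely many over a finite field; denominators are inverted modulo \<open>Q\<close>.\<close>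

lemma base_residue:
  fixes V :: "'a::{finite,field} ac set"
  assumes B: "base_place V t" and irr: "irred Q"
    and dv: "\<And>f. ev t f \<in> mm V \<longleftrightarrow> Q dvd f"
  shows "\<exists>C. finite C \<and> C \<subseteq> V \<and> (\<forall>y\<in>V. \<exists>c\<in>C. y - c \<in> mm V)"
proof -
  interpret base_place V t by (rule B)
  let ?m = "mm V"
  note Qne = Qne[OF irr dv]
  let ?D = "{f :: 'a poly. pdeg f < pdeg Q}"
  have md: "f mod Q \<in> ?D" for f using degree_mod_less[OF Qne(1), of f] Qne(2) by auto
  have me: "ev t f - ev t (f mod Q) \<in> ?m" for f
    using dv[of "f - f mod Q"] by (simp add: ev_simps dvd_minus_mod)
  \<comment> \<open>Two powers of \<open>g\<close> have the same remainder, since remainders are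
    finite in number, and \<open>Q\<close> is prime.\<close>
  have inv: "\<exists>h. Q dvd g * h - 1" if g: "\<not> Q dvd g" for g
  proof -
    have pr: "prime_elem Q" using irr by (rule field_poly_irreducible_imp_prime)
    have "\<not> inj (\<lambda>n::nat. g ^ n mod Q)"
    proof
      assume "inj (\<lambda>n::nat. g ^ n mod Q)"
      moreover have "range (\<lambda>n::nat. g ^ n mod Q) \<subseteq> ?D" using md by blast
      ultimately show False using finite_degree_less finite_subset range_inj_infinite by blast
    qed
    then obtain i j where ij: "i < j" "g ^ i mod Q = g ^ j mod Q" unfolding inj_def by (metis linorder_neqE_nat)
    hence "Q dvd g ^ j - g ^ i" using mod_eq_dvd_iff by metis
    moreover have "g ^ j - g ^ i = g ^ i * (g ^ (j - i) - 1)" using ij(1) by (simp add: algebra_simps flip: power_add)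
    ultimately have "Q dvd g ^ i \<or> Q dvd g ^ (j - i) - 1" using prime_elem_dvd_mult_iff[OF pr] by metis
    hence "Q dvd g ^ (j - i) - 1" using g prime_elem_dvd_power[OF pr] by blast
    moreover have "j - i = Suc (j - i - 1)" using ij(1) by simp
    hence "g ^ (j - i) = g * g ^ (j - i - 1)" by (metis power_Suc)
    ultimately show ?thesis by metis
  qed
  have "\<exists>c\<in>ev t ` ?D. y - c \<in> ?m" if y: "y \<in> V" for y
  proof -
    obtain f g where fg: "\<not> Q dvd g" "y = ev t f / ev t g" using place_rep[OF irr dv y] by blast
    obtain h where h: "Q dvd g * h - 1" using inv[OF fg(1)] by blast
    have u: "ev t g \<noteq> 0" using unit(2) dv fg(1) by blast
    have "y * ev t (g * h - 1) \<in> ?m" using h dv mm_mult[OF V y] by blast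
    moreover have "y * ev t (g * h - 1) = ev t (f * h) - y" using u by (simp add: fg ev_simps field_simps)
    ultimately have "y - ev t (f * h) \<in> ?m" using mm_cong_sym[OF V] by metis
    hence "y - ev t (f * h mod Q) \<in> ?m" using mm_cong_trans[OF V _ me] by blast
    thus ?thesis using md by blast
  qed
  moreover have "finite (ev t ` ?D)" "ev t ` ?D \<subseteq> V" using finite_degree_less ev_in by auto
  ultimately show ?thesis by blast
qed

section \<open>Places of the algebraic closure\<close>

definition place :: "'a::field ac set =>
    ('a ac => 'a ac) => bool" where
  "place W \<phi> \<longleftrightarrow> vring UNIV W \<and> constants \<subseteq> W \<and> (\<forall>x\<in>W. \<forall>y\<in>W. \<phi> (x + y) = \<phi> x + \<phi> y) \<and>
     (\<forall>x\<in>W. \<forall>y\<in>W. \<phi> (x * y) = \<phi> x * \<phi> y) \<and> \<phi> 1 = 1 \<and> (\<forall>x\<in>W. \<phi> x = 0 \<longleftrightarrow> x \<in> mm W)"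

text \<open>Since \<open>t\<close> is transcendental over the constants, substituting
  \<open>\<theta>\<close> for \<open>t\<close> is a homomorphism on the polynomials in
  \<open>t\<close>. A maximal extension is defined on a valuation ring, and maximality makes its
  kernel the maximal ideal.\<close>

lemma place_exists:
  fixes t \<theta> :: "'a::field ac"
  assumes tr: "\<And>f. ev t f = 0 ==> f = 0"
  shows "\<exists>W \<phi>. place W \<phi> \<and> (\<forall>f. ev t f \<in> W \<and> \<phi> (ev t f) = ev \<theta> f)"
proof -
  define G0 where "G0 = range (\<lambda>f. (ev t f, ev \<theta> f))"
  have el0: "(ev t h, ev \<theta> h) \<in> G0" for h by (simp add: G0_def)
  have "phom G0"
    unfolding phom_def
  proof (intro conjI allI impI)
    show "(1, 1) \<in> G0" using el0[of 1] by (simp add: ev_simps)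
    fix x a y b assume "(x, a) \<in> G0" "(y, b) \<in> G0"
    then obtain f g where "x = ev t f" "a = ev \<theta> f" "y = ev t g" "b = ev \<theta> g" by (auto simp: G0_def)
    thus "(x + y, a + b) \<in> G0" "(x * y, a * b) \<in> G0"
      using el0[of "f + g"] el0[of "f * g"] by (simp_all add: ev_simps)
  next
    fix x a assume "(x, a) \<in> G0"
    then obtain f where "x = ev t f" "a = ev \<theta> f" by (auto simp: G0_def)
    thus "(- x, - a) \<in> G0" using el0[of "- f"] by (simp add: ev_simps)
  next
    fix a assume "(0, a) \<in> G0"
    then obtain f where f: "ev t f = 0" "a = ev \<theta> f" by (auto simp: G0_def)
    thus "a = 0" using tr[OF f(1)] by (simp add: ev_simps)
  qed
  then obtain G where G: "maximal_phom G" "G0 \<subseteq> G" using maximal_phom_exists by blast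
  hence H: "phom G" by (simp add: maximal_phom_def)
  define \<phi> where "\<phi> x = (THE a. (x, a) \<in> G)" for x
  have pe: "\<phi> x = a" if "(x, a) \<in> G" for x a
    unfolding \<phi>_def by (rule the_equality[of "\<lambda>a. (x, a) \<in> G", OF that]) (rule phom_unique[OF H _ that])
  have pg: "(x, \<phi> x) \<in> G" if "x \<in> Domain G" for x using that pe by auto
  have ts: "tsubring (Domain G)"
    unfolding tsubring_def
  proof (intro conjI ballI)
    show "0 \<in> Domain G" "1 \<in> Domain G" using phomD(1)[OF H] phom_0[OF H] by blast+
    fix x assume x: "x \<in> Domain G"
    thus "- x \<in> Domain G" using phomD(4)[OF H] by blast
    fix y assume "y \<in> Domain G"
    thus "x + y \<in> Domain G" "x * y \<in> Domain G" using x phomD(2,3)[OF H] by blast+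
  qed
  have V: "vring UNIV (Domain G)"
    using ts maximal_phom_valuation[OF G(1)] by (auto simp: vring_def tfield_def tsubring_def)
  have hom: "\<phi> (x + y) = \<phi> x + \<phi> y" "\<phi> (x * y) = \<phi> x * \<phi> y" if "x \<in> Domain G" "y \<in> Domain G" for x y
    using pe[OF phomD(2)[OF H pg[OF that(1)] pg[OF that(2)]]] pe[OF phomD(3)[OF H pg[OF that(1)] pg[OF that(2)]]]
    by simp_all
  have one: "\<phi> 1 = 1" by (rule pe[OF phomD(1)[OF H]])
  have ker: "\<phi> x = 0 \<longleftrightarrow> x \<in> mm (Domain G)" if x: "x \<in> Domain G" for x
  proof
    assume "\<phi> x = 0"
    show "x \<in> mm (Domain G)"
    proof (rule ccontr)
      assume "x \<notin> mm (Domain G)"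
      hence i: "inverse x \<in> Domain G" "x \<noteq> 0" using mmD(4,5)[OF V x] by auto
      thus False using hom(2)[OF x i(1)] one \<open>\<phi> x = 0\<close> by simp
    qed
  next
    assume m: "x \<in> mm (Domain G)"
    show "\<phi> x = 0"
    proof (rule ccontr)
      assume n: "\<phi> x \<noteq> 0"
      hence "x \<noteq> 0" using pg[OF x] phomD(5)[OF H] by blast
      thus False using maximal_phom_inverse[OF G(1) pg[OF x] n] m by (simp add: max_ideal_def)
    qed
  qed
  have el: "(ev t f, ev \<theta> f) \<in> G" for f using G(2) by (auto simp: G0_def)
  have "constants \<subseteq> Domain G"
  proof
    fix x :: "'a ac" assume "x \<in> constants"
    then obtain c where "x = ev t [:c:]" by (auto simp: constants_def ev_const emb_def)
    thus "x \<in> Domain G" using el by blast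
  qed
  hence "place (Domain G) \<phi>" using V hom one ker by (simp add: place_def)
  moreover have "ev t f \<in> Domain G \<and> \<phi> (ev t f) = ev \<theta> f" for f using el pe by blast
  ultimately show ?thesis by blast
qed

lemma ev_var_transcendental: "ev var_T f = 0 ==> f = 0"
  by (simp add: ev_var emb_eq_0_iff)

lemma ev_inverse_var_transcendental: "ev (inverse var_T) f = 0 ==> f = 0"
  using ev_reflect_poly[of "inverse var_T" f] by (simp add: ev_var emb_eq_0_iff var_T_nonzero)

lemma ratfun_ev_var: "x \<in> kk ==> \<exists>f g. g \<noteq> 0 \<and> x = ev var_T f / ev var_T g"
  unfolding ev_var by (erule ratfun_fieldE) blast

lemma ratfun_ev_inverse_var:
  assumes "x \<in> kk" shows "\<exists>f g. g \<noteq> 0 \<and> x = ev (inverse var_T) f / ev (inverse var_T) g"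
proof -
  let ?s = "inverse var_T" and ?m = "Polynomial.monom 1"
  obtain a b where ab: "b \<noteq> 0" "x = emb a / emb b" using assms by (rule ratfun_fieldE)
  have pw: "ev ?s (?m k) = ?s ^ k" for k
    by (simp add: ev_def map_poly_monom emb_eq_0_iff poly_monom one_pCons[symmetric] emb_simps)
  have "x = ev ?s (reflect_poly a * ?m (pdeg b)) / ev ?s (reflect_poly b * ?m (pdeg a))"
    unfolding rhom_mult[OF rhom_ev] pw ev_reflect_poly[OF var_T_nonzero] ev_var by (simp add: ab(2) field_simps var_T_nonzero)
  moreover have "reflect_poly b * ?m (pdeg a) \<noteq> 0" using ab(1) by simp
  ultimately show ?thesis by blast
qed

lemma base_place_var:
  assumes "vring kk V" "constants \<subseteq> V" "V \<noteq> kk" "var_T \<in> V"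
  shows "base_place V var_T"
  by (rule base_place.intro[OF assms ratfun_ev_var ev_var_transcendental])

lemma base_place_inverse_var:
  assumes "vring kk V" "constants \<subseteq> V" "V \<noteq> kk" "inverse var_T \<in> V"
  shows "base_place V (inverse var_T)"
  by (rule base_place.intro[OF assms ratfun_ev_inverse_var ev_inverse_var_transcendental])

lemma base_place_var_finite_prime:
  assumes V: "base_place V var_T" and irr: "irred Q"
    and dv: "\<And>f. emb f \<in> mm V \<longleftrightarrow> Q dvd f"
  shows "V = finite_prime Q"
proof -
  interpret base_place V var_T by (rule V)
  have dv': "ev var_T f \<in> mm V \<longleftrightarrow> Q dvd f" for f using dv by (simp add: ev_var)
  show ?thesis
  proof (intro equalityI subsetI)
    fix x assume "x \<in> V"
    then obtain f g where fg: "\<not> Q dvd g" "x = emb f / emb g" using place_rep[OF irr dv'] unfolding ev_var by blast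
    hence "g \<noteq> 0" by auto
    thus "x \<in> finite_prime Q"
      unfolding finite_prime_def using fg to_ac_Fract[of f g] by (intro CollectI exI[of _ f] exI[of _ g]) simp
  next
    fix x assume "x \<in> finite_prime Q"
    then obtain f g where "\<not> Q dvd g" "x = emb f / emb g" unfolding finite_prime_def to_ac_Fract by blast
    thus "x \<in> V" using tsubringD(5)[OF R ev_in unit(1), of g f] dv'[of g] by (simp add: ev_var divide_inverse)
  qed
qed

context
  fixes V :: "'a::field ac set"
  assumes V: "vring kk V" and const: "constants \<subseteq> V" and s: "inverse var_T \<in> mm V"
begin

lemma ev_inverse_var_cong: "ev (inverse var_T) f - emb [:coef f 0:] \<in> mm V"
proof (cases f)
  case (pCons c g)
  have "emb [:c:] \<in> V" for c using const by (auto simp: constants_def emb_def)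
  hence "ev (inverse var_T) g \<in> V"
    unfolding ev_def
    by (intro poly_eval_closed[OF vringD(3)[OF V] _ mmD(1)[OF V s]]) (simp add: poly_over_def coeff_ev_poly)
  hence "ev (inverse var_T) g * inverse var_T \<in> mm V" by (rule mm_mult[OF V _ s])
  thus ?thesis by (simp add: pCons ev_pCons mult.commute)
qed

lemma const_in_max_ideal: "emb [:c:] \<in> mm V \<longleftrightarrow> c = 0"
proof
  assume m: "emb [:c:] \<in> mm V"
  show "c = 0"
  proof (rule ccontr)
    assume "c \<noteq> 0"
    have "emb [:inverse c:] \<in> V" using const by (auto simp: constants_def emb_def)
    from mm_mult[OF V this m] have "emb ([:inverse c:] * [:c:]) \<in> mm V" by (simp only: emb_simps)
    thus False using \<open>c \<noteq> 0\<close> mmD(3)[OF V] by (simp add: one_pCons[symmetric] emb_simps)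
  qed
qed (simp add: emb_simps mmD(2)[OF V])

text \<open>Divided by the power of \<open>T\<close>, the polynomial becomes one in
  \<open>inverse var_T\<close> whose constant term is the leading coefficient of \<open>f\<close>, a
  nonzero constant.\<close>

lemma unit_at_infinity:
  assumes "f \<noteq> 0" shows "val_equiv V (emb f) (var_T ^ pdeg f)"
proof -
  let ?u = "emb f / var_T ^ pdeg f"
  have u: "?u - emb [:lcoeff f:] \<in> mm V"
    using ev_inverse_var_cong[of "reflect_poly f"] by (simp add: ev_reflect_poly var_T_nonzero ev_var)
  have cV: "emb [:c:] \<in> V" for c using const by (auto simp: constants_def emb_def)
  have uV: "?u \<in> V" by (rule vring_cong_in[OF V u cV])
  have "?u \<notin> mm V"
    using mm_cong_in[OF V mm_cong_sym[OF V u]] const_in_max_ideal assms by auto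
  hence "inverse ?u \<in> V" using mmD(4)[OF V uV] by blast
  thus ?thesis using uV by (simp add: val_equiv_def divide_inverse mult.commute)
qed

lemma infinity_zval: "\<exists>v. zval kk V v"
proof -
  have "V \<noteq> kk"
  proof
    assume "V = kk"
    hence "var_T \<in> V" using emb_ratfun by blast
    thus False using s by (simp add: max_ideal_def var_T_nonzero)
  qed
  then interpret base_place V "inverse var_T"
    by (rule base_place_inverse_var[OF V const _ mmD(1)[OF V s]])
  show ?thesis using prime_of_place base_zval by blast
qed

text \<open>The value of a nonzero \<open>f\<close> is its degree times the value of
  \<open>T\<close>, which is negative.\<close>

lemma emb_in_infinite_place:
  shows "emb f \<in> mm V \<longleftrightarrow> f = 0"
    "f \<noteq> 0 ==> g \<noteq> 0 ==> emb f / emb g \<in> V \<longleftrightarrow> pdeg f \<le> pdeg g"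
proof -
  obtain v where v: "zval kk V v" using infinity_zval by blast
  note iv = zval_ival[OF v]
  have T: "(var_T :: 'a ac) \<in> kk" by (rule emb_ratfun)
  have sT: "v (inverse var_T) > 0"
    using s zval_max_ideal[OF v tfieldD(2)[OF tfield_ratfun T]] by (simp add: var_T_nonzero)
  hence vT: "v var_T < 0" using ival_inverse[OF tfield_ratfun iv T var_T_nonzero] by linarith
  have vf: "v (emb f) = int (pdeg f) * v var_T" if "f \<noteq> 0" for f
    using unit_at_infinity[OF that] val_equiv_zval[OF v emb_ratfun _ tsubring_power[OF kr T]] that
      ival_power[OF tfield_ratfun iv T var_T_nonzero] by (simp add: emb_eq_0_iff var_T_nonzero)
  show "emb f \<in> mm V \<longleftrightarrow> f = 0"
  proof (cases "f = 0")
    case False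
    hence "\<not> v (emb f) > 0" using vf[OF False] vT by (simp add: zero_less_mult_iff)
    thus ?thesis using False zval_max_ideal[OF v emb_ratfun] emb_eq_0_iff by blast
  qed (simp add: emb_simps mmD(2)[OF V])
  show "emb f / emb g \<in> V \<longleftrightarrow> pdeg f \<le> pdeg g" if fg: "f \<noteq> 0" "g \<noteq> 0"
  proof -
    let ?i = "inverse (emb g)"
    have nz: "emb f \<noteq> 0" "?i \<noteq> 0" "?i \<in> kk" using fg emb_eq_0_iff tfieldD(2)[OF tfield_ratfun emb_ratfun] by auto
    have "v (emb f * ?i) = v (emb f) + v ?i" by (rule zvalD(2)[OF v emb_ratfun nz(1) nz(3,2)])
    also have "v ?i = - v (emb g)" using ival_inverse[OF tfield_ratfun iv emb_ratfun] fg emb_eq_0_iff by blast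
    finally have "v (emb f * ?i) = (int (pdeg f) - int (pdeg g)) * v var_T"
      by (simp only: vf[OF fg(1)] vf[OF fg(2)]) (simp add: left_diff_distrib)
    moreover have "emb f * ?i \<in> kk" by (rule tsubringD(5)[OF kr emb_ratfun nz(3)])
    moreover have "emb f * ?i \<noteq> 0" using nz by simp
    ultimately have "emb f * ?i \<in> V \<longleftrightarrow> 0 \<le> (int (pdeg f) - int (pdeg g)) * v var_T"
      using zvalD(3)[OF v] by simp
    thus ?thesis using vT by (simp add: zero_le_mult_iff divide_inverse)
  qed
qed

lemma place_infinite_prime: "V = infinite_prime"
proof (intro equalityI subsetI)
  fix x :: "'a ac" assume x: "x \<in> V"
  obtain a b where ab: "b \<noteq> 0" "x = emb a / emb b" using vringD(4)[OF V x] by (rule ratfun_fieldE)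
  have "pdeg a \<le> pdeg b" using emb_in_infinite_place(2)[of a b] ab x by (cases "a = 0") auto
  thus "x \<in> infinite_prime" unfolding infinite_prime_def using ab to_ac_Fract[of a b] by force
next
  fix x :: "'a ac" assume "x \<in> infinite_prime"
  then obtain a b where "b \<noteq> 0" "x = emb a / emb b" "pdeg a \<le> pdeg b"
    by (auto simp: infinite_prime_def to_ac_Fract)
  thus "x \<in> V" using emb_in_infinite_place(2)[of a b] tsubringD(1)[OF vringD(3)[OF V]]
    by (cases "a = 0") (auto simp: emb_simps)
qed

end

text \<open>\<open>vprime L V\<close> is \<^const>\<open>is_prime_of\<close> with properness stated at the level of the base field.\<close>

definition vprime :: "'a::field ac set => 'a ac set => bool" where
  "vprime L V \<longleftrightarrow> vring L V \<and> kk \<subseteq> L \<and> constants \<subseteq> V \<and> \<not> kk \<subseteq> V"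

lemma vprimeD:
  assumes "vprime L V"
  shows "vring L V" "kk \<subseteq> L" "constants \<subseteq> V" "\<not> kk \<subseteq> V"
    "vring kk (V \<inter> kk)" "mm (V \<inter> kk) = mm V \<inter> kk"
    "constants \<subseteq> V \<inter> kk" "V \<inter> kk \<noteq> kk"
proof -
  show *: "vring L V" "kk \<subseteq> L" "constants \<subseteq> V" "\<not> kk \<subseteq> V" using assms by (auto simp: vprime_def)
  show "vring kk (V \<inter> kk)" "mm (V \<inter> kk) = mm V \<inter> kk"
    using vring_restrict[OF *(1) tfield_ratfun *(2)] .
  have "constants \<subseteq> (kk :: 'a ac set)" by (auto simp: constants_def ratfun_field_def)
  thus "constants \<subseteq> V \<inter> kk" using *(3) by blast
  show "V \<inter> kk \<noteq> kk" using *(4) by blast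
qed

lemma vprime_restrict:
  assumes V: "vprime L V" and F: "tfield F" "kk \<subseteq> F" "F \<subseteq> L"
  shows "vprime F (V \<inter> F)" "mm (V \<inter> F) = mm V \<inter> F"
    "(V \<inter> F) \<inter> kk = V \<inter> kk"
proof -
  show "vprime F (V \<inter> F)"
    using vring_restrict(1)[OF vprimeD(1)[OF V] F(1,3)] vprimeD(2-4,7)[OF V] F(2) unfolding vprime_def by blast
  show "mm (V \<inter> F) = mm V \<inter> F" by (rule vring_restrict(2)[OF vprimeD(1)[OF V] F(1,3)])
  show "(V \<inter> F) \<inter> kk = V \<inter> kk" using F(2) by blast
qed

text \<open>If \<open>V\<close> contained the base field, all of \<open>L\<close> would be integral
  over it and so lie in \<open>V\<close>. Conversely \<open>V\<close> exceeds the constants because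
  it contains \<open>T\<close> or the inverse of \<open>T\<close>.\<close>

lemma is_prime_of_iff_vprime:
  assumes L: "tfield L" "kk \<subseteq> L"
  shows "is_prime_of L V \<longleftrightarrow> vprime L V"
proof
  assume p: "is_prime_of L V"
  hence V: "vring L V" using L(1) by (auto simp: is_prime_of_def vring_def subring_ambient)
  have "\<not> kk \<subseteq> V"
  proof
    assume k: "kk \<subseteq> V"
    have "x \<in> V" if x: "x \<in> L" for x
    proof -
      obtain f where "f \<noteq> 0" "poly_over kk f" "poly f x = 0" using alg_over_ratfun unfolding alg_over_def by blast
      thus ?thesis using alg_in_valuation[OF tfield_ratfun vringD(3)[OF V] k, of f x] vringD(5)[OF V x] by blast
    qed
    thus False using p by (auto simp: is_prime_of_def)
  qed
  thus "vprime L V" using V L(2) p by (auto simp: vprime_def is_prime_of_def)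
next
  assume p: "vprime L V"
  note V = vprimeD(1)[OF p] and k = vprimeD(2-4)[OF p]
  have "V \<noteq> constants"
  proof
    assume e: "V = constants"
    have T: "(var_T :: 'a ac) \<in> L" using emb_ratfun L(2) by blast
    have "emb [:0, 1:] \<in> V \<or> inverse (emb [:0, 1:]) \<in> V" using vringD(5)[OF V T] by blast
    hence "\<exists>c. emb [:0, 1:] = emb [:c:] \<or> inverse (emb [:0, 1:]) = (emb [:c:] :: 'a ac)"
      by (auto simp: e constants_def emb_def)
    then obtain c :: 'a where "emb [:0, 1:] = emb [:c:] \<or> inverse (emb [:0, 1:]) = emb [:c:]" by blast
    moreover have "emb [:0, 1:] * emb [:c:] \<noteq> 1"
    proof
      assume "emb [:0, 1:] * emb [:c:] = 1"
      hence "emb ([:0, 1:] * [:c:]) = emb 1" by (simp only: emb_simps)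
      thus False unfolding emb_eq_iff by (auto simp: one_pCons)
    qed
    moreover have "emb [:0, 1:] \<noteq> emb [:c:]" by (simp add: emb_eq_iff)
    ultimately show False using right_inverse[of "emb [:0, 1::'a:]"] emb_eq_0_iff[of "[:0, 1::'a:]"] by auto
  qed
  hence "constants \<subset> V" using k(2) by blast
  moreover have "V \<subset> L" using V k(1,3) vringD(4)[OF V] by blast
  ultimately show "is_prime_of L V"
    using V unfolding is_prime_of_def vring_def subring_ambient by blast
qed

lemma vprime_infinite:
  assumes V: "vprime L V" and T: "var_T \<notin> V"
  shows "V \<inter> kk = infinite_prime" "inverse var_T \<in> mm (V \<inter> kk)"
proof -
  show s: "inverse var_T \<in> mm (V \<inter> kk)"
    using mmD(6)[OF vprimeD(5)[OF V], of var_T] T emb_ratfun by blast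
  show "V \<inter> kk = infinite_prime" by (rule place_infinite_prime[OF vprimeD(5,7)[OF V] s])
qed

lemma vprime_finite:
  assumes V: "vprime L V" and T: "var_T \<in> V"
  shows "\<exists>Q. irred Q \<and> lcoeff Q = 1 \<and> V \<inter> kk = finite_prime Q
    \<and> (\<forall>f. emb f \<in> mm V \<longleftrightarrow> Q dvd f)"
proof -
  have B: "base_place (V \<inter> kk) var_T"
    by (rule base_place_var[OF vprimeD(5,7,8)[OF V]]) (use T emb_ratfun in blast)
  obtain Q where Q: "irred Q" "lcoeff Q = 1"
    "\<And>f. emb f \<in> mm (V \<inter> kk) \<longleftrightarrow> Q dvd f"
    using base_place.prime_of_place[OF B] unfolding ev_var by blast
  have "V \<inter> kk = finite_prime Q" by (rule base_place_var_finite_prime[OF B Q(1,3)])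
  moreover have "emb f \<in> mm V \<longleftrightarrow> Q dvd f" for f
    using Q(3)[of f] vprimeD(6)[OF V] emb_ratfun by auto
  ultimately show ?thesis using Q(1,2) by blast
qed

lemma vprime_base_place:
  assumes V: "vprime L V" shows "\<exists>t. base_place (V \<inter> kk) t"
proof (cases "var_T \<in> V")
  case True
  have "base_place (V \<inter> kk) var_T"
    by (rule base_place_var[OF vprimeD(5,7,8)[OF V]]) (use True emb_ratfun in blast)
  thus ?thesis by blast
next
  case False
  have "base_place (V \<inter> kk) (inverse var_T)"
    by (rule base_place_inverse_var[OF vprimeD(5,7,8)[OF V] mmD(1)[OF vprimeD(5)[OF V] vprime_infinite(2)[OF V False]]])
  thus ?thesis by blast
qed

lemma vprime_base_zval:
  assumes V: "vprime L V" shows "\<exists>v. zval kk (V \<inter> kk) v"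
proof -
  obtain t where "base_place (V \<inter> kk) t" using vprime_base_place[OF V] by blast
  then interpret base_place "V \<inter> kk" t .
  show ?thesis using prime_of_place base_zval by blast
qed

lemma prime_CHAR_finite_field: "prime CHAR('a::{finite,field})"
  by (intro prime_CHAR_semidom finite_imp_CHAR_pos finite_class.finite_UNIV)

lemma CHAR_ratfun [simp]: "CHAR('a::field poly fract) = CHAR('a)"
proof -
  have "of_nat n = (0 :: 'a poly fract) \<longleftrightarrow> of_nat n = (0 :: 'a poly)" for n
    by (simp add: of_nat_fract Zero_fract_def eq_fract)
  hence "CHAR('a poly fract) = CHAR('a poly)"
    by (intro CHAR_eqI) (auto simp: of_nat_eq_0_iff_char_dvd)
  thus ?thesis by simp
qed

lemma vprime_residue:
  fixes L :: "'a::{finite,field} ac set"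
  assumes V: "vprime L V" and x: "x \<in> V"
  shows "\<exists>n\<ge>1. x ^ (CHAR('a) ^ n) - x \<in> mm V"
proof -
  obtain t where B: "base_place (V \<inter> kk) t" using vprime_base_place[OF V] by blast
  obtain Q where Q: "irred Q" "\<And>f. ev t f \<in> mm (V \<inter> kk) \<longleftrightarrow> Q dvd f"
    using base_place.prime_of_place[OF B] by blast
  obtain C where C: "finite C" "C \<subseteq> V \<inter> kk"
    "\<And>y. y \<in> V \<inter> kk ==> \<exists>c\<in>C. y - c \<in> mm (V \<inter> kk)"
    using base_residue[OF B Q] by blast
  have C3: "\<exists>c\<in>C. y - c \<in> mm V" if "y \<in> V \<inter> kk" for y
    using C(3)[OF that] vprimeD(6)[OF V] by blast
  obtain f where "f \<noteq> 0" "poly_over kk f" "poly f x = 0" using alg_over_ratfun unfolding alg_over_def by blast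
  from residue_algebraic[OF vprimeD(1)[OF V] tfield_ratfun vprimeD(2)[OF V] C(1,2) C3 _ _ x this]
  show ?thesis using prime_CHAR_finite_field[where ?'a = 'a] by simp
qed

lemma place_vprime:
  assumes "place W \<phi>" "\<not> kk \<subseteq> W" shows "vprime UNIV W"
  using assms by (auto simp: place_def vprime_def)

text \<open>Take a place that sends the inverse of \<open>T\<close> to \<open>0\<close>.\<close>

lemma infinite_place_exists:
  "\<exists>W \<phi>. place W \<phi> \<and> vprime UNIV W \<and> var_T \<notin> (W :: 'a::field ac set)"
proof -
  let ?s = "inverse var_T :: 'a ac"
  obtain W \<phi> where W: "place W \<phi>" "\<And>f. ev ?s f \<in> W \<and> \<phi> (ev ?s f) = ev 0 f"
    using place_exists[of ?s 0] ev_inverse_var_transcendental by blast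
  have "ev ?s [:0, 1:] = ?s" "ev 0 [:0, 1::'a:] = 0" by (simp_all add: ev_pCons ev_simps emb_simps one_pCons[symmetric])
  hence "?s \<in> W" "\<phi> ?s = 0" using W(2)[of "[:0, 1:]"] by auto
  hence "?s \<in> mm W" using W(1) by (auto simp: place_def)
  hence "var_T \<notin> W" by (simp add: max_ideal_def var_T_nonzero)
  thus ?thesis using W(1) place_vprime emb_ratfun by blast
qed

lemma monic_irreducible_dvd_eq:
  fixes Q Q' :: "'a::field poly"
  assumes "irred Q" "lcoeff Q = 1" "irred Q'" "lcoeff Q' = 1" "Q' dvd Q"
  shows "Q' = Q"
proof -
  obtain c where c: "Q = Q' * c" using assms(5) by (rule dvdE)
  hence "c dvd 1" using assms(1,3) unfolding Factorial_Ring.irreducible_def by blast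
  then obtain u where "c = [:u:]" by (auto simp: is_unit_poly_iff)
  hence Qu: "Q = smult u Q'" by (simp add: c)
  hence "u = 1" using assms(2,4) by (metis lead_coeff_smult mult.right_neutral)
  thus ?thesis using Qu by simp
qed

text \<open>Take a place that sends \<open>T\<close> to a root of \<open>Q\<close> in the closure.
  The monic irreducible polynomial \<open>Q'\<close> below it divides \<open>Q\<close>, hence equals
  it.\<close>

lemma finite_place_exists:
  fixes Q :: "'a::field poly"
  assumes Q: "irred Q" "lcoeff Q = 1"
  shows "\<exists>W \<phi>. place W \<phi> \<and> vprime UNIV W \<and> W \<inter> kk = finite_prime Q"
proof -
  let ?Q = "map_poly (\<lambda>c. emb [:c:]) Q"
  have "Q \<noteq> 0" "\<not> Q dvd 1" using Q(1) by (auto simp: Factorial_Ring.irreducible_def)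
  hence "pdeg Q > 0" by (meson is_unit_iff_degree not_gr_zero)
  hence "pdeg ?Q > 0" by (simp add: degree_map_poly emb_eq_0_iff)
  then obtain \<theta> where \<theta>: "poly ?Q \<theta> = 0" using alg_closed_imp_poly_has_root by blast
  obtain W \<phi> where W: "place W \<phi>" "\<And>f. emb f \<in> W \<and> \<phi> (emb f) = ev \<theta> f"
    using place_exists[of var_T \<theta>, OF ev_var_transcendental] unfolding ev_var by blast
  have "emb Q \<in> W" "\<phi> (emb Q) = 0" using W(2)[of Q] \<theta> by (simp_all add: ev_def)
  hence m: "emb Q \<in> mm W" using W(1) unfolding place_def by blast
  hence "inverse (emb Q) \<notin> W" using \<open>Q \<noteq> 0\<close> by (simp add: max_ideal_def emb_eq_0_iff)
  hence V: "vprime UNIV W" using place_vprime[OF W(1)] tfieldD(2)[OF tfield_ratfun emb_ratfun] by blast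
  have "var_T \<in> W" using W(2)[of "[:0, 1:]"] by simp
  then obtain Q' where Q': "irred Q'" "lcoeff Q' = 1" "W \<inter> kk = finite_prime Q'"
    "\<forall>f. emb f \<in> mm W \<longleftrightarrow> Q' dvd f"
    using vprime_finite[OF V] by metis
  have "Q' dvd Q" using Q'(4) m by simp
  hence "Q' = Q" by (rule monic_irreducible_dvd_eq[OF Q Q'(1,2)])
  thus ?thesis using Q'(3) W(1) V by blast
qed

text \<open>Gaussian elimination with pivot \<open>a i j1\<close>; the value of the unknown
  \<open>j1\<close> is restored at the end. \<open>F\<close> is general because the lemma serves
  over \<open>M\<close> as well as over the base field.\<close>

lemma hom_system:
  fixes F :: "'b::field set"
  assumes F: "tfield F"
  shows "finite I ==> finite J ==> card I < card J ==> (\<And>i j. i \<in> I ==> j \<in> J ==> a i j \<in> F) ==>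
    \<exists>y. (\<forall>j\<in>J. y j \<in> F) \<and> (\<exists>j\<in>J. y j \<noteq> 0) \<and> (\<forall>i\<in>I. (\<Sum>j\<in>J. a i j * y j) = 0)"
proof (induction I arbitrary: J a rule: finite_induct)
  case empty
  hence "J \<noteq> {}" by auto
  thus ?case using tsubringD(2)[OF tfieldD(1)[OF F]] by (intro exI[of _ "\<lambda>_. 1"]) auto
next
  case (insert i I)
  note R = tfieldD(1)[OF F]
  have aF: "a i' j \<in> F" if "i' \<in> insert i I" "j \<in> J" for i' j using insert.prems(3) that by blast
  show ?case
  proof (cases "\<forall>j\<in>J. a i j = 0")
    case True
    have "card I < card J" using insert.prems(2) insert.hyps by simp
    then obtain y where y: "\<forall>j\<in>J. y j \<in> F" "\<exists>j\<in>J. y j \<noteq> 0" "\<forall>i\<in>I. (\<Sum>j\<in>J. a i j * y j) = 0"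
      using insert.IH[OF insert.prems(1), of a] aF by blast
    moreover have "(\<Sum>j\<in>J. a i j * y j) = 0" by (rule sum.neutral) (use True in simp)
    ultimately show ?thesis by (intro exI[of _ y]) auto
  next
    case False
    then obtain j1 where j1: "j1 \<in> J" "a i j1 \<noteq> 0" by blast
    define b where "b i' j = a i' j - a i' j1 * (a i j / a i j1)" for i' j
    have bF: "b i' j \<in> F" if "i' \<in> I" "j \<in> J - {j1}" for i' j
      unfolding b_def
      by (rule tsubring_diff[OF R aF tsubringD(5)[OF R aF tfield_divide[OF F aF aF]]]) (use that j1(1) in auto)
    have "card I < card (J - {j1})" using insert.prems(1,2) insert.hyps j1(1) by (simp add: card_Diff_singleton)
    then obtain y where y: "\<forall>j\<in>J - {j1}. y j \<in> F" "\<exists>j\<in>J - {j1}. y j \<noteq> 0"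
      "\<forall>i\<in>I. (\<Sum>j\<in>J - {j1}. b i j * y j) = 0"
      using insert.IH[of "J - {j1}" b] insert.prems(1) bF by blast
    define s where "s = (\<Sum>j\<in>J - {j1}. a i j / a i j1 * y j)"
    define y' where "y' = y(j1 := - s)"
    have sF: "s \<in> F"
      unfolding s_def
      by (intro tsubring_sum[OF R] tsubringD(5)[OF R] tfield_divide[OF F] aF) (use y(1) j1(1) in auto)
    have split: "(\<Sum>j\<in>J. a i' j * y' j) = (\<Sum>j\<in>J - {j1}. a i' j * y j) - a i' j1 * s" for i'
      using insert.prems(1) j1(1) by (simp add: sum.remove[of J j1] y'_def)
    have eqI: "(\<Sum>j\<in>J. a i' j * y' j) = 0" if "i' \<in> I" for i'
    proof -
      have "(\<Sum>j\<in>J - {j1}. b i' j * y j) = (\<Sum>j\<in>J - {j1}. a i' j * y j) - a i' j1 * s"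
        by (simp add: b_def s_def left_diff_distrib sum_subtractf sum_distrib_left mult.assoc)
      thus ?thesis using split y(3) that by simp
    qed
    have "a i j1 * s = (\<Sum>j\<in>J - {j1}. a i j * y j)"
      unfolding s_def sum_distrib_left using j1(2) by (intro sum.cong) auto
    hence eqi: "(\<Sum>j\<in>J. a i j * y' j) = 0" using split by simp
    have "\<forall>j\<in>J. y' j \<in> F" using y(1) tsubringD(4)[OF R sF] by (simp add: y'_def)
    moreover have "\<exists>j\<in>J. y' j \<noteq> 0" using y(2) by (auto simp: y'_def)
    ultimately show ?thesis using eqI eqi by (intro exI[of _ y']) auto
  qed
qed

text \<open>In a fraction with denominator of least degree, a prime factor \<open>Q\<close> of the
  denominator would divide the numerator too, by integrality at \<open>Q\<close>, and could be
  cancelled.\<close>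

lemma polynomial_of_integral:
  assumes x: "x \<in> kk"
    and int: "\<And>Q. irred Q ==> lcoeff Q = 1 ==> x \<in> finite_prime Q"
  shows "\<exists>f. x = emb (f :: 'a::field poly)"
proof -
  let ?P = "\<lambda>b. b \<noteq> 0 \<and> (\<exists>a. x = emb a / emb b)"
  have "\<exists>b. ?P b" using x by (rule ratfun_fieldE) blast
  then obtain b where b: "?P b" "\<And>c. ?P c ==> pdeg b \<le> pdeg c"
    using ex_has_least_nat[of ?P _ pdeg] by blast
  obtain a where a: "x = emb a / emb b" using b(1) by blast
  have "pdeg b = 0"
  proof (rule ccontr)
    assume "pdeg b \<noteq> 0"
    let ?D = "\<lambda>Q. Q dvd b \<and> pdeg Q > 0"
    have "\<exists>Q. ?D Q" using \<open>pdeg b \<noteq> 0\<close> by (intro exI[of _ b]) auto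
    then obtain Q0 where Q0: "?D Q0" "\<And>c. ?D c ==> pdeg Q0 \<le> pdeg c"
      using ex_has_least_nat[of ?D _ pdeg] by blast
    have Qn: "Q0 \<noteq> 0" using Q0(1) by auto
    have irr0: "irred Q0"
      unfolding Factorial_Ring.irreducible_def
    proof (intro conjI allI impI Qn)
      show "\<not> Q0 dvd 1" using Q0(1) Qn by (metis is_unit_iff_degree neq0_conv)
      fix c d assume cd: "Q0 = c * d"
      hence nz: "c \<noteq> 0" "d \<noteq> 0" using Qn by auto
      have "c dvd b" "d dvd b" using Q0(1) cd by (metis dvd_trans dvd_triv_left dvd_triv_right)+
      moreover have "pdeg Q0 = pdeg c + pdeg d" using cd nz by (simp add: degree_mult_eq)
      ultimately have "pdeg c = 0 \<or> pdeg d = 0" using Q0(2)[of c] Q0(2)[of d] by linarith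
      thus "c dvd 1 \<or> d dvd 1" using nz is_unit_iff_degree by blast
    qed
    define u where "u = lcoeff Q0"
    have u0: "u \<noteq> 0" using Qn by (simp add: u_def)
    define Q where "Q = smult (inverse u) Q0"
    have Q0Q: "Q0 = [:u:] * Q" using u0 by (simp add: Q_def)
    have "[:u:] dvd 1" using u0 by (simp add: is_unit_pCons_iff)
    have Qb: "Q dvd b" using Q0(1) Q0Q by (metis dvd_mult_right)
    have irr: "irred Q"
      using irr0 unfolding Q0Q irreducible_mult_unit_left[OF \<open>[:u:] dvd 1\<close>] .
    have lc: "lcoeff Q = 1" using u0 by (simp add: Q_def u_def)
    have Qd: "pdeg Q > 0" using Q0(1) u0 by (simp add: Q_def)
    obtain a' b' where ab': "b' \<noteq> 0" "\<not> Q dvd b'" "x = emb a' / emb b'"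
      using int[OF irr lc] unfolding finite_prime_def to_ac_Fract by blast
    have "emb b \<noteq> 0" "emb b' \<noteq> 0" using ab'(1) b(1) emb_eq_0_iff by blast+
    hence "emb a * emb b' = emb a' * emb b" using a ab'(3) frac_eq_eq by metis
    hence "a * b' = a' * b" by (simp only: emb_simps(4)[symmetric] emb_eq_iff)
    hence "Q dvd a * b'" using Qb by simp
    hence "Q dvd a" using prime_elem_dvd_mult_iff[OF field_poly_irreducible_imp_prime[OF irr]] ab'(2) by blast
    then obtain a1 b1 where ab1: "a = Q * a1" "b = Q * b1" using Qb by (auto elim!: dvdE)
    have b1: "b1 \<noteq> 0" "pdeg b1 < pdeg b" using b(1) Qd by (auto simp: ab1 degree_mult_eq)
    have "emb Q \<noteq> 0" using Qd emb_eq_0_iff[of Q] by auto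
    hence "x = emb a1 / emb b1" by (simp add: a ab1 emb_simps)
    thus False using b(2)[of b1] b1 by auto
  qed
  then obtain c where c: "b = [:c:]" by (rule degree_eq_zeroE)
  hence c0: "c \<noteq> 0" using b(1) by auto
  have "emb [:inverse c:] * emb b = 1" using c0 by (simp add: c one_pCons[symmetric] emb_simps flip: rhom_mult[OF rhom_emb])
  hence "inverse (emb b) = emb [:inverse c:]" by (metis inverse_unique mult.commute)
  hence "x = emb (a * [:inverse c:])" by (simp only: a divide_inverse emb_simps)
  thus ?thesis by blast
qed

lemma proper_fraction_in_max_ideal:
  assumes V: "vring kk V" "constants \<subseteq> V" "inverse var_T \<in> mm V"
    and ab: "b \<noteq> 0" "a = 0 \<or> pdeg a < pdeg b"
  shows "emb a / emb b \<in> mm V"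
proof (cases "a = 0")
  case False
  note E = emb_in_infinite_place[OF V]
  have "emb a / emb b \<in> V" "emb b / emb a \<notin> V" using E(2)[of a b] E(2)[of b a] ab False by auto
  thus ?thesis by (simp add: max_ideal_def)
qed (simp add: emb_simps mmD(2)[OF V(1)])

text \<open>The residue is the quotient of the leading coefficients if the degrees agree and
  \<open>0\<close> otherwise; so the infinite prime has degree one.\<close>

lemma infinite_residue:
  assumes V: "vring kk V" "constants \<subseteq> V" "inverse var_T \<in> mm V" and y: "y \<in> V"
  shows "\<exists>c. y - emb [:c:] \<in> mm V"
proof -
  note E = emb_in_infinite_place[OF V]
  note small = proper_fraction_in_max_ideal[OF V]
  obtain a b where ab: "b \<noteq> 0" "y = emb a / emb b" using vringD(4)[OF V(1) y] by (rule ratfun_fieldE)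
  have le: "a = 0 \<or> pdeg a \<le> pdeg b" using E(2)[of a b] ab y by auto
  show ?thesis
  proof (cases "pdeg a = pdeg b")
    case True
    let ?c = "lcoeff a / lcoeff b"
    have "a - smult ?c b = a - [:?c:] * b" by simp
    hence "emb (a - smult ?c b) = emb a - emb [:?c:] * emb b" by (simp only: emb_simps)
    hence "emb (a - smult ?c b) / emb b = y - emb [:?c:]"
      using ab(1) by (simp add: ab(2) diff_divide_distrib emb_eq_0_iff)
    thus ?thesis using small[OF ab(1)] degree_cancel[OF ab(1), of a] True
      by (metis diff_self_eq_0 monom_0 mult_pCons_left mult_zero_left order_refl pCons_0_0 add_0_right)
  next
    case False
    hence "a = 0 \<or> pdeg a < pdeg b" using le by linarith
    hence "y - emb [:0:] \<in> mm V" using small[OF ab(1)] ab(2) by (simp add: emb_simps)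
    thus ?thesis by blast
  qed
qed

section \<open>Everywhere unramified extensions of the rational function field\<close>

text \<open>One place \<open>W Q\<close> above each finite prime is fixed; conditions at the other
  places above it are expressed by applying the automorphisms in \<open>A\<close>. The condition at
  infinity is what excludes extensions of the field of constants. The outcome is a function field
  analogue of Minkowski's theorem on unramified extensions.\<close>

locale everywhere_unramified = fin_auts A M
  for A and M :: "'a::{finite,field} ac set" +
  fixes W :: "'a poly => 'a ac set" and U :: "'a ac set"
  assumes kM: "kk \<subseteq> M" and Fix_k: "Fix = kk"
    and W: "\<And>Q. irred Q ==> lcoeff Q = 1 ==>
        vprime UNIV (W Q) \<and> W Q \<inter> kk = finite_prime Q \<and> (\<exists>v. zval M (W Q \<inter> M) v)"
    and inertia: "\<And>Q s. irred Q ==> lcoeff Q = 1 ==> s \<in> A ==>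
        \<forall>x\<in>W Q \<inter> M. s x - x \<in> mm (W Q) ==> \<forall>x\<in>M. s x = x"
    and U: "vprime UNIV U" "var_T \<notin> U" "\<exists>v. zval M (U \<inter> M) v"
    and decomposition: "\<And>s. s \<in> A ==> \<forall>x\<in>M. s x \<in> U \<longleftrightarrow> x \<in> U ==> \<forall>x\<in>M. s x = x"
begin

abbreviation "Irr (Q :: 'a poly) \<equiv> irred Q \<and> lcoeff Q = 1"

lemma trace_unit_gen:
  assumes P: "vprime UNIV P" and v: "\<exists>v. zval M (P \<inter> M) v"
    and I: "\<And>s. s \<in> A ==> \<forall>x\<in>P \<inter> M. s x - x \<in> mm P ==> \<forall>x\<in>M. s x = x"
    and y: "y \<in> M" "y \<noteq> 0"
  shows "\<exists>u\<in>M. (\<forall>s\<in>A. s u \<in> P) \<and> Tr (u * y) / y \<in> P - mm P"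
proof -
  obtain v where v: "zval M (P \<inter> M) v" using v by blast
  interpret val_auts A M "P \<inter> M" v by unfold_locales (rule v)
  have m: "mm (P \<inter> M) = mm P \<inter> M" by (rule vring_restrict(2)[OF vprimeD(1)[OF P] L]) simp
  have "\<forall>s\<in>Ig. \<forall>x\<in>M. s x = x" using I unfolding Ig_def m by blast
  from trace_unit[OF this y] obtain u where u: "u \<in> M" "\<forall>s\<in>A. s u \<in> P \<inter> M"
    "Tr (u * y) / y \<in> P \<inter> M - mm (P \<inter> M)" by blast
  hence "Tr (u * y) / y \<in> P - mm P" using m by blast
  thus ?thesis using u(1,2) by blast
qed

lemma trace_unit_finite:
  assumes "Irr Q" "y \<in> M" "y \<noteq> 0"
  shows "\<exists>u\<in>M. (\<forall>s\<in>A. s u \<in> W Q) \<and> Tr (u * y) / y \<in> W Q - mm (W Q)"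
proof (rule trace_unit_gen[OF _ _ _ assms(2,3)])
  show "vprime UNIV (W Q)" "\<exists>v. zval M (W Q \<inter> M) v" using W[of Q] assms(1) by simp_all
  show "\<forall>x\<in>M. s x = x" if "s \<in> A" "\<forall>x\<in>W Q \<inter> M. s x - x \<in> mm (W Q)" for s
    using inertia[OF _ _ that] assms(1) by simp
qed

lemma U_split: "ram_index_one kk M (U \<inter> M)" "res_degree_one kk (U \<inter> M)"
proof -
  obtain v where v: "zval M (U \<inter> M) v" using U(3) by blast
  interpret val_auts A M "U \<inter> M" v by unfold_locales (rule v)
  have "\<forall>s\<in>Dg. \<forall>x\<in>M. s x = x" using decomposition stab unfolding Dg_def by blast
  from decomposition_trivial_imp_split[OF this]
  show "ram_index_one kk M (U \<inter> M)" "res_degree_one kk (U \<inter> M)" by (simp_all add: Fix_k)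
qed

lemmas mU = vprimeD(1)[OF U(1)]
lemmas UR = vringD(3)[OF mU]

lemma trace_unit_infinite:
  assumes y: "y \<in> M" "y \<noteq> 0"
  shows "\<exists>u\<in>M. (\<forall>s\<in>A. s u \<in> U) \<and> Tr (u * y) / y \<in> U - mm U"
proof (rule trace_unit_gen[OF U(1,3) _ y])
  fix s assume s: "s \<in> A" "\<forall>x\<in>U \<inter> M. s x - x \<in> mm U"
  obtain v where v: "zval M (U \<inter> M) v" using U(3) by blast
  interpret val_auts A M "U \<inter> M" v by unfold_locales (rule v)
  have m: "mm (U \<inter> M) = mm U \<inter> M" by (rule vring_restrict(2)[OF mU L]) simp
  have "s \<in> Ig" using s stab tsubring_diff[OF Lr] unfolding Ig_def m by blast
  hence "s \<in> Dg" by (rule Ig_Dg)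
  thus "\<forall>x\<in>M. s x = x" using decomposition[OF s(1)] stab[OF s(1)] unfolding Dg_def by blast
qed

lemma Tr_nondegenerate:
  assumes "y \<in> M" "y \<noteq> 0" shows "\<exists>u\<in>M. Tr (u * y) \<noteq> 0"
  using trace_unit_infinite[OF assms] mmD(2)[OF mU] by force

lemma emb_M: "emb f \<in> M" using kM emb_ratfun by blast

lemma A_k: "s \<in> A ==> x \<in> kk ==> s x = x"
  using Fix_k by (auto simp: Fix_def)

lemma sT: "inverse var_T \<in> mm U"
  using vprime_infinite(2)[OF U(1,2)] vprimeD(6)[OF U(1)] by blast

lemma const_U: "emb [:c:] \<in> U"
  using vprimeD(3)[OF U(1)] by (auto simp: constants_def emb_def)

lemma emb_U: "emb f \<in> mm U ==> f = 0"
  using emb_in_infinite_place(1)[OF vprimeD(5,7)[OF U(1)] vprime_infinite(2)[OF U(1,2)]] vprimeD(6)[OF U(1)] emb_ratfun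
  by blast

text \<open>Ramification index one gives \<open>t\<close> the value of an element of the base field,
  where the inverse of \<open>T\<close> is a uniformizer.\<close>

lemma U_uniformizer:
  assumes t: "t \<in> M" "t \<in> mm U" shows "t * var_T \<in> U"
proof (cases "t = 0")
  case False
  obtain y where y: "y \<in> kk" "y \<noteq> 0" "t * inverse y \<in> U" "y * inverse t \<in> U"
    using U_split(1) t(1) False unfolding ram_index_one_def by blast
  obtain a b where ab: "b \<noteq> 0" "y = emb a / emb b" using y(1) by (rule ratfun_fieldE)
  hence a0: "a \<noteq> 0" using y(2) by (auto simp: emb_simps)
  note E = emb_in_infinite_place(2)[OF vprimeD(5,7)[OF U(1)] vprime_infinite(2)[OF U(1,2)]]
  have "y = (y * inverse t) * t" using False by (simp add: mult.assoc)
  hence "y \<in> mm U" using mm_mult[OF mU y(4) t(2)] by metis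
  hence "inverse y \<notin> U" using y(2) by (simp add: max_ideal_def)
  moreover have "emb b / emb a \<in> kk" by (rule tfield_divide[OF tfield_ratfun emb_ratfun emb_ratfun])
  ultimately have "emb b / emb a \<notin> U \<inter> kk" by (simp add: ab)
  hence "pdeg a < pdeg b" using E[OF ab(1) a0] by linarith
  hence "pdeg (a * [:0, 1:]) \<le> pdeg b" using a0 by (simp add: degree_mult_eq del: mult_pCons_right)
  moreover have "a * [:0, 1:] \<noteq> 0" using a0 by (simp del: mult_pCons_right)
  ultimately have "emb (a * [:0, 1:]) / emb b \<in> U" using E[of "a * [:0, 1:]" b] ab(1) by blast
  hence "y * var_T \<in> U" by (simp add: ab emb_simps del: mult_pCons_right)
  hence "(t * inverse y) * (y * var_T) \<in> U" by (rule tsubringD(5)[OF UR y(3)])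
  thus ?thesis using y(2) by (simp add: field_simps)
qed (simp add: tsubringD(1)[OF UR])

lemma U_residue:
  assumes x: "x \<in> M" "x \<in> U" shows "\<exists>c. x - emb [:c:] \<in> mm U"
proof -
  obtain y where y: "y \<in> U \<inter> M \<inter> kk" "x - y \<in> mm (U \<inter> M)"
    using U_split(2) x unfolding res_degree_one_def by blast
  have "x - y \<in> mm U" using y(2) vring_restrict(2)[OF mU L] by blast
  moreover obtain c where "y - emb [:c:] \<in> mm (U \<inter> kk)"
    using infinite_residue[OF vprimeD(5,7)[OF U(1)] vprime_infinite(2)[OF U(1,2)]] y(1) by blast
  hence "y - emb [:c:] \<in> mm U" using vprimeD(6)[OF U(1)] by blast
  ultimately show ?thesis using mm_cong_trans[OF mU] by blast
qed

text \<open>The integral closure of the polynomial ring in \<open>M\<close>, described by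
  valuations: all conjugates are integral at the chosen place above each prime.\<close>

definition B :: "'a ac set" where
  "B = {x \<in> M. \<forall>Q. Irr Q --> (\<forall>s\<in>A. s x \<in> W Q)}"

lemma W_ring: "Irr Q ==> tsubring (W Q)"
  using W[of Q] vprimeD(1) vringD(3) by blast

lemma W_vring: "Irr Q ==> vring UNIV (W Q)"
  using W[of Q] vprimeD(1) by blast

lemma emb_W: "Irr Q ==> emb f \<in> W Q" "Irr Q ==> \<not> Q dvd f ==> inverse (emb f) \<in> W Q"
proof -
  assume Q: "Irr Q"
  hence u: "\<not> Q dvd 1" by (simp add: Factorial_Ring.irreducible_def)
  have fp: "emb a / emb b \<in> W Q" if "\<not> Q dvd b" for a b
  proof -
    have "b \<noteq> 0" using that by auto
    hence "emb a / emb b \<in> finite_prime Q" using that unfolding finite_prime_def to_ac_Fract by blast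
    thus ?thesis using W[of Q] Q by blast
  qed
  show "emb f \<in> W Q" using fp[OF u, of f] by (simp add: emb_simps)
  show "inverse (emb f) \<in> W Q" if "\<not> Q dvd f" using fp[OF that, of 1] by (simp add: emb_simps divide_inverse)
qed

lemma BD: "x \<in> B ==> x \<in> M" "x \<in> B ==> Irr Q ==> s \<in> A ==> s x \<in> W Q"
  by (auto simp: B_def)

lemma BI: "x \<in> M ==> (\<And>Q s. Irr Q ==> s \<in> A ==> s x \<in> W Q) ==> x \<in> B"
  by (auto simp: B_def)

lemma B_emb: "emb f \<in> B"
proof (rule BI[OF emb_M])
  fix Q s assume q: "Irr Q" and s: "s \<in> A"
  show "s (emb f) \<in> W Q" unfolding A_k[OF s emb_ratfun] by (rule emb_W(1)[OF q])
qed

lemma B_ring: "tsubring B"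
  unfolding tsubring_def
proof (intro conjI ballI)
  show "0 \<in> B" "1 \<in> B" using B_emb[of 0] B_emb[of 1] by (simp_all add: emb_simps)
  fix x assume x: "x \<in> B"
  show "- x \<in> B"
    by (rule BI) (simp_all add: rhom_minus[OF rh] tsubringD(4)[OF Lr] tsubringD(4)[OF W_ring] BD x)
  fix y assume y: "y \<in> B"
  show "x + y \<in> B"
    by (rule BI) (simp_all add: rhom_add[OF rh] tsubringD(3)[OF Lr] tsubringD(3)[OF W_ring] BD x y)
  show "x * y \<in> B"
    by (rule BI) (simp_all add: rhom_mult[OF rh] tsubringD(5)[OF Lr] tsubringD(5)[OF W_ring] BD x y)
qed

text \<open>The norm of \<open>x\<close> is a polynomial, being integral at all finite primes, and
  it vanishes at infinity; hence it is \<open>0\<close>.\<close>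

lemma B_vanish:
  assumes x: "x \<in> B" and b: "\<And>s. s \<in> A ==> s x \<in> U" and m: "x \<in> mm U"
  shows "x = 0"
proof -
  have xM: "x \<in> M" by (rule BD(1)[OF x])
  have conj: "\<exists>s\<in>A. g x = s x" if "g \<in> \<Gamma>" for g using that xM by (auto elim!: \<Gamma>E)
  have k: "Nm x \<in> kk" using Nm_Fix[OF xM] Fix_k by simp
  have "Nm x \<in> finite_prime Q" if "irred Q" "lcoeff Q = 1" for Q
  proof -
    have Q: "Irr Q" using that by simp
    have "Nm x \<in> W Q" unfolding Nm_def by (rule tsubring_prod[OF W_ring[OF Q]]) (use conj BD(2)[OF x Q] in metis)
    thus ?thesis using k W[OF that] by blast
  qed
  then obtain f where f: "Nm x = emb f" using polynomial_of_integral[OF k] by blast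
  have idS: "restrict id M \<in> \<Gamma>" by (rule \<Gamma>I[OF id_A])
  have "Nm x = x * (\<Prod>g\<in>\<Gamma> - {restrict id M}. g x)"
    unfolding Nm_def using prod.remove[OF finite_\<Gamma> idS, of "\<lambda>g. g x"] xM by simp
  moreover have "(\<Prod>g\<in>\<Gamma> - {restrict id M}. g x) \<in> U"
    by (rule tsubring_prod[OF UR]) (use conj b in "metis DiffD1")
  ultimately have "Nm x \<in> mm U" using mm_mult[OF mU _ m] mult.commute by metis
  hence "f = 0" using emb_U f by simp
  hence "Nm x = 0" by (simp add: f emb_simps)
  then obtain g where "g \<in> \<Gamma>" "g x = 0" unfolding Nm_def using finite_\<Gamma> by auto
  thus ?thesis using \<Gamma>_rhom(4)[OF _ xM] by blast
qed

text \<open>Subtracting the constant that represents the residue at \<open>U\<close> gives an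
  integral element that vanishes there, to which \<open>B_vanish\<close> applies.\<close>

lemma B_const:
  assumes x: "x \<in> B" and b: "\<And>s. s \<in> A ==> s x \<in> U"
  shows "\<exists>c. x = emb [:c:]"
proof -
  have "x \<in> U" using b[OF id_A] by simp
  then obtain c where c: "x - emb [:c:] \<in> mm U" using U_residue[OF BD(1)[OF x]] by blast
  have "x - emb [:c:] = 0"
  proof (rule B_vanish[OF tsubring_diff[OF B_ring x B_emb] _ c])
    fix s assume s: "s \<in> A"
    have "s (x - emb [:c:]) = s x - emb [:c:]" using A_k[OF s emb_ratfun] rhom_diff[OF rh[OF s]] by simp
    thus "s (x - emb [:c:]) \<in> U" using tsubring_diff[OF UR b[OF s] const_U] by simp
  qed
  thus ?thesis by auto
qed

lemma common_denominator:
  fixes c :: "nat => 'a ac"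
  assumes "\<And>i. i < N ==> c i \<in> kk"
  shows "\<exists>d. d \<noteq> 0 \<and> (\<forall>i<N. \<exists>f. emb d * c i = emb f)"
  using assms
proof (induction N)
  case (Suc N)
  then obtain d where d: "d \<noteq> 0" "\<forall>i<N. \<exists>f. emb d * c i = emb f" by auto
  obtain a b where ab: "b \<noteq> 0" "c N = emb a / emb b" by (rule ratfun_fieldE[OF Suc.prems[of N]]) simp
  have "\<exists>f. emb (b * d) * c i = emb f" if "i < Suc N" for i
  proof (cases "i = N")
    case True
    have "emb (b * d) * c i = emb (d * a)" using ab(1) emb_eq_0_iff[of b] by (simp add: True emb_simps ab(2))
    thus ?thesis by blast
  next
    case False
    hence "i < N" using that by simp
    then obtain f where "emb d * c i = emb f" using d(2) by blast
    hence "emb (b * d) * c i = emb (b * f)" by (simp add: emb_simps mult.assoc)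
    thus ?thesis by blast
  qed
  thus ?case using d(1) ab(1) by (intro exI[of _ "b * d"]) auto
qed (auto intro: exI[of _ 1])

text \<open>A common denominator of the characteristic polynomial makes \<open>emb d * x\<close> and
  its conjugates integral over the polynomials.\<close>

lemma B_scale:
  assumes x: "x \<in> M" shows "\<exists>d. d \<noteq> 0 \<and> emb d * x \<in> B"
proof -
  define N where "N = card \<Gamma>"
  let ?c = "coef (char_poly x)"
  have ck: "?c i \<in> kk" for i using char_poly_Fix[OF x] Fix_k by (simp add: poly_over_def)
  obtain d where d: "d \<noteq> 0" "\<forall>i<N. \<exists>f. emb d * ?c i = emb f" using common_denominator[of N ?c] ck by blast
  have "emb d * x \<in> B"
  proof (rule BI)
    show "emb d * x \<in> M" by (rule tsubringD(5)[OF Lr emb_M x])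
    fix Q s assume Q: "Irr Q" and s: "s \<in> A"
    note R = W_ring[OF Q] and V = W_vring[OF Q]
    define x' where "x' = s x"
    have "s (poly (char_poly x) x) = poly (char_poly x) x'"
      unfolding x'_def by (rule rhom_poly_fixed[OF rh[OF s]]) (rule A_k[OF s ck])
    hence "poly (char_poly x) x' = 0" using char_poly_root[OF x] rhom_0[OF rh[OF s]] by simp
    moreover have "?c N = 1" using lead_coeff_char_poly[of x] by (simp add: degree_char_poly N_def)
    ultimately have "(\<Sum>i<N. ?c i * x' ^ i) + x' ^ N = 0"
      by (simp add: poly_altdef degree_char_poly N_def flip: lessThan_Suc_atMost)
    hence "(emb d * x') ^ N = emb d ^ N * - (\<Sum>i<N. ?c i * x' ^ i)"
      unfolding power_mult_distrib by (simp add: add_eq_0_iff)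
    also have "\<dots> = (\<Sum>i<N. - (emb d * ?c i * emb d ^ (N - 1 - i)) * (emb d * x') ^ i)"
      unfolding sum_negf[symmetric] sum_distrib_left
    proof (intro sum.cong refl)
      fix i assume "i \<in> {..<N}"
      then obtain k where "N = Suc (i + k)" using less_imp_Suc_add by auto
      thus "emb d ^ N * - (?c i * x' ^ i) = - (emb d * ?c i * emb d ^ (N - 1 - i)) * (emb d * x') ^ i"
        by (simp add: power_add power_mult_distrib)
    qed
    finally have "emb d * x' \<in> W Q"
    proof (rule integral_in_valuation[OF R, rotated])
      show "emb d * x' \<in> W Q \<or> inverse (emb d * x') \<in> W Q" using vringD(5)[OF V, of "emb d * x'"] by blast
      fix i assume "i < N"
      then obtain f where "emb d * ?c i = emb f" using d(2) by blast
      thus "- (emb d * ?c i * emb d ^ (N - 1 - i)) \<in> W Q"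
        using tsubringD(4,5)[OF R] tsubring_power[OF R] emb_W(1)[OF Q] by simp
    qed
    thus "s (emb d * x) \<in> W Q" using A_k[OF s emb_ratfun] rhom_mult[OF rh[OF s]] by (simp add: x'_def)
  qed
  thus ?thesis using d(1) by blast
qed

section \<open>Dimension and sizes at infinity\<close>

definition indep :: "nat => (nat => 'a ac) => bool" where
  "indep n x \<longleftrightarrow> (\<forall>f. (\<forall>j<n. f j \<in> kk) --> (\<Sum>j<n. f j * x j) = 0 --> (\<forall>j<n. f j = 0))"

lemma indepD: "indep n x ==> (\<And>j. j < n ==> f j \<in> kk) ==> (\<Sum>j<n. f j * x j) = 0 ==> j < n ==> f j = 0"
  by (auto simp: indep_def)

text \<open>If \<open>n\<close> exceeded \<open>card \<Gamma>\<close>, a nonzero \<open>y\<close>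
  would make all sums of \<open>g (x j) * y j\<close> vanish. Multiplying by \<open>c\<close> and
  summing over conjugates turns this into a relation between the \<open>x j\<close> with the traces
  of \<open>c * y j\<close> as coefficients, one of them nonzero.\<close>

lemma indep_le_card:
  assumes x: "\<And>j. j < n ==> x j \<in> M" "indep n x" shows "n \<le> card \<Gamma>"
proof (rule ccontr)
  assume "\<not> ?thesis"
  hence lt: "card \<Gamma> < card {..<n}" by simp
  have "g (x j) \<in> M" if "g \<in> \<Gamma>" "j \<in> {..<n}" for g j using \<Gamma>_in_L[OF that(1) x(1)] that(2) by simp
  hence "\<exists>y. (\<forall>j\<in>{..<n}. y j \<in> M) \<and> (\<exists>j\<in>{..<n}. y j \<noteq> 0) \<and> (\<forall>g\<in>\<Gamma>. (\<Sum>j\<in>{..<n}. g (x j) * y j) = 0)"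
    by (rule hom_system[OF L finite_\<Gamma> finite_lessThan lt, of "\<lambda>g j. g (x j)"])
  then obtain y where y: "\<forall>j\<in>{..<n}. y j \<in> M" "\<exists>j\<in>{..<n}. y j \<noteq> 0" "\<forall>g\<in>\<Gamma>. (\<Sum>j\<in>{..<n}. g (x j) * y j) = 0"
    by blast
  obtain j0 where j0: "j0 < n" "y j0 \<noteq> 0" using y(2) by auto
  obtain c where c: "c \<in> M" "Tr (c * y j0) \<noteq> 0" using Tr_nondegenerate[of "y j0"] y(1) j0 by auto
  have cy: "c * y j \<in> M" if "j < n" for j using tsubringD(5)[OF Lr c(1)] y(1) that by simp
  have "(\<Sum>j<n. Tr (c * y j) * x j) = (\<Sum>h\<in>\<Gamma>. \<Sum>j<n. h (c * y j) * x j)"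
    unfolding Tr_def sum_distrib_right by (rule sum.swap)
  also have "\<dots> = 0"
  proof (rule sum.neutral, rule ballI)
    fix h assume "h \<in> \<Gamma>"
    then obtain s where s: "s \<in> A" "h = restrict s M" by (rule \<Gamma>E)
    obtain t where t: "t \<in> A" "\<And>x. s (t x) = x" using inv_A[OF s(1)] by blast
    have "(\<Sum>j<n. h (c * y j) * x j) = (\<Sum>j<n. s c * s (t (x j) * y j))"
      by (rule sum.cong) (simp_all add: s(2) cy t(2) rhom_mult[OF rh[OF s(1)]] ac_simps)
    also have "\<dots> = s c * s (\<Sum>j<n. t (x j) * y j)"
      by (simp add: rhom_sum[OF rh[OF s(1)]] sum_distrib_left)
    also have "(\<Sum>j<n. t (x j) * y j) = (\<Sum>j<n. restrict t M (x j) * y j)"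
      by (rule sum.cong) (use x(1) in auto)
    also have "\<dots> = 0" using y(3) \<Gamma>I[OF t(1)] by blast
    finally show "(\<Sum>j<n. h (c * y j) * x j) = 0" by (simp add: rhom_0[OF rh[OF s(1)]])
  qed
  finally have "Tr (c * y j0) = 0"
    using indepD[OF x(2), of "\<lambda>j. Tr (c * y j)"] Tr_Fix[OF cy] Fix_k j0(1) by simp
  thus False using c(2) by simp
qed

lemma scale_into_U:
  assumes y: "y \<in> M" shows "\<exists>a. y / var_T ^ a \<in> U"
proof (cases "y = 0")
  case False
  obtain v where v: "zval M (U \<inter> M) v" using U(3) by blast
  note iv = zval_ival[OF v]
  have s: "inverse var_T \<in> M" "inverse (var_T :: 'a ac) \<noteq> 0" using tfieldD(2)[OF L emb_M] var_T_nonzero by auto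
  have "inverse var_T \<in> mm (U \<inter> M)" using sT s(1) vring_restrict(2)[OF mU L] by blast
  hence vs: "v (inverse var_T) > 0" using zval_max_ideal[OF v s] by simp
  define a where "a = nat \<bar>v y\<bar>"
  have pM: "inverse var_T ^ a \<in> M" by (rule tsubring_power[OF Lr s(1)])
  have "v (y * inverse var_T ^ a) = v y + int a * v (inverse var_T)"
    using zvalD(2)[OF v y False pM] ival_power[OF L iv s] s(2) by simp
  moreover have "int a * v (inverse var_T) \<ge> int a * 1" using vs by (intro mult_left_mono) auto
  ultimately have "v (y * inverse var_T ^ a) \<ge> 0" by (simp add: a_def)
  moreover have "y * inverse var_T ^ a \<in> M" by (rule tsubringD(5)[OF Lr y pM])
  moreover have "y * inverse var_T ^ a \<noteq> 0" using False s(2) by simp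
  ultimately have "y * inverse var_T ^ a \<in> U" using zvalD(3)[OF v] by blast
  thus ?thesis by (auto simp: divide_inverse power_inverse)
qed (simp add: tsubringD(1)[OF UR])

lemma divide_T_mono:
  assumes "y / var_T ^ a \<in> U" "a \<le> b" shows "y / var_T ^ b \<in> U"
proof -
  have "y / var_T ^ b = y / var_T ^ a * inverse var_T ^ (b - a)"
    using assms(2) var_T_nonzero by (simp add: field_simps flip: power_add)
  thus ?thesis using tsubringD(5)[OF UR assms(1) tsubring_power[OF UR mmD(1)[OF mU sT]]] by simp
qed

definition bnd :: "nat => 'a ac => bool" where
  "bnd a x \<longleftrightarrow> (\<forall>s\<in>A. s x / var_T ^ a \<in> U)"

text \<open>The largest pole order of a conjugate of \<open>x\<close> at \<open>U\<close>, cut off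
  at \<open>0\<close>: an element without poles has size \<open>0\<close> even if it vanishes at
  infinity.\<close>

definition sz :: "'a ac => nat" where "sz x = (LEAST a. bnd a x)"

lemma bnd_mono: "bnd a x ==> a \<le> b ==> bnd b x"
  unfolding bnd_def using divide_T_mono by blast

lemma bnd_sz: assumes x: "x \<in> M" shows "bnd (sz x) x"
proof -
  define N where "N g = (SOME a. g x / var_T ^ a \<in> U)" for g
  have N: "g x / var_T ^ N g \<in> U" if "g \<in> \<Gamma>" for g
    unfolding N_def by (rule someI_ex[OF scale_into_U[OF \<Gamma>_in_L[OF that x]]])
  have "bnd (\<Sum>g\<in>\<Gamma>. N g) x"
    unfolding bnd_def
  proof
    fix s assume s: "s \<in> A"
    have "N (restrict s M) \<le> (\<Sum>g\<in>\<Gamma>. N g)" by (rule member_le_sum[OF \<Gamma>I[OF s] _ finite_\<Gamma>]) simp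
    from divide_T_mono[OF N[OF \<Gamma>I[OF s]] this] show "s x / var_T ^ (\<Sum>g\<in>\<Gamma>. N g) \<in> U" using x by simp
  qed
  thus ?thesis unfolding sz_def by (rule LeastI)
qed

lemma sz_le: "bnd a x ==> sz x \<le> a"
  unfolding sz_def by (rule Least_le)

end

lemma finite_max_witness:
  fixes g :: "'i => nat"
  assumes "finite J" "J \<noteq> {}" shows "\<exists>j0\<in>J. \<forall>j\<in>J. g j \<le> g j0"
proof -
  have "Max (g ` J) \<in> g ` J" using assms by (intro Max_in) auto
  then obtain j0 where j0: "j0 \<in> J" "Max (g ` J) = g j0" by blast
  have "g j \<le> g j0" if "j \<in> J" for j using Max_ge[of "g ` J" "g j"] assms(1) that j0(2) by simp
  thus ?thesis using j0(1) by blast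
qed

context everywhere_unramified
begin

lemma polynomial_part:
  assumes "z \<in> kk" shows "\<exists>q. z - emb q \<in> mm U"
proof -
  obtain a b where ab: "b \<noteq> 0" "z = emb a / emb b" using assms by (rule ratfun_fieldE)
  have "a mod b = a - (a div b) * b" by (simp add: minus_div_mult_eq_mod)
  hence "emb (a mod b) = emb a - emb (a div b) * emb b" by (simp only: emb_simps)
  hence "z - emb (a div b) = emb (a mod b) / emb b" using ab emb_eq_0_iff[of b] by (simp add: field_simps)
  moreover have "emb (a mod b) / emb b \<in> mm (U \<inter> kk)"
    by (rule proper_fraction_in_max_ideal[OF vprimeD(5,7)[OF U(1)] vprime_infinite(2)[OF U(1,2)] ab(1) degree_mod_less[OF ab(1)]])
  ultimately show ?thesis using vprimeD(6)[OF U(1)] by (intro exI[of _ "a div b"]) auto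
qed

lemma Tr_lin:
  fixes n :: nat
  assumes "\<And>j. j < n ==> f j \<in> kk" "\<And>j. j < n ==> z j \<in> M"
  shows "Tr (\<Sum>j<n. f j * z j) = (\<Sum>j<n. f j * Tr (z j))"
  using assms
proof (induction n)
  case 0
  have "0 \<in> Fix" using Fix_k tsubringD(1)[OF kr] by simp
  thus ?case using Tr_mult[of 0 0] tsubringD(1)[OF Lr] by simp
next
  case (Suc n)
  have fz: "f j * z j \<in> M" if "j < Suc n" for j
    by (rule tsubringD(5)[OF Lr]) (use Suc.prems that kM in auto)
  have "(\<Sum>j<n. f j * z j) \<in> M" by (rule tsubring_sum[OF Lr]) (use fz in auto)
  hence "Tr (\<Sum>j<Suc n. f j * z j) = Tr (\<Sum>j<n. f j * z j) + Tr (f n * z n)"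
    using Tr_add fz[of n] by simp
  also have "Tr (f n * z n) = f n * Tr (z n)" using Tr_mult Suc.prems Fix_k by simp
  finally show ?case using Suc by simp
qed

lemma indep_scale:
  assumes x: "indep n x" and d: "\<And>j. j < n ==> d j \<in> kk \<and> d j \<noteq> 0"
  shows "indep n (\<lambda>j. d j * x j)"
  unfolding indep_def
proof (intro allI impI)
  fix f j assume f: "\<forall>j<n. f j \<in> kk" "(\<Sum>j<n. f j * (d j * x j)) = 0" "j < n"
  have "(f j * d j) = 0"
  proof (rule indepD[OF x, of "\<lambda>j. f j * d j"])
    show "f j * d j \<in> kk" if "j < n" for j using tsubringD(5)[OF kr] f(1) d that by blast
    show "(\<Sum>j<n. f j * d j * x j) = 0" using f(2) by (simp add: mult.assoc)
  qed (rule f(3))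
  thus "f j = 0" using d[OF f(3)] by simp
qed

text \<open>The third condition makes \<open>n\<close> the dimension of \<open>M\<close> over the
  base field. Minimality of the total size is the property from which reducedness will
  follow.\<close>

definition min_basis :: "nat => (nat => 'a ac) => bool" where
  "min_basis n x \<longleftrightarrow> (\<forall>j<n. x j \<in> B) \<and> indep n x \<and> (\<forall>y. (\<forall>j<Suc n. y j \<in> M) --> \<not> indep (Suc n) y) \<and>
     (\<forall>y. (\<forall>j<n. y j \<in> B) --> indep n y --> (\<Sum>j<n. sz (x j)) \<le> (\<Sum>j<n. sz (y j)))"

lemma min_basis_exists: "\<exists>n x. min_basis n x"
proof -
  let ?P = "\<lambda>n. \<exists>x. (\<forall>j<n. x j \<in> M) \<and> indep n x"
  have "?P 0" by (simp add: indep_def)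
  moreover have "\<forall>n. ?P n --> n < Suc (card \<Gamma>)" using indep_le_card by (metis less_Suc_eq_le)
  ultimately have "\<exists>n. ?P n \<and> (\<forall>m. ?P m --> m \<le> n)" by (rule ex_has_greatest_nat)
  then obtain n where n: "?P n" "\<And>m. ?P m ==> m \<le> n" by blast
  obtain x where x: "\<forall>j<n. x j \<in> M" "indep n x" using n(1) by blast
  define d where "d j = (SOME d. d \<noteq> 0 \<and> emb d * x j \<in> B)" for j
  have d: "d j \<noteq> 0 \<and> emb (d j) * x j \<in> B" if "j < n" for j
    unfolding d_def by (rule someI_ex[OF B_scale]) (use x(1) that in blast)
  let ?R = "\<lambda>y. (\<forall>j<n. y j \<in> B) \<and> indep n y"
  have "?R (\<lambda>j. emb (d j) * x j)"
    using d indep_scale[OF x(2), of "\<lambda>j. emb (d j)"] emb_ratfun emb_eq_0_iff by blast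
  hence "\<exists>y. ?R y \<and> (\<forall>z. ?R z --> (\<Sum>j<n. sz (y j)) \<le> (\<Sum>j<n. sz (z j)))"
    by (rule ex_has_least_nat[where P = ?R and m = "\<lambda>y. \<Sum>j<n. sz (y j)"])
  then obtain y where y: "?R y" "\<And>z. ?R z ==> (\<Sum>j<n. sz (y j)) \<le> (\<Sum>j<n. sz (z j))" by blast
  have "\<not> ?P (Suc n)" using n(2)[of "Suc n"] by auto
  hence "min_basis n y" unfolding min_basis_def using y by blast
  thus ?thesis by blast
qed

context
  fixes n x
  assumes mb: "min_basis n x"
begin

lemma xB: "j < n ==> x j \<in> B" and xM: "j < n ==> x j \<in> M" and x_indep: "indep n x"
  using mb BD(1) by (auto simp: min_basis_def)

lemma span:
  assumes y: "y \<in> M" shows "\<exists>f. (\<forall>j<n. f j \<in> kk) \<and> y = (\<Sum>j<n. f j * x j)"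
proof -
  let ?y = "x(n := y)"
  have "\<forall>j<Suc n. ?y j \<in> M" using xM y by (simp add: less_Suc_eq)
  hence "\<not> indep (Suc n) ?y" using mb unfolding min_basis_def by blast
  then obtain f j0 where f: "\<forall>j<Suc n. f j \<in> kk" "(\<Sum>j<Suc n. f j * ?y j) = 0" "j0 < Suc n" "f j0 \<noteq> 0"
    unfolding indep_def by blast
  have "(\<Sum>j<n. f j * ?y j) = (\<Sum>j<n. f j * x j)" by (rule sum.cong) auto
  hence s: "(\<Sum>j<n. f j * x j) + f n * y = 0" using f(2) by simp
  have fn: "f n \<noteq> 0"
  proof
    assume "f n = 0"
    hence z: "(\<Sum>j<n. f j * x j) = 0" "j0 < n" using s f(3,4) by (auto simp: less_Suc_eq)
    have "f j0 = 0" by (rule indepD[of n x f, OF x_indep _ z]) (use f(1) in simp)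
    thus False using f(4) by simp
  qed
  have "(\<Sum>j<n. - (f j / f n) * x j) = - ((\<Sum>j<n. f j * x j) / f n)"
    by (simp add: sum_divide_distrib sum_negf)
  also have "(\<Sum>j<n. f j * x j) = - (f n * y)" using s by (simp add: eq_neg_iff_add_eq_0)
  finally have "y = (\<Sum>j<n. - (f j / f n) * x j)" using fn by simp
  moreover have "- (f j / f n) \<in> kk" if "j < n" for j
    by (intro tsubringD(4)[OF kr] tfield_divide[OF tfield_ratfun]) (use f(1) that in auto)
  ultimately show ?thesis by (intro exI[of _ "\<lambda>j. - (f j / f n)"]) blast
qed

text \<open>Replacing \<open>x j0\<close> by \<open>y\<close> leaves the family independent, so
  minimality forbids a gain in size.\<close>

lemma exchange:
  assumes y: "y \<in> B" "y = (\<Sum>j<n. f j * x j)" and f: "\<And>j. j < n ==> f j \<in> kk" and j0: "j0 < n" "f j0 \<noteq> 0"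
  shows "sz (x j0) \<le> sz y"
proof -
  let ?x = "x(j0 := y)"
  have rest: "(\<Sum>j<n. h j * ?x j) = h j0 * y + (\<Sum>j\<in>{..<n} - {j0}. h j * x j)" for h :: "nat => 'a ac"
    using j0(1) by (simp add: sum.remove[of "{..<n}" j0])
  have "indep n ?x"
    unfolding indep_def
  proof (intro allI impI)
    fix g j assume g: "\<forall>j<n. g j \<in> kk" "(\<Sum>j<n. g j * ?x j) = 0" "j < n"
    define h where "h j = (if j = j0 then 0 else g j) + g j0 * f j" for j
    have "(\<Sum>j<n. h j * x j) = (\<Sum>j<n. (if j = j0 then 0 else g j) * x j) + g j0 * y"
      by (simp add: h_def y(2) distrib_right sum.distrib sum_distrib_left mult.assoc)
    also have "(\<Sum>j<n. (if j = j0 then 0 else g j) * x j) = (\<Sum>j\<in>{..<n} - {j0}. g j * x j)"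
      using j0(1) by (simp add: sum.remove[of "{..<n}" j0])
    finally have "(\<Sum>j<n. h j * x j) = 0" using g(2) rest[of g] by (simp add: add.commute)
    moreover have "h j \<in> kk" if "j < n" for j
    proof -
      have "(if j = j0 then 0 else g j) \<in> kk" using g(1) that tsubringD(1)[OF kr] by (cases "j = j0") simp_all
      moreover have "g j0 * f j \<in> kk" using tsubringD(5)[OF kr] g(1) f that j0(1) by blast
      ultimately show ?thesis unfolding h_def by (rule tsubringD(3)[OF kr])
    qed
    ultimately have h0: "h j = 0" if "j < n" for j using indepD[OF x_indep] that by blast
    have "g j0 = 0" using h0[OF j0(1)] j0(2) by (simp add: h_def)
    thus "g j = 0" using h0[OF g(3)] by (cases "j = j0") (simp_all add: h_def)
  qed
  moreover have "\<forall>j<n. ?x j \<in> B" using xB y(1) by simp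
  ultimately have le: "(\<Sum>j<n. sz (x j)) \<le> (\<Sum>j<n. sz (?x j))" using mb unfolding min_basis_def by blast
  have "(\<Sum>j<n. sz (x j)) = sz (x j0) + (\<Sum>j\<in>{..<n} - {j0}. sz (x j))"
    "(\<Sum>j<n. sz (?x j)) = sz y + (\<Sum>j\<in>{..<n} - {j0}. sz (x j))"
    using j0(1) by (simp_all add: sum.remove[of "{..<n}" j0])
  thus ?thesis using le by linarith
qed

text \<open>Such a \<open>y\<close> would have smaller size than \<open>x j0\<close> and could
  replace it. If \<open>sz (x j0)\<close> is \<open>0\<close> there is no smaller size, but then
  \<open>y\<close> vanishes at infinity and is \<open>0\<close>, against independence.\<close>

lemma no_small_combination:
  assumes y: "y \<in> B" "y = (\<Sum>j<n. r j * x j)" and r: "\<And>j. j < n ==> r j \<in> kk" and j0: "j0 < n" "r j0 \<noteq> 0"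
    and small: "\<And>s. s \<in> A ==> s y / var_T ^ sz (x j0) \<in> mm U"
  shows False
proof (cases "sz (x j0)")
  case 0
  have m: "s y \<in> mm U" if "s \<in> A" for s using small[OF that] 0 by simp
  have "y \<in> mm U" using m[OF id_A] by simp
  hence "y = 0" using B_vanish[OF y(1)] mmD(1)[OF mU m] by blast
  thus False using indepD[of n x r, OF x_indep r _ j0(1)] y(2) j0(2) by simp
next
  case (Suc a)
  have "s y / var_T ^ a \<in> U" if s: "s \<in> A" for s
  proof -
    have "s y / var_T ^ sz (x j0) \<in> M"
      by (intro tfield_divide[OF L] stab[OF s] BD(1)[OF y(1)] tsubring_power[OF Lr emb_M])
    from U_uniformizer[OF this small[OF s]] show ?thesis by (simp add: Suc var_T_nonzero)
  qed
  hence "sz y \<le> a" using sz_le by (simp add: bnd_def)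
  thus False using exchange[OF y r j0] Suc by simp
qed

lemma conj_combination:
  assumes s: "s \<in> A" and r: "\<And>j. j < n ==> r j \<in> kk"
  shows "s (\<Sum>j<n. r j * x j) = (\<Sum>j<n. r j * s (x j))"
  unfolding rhom_sum[OF rh[OF s]] rhom_mult[OF rh[OF s]]
  by (rule sum.cong) (simp_all add: A_k[OF s r])

text \<open>Subtracting the polynomial parts leaves coefficients in the maximal ideal at infinity.
  If one were nonzero, their combination would be too small compared with the largest basis element
  involved. So \<open>x\<close> is a basis of \<open>B\<close> over the polynomials.\<close>

lemma coords_polynomial:
  assumes y: "y \<in> B" "y = (\<Sum>j<n. f j * x j)" and f: "\<And>j. j < n ==> f j \<in> kk" and j: "j < n"
  shows "\<exists>q. f j = emb q"
proof -
  define q where "q j = (SOME q. f j - emb q \<in> mm U)" for j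
  define r where "r j = f j - emb (q j)" for j
  have rm: "r j \<in> mm U" if "j < n" for j
    unfolding r_def q_def by (rule someI_ex[OF polynomial_part[OF f[OF that]]])
  have rk: "r j \<in> kk" if "j < n" for j
    unfolding r_def by (rule tsubring_diff[OF kr f[OF that] emb_ratfun])
  let ?y = "\<Sum>j<n. r j * x j"
  have "?y = y - (\<Sum>j<n. emb (q j) * x j)" by (simp add: r_def y(2) left_diff_distrib sum_subtractf)
  moreover have "(\<Sum>j<n. emb (q j) * x j) \<in> B"
    by (intro tsubring_sum[OF B_ring] tsubringD(5)[OF B_ring] B_emb) (use xB in auto)
  ultimately have yB: "?y \<in> B" using tsubring_diff[OF B_ring y(1)] by simp
  have "r j = 0"
  proof (rule ccontr)
    let ?J = "{j. j < n \<and> r j \<noteq> 0}"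
    assume "r j \<noteq> 0"
    hence "?J \<noteq> {}" using j by blast
    then obtain j0 where j0: "j0 < n" "r j0 \<noteq> 0" "\<And>j. j < n ==> r j \<noteq> 0 ==> sz (x j) \<le> sz (x j0)"
      using finite_max_witness[of ?J "\<lambda>j. sz (x j)"] by auto
    show False
    proof (rule no_small_combination[OF yB refl rk j0(1,2)])
      fix s assume s: "s \<in> A"
      have cc: "s ?y = (\<Sum>j<n. r j * s (x j))" by (rule conj_combination[OF s]) (rule rk)
      have "s ?y / var_T ^ sz (x j0) = (\<Sum>j<n. (s (x j) / var_T ^ sz (x j0)) * r j)"
        unfolding cc sum_divide_distrib by (rule sum.cong) auto
      also have "\<dots> \<in> mm U"
      proof (rule mm_sum[OF mU])
        fix j assume "j \<in> {..<n}"
        hence j: "j < n" by simp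
        show "(s (x j) / var_T ^ sz (x j0)) * r j \<in> mm U"
        proof (cases "r j = 0")
          case False
          have "bnd (sz (x j0)) (x j)" by (rule bnd_mono[OF bnd_sz[OF xM[OF j]] j0(3)[OF j False]])
          hence "s (x j) / var_T ^ sz (x j0) \<in> U" using s by (simp add: bnd_def)
          thus ?thesis by (rule mm_mult[OF mU _ rm[OF j]])
        qed (simp add: mmD(2)[OF mU])
      qed
      finally show "s ?y / var_T ^ sz (x j0) \<in> mm U" .
    qed
  qed
  thus ?thesis by (auto simp: r_def)
qed

text \<open>Leading terms of basis elements do not cancel at infinity. The coordinates are scaled by
  the sizes and divided by a power of \<open>T\<close>; if the least exponent making them all
  integral were positive, their residues would give a combination excluded by
  \<open>no_small_combination\<close>.\<close>

lemma reduced: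
  assumes u: "u = (\<Sum>j<n. f j * x j)" "\<And>s. s \<in> A ==> s u \<in> U" and f: "\<And>j. j < n ==> f j \<in> kk" and j: "j < n"
  shows "f j * var_T ^ sz (x j) \<in> U"
proof -
  let ?a = "\<lambda>j. sz (x j)"
  define g where "g e j = f j * var_T ^ ?a j / var_T ^ e" for e j
  have gM: "g e j \<in> M" if "j < n" for e j
    unfolding g_def
    by (intro tfield_divide[OF L] tsubringD(5)[OF Lr] tsubring_power[OF Lr emb_M]) (use f that kM in blast)
  let ?E = "\<lambda>e. \<forall>j<n. g e j \<in> U"
  have "\<exists>e. ?E e"
  proof -
    define N where "N j = (SOME e. g e j \<in> U)" for j
    have N: "g (N j) j \<in> U" if "j < n" for j
      unfolding N_def
    proof (rule someI_ex)
      have "g 0 j \<in> M" by (rule gM[OF that])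
      from scale_into_U[OF this] show "\<exists>e. g e j \<in> U" by (simp add: g_def)
    qed
    have "g (\<Sum>j<n. N j) j \<in> U" if "j < n" for j
    proof -
      have "N j \<le> (\<Sum>j<n. N j)" by (rule member_le_sum) (use that in auto)
      thus ?thesis using divide_T_mono[OF N[OF that, unfolded g_def]] by (simp add: g_def)
    qed
    thus ?thesis by blast
  qed
  hence E: "?E (LEAST e. ?E e)" by (rule LeastI_ex)
  show ?thesis
  proof (cases "LEAST e. ?E e")
    case 0
    thus ?thesis using E j by (simp add: g_def)
  next
    case (Suc e')
    let ?e = "Suc e'"
    have Ee: "?E ?e" using E Suc by simp
    have nE: "\<not> ?E e'" using not_less_Least[of e' ?E] Suc by simp
    define c where "c j = (SOME c. g ?e j - emb [:c:] \<in> mm U)" for j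
    have c: "g ?e j - emb [:c j:] \<in> mm U" if "j < n" for j
      unfolding c_def by (rule someI_ex[OF U_residue[OF gM[OF that]]]) (use Ee that in blast)
    have "{j. j < n \<and> c j \<noteq> 0} \<noteq> {}"
    proof
      assume "{j. j < n \<and> c j \<noteq> 0} = {}"
      hence c0: "c j = 0" if "j < n" for j using that by blast
      have "g e' j \<in> U" if "j < n" for j
      proof -
        have "g ?e j \<in> mm U" using c[OF that] by (simp add: c0[OF that] emb_simps)
        from U_uniformizer[OF gM[OF that] this] show ?thesis by (simp add: g_def var_T_nonzero)
      qed
      thus False using nE by blast
    qed
    then obtain j0 where j0: "j0 < n" "c j0 \<noteq> 0" "\<And>j. j < n ==> c j \<noteq> 0 ==> ?a j \<le> ?a j0"
      using finite_max_witness[of "{j. j < n \<and> c j \<noteq> 0}" ?a] by auto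
    \<comment> \<open>The powers of \<open>T\<close> bring all terms to the common size bound
      \<open>?a j0\<close>. Truncated subtraction does no harm, since \<open>?a j\<close> can exceed
      \<open>?a j0\<close> only where \<open>c j = 0\<close>.\<close>
    define r where "r j = emb [:c j:] * var_T ^ (?a j0 - ?a j)" for j
    have rB: "r j \<in> B" for j unfolding r_def by (intro tsubringD(5)[OF B_ring] tsubring_power[OF B_ring] B_emb)
    have rk: "r j \<in> kk" for j unfolding r_def by (intro tsubringD(5)[OF kr] tsubring_power[OF kr] emb_ratfun)
    have r0: "r j0 \<noteq> 0" using j0(2) var_T_nonzero by (simp add: r_def emb_eq_0_iff)
    let ?y = "\<Sum>j<n. r j * x j"
    have yB: "?y \<in> B" by (intro tsubring_sum[OF B_ring] tsubringD(5)[OF B_ring] rB) (use xB in auto)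
    have False
    proof (rule no_small_combination[OF yB refl rk j0(1) r0])
      fix s assume s: "s \<in> A"
      let ?z = "\<lambda>j. s (x j) / var_T ^ ?a j"
      have z: "?z j \<in> U" if "j < n" for j using bnd_sz[OF xM[OF that]] s by (simp add: bnd_def)
      have "r j * s (x j) / var_T ^ ?a j0 = emb [:c j:] * ?z j" if "j < n" for j
      proof (cases "c j = 0")
        case False
        have "var_T ^ ?a j0 = var_T ^ (?a j0 - ?a j) * var_T ^ ?a j" using j0(3)[OF that False] by (simp flip: power_add)
        thus ?thesis unfolding r_def \<open>var_T ^ ?a j0 = _\<close> by (simp add: var_T_nonzero)
      qed (simp add: r_def emb_simps)
      moreover have "s ?y = (\<Sum>j<n. r j * s (x j))" by (rule conj_combination[OF s]) (rule rk)
      ultimately have "s ?y / var_T ^ ?a j0 = (\<Sum>j<n. emb [:c j:] * ?z j)"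
        unfolding sum_divide_distrib by (simp add: sum_divide_distrib)
      also have "\<dots> = (\<Sum>j<n. g ?e j * ?z j) - (\<Sum>j<n. ?z j * (g ?e j - emb [:c j:]))"
      proof -
        have "c * z = g * z - z * (g - c)" for c g z :: "'a ac" by (simp add: algebra_simps)
        hence "(\<Sum>j<n. emb [:c j:] * ?z j) = (\<Sum>j<n. g ?e j * ?z j - ?z j * (g ?e j - emb [:c j:]))"
          by (intro sum.cong refl)
        thus ?thesis by (simp only: sum_subtractf)
      qed
      also have "(\<Sum>j<n. g ?e j * ?z j) = s u / var_T ^ ?e"
      proof -
        have "s u = (\<Sum>j<n. f j * s (x j))" unfolding u(1) by (rule conj_combination[OF s]) (rule f)
        thus ?thesis unfolding sum_divide_distrib
          by (simp only: sum_divide_distrib) (rule sum.cong, simp_all add: g_def var_T_nonzero)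
      qed
      also have "s u / var_T ^ ?e = (s u * inverse var_T ^ e') * inverse var_T" by (simp add: divide_inverse power_inverse)
      also have "\<dots> - (\<Sum>j<n. ?z j * (g ?e j - emb [:c j:])) \<in> mm U"
        by (intro mm_diff[OF mU] mm_sum[OF mU] mm_mult[OF mU] tsubringD(5)[OF UR] u(2)[OF s]
            tsubring_power[OF UR] mmD(1)[OF mU sT] sT z c) auto
      finally show "s ?y / var_T ^ ?a j0 \<in> mm U" .
    qed
    thus ?thesis ..
  qed
qed

text \<open>An element orthogonal to all \<open>x j\<close> with \<open>j \<noteq> i\<close> exists
  by counting equations. Nondegeneracy of the trace form keeps it from being orthogonal to
  \<open>x i\<close> as well, and it is then scaled.\<close>

lemma dual_element:
  assumes i: "i < n" shows "\<exists>c\<in>M. \<forall>j<n. Tr (x j * c) = (if j = i then 1 else 0)"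
proof -
  have lt: "card ({..<n} - {i}) < card {..<n}" using i by simp
  have "Tr (x i' * x j) \<in> kk" if "i' \<in> {..<n} - {i}" "j \<in> {..<n}" for i' j
    using Tr_Fix[OF tsubringD(5)[OF Lr xM xM], of i' j] Fix_k that by simp
  hence "\<exists>y. (\<forall>j\<in>{..<n}. y j \<in> kk) \<and> (\<exists>j\<in>{..<n}. y j \<noteq> 0) \<and>
      (\<forall>i'\<in>{..<n} - {i}. (\<Sum>j\<in>{..<n}. Tr (x i' * x j) * y j) = 0)"
    by (intro hom_system[OF tfield_ratfun _ _ lt, of "\<lambda>i' j. Tr (x i' * x j)"]) auto
  then obtain y j1 where y: "\<forall>j\<in>{..<n}. y j \<in> kk" "j1 \<in> {..<n}" "y j1 \<noteq> 0"
    "\<forall>i'\<in>{..<n} - {i}. (\<Sum>j\<in>{..<n}. Tr (x i' * x j) * y j) = 0" by blast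
  define c where "c = (\<Sum>j<n. y j * x j)"
  have cM: "c \<in> M" unfolding c_def by (intro tsubring_sum[OF Lr] tsubringD(5)[OF Lr]) (use y(1) kM xM in auto)
  have c0: "c \<noteq> 0" using indepD[OF x_indep, of y j1] y(1,2,3) by (auto simp: c_def)
  have xc: "x j * c \<in> M" if "j < n" for j by (rule tsubringD(5)[OF Lr xM[OF that] cM])
  have Tc: "Tr (x i' * c) = (\<Sum>j<n. Tr (x i' * x j) * y j)" if "i' < n" for i'
  proof -
    have "x i' * c = (\<Sum>j<n. y j * (x i' * x j))" unfolding c_def sum_distrib_left by (rule sum.cong) (auto simp: ac_simps)
    hence "Tr (x i' * c) = (\<Sum>j<n. y j * Tr (x i' * x j))"
      using Tr_lin[of n y "\<lambda>j. x i' * x j"] y(1) tsubringD(5)[OF Lr xM xM] that by simp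
    thus ?thesis by (simp add: mult.commute)
  qed
  hence T0: "Tr (x j * c) = 0" if "j < n" "j \<noteq> i" for j using y(4) that by simp
  let ?t = "Tr (x i * c)"
  have t0: "?t \<noteq> 0"
  proof
    assume "?t = 0"
    hence all0: "Tr (x j * c) = 0" if "j < n" for j using T0 that by (cases "j = i") auto
    obtain u where u: "u \<in> M" "Tr (u * c) \<noteq> 0" using Tr_nondegenerate[OF cM c0] by blast
    obtain f where f: "\<forall>j<n. f j \<in> kk" "u = (\<Sum>j<n. f j * x j)" using span[OF u(1)] by blast
    have "u * c = (\<Sum>j<n. f j * (x j * c))" unfolding f(2) sum_distrib_right by (rule sum.cong) (auto simp: ac_simps)
    hence "Tr (u * c) = (\<Sum>j<n. f j * Tr (x j * c))" using Tr_lin[of n f "\<lambda>j. x j * c"] f(1) xc by simp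
    also have "\<dots> = 0" by (rule sum.neutral) (use all0 in auto)
    finally show False using u(2) by simp
  qed
  have tk: "?t \<in> Fix" by (rule Tr_Fix[OF xc[OF i]])
  hence itk: "inverse ?t \<in> Fix" using tfieldD(2)[OF tfield_ratfun] Fix_k by simp
  have "inverse ?t * c \<in> M" using itk Fix_k kM tsubringD(5)[OF Lr _ cM] by blast
  moreover have "Tr (x j * (inverse ?t * c)) = (if j = i then 1 else 0)" if "j < n" for j
  proof -
    have "x j * (inverse ?t * c) = inverse ?t * (x j * c)" by (simp only: ac_simps)
    hence "Tr (x j * (inverse ?t * c)) = inverse ?t * Tr (x j * c)" using Tr_mult[OF itk xc[OF that]] by (simp only:)
    thus ?thesis using T0[OF that] t0 by simp
  qed
  ultimately show ?thesis by blast
qed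

section \<open>The dual basis and the vanishing of sizes\<close>

context
  fixes i c
  assumes i: "i < n" and c: "c \<in> M" "\<forall>j<n. Tr (x j * c) = (if j = i then 1 else 0)"
begin

lemma dual_coord:
  assumes f: "\<And>j. j < n ==> f j \<in> kk" shows "Tr ((\<Sum>j<n. f j * x j) * c) = f i"
proof -
  have "(\<Sum>j<n. f j * x j) * c = (\<Sum>j<n. f j * (x j * c))"
    unfolding sum_distrib_right by (rule sum.cong) (auto simp: ac_simps)
  hence "Tr ((\<Sum>j<n. f j * x j) * c) = (\<Sum>j<n. f j * Tr (x j * c))"
    using Tr_lin[of n f "\<lambda>j. x j * c"] f tsubringD(5)[OF Lr xM c(1)] by simp
  also have "\<dots> = (\<Sum>j<n. if j = i then f j else 0)" by (rule sum.cong) (use c(2) in auto)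
  finally show ?thesis using i by simp
qed

lemma Tr_shift:
  assumes s: "s \<in> A" and u: "u \<in> M"
  shows "\<exists>t\<in>A. Tr (u * s c) = Tr (t u * c)"
proof -
  obtain t where t: "t \<in> A" "\<And>x. s (t x) = x" using inv_A[OF s] by blast
  have uM: "t u \<in> M" by (rule stab[OF t(1) u])
  have "u * s c = s (t u * c)" by (simp add: rhom_mult[OF rh[OF s]] t(2))
  hence "Tr (u * s c) = Tr (t u * c)" using Tr_conj[OF tsubringD(5)[OF Lr uM c(1)] s] by simp
  thus ?thesis using t(1) by blast
qed

lemma conj_conj: "t \<in> A ==> \<forall>t\<in>A. t u \<in> P ==> \<forall>t'\<in>A. t' (t u) \<in> P"
  using comp_A by fastforce

text \<open>If \<open>s c\<close> had a pole at \<open>Q\<close>, so would the trace of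
  \<open>u * s c\<close> for some \<open>u\<close> integral at \<open>Q\<close>. That trace is a
  coordinate of a conjugate of \<open>u\<close>, which becomes an integral element after
  multiplication by a polynomial prime to \<open>Q\<close> and therefore has polynomial
  coordinates.\<close>

lemma dual_in_B: "c \<in> B"
proof (rule BI[OF c(1)])
  fix Q s assume Q: "Irr Q" and s: "s \<in> A"
  note V = W_vring[OF Q] and R = W_ring[OF Q]
  show "s c \<in> W Q"
  proof (rule ccontr)
    let ?y = "s c"
    assume n: "?y \<notin> W Q"
    hence y: "?y \<in> M" "?y \<noteq> 0" using stab[OF s c(1)] tsubringD(1)[OF R] by auto
    obtain u where u: "u \<in> M" "\<forall>t\<in>A. t u \<in> W Q" "Tr (u * ?y) / ?y \<in> W Q" "Tr (u * ?y) / ?y \<notin> mm (W Q)"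
      using trace_unit_finite[OF Q y] by blast
    have nT: "Tr (u * ?y) \<notin> W Q"
    proof
      assume "Tr (u * ?y) \<in> W Q"
      hence "Tr (u * ?y) * inverse (Tr (u * ?y) / ?y) \<in> W Q"
        by (rule tsubringD(5)[OF R _ mmD(4)[OF V u(3,4)]])
      moreover have "Tr (u * ?y) \<noteq> 0" using mmD(5)[OF V u(3,4)] by auto
      ultimately show False using n by simp
    qed
    obtain \<rho> where \<rho>: "\<rho> \<in> A" "Tr (u * ?y) = Tr (\<rho> u * c)" using Tr_shift[OF s u(1)] by blast
    define u' where "u' = \<rho> u"
    have u': "u' \<in> M" "Tr (u * ?y) = Tr (u' * c)" "\<forall>t\<in>A. t u' \<in> W Q"
      unfolding u'_def by (rule stab[OF \<rho>(1) u(1)], rule \<rho>(2), rule conj_conj[OF \<rho>(1) u(2)])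
    \<comment> \<open>A denominator of least degree is prime to \<open>Q\<close>: as
      \<open>u'\<close> and its conjugates are integral at \<open>Q\<close>, a factor
      \<open>Q\<close> could be dropped.\<close>
    let ?P = "\<lambda>d. d \<noteq> 0 \<and> emb d * u' \<in> B"
    obtain d0 where "?P d0" using B_scale[OF u'(1)] by blast
    hence "\<exists>d. ?P d \<and> (\<forall>e. ?P e --> pdeg d \<le> pdeg e)" by (rule ex_has_least_nat)
    then obtain d where d: "?P d" "\<And>e. ?P e ==> pdeg d \<le> pdeg e" by blast
    have nd: "\<not> Q dvd d"
    proof
      assume "Q dvd d"
      then obtain e where e: "d = Q * e" by auto
      hence e0: "e \<noteq> 0" "Q \<noteq> 0" using d(1) by auto
      have "\<not> Q dvd 1" using Q by (simp add: Factorial_Ring.irreducible_def)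
      hence "pdeg Q > 0" using e0(2) by (metis is_unit_iff_degree neq0_conv)
      hence lt: "pdeg e < pdeg d" using e0 by (simp add: e degree_mult_eq)
      have "emb e * u' \<in> B"
      proof (rule BI)
        show "emb e * u' \<in> M" by (rule tsubringD(5)[OF Lr emb_M u'(1)])
        fix Q' t assume Q': "Irr Q'" and t: "t \<in> A"
        have te: "t (emb e * u') = emb e * t u'" using A_k[OF t emb_ratfun] rhom_mult[OF rh[OF t]] by simp
        show "t (emb e * u') \<in> W Q'"
        proof (cases "Q' = Q")
          case True
          thus ?thesis unfolding te using tsubringD(5)[OF R emb_W(1)[OF Q]] u'(3) t by blast
        next
          case False
          hence "\<not> Q' dvd Q" using monic_irreducible_dvd_eq[of Q Q'] Q Q' by blast
          hence iQ: "inverse (emb Q) \<in> W Q'" by (rule emb_W(2)[OF Q'])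
          have "t (emb d * u') \<in> W Q'" using d(1) BD(2)[OF _ Q' t] by blast
          hence "inverse (emb Q) * t (emb d * u') \<in> W Q'" by (rule tsubringD(5)[OF W_ring[OF Q'] iQ])
          also have "inverse (emb Q) * t (emb d * u') = emb e * t u'"
            using A_k[OF t emb_ratfun] rhom_mult[OF rh[OF t]] e0(2) emb_eq_0_iff[of Q] by (simp add: e emb_simps)
          finally show ?thesis unfolding te .
        qed
      qed
      thus False using d(2)[of e] e0 lt by auto
    qed
    obtain f where f: "\<forall>j<n. f j \<in> kk" "emb d * u' = (\<Sum>j<n. f j * x j)"
      using span[OF BD(1)] d(1) by blast
    obtain q where q: "f i = emb q" using coords_polynomial[OF _ f(2) _ i] d(1) f(1) by blast
    have "emb d * Tr (u' * c) = Tr (emb d * (u' * c))"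
      using Tr_mult[of "emb d" "u' * c"] tsubringD(5)[OF Lr u'(1) c(1)] Fix_k emb_ratfun[of d] by simp
    also have "\<dots> = f i" using dual_coord[of f] f by (simp flip: mult.assoc)
    finally have "Tr (u' * c) = inverse (emb d) * emb q" using d(1) emb_eq_0_iff[of d] by (simp add: q field_simps)
    hence "Tr (u' * c) \<in> W Q" using tsubringD(5)[OF R emb_W(2)[OF Q nd] emb_W(1)[OF Q]] by simp
    thus False using nT u'(2) by simp
  qed
qed

text \<open>The argument of \<open>dual_in_B\<close> at infinity, with \<open>reduced\<close> in
  place of polynomial coordinates: poles of a basis element correspond to zeros of its dual.\<close>

lemma dual_at_infinity:
  assumes s: "s \<in> A" shows "s c * var_T ^ sz (x i) \<in> U"
proof (cases "s c = 0")
  case False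
  let ?y = "s c"
  have yM: "?y \<in> M" by (rule stab[OF s c(1)])
  obtain u where u: "u \<in> M" "\<forall>t\<in>A. t u \<in> U" "Tr (u * ?y) / ?y \<in> U" "Tr (u * ?y) / ?y \<notin> mm U"
    using trace_unit_infinite[OF yM False] by blast
  obtain \<rho> where \<rho>: "\<rho> \<in> A" "Tr (u * ?y) = Tr (\<rho> u * c)" using Tr_shift[OF s u(1)] by blast
  define u' where "u' = \<rho> u"
  have u': "u' \<in> M" "Tr (u * ?y) = Tr (u' * c)" "\<forall>t\<in>A. t u' \<in> U"
    unfolding u'_def by (rule stab[OF \<rho>(1) u(1)], rule \<rho>(2), rule conj_conj[OF \<rho>(1) u(2)])
  obtain f where f: "\<forall>j<n. f j \<in> kk" "u' = (\<Sum>j<n. f j * x j)" using span[OF u'(1)] by blast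
  have fi: "Tr (u * ?y) = f i" using dual_coord[of f] f u'(2) by simp
  have "f i * var_T ^ sz (x i) \<in> U" using reduced[OF f(2) _ _ i] u'(3) f(1) by blast
  from tsubringD(5)[OF UR mmD(4)[OF mU u(3,4)] this]
  have "inverse (f i / ?y) * (f i * var_T ^ sz (x i)) \<in> U" unfolding fi .
  moreover have "f i \<noteq> 0" using mmD(5)[OF mU u(3,4)] fi by auto
  hence "inverse (f i / ?y) * (f i * var_T ^ sz (x i)) = ?y * var_T ^ sz (x i)" by simp
  ultimately show ?thesis by simp
qed (simp add: tsubringD(1)[OF UR])

text \<open>A positive size would make all conjugates of the dual element vanish at infinity, so it
  would be \<open>0\<close>, although its trace with \<open>x i\<close> is \<open>1\<close>.\<close>

lemma sz_zero: "sz (x i) = 0"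
proof (rule ccontr)
  assume n: "sz (x i) \<noteq> 0"
  then obtain a where a: "sz (x i) = Suc a" by (cases "sz (x i)") auto
  have m: "s c \<in> mm U" if "s \<in> A" for s
  proof -
    have "s c * var_T ^ Suc a * inverse var_T ^ a \<in> U"
      using dual_at_infinity[OF that] unfolding a
      by (rule tsubringD(5)[OF UR _ tsubring_power[OF UR mmD(1)[OF mU sT]]])
    hence "s c * var_T ^ Suc a * inverse var_T ^ a * inverse var_T \<in> mm U" by (rule mm_mult[OF mU _ sT])
    moreover have "s c * var_T ^ Suc a * inverse var_T ^ a * inverse var_T = s c"
    proof -
      have "t \<noteq> 0 ==> y * t ^ Suc a * inverse t ^ a * inverse t = y" for t y :: "'a ac"
        by (simp add: field_simps)
      thus ?thesis using var_T_nonzero by blast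
    qed
    ultimately show ?thesis by (simp only:)
  qed
  have "c \<in> mm U" using m[OF id_A] by simp
  hence "c = 0" by (rule B_vanish[OF dual_in_B, rotated]) (rule mmD(1)[OF mU m])
  hence "Tr (x i * c) = 0" using Tr_mult[of 0 0] Fix_k tsubringD(1)[OF kr] tsubringD(1)[OF Lr] by simp
  thus False using c(2) i by simp
qed

end

lemma basis_const: assumes "i < n" shows "\<exists>c. x i = emb [:c:]"
proof (rule B_const[OF xB[OF assms]])
  obtain c where "c \<in> M" "\<forall>j<n. Tr (x j * c) = (if j = i then 1 else 0)" using dual_element[OF assms] by blast
  hence "sz (x i) = 0" by (rule sz_zero[OF assms])
  hence "bnd 0 (x i)" using bnd_sz[OF xM[OF assms]] by simp
  thus "s (x i) \<in> U" if "s \<in> A" for s using that by (simp add: bnd_def)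
qed

lemma M_subset: "M \<subseteq> kk"
proof
  fix y assume "y \<in> M"
  then obtain f where f: "\<forall>j<n. f j \<in> kk" "y = (\<Sum>j<n. f j * x j)" using span by blast
  have "x j \<in> kk" if "j < n" for j using basis_const[OF that] emb_ratfun by auto
  thus "y \<in> kk" unfolding f(2) by (intro tsubring_sum[OF kr] tsubringD(5)[OF kr]) (use f(1) in auto)
qed

end

theorem everywhere_unramified_trivial: "M = kk"
  using min_basis_exists M_subset kM by blast

end

section \<open>Extensions generated by Witt vectors\<close>

context
  fixes p :: nat
  assumes p: "prime p" "p = CHAR('b::field)"
begin

lemma frob_rhom: "is_rhom (\<lambda>x::'b. x ^ p)"
  unfolding is_rhom_def
proof (intro conjI allI)
  fix x y :: 'b
  have "(x - - y) ^ (p ^ 1) = x ^ (p ^ 1) - (- y) ^ (p ^ 1)" by (rule power_CHAR_diff[OF p])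
  moreover have "(0 - y) ^ (p ^ 1) = 0 ^ (p ^ 1) - y ^ (p ^ 1)" by (rule power_CHAR_diff[OF p])
  ultimately show "(x + y) ^ p = x ^ p + y ^ p" using prime_gt_0_nat[OF p(1)] by (simp add: zero_power)
qed (simp_all add: power_mult_distrib)

definition prime_field :: "'b set" where "prime_field = of_nat ` {..<p}"

lemma card_prime_field: "finite prime_field" "card prime_field = p"
proof -
  have "inj_on (of_nat :: nat => 'b) {..<p}"
  proof (rule inj_onI)
    have le: "j \<le> i" if ij: "i < p" "j < p" "(of_nat i :: 'b) = of_nat j" for i j
    proof (rule ccontr)
      assume "\<not> j \<le> i"
      hence "(of_nat (j - i) :: 'b) = 0" using ij(3) by (simp add: of_nat_diff)
      hence "p dvd j - i" using p(2) by (simp add: of_nat_eq_0_iff_char_dvd)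
      thus False using ij \<open>\<not> j \<le> i\<close> by (auto dest: dvd_imp_le)
    qed
    fix i j assume "i \<in> {..<p}" "j \<in> {..<p}" "(of_nat i :: 'b) = of_nat j"
    thus "i = j" using le[of i j] le[of j i] by simp
  qed
  thus "finite prime_field" "card prime_field = p" by (auto simp: prime_field_def card_image)
qed

lemma prime_field_power: "c \<in> prime_field ==> c ^ p = c"
  using rhom_of_nat[OF frob_rhom] by (auto simp: prime_field_def)

text \<open>The right-hand side is the Artin-Schreier polynomial X^p - X - (b^p - b). Both sides are
  monic of degree \<open>p\<close> and share the \<open>p\<close> roots \<open>b + c\<close>, so
  their difference has more roots than its degree.\<close>

lemma root_poly_artin_schreier:
  "root_poly ((+) b ` prime_field) = Polynomial.monom 1 p - [:b ^ p - b, 1:]"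
proof -
  let ?Z = "(+) b ` prime_field" and ?f = "Polynomial.monom 1 p - [:b ^ p - b, 1:]"
  have Z: "finite ?Z" "card ?Z = p" using card_prime_field by (simp_all add: card_image)
  have p2: "p \<ge> 2" using p(1) prime_ge_2_nat by blast
  have lZ: "lcoeff (root_poly ?Z) = 1" unfolding root_poly_def by (simp add: lead_coeff_prod)
  have dZ: "pdeg (root_poly ?Z) = p"
    unfolding root_poly_def using Z by (simp add: degree_prod_sum_eq)
  note dZ = dZ lZ
  have "pdeg [:b ^ p - b, 1::'b:] < pdeg (Polynomial.monom (1::'b) p)"
    using p2 by (simp add: degree_monom_eq)
  hence "pdeg (Polynomial.monom 1 p + - [:b ^ p - b, 1:]) = p"
    by (subst degree_add_eq_left) (simp_all add: degree_monom_eq)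
  hence df: "pdeg ?f = p" by (simp only: diff_conv_add_uminus)
  moreover have "coef ?f p = 1" using p2 by (auto simp: coeff_pCons split: nat.splits)
  ultimately have df: "pdeg ?f = p" "lcoeff ?f = 1" by simp_all
  have fZ: "poly ?f z = 0" if z: "z \<in> ?Z" for z
  proof -
    obtain c where c: "c \<in> prime_field" "z = b + c" using z by blast
    have "z ^ p = b ^ p + c" using rhom_add[OF frob_rhom, of b c] prime_field_power[OF c(1)] c(2) by simp
    thus ?thesis using c(2) by (simp add: poly_monom)
  qed
  show ?thesis
  proof (rule ccontr)
    assume "root_poly ?Z \<noteq> ?f"
    hence d0: "?f - root_poly ?Z \<noteq> 0" by auto
    have "pdeg (?f - root_poly ?Z) < p"
    proof -
      have "pdeg (?f - root_poly ?Z) \<le> p" using degree_diff_le[of ?f p "root_poly ?Z"] df(1) dZ(1) by simp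
      moreover have "coef (?f - root_poly ?Z) p = 0"
        using df dZ by (metis coeff_diff diff_self)
      ultimately show ?thesis using d0 by (metis leading_coeff_0_iff order_le_less)
    qed
    moreover have "?Z \<subseteq> {z. poly (?f - root_poly ?Z) z = 0}" using fZ poly_root_poly[OF Z(1)] by auto
    hence "card ?Z \<le> card {z. poly (?f - root_poly ?Z) z = 0}" by (rule card_mono[OF poly_roots_finite[OF d0]])
    hence "p \<le> pdeg (?f - root_poly ?Z)" unfolding Z(2) by (rule order_trans[OF _ card_poly_roots_bound[OF d0]])
    ultimately show False by simp
  qed
qed

text \<open>For \<open>b = 0\<close> the preceding identity shows that X^p - X has no roots outside
  the prime field.\<close>

lemma prime_fieldI: assumes "c ^ p = c" shows "c \<in> prime_field"
proof -
  have "poly (root_poly ((+) 0 ` prime_field)) c = 0"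
    unfolding root_poly_artin_schreier using assms prime_gt_0_nat[OF p(1)] by (simp add: poly_monom zero_power)
  thus ?thesis using poly_root_poly[of "(+) 0 ` prime_field" c] card_prime_field(1) by auto
qed

lemma prime_field_tsubring: "tsubring R ==> prime_field \<subseteq> R"
  using tsubring_of_nat by (auto simp: prime_field_def)

lemma prime_field_fixed: "is_rhom s ==> c \<in> prime_field ==> s c = c"
  using rhom_of_nat by (auto simp: prime_field_def)

lemma prime_field_max_ideal:
  assumes V: "vring L V" and c: "c \<in> prime_field" "c \<in> mm V" shows "c = 0"
proof (rule ccontr)
  assume "c \<noteq> 0"
  have "inverse c ^ p = inverse c" using prime_field_power[OF c(1)] by (simp add: power_inverse)
  hence "inverse c \<in> V" using prime_field_tsubring[OF vringD(3)[OF V]] prime_fieldI by blast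
  thus False using c(2) \<open>c \<noteq> 0\<close> by (simp add: max_ideal_def)
qed

lemma sep_elem_artin_schreier:
  fixes b :: 'b
  assumes F: "tsubring F" and b: "b ^ p - b \<in> F" shows "sep_elem F b"
  unfolding sep_elem_def
proof (intro exI conjI)
  show "finite ((+) b ` prime_field)" using card_prime_field(1) by simp
  show "b \<in> (+) b ` prime_field"
  proof (rule image_eqI[of _ _ 0])
    show "0 \<in> prime_field" using prime_gt_0_nat[OF p(1)] by (intro prime_fieldI) (simp add: zero_power)
  qed simp
  show "poly_over F (root_poly ((+) b ` prime_field))"
    unfolding root_poly_artin_schreier
    by (intro poly_over_diff poly_over_monom poly_over_pCons poly_over_0 F b tsubringD(2)[OF F])
qed

text \<open>The fibres of the Artin-Schreier-Witt map are the cosets of the Witt vectors over the prime field.\<close>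

definition asw :: "'b list => 'b list" where "asw w = witt_diff p (witt_frob p w) w"

lemma length_asw [simp]: "length (asw w) = length w"
  by (simp add: asw_def)

lemma witt_frob_map: "witt_frob p x = map (\<lambda>c::'b. c ^ p) x"
  by (simp add: witt_frob_def)

lemma witt_frob_asw: "witt_frob p w = witt_add p (asw w) w"
  unfolding asw_def by (rule witt_add_diff[OF p(1), symmetric]) auto

lemma witt_frob_add:
  fixes x y :: "'b list"
  shows "length x = length y ==> witt_frob p (witt_add p x y) = witt_add p (witt_frob p x) (witt_frob p y)"
  unfolding witt_frob_map by (rule map_witt_add[OF p(1) frob_rhom])

lemma asw_add:
  assumes "length x = length y" shows "asw (witt_add p x y) = witt_add p (asw x) (asw y)"
proof -
  have len: "length x = length x" "length y = length x" "length (asw x) = length x" "length (asw y) = length x"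
    "length (witt_add p x y) = length x" "length (witt_add p (asw y) y) = length x"
    using assms by simp_all
  have "witt_frob p (witt_add p x y) = witt_add p (witt_add p (asw x) x) (witt_add p (asw y) y)"
    using witt_frob_add[OF assms] witt_frob_asw by simp
  also have "\<dots> = witt_add p (asw x) (witt_add p x (witt_add p (asw y) y))"
    by (rule witt_add_assoc[OF p(1) len(3,1,6)])
  also have "witt_add p x (witt_add p (asw y) y) = witt_add p (asw y) (witt_add p x y)"
    by (rule witt_add_left_commute[OF p(1) len(1,4,2)])
  also have "witt_add p (asw x) (witt_add p (asw y) (witt_add p x y)) = witt_add p (witt_add p (asw x) (asw y)) (witt_add p x y)"
    by (rule witt_add_assoc[OF p(1) len(3,4,5), symmetric])
  finally have "witt_add p (asw (witt_add p x y)) (witt_add p x y) = witt_add p (witt_add p (asw x) (asw y)) (witt_add p x y)"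
    using witt_frob_asw by simp
  thus ?thesis by (rule witt_add_right_cancel[OF p(1), of _ "length x", rotated 3]) (use len in simp_all)
qed

text \<open>The Witt difference of \<open>x\<close> and \<open>y\<close> is sent to zero by the
  additive map \<open>asw\<close>, so Frobenius fixes its components.\<close>

lemma asw_fibre:
  assumes xy: "length x = length y" "asw x = asw y"
  shows "\<exists>c. length c = length y \<and> set c \<subseteq> prime_field \<and> x = witt_add p c y"
proof -
  define c where "c = witt_diff p x y"
  have lc: "length c = length y" using xy(1) by (simp add: c_def)
  have x: "x = witt_add p c y" unfolding c_def by (rule witt_add_diff[OF p(1), symmetric]) (use xy(1) in auto)
  have "witt_add p (asw c) (asw y) = asw x" using asw_add[of c y] lc x by simp
  also have "\<dots> = witt_add p (replicate (length y) 0) (asw y)"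
    using witt_add_zero[OF p(1), of "asw y" "length y"] xy(2) by simp
  finally have "asw c = replicate (length y) 0"
    by (rule witt_add_right_cancel[OF p(1), of _ "length y", rotated 3]) (use lc in simp_all)
  hence "witt_frob p c = witt_add p (replicate (length y) 0) c" using witt_frob_asw by simp
  also have "\<dots> = c"
    using witt_add_zero[OF p(1) lc] by simp
  finally have "map (\<lambda>c. c ^ p) c = map (\<lambda>c. c) c" by (simp add: witt_frob_map)
  hence "u ^ p = u" if "u \<in> set c" for u using that unfolding map_eq_conv by blast
  hence "set c \<subseteq> prime_field" using prime_fieldI by blast
  thus ?thesis using lc x by blast
qed

lemma map_asw:
  assumes "is_rhom s" shows "map s (asw w) = asw (map s w)"
proof -
  have "map s (witt_frob p w) = witt_frob p (map s w)" by (simp add: witt_frob_map rhom_power[OF assms])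
  thus ?thesis unfolding asw_def using map_witt_diff[OF p(1) assms, of "witt_frob p w" w] by simp
qed

lemma asw_conj:
  assumes s: "is_rhom s" "\<And>u. u \<in> set (asw w) ==> s u = u"
  shows "\<exists>c. length c = length w \<and> set c \<subseteq> prime_field \<and> map s w = witt_add p c w"
proof (rule asw_fibre)
  show "asw (map s w) = asw w" using map_asw[OF s(1), of w] map_idI[of "asw w" s] s(2) by simp
qed simp

text \<open>From the leading term of the Witt difference: component \<open>n\<close> satisfies an
  Artin-Schreier equation whose right-hand side is \<open>asw w ! n\<close> plus a polynomial in the
  earlier components.\<close>

lemma asw_nth:
  assumes R: "tsubring R" and n: "n < length w" and w: "set (take n w) \<subseteq> R"
  shows "w ! n ^ p - w ! n - asw w ! n \<in> R"
proof -
  have wi: "w ! i \<in> R" if "i < n" for i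
  proof -
    have "take n w ! i \<in> set (take n w)" by (rule nth_mem) (use that n in simp)
    thus ?thesis using w that by auto
  qed
  have "asw w ! n = wdiff p ((!) (witt_frob p w)) ((!) w) n"
    unfolding asw_def by (rule nth_witt_diff[OF p(1)]) (use n in simp_all)
  also have "\<dots> = witt_frob p w ! n - w ! n + wdiff p (trunc n ((!) (witt_frob p w))) (trunc n ((!) w)) n"
    using witt_operation.wop_leading[OF witt_operation_diff[OF p(1)]] by simp
  also have "witt_frob p w ! n = w ! n ^ p" using n by (simp add: witt_frob_map)
  finally have "w ! n ^ p - w ! n - asw w ! n = - wdiff p (trunc n ((!) (witt_frob p w))) (trunc n ((!) w)) n" by simp
  also have "\<dots> \<in> R"
  proof (intro tsubringD(4)[OF R] witt_operation.wop_closed[OF witt_operation_diff[OF p(1)] R])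
    fix i
    show "trunc n ((!) (witt_frob p w)) i \<in> R" "trunc n ((!) w) i \<in> R"
      using wi[of i] n tsubring_power[OF R] tsubringD(1)[OF R] by (simp_all add: trunc_def witt_frob_map)
  qed
  finally show ?thesis .
qed

text \<open>Component by component, each being a root of an Artin-Schreier polynomial over
  \<open>V\<close> by \<open>asw_nth\<close>.\<close>

lemma asw_integral:
  assumes V: "vring L V" and w: "set w \<subseteq> L" and xi: "set (asw w) \<subseteq> V"
  shows "set w \<subseteq> V"
proof -
  note R = vringD(3)[OF V]
  have "set (take n w) \<subseteq> V" if "n \<le> length w" for n
    using that
  proof (induction n)
    case (Suc n)
    hence n: "n < length w" and IH: "set (take n w) \<subseteq> V" by auto
    let ?b = "w ! n"
    have "asw w ! n \<in> set (asw w)" by (rule nth_mem) (use n in simp)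
    hence a: "asw w ! n \<in> V" using xi by blast
    from tsubringD(3)[OF R asw_nth[OF R n IH] a] have e: "?b ^ p - ?b \<in> V" by simp
    \<comment> \<open>As \<open>p\<close> is at least \<open>2\<close>, the terms of degree
      \<open>0\<close> and \<open>1\<close> lie below the leading one, so
      \<open>?b ^ p = (?b ^ p - ?b) + ?b\<close> is a monic equation.\<close>
    obtain q where q: "p = Suc (Suc q)" using prime_ge_2_nat[OF p(1)] by (metis add_2_eq_Suc le_Suc_ex)
    have "?b \<in> V"
    proof (rule integral_in_valuation[OF R, of p "\<lambda>i. if i = 0 then ?b ^ p - ?b else if i = 1 then 1 else 0"])
      show "?b ^ p = (\<Sum>i<p. (if i = 0 then ?b ^ p - ?b else if i = 1 then 1 else 0) * ?b ^ i)"
        unfolding q sum.lessThan_Suc_shift by simp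
      show "?b \<in> V \<or> inverse ?b \<in> V" using vringD(5)[OF V, of ?b] w nth_mem[OF n] by blast
    qed (use e tsubringD(1,2)[OF R] in auto)
    thus ?case using IH n by (simp add: take_Suc_conv_app_nth)
  qed simp
  from this[of "length w"] show ?thesis by simp
qed

lemma witt_fixed_aux:
  assumes V: "vring L V" and w: "set w \<subseteq> V" and s: "is_rhom s" "\<And>u. u \<in> set (asw w) ==> s u = u"
    and cong: "\<And>u. u \<in> set w ==> s u - u \<in> mm V"
  shows "map s w = w"
proof -
  note R = vringD(3)[OF V]
  obtain c where c: "length c = length w" "set c \<subseteq> prime_field" "map s w = witt_add p c w"
    using asw_conj[OF s] by blast
  have cd: "c = witt_diff p (map s w) w" using witt_diff_add[OF p(1) c(1) refl] c(3) by simp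
  have sV: "s u \<in> V" if "u \<in> set w" for u using vring_cong_in[OF V cong[OF that]] w that by blast
  have "c ! n = 0" if n: "n < length w" for n
  proof -
    have "c ! n = wdiff p ((!) (map s w)) ((!) w) n" unfolding cd by (rule nth_witt_diff[OF p(1)]) (use n in simp_all)
    moreover have "wdiff p ((!) (map s w)) ((!) w) n - wdiff p ((!) w) ((!) w) n \<in> mm V"
    proof (rule witt_operation.wop_cong_ideal[OF witt_operation_diff[OF p(1)] R tideal_max_ideal[OF V]])
      fix i assume "i \<le> n"
      hence i: "i < length w" "w ! i \<in> set w" using n by auto
      thus "(!) (map s w) i \<in> V \<and> (!) w i \<in> V \<and> (!) w i \<in> V \<and> (!) w i \<in> V \<and>
          (!) (map s w) i - (!) w i \<in> mm V \<and> (!) w i - (!) w i \<in> mm V"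
        using sV cong w mmD(2)[OF V] by auto
    qed
    moreover have "wdiff p ((!) w) ((!) w) n = witt_diff p w w ! n" by (rule nth_witt_diff[OF p(1), symmetric]) (use n in simp_all)
    hence "wdiff p ((!) w) ((!) w) n = 0" using witt_diff_self[OF p(1) refl, of w] n by simp
    ultimately have "c ! n \<in> mm V" by simp
    moreover have "c ! n \<in> prime_field" using c(1,2) n by auto
    ultimately show ?thesis using prime_field_max_ideal[OF V] by blast
  qed
  hence "c = replicate (length w) 0" using c(1) by (auto intro: nth_equalityI)
  thus ?thesis
    using c(3) witt_add_zero[OF p(1) refl, of w] by simp
qed

lemma inertia_fixes_witt:
  assumes V: "vring L V" and w: "set w \<subseteq> L" "set (asw w) \<subseteq> V"
    and s: "is_rhom s" "\<And>u. u \<in> set (asw w) ==> s u = u" "\<And>x. x \<in> V ==> s x - x \<in> mm V"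
  shows "map s w = w"
proof (rule witt_fixed_aux[OF V asw_integral[OF V w] s(1,2)])
  show "s u - u \<in> mm V" if "u \<in> set w" for u using s(3) asw_integral[OF V w] that by blast
qed

text \<open>Modulo the maximal ideal the equation says that Frobenius fixes \<open>w\<close>, so
  each residue is a root of X^p - X, which splits over the prime field. Consequently decomposition
  automorphisms move no residue of \<open>w\<close>.\<close>

lemma asw_residue:
  assumes V: "vring L V" and w: "set w \<subseteq> V" "set (asw w) \<subseteq> mm V" and b: "b \<in> set w"
  shows "\<exists>c\<in>prime_field. b - c \<in> mm V"
proof -
  note R = vringD(3)[OF V]
  obtain n where n: "n < length w" "b = w ! n" using b by (auto simp: in_set_conv_nth)
  let ?z = "replicate (length w) (0::'b)"
  have "witt_add p ?z w = w"
    by (rule witt_add_zero[OF p(1) refl])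
  hence bz: "b = wadd p ((!) ?z) ((!) w) n" using nth_witt_add[OF p(1), of n ?z w] n by simp
  have "b ^ p = witt_frob p w ! n" using n by (simp add: witt_frob_map)
  also have "\<dots> = wadd p ((!) (asw w)) ((!) w) n"
    unfolding witt_frob_asw by (rule nth_witt_add[OF p(1)]) (use n in simp_all)
  finally have bp: "b ^ p = wadd p ((!) (asw w)) ((!) w) n" .
  have "wadd p ((!) (asw w)) ((!) w) n - wadd p ((!) ?z) ((!) w) n \<in> mm V"
  proof (rule witt_operation.wop_cong_ideal[OF witt_operation_add[OF p(1)] R tideal_max_ideal[OF V]])
    fix i assume "i \<le> n"
    hence i: "i < length w" using n by simp
    have "asw w ! i \<in> set (asw w)" "w ! i \<in> set w" using i by simp_all
    hence "asw w ! i \<in> mm V" "w ! i \<in> V" using w by blast+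
    thus "(!) (asw w) i \<in> V \<and> (!) ?z i \<in> V \<and> (!) w i \<in> V \<and> (!) w i \<in> V \<and>
        (!) (asw w) i - (!) ?z i \<in> mm V \<and> (!) w i - (!) w i \<in> mm V"
      using w mmD(1,2)[OF V] i tsubringD(1)[OF R] by auto
  qed
  hence "b ^ p - b \<in> mm V" using bz bp by simp
  also have "b ^ p - b = poly (root_poly ((+) 0 ` prime_field)) b"
    unfolding root_poly_artin_schreier using prime_gt_0_nat[OF p(1)] by (simp add: poly_monom zero_power)
  also have "\<dots> = (\<Prod>c\<in>prime_field. b - c)" by (simp add: root_poly_def poly_prod)
  finally have "(\<Prod>c\<in>prime_field. b - c) \<in> mm V" .
  moreover have "b - c \<in> V" if "c \<in> prime_field" for c
    using tsubring_diff[OF R] w(1) b prime_field_tsubring[OF R] that by blast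
  ultimately show ?thesis using mm_prod[OF V card_prime_field(1), of "\<lambda>c. b - c"] by blast
qed

lemma decomposition_fixes_witt:
  assumes V: "vring L V" and w: "set w \<subseteq> L" "set (asw w) \<subseteq> mm V"
    and s: "is_rhom s" "\<And>u. u \<in> set (asw w) ==> s u = u" "\<And>x. x \<in> mm V ==> s x \<in> mm V"
  shows "map s w = w"
proof (rule witt_fixed_aux[OF V _ s(1,2)])
  show wV: "set w \<subseteq> V" by (rule asw_integral[OF V w(1)]) (use w(2) mmD(1)[OF V] in blast)
  fix u assume "u \<in> set w"
  then obtain c where c: "c \<in> prime_field" "u - c \<in> mm V" using asw_residue[OF V wV w(2)] by blast
  have "s u - c \<in> mm V"
    using s(3)[OF c(2)] prime_field_fixed[OF s(1) c(1)] by (simp add: rhom_diff[OF s(1)])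
  thus "s u - u \<in> mm V" using mm_cong_trans[OF V _ mm_cong_sym[OF V c(2)]] by blast
qed

section \<open>Galois action on the components of Witt vectors\<close>

lemma set_witt_add_prime_field:
  assumes "tsubring R" "set c \<subseteq> prime_field" "set w \<subseteq> R" shows "set (witt_add p c w) \<subseteq> R"
  using witt_add_closed[OF p(1) assms(1) _ assms(3)] assms(2) prime_field_tsubring[OF assms(1)] by blast

lemma witt_generator_conj:
  assumes "is_rhom s" "\<And>u. u \<in> set (asw w) ==> s u = u" "tsubring R" "set w \<subseteq> R" "u \<in> set w"
  shows "s u \<in> R"
proof -
  obtain c where c: "set c \<subseteq> prime_field" "map s w = witt_add p c w" using asw_conj[OF assms(1,2)] by blast
  have "set (map s w) \<subseteq> R" unfolding c(2) by (rule set_witt_add_prime_field[OF assms(3) c(1) assms(4)])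
  thus ?thesis using assms(5) by auto
qed

text \<open>Both automorphisms translate \<open>w\<close> by Witt vectors over the prime field,
  which they fix, and translations commute.\<close>

lemma witt_generator_commute:
  assumes s: "is_rhom s" "\<And>u. u \<in> set (asw w) ==> s u = u" and t: "is_rhom t" "\<And>u. u \<in> set (asw w) ==> t u = u"
    and u: "u \<in> set w"
  shows "s (t u) = t (s u)"
proof -
  obtain c where c: "length c = length w" "set c \<subseteq> prime_field" "map s w = witt_add p c w" using asw_conj[OF s] by blast
  obtain d where d: "length d = length w" "set d \<subseteq> prime_field" "map t w = witt_add p d w" using asw_conj[OF t] by blast
  have "map s d = d" "map t c = c" using prime_field_fixed[OF s(1)] prime_field_fixed[OF t(1)] c(2) d(2) by (auto intro!: map_idI)
  hence "map s (map t w) = witt_add p d (witt_add p c w)" "map t (map s w) = witt_add p c (witt_add p d w)"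
    unfolding c(3) d(3) using map_witt_add[OF p(1) s(1)] map_witt_add[OF p(1) t(1)] c d by simp_all
  hence "map s (map t w) = map t (map s w)" using witt_add_left_commute[OF p(1) d(1) c(1) refl] by simp
  thus ?thesis using u by simp
qed

text \<open>Components of a Witt vector satisfy Artin-Schreier equations only over the field of the
  earlier components, so separability is recorded relative to initial segments.\<close>

definition as_tower :: "'b set => 'b list => bool" where
  "as_tower F xs \<longleftrightarrow> (\<forall>i<length xs. xs ! i ^ p - xs ! i \<in> adjoin F (set (take i xs)))"

lemma as_tower_append:
  assumes xs: "as_tower F xs" and w: "set (asw w) \<subseteq> F" shows "as_tower F (xs @ w)"
  unfolding as_tower_def
proof (intro allI impI)
  fix i assume i: "i < length (xs @ w)"
  show "(xs @ w) ! i ^ p - (xs @ w) ! i \<in> adjoin F (set (take i (xs @ w)))"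
  proof (cases "i < length xs")
    case True
    thus ?thesis using xs by (simp add: as_tower_def nth_append)
  next
    case False
    define n where "n = i - length xs"
    have n: "n < length w" "i = length xs + n" using i False by (auto simp: n_def)
    let ?E = "adjoin F (set (take i (xs @ w)))"
    note R = tfieldD(1)[OF tfield_adjoin, of F "set (take i (xs @ w))"]
    have sub: "set (take n w) \<subseteq> ?E" using adjoin_incl(2)[of "set (take i (xs @ w))" F] by (simp add: n(2))
    have "asw w ! n \<in> set (asw w)" by (rule nth_mem) (use n in simp)
    hence "asw w ! n \<in> ?E" using w adjoin_incl(1) by blast
    from tsubringD(3)[OF R asw_nth[OF R n(1) sub] this] show ?thesis by (simp add: n(2))
  qed
qed

lemma as_tower_concat: "\<forall>w\<in>set ws. set (asw w) \<subseteq> F ==> as_tower F (concat ws)"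
proof (induction ws rule: rev_induct)
  case Nil
  thus ?case by (simp add: as_tower_def)
next
  case (snoc w ws)
  thus ?case using as_tower_append by simp
qed

end

text \<open>Normality holds because automorphisms translate the generating vectors by vectors over
  the prime field; fixed elements descend through the Artin-Schreier tower of all
  components.\<close>

lemma witt_extension:
  fixes k :: "'b::alg_closed_field set"
  assumes p: "prime p" "p = CHAR('b)" and k: "tfield k" "alg_over k"
    and fin: "finite Ws" and xi: "\<And>w. w \<in> Ws ==> set (asw p w) \<subseteq> k"
  defines "L \<equiv> adjoin k (\<Union>w\<in>Ws. set w)"
  shows "normal_sep k L" "commuting k L"
proof -
  have fx: "s u = u" if "s \<in> auts k" "w \<in> Ws" "u \<in> set (asw p w)" for s w u
    using autsD(3)[OF that(1)] xi[OF that(2)] that(3) by blast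
  have gen: "set w \<subseteq> L" if "w \<in> Ws" for w
    using adjoin_incl(2)[of "\<Union>w\<in>Ws. set w" k] that unfolding L_def by blast
  note L = tfield_adjoin[of k "\<Union>w\<in>Ws. set w", folded L_def]
  show "normal_sep k L"
    unfolding normal_sep_def
  proof (intro conjI ballI impI k(1) L)
    show kL: "k \<subseteq> L" unfolding L_def by (rule adjoin_incl(1))
    fix s x assume s: "s \<in> auts k" and x: "x \<in> L"
    show "s x \<in> L"
    proof (rule rhom_adjoin[OF autsD(1)[OF s] L])
      show "s y \<in> L" if "y \<in> k" for y using autsD(3)[OF s that] kL that by auto
      show "s y \<in> L" if y: "y \<in> (\<Union>w\<in>Ws. set w)" for y
      proof -
        obtain w where w: "w \<in> Ws" "y \<in> set w" using y by blast
        show ?thesis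
          by (rule witt_generator_conj[OF p autsD(1)[OF s] _ tfieldD(1)[OF L] gen[OF w(1)] w(2)]) (rule fx[OF s w(1)])
      qed
    qed (use x in "simp add: L_def")
  next
    fix x assume x: "x \<in> L" and fixed: "\<forall>s\<in>auts k. s x = x"
    obtain ws where ws: "set ws = Ws" using finite_list[OF fin] by blast
    have tw: "as_tower p k (concat ws)" by (rule as_tower_concat[OF p]) (use ws xi in blast)
    show "x \<in> k"
    proof (rule sep_tower[OF k k(1) subset_refl])
      show "x \<in> adjoin k (set (concat ws))" using x ws by (simp add: L_def)
      show "sep_elem (adjoin k (set (take i (concat ws)))) (concat ws ! i)" if "i < length (concat ws)" for i
        using sep_elem_artin_schreier[OF p tfieldD(1)[OF tfield_adjoin]] tw that by (simp add: as_tower_def[OF p])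
    qed (use fixed in blast)
  qed
  show "commuting k L"
    unfolding commuting_def
  proof (intro ballI)
    fix s t x assume s: "s \<in> auts k" and t: "t \<in> auts k" and x: "x \<in> L"
    have st: "s \<circ> t \<in> auts k" "t \<circ> s \<in> auts k" using auts_comp s t by blast+
    have "(s \<circ> t) x = (t \<circ> s) x"
    proof (rule rhom_eq_adjoin[OF autsD(1)[OF st(1)] autsD(1)[OF st(2)]])
      show "(s \<circ> t) y = (t \<circ> s) y" if "y \<in> k" for y using autsD(3)[OF st(1) that] autsD(3)[OF st(2) that] by simp
      show "(s \<circ> t) y = (t \<circ> s) y" if y: "y \<in> (\<Union>w\<in>Ws. set w)" for y
      proof -
        obtain w where w: "w \<in> Ws" "y \<in> set w" using y by blast
        show ?thesis
          using witt_generator_commute[OF p autsD(1)[OF s] _ autsD(1)[OF t] _ w(2)] fx[OF s w(1)] fx[OF t w(1)] by simp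
      qed
    qed (use x in "simp add: L_def")
    thus "s (t x) = t (s x)" by simp
  qed
qed

section \<open>Cancellation in iterated Witt sums\<close>

context
  fixes p :: nat and js :: "'i list" and f g :: "'i => 'b::comm_ring_1 list" and z z' :: "'b list" and v :: nat
  assumes p: "prime p" and len: "\<And>j. j \<in> set js ==> length (f j) = v \<and> length (g j) = v" "length z = v" "length z' = v"
begin

lemma length_foldr_witt_add:
  "(\<And>j. j \<in> set ks ==> length (h j) = v) ==> length y = v ==> length (foldr (witt_add p) (map h ks) y) = v"
  by (induction ks) auto

text \<open>For the last entry of the fold, where the polynomial part will stand.\<close>

lemma foldr_witt_add_cancel_end:
  assumes "foldr (witt_add p) (map f js) z = foldr (witt_add p) (map f js) z'"
  shows "z = z'"
proof -
  have "(\<forall>j\<in>set ks. length (f j) = v) ==> foldr (witt_add p) (map f ks) z = foldr (witt_add p) (map f ks) z' ==> z = z'" for ks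
  proof (induction ks)
    case (Cons j ks)
    let ?a = "foldr (witt_add p) (map f ks) z" and ?b = "foldr (witt_add p) (map f ks) z'"
    have l: "length ?a = v" "length ?b = v" "length (f j) = v"
      using length_foldr_witt_add[of ks f] Cons.prems(1) len(2,3) by simp_all
    have "witt_add p ?a (f j) = witt_add p ?b (f j)"
      using Cons.prems(2) witt_add_commute[OF p l(1,3)] witt_add_commute[OF p l(2,3)] by simp
    hence "?a = ?b" by (rule witt_add_right_cancel[OF p l(1,2,3)])
    thus ?case using Cons by simp
  qed simp
  thus ?thesis using assms len(1) by blast
qed

text \<open>With \<open>g\<close> as the image of \<open>f\<close> under an automorphism: if it
  fixes the total and all but one of the summands, it fixes the remaining one too.\<close>

lemma foldr_witt_add_cancel:
  assumes eq: "foldr (witt_add p) (map f js) z = foldr (witt_add p) (map g js) z" and d: "distinct js"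
    and j0: "j0 \<in> set js" and rest: "\<And>j. j \<in> set js ==> j \<noteq> j0 ==> f j = g j"
  shows "f j0 = g j0"
proof -
  have "(\<forall>j\<in>set ks. length (f j) = v \<and> length (g j) = v \<and> (j \<noteq> j0 --> f j = g j)) ==> distinct ks ==> j0 \<in> set ks ==>
      foldr (witt_add p) (map f ks) z = foldr (witt_add p) (map g ks) z ==> f j0 = g j0" for ks
  proof (induction ks)
    case (Cons j ks)
    let ?a = "foldr (witt_add p) (map f ks) z" and ?b = "foldr (witt_add p) (map g ks) z"
    have l: "length ?a = v" "length ?b = v" "length (f j) = v" "length (g j) = v"
      using length_foldr_witt_add[of ks f] length_foldr_witt_add[of ks g] Cons.prems(1) len(2) by simp_all
    have e: "witt_add p (f j) ?a = witt_add p (g j) ?b" using Cons.prems(4) by simp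
    show ?case
    proof (cases "j = j0")
      case True
      hence "\<forall>j\<in>set ks. f j = g j" using Cons.prems(1,2) by auto
      hence "map f ks = map g ks" by simp
      hence "?a = ?b" by (simp only:)
      thus ?thesis using witt_add_right_cancel[OF p l(3,4,2)] e True by simp
    next
      case False
      hence "f j = g j" using Cons.prems(1) by simp
      hence "witt_add p ?a (g j) = witt_add p ?b (g j)"
        using e witt_add_commute[OF p l(1,4)] witt_add_commute[OF p l(2,4)] by simp
      hence "?a = ?b" by (rule witt_add_right_cancel[OF p l(1,2,4)])
      thus ?thesis using Cons False by simp
    qed
  qed simp
  thus ?thesis using assms len(1) by blast
qed

end

text \<open>Characteristic polynomials have degree \<open>card \<Gamma>\<close> for every
  \<open>x\<close>, which gives the uniform exponent \<open>fact (card \<Gamma>)\<close> required by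
  \<open>zval_extend\<close>.\<close>

lemma (in fin_auts) zval_over_Fix:
  assumes V: "vring L V" and v: "zval Fix (V \<inter> Fix) v"
  shows "\<exists>w. zval L V w"
proof -
  have F: "tfield Fix" "Fix \<subseteq> L" using zvalD(1)[OF v] vringD(1) by (auto simp: Fix_def)
  show ?thesis
  proof (rule zval_extend[OF V F v])
    show "(0::nat) < fact (card \<Gamma>)" by simp
    fix x assume x: "x \<in> L" "x \<noteq> 0"
    show "\<exists>c\<in>Fix - {0}. val_equiv V (x ^ fact (card \<Gamma>)) c"
    proof (rule algebraic_val_equiv[OF V F x])
      show "char_poly x \<noteq> 0" using lead_coeff_char_poly[of x] by auto
    qed (use char_poly_Fix[OF x(1)] char_poly_root[OF x(1)] degree_char_poly in auto)
  qed
qed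

lemma adjoin_stable:
  assumes "\<forall>s\<in>auts F. \<forall>x\<in>S. s x \<in> adjoin F S" and s: "s \<in> auts F" and x: "x \<in> adjoin F S"
  shows "s x \<in> adjoin F S"
proof (rule rhom_adjoin[OF autsD(1)[OF s] tfield_adjoin _ _ x])
  show "s y \<in> adjoin F S" if "y \<in> F" for y using autsD(3)[OF s that] adjoin_incl(1) that by auto
  show "s y \<in> adjoin F S" if "y \<in> S" for y using assms(1) s that by blast
qed

lemma commuting_adjoin:
  assumes c: "\<And>s t x. s \<in> auts F ==> t \<in> auts F ==> x \<in> S ==> s (t x) = t (s x)"
  shows "commuting F (adjoin F S)"
  unfolding commuting_def
proof (intro ballI)
  fix s t x assume s: "s \<in> auts F" and t: "t \<in> auts F" and x: "x \<in> adjoin F S"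
  have st: "s \<circ> t \<in> auts F" "t \<circ> s \<in> auts F" using auts_comp s t by blast+
  have "(s \<circ> t) x = (t \<circ> s) x"
  proof (rule rhom_eq_adjoin[OF autsD(1)[OF st(1)] autsD(1)[OF st(2)] _ _ x])
    show "(s \<circ> t) y = (t \<circ> s) y" if "y \<in> F" for y using autsD(3)[OF st(1) that] autsD(3)[OF st(2) that] by simp
    show "(s \<circ> t) y = (t \<circ> s) y" if "y \<in> S" for y using c[OF s t that] by simp
  qed
  thus "s (t x) = t (s x)" by simp
qed

lemma commuting_mono: "commuting F L ==> F \<subseteq> E ==> M \<subseteq> L ==> commuting E M"
  unfolding commuting_def using auts_mono by blast

section \<open>Intermediate fields and finite normal pieces\<close>

context
  fixes B F L :: "'b::alg_closed_field set"
  assumes B: "tfield B" "alg_over B" "B \<subseteq> F" and F: "tfield F"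
begin

text \<open>Separability over \<open>F\<close> persists over \<open>E\<close>; this makes
  \<open>E\<close> the fixed field of \<open>auts E\<close> on \<open>L\<close>.\<close>

lemma normal_sep_intermediate:
  assumes L: "normal_sep F L" and E: "tfield E" "F \<subseteq> E" "E \<subseteq> L"
  shows "normal_sep E L"
  unfolding normal_sep_def
proof (intro conjI ballI impI E(1,3) normal_sepD(2)[OF L])
  show "s x \<in> L" if "s \<in> auts E" "x \<in> L" for s x
    using normal_sepD(4)[OF L _ that(2)] auts_mono[OF E(2)] that(1) by blast
  fix x assume x: "x \<in> L" "\<forall>s\<in>auts E. s x = x"
  show "x \<in> E"
  proof (rule sep_adjoin[OF B(1,2) E(1)])
    show "B \<subseteq> E" using B(3) E(2) by blast
    show "x \<in> adjoin E L" using adjoin_incl(2) x(1) by blast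
    show "sep_elem E y" if "y \<in> L" for y
      using sep_elem_mono[OF E(2) normal_sep_sep_elem[OF B(2,3) L that]] .
  qed (use x(2) in blast)
qed

lemma normal_sep_adjoin:
  assumes sep: "\<And>x. x \<in> S ==> sep_elem F x"
    and stab: "\<And>s x. s \<in> auts F ==> x \<in> S ==> s x \<in> adjoin F S"
  shows "normal_sep F (adjoin F S)"
  unfolding normal_sep_def
proof (intro conjI ballI impI F tfield_adjoin adjoin_incl(1))
  show "s x \<in> adjoin F S" if "s \<in> auts F" "x \<in> adjoin F S" for s x
    by (rule adjoin_stable[OF _ that]) (use stab in blast)
  fix x assume x: "x \<in> adjoin F S" "\<forall>s\<in>auts F. s x = x"
  show "x \<in> F"
  proof (rule sep_adjoin[OF B(1,2) F B(3) _ x(1)])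
    show "s x = x" if "s \<in> auts F" for s using x(2) that by blast
  qed (rule sep)
qed

text \<open>Adjoining full orbits makes the generated field stable under automorphisms. This
  provides finite normal pieces of an infinite normal extension.\<close>

lemma orbit_closure:
  assumes S: "finite S" and L: "normal_sep F L" "S \<subseteq> L"
  defines "S' \<equiv> \<Union>s\<in>S. orb F s"
  shows "finite S'" "S \<subseteq> S'" "S' \<subseteq> L" "normal_sep F (adjoin F S')" "adjoin F S' \<subseteq> L"
proof -
  show "finite S'" unfolding S'_def using finite_orb[OF B(2,3)] S by blast
  show "S \<subseteq> S'" unfolding S'_def using orb_self by blast
  show sub: "S' \<subseteq> L" unfolding S'_def orb_def using normal_sepD(4)[OF L(1)] L(2) by blast
  show "adjoin F S' \<subseteq> L" by (rule adjoin_minimal[OF normal_sepD(2,3)[OF L(1)] sub])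
  show "normal_sep F (adjoin F S')"
  proof (rule normal_sep_adjoin)
    show "sep_elem F x" if "x \<in> S'" for x using normal_sep_sep_elem[OF B(2,3) L(1)] sub that by blast
    fix s x assume s: "s \<in> auts F" and "x \<in> S'"
    then obtain y where y: "y \<in> S" "x \<in> orb F y" by (auto simp: S'_def)
    hence "s x \<in> orb F y" using orb_aut[OF s, of y] by blast
    hence "s x \<in> S'" using y(1) by (auto simp: S'_def)
    thus "s x \<in> adjoin F S'" using adjoin_incl(2) by blast
  qed
qed

end

section \<open>The Hilbert class field\<close>

definition fin_normal :: "'b::field set => 'b set => bool" where
  "fin_normal F L \<longleftrightarrow> normal_sep F L \<and> (\<exists>S. finite S \<and> L = adjoin F S)"

lemma fin_normalD: "fin_normal F L ==> normal_sep F L"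
  by (simp add: fin_normal_def)

lemma fin_normal_auts:
  assumes "fin_normal F L" "kk \<subseteq> F"
  shows "fin_auts (auts F) L" "fin_auts.Fix (auts F) L = F"
proof -
  show a: "fin_auts (auts F) L"
    using assms fin_auts_normal[OF alg_over_ratfun assms(2)] unfolding fin_normal_def by blast
  show "fin_auts.Fix (auts F) L = F" by (rule fin_auts_normal_Fix[OF fin_normalD[OF assms(1)] a])
qed

lemma fin_normal_zval:
  assumes L: "fin_normal F L" "kk \<subseteq> F" and V: "vring L V" and v: "\<exists>v. zval F (V \<inter> F) v"
  shows "\<exists>w. zval L V w"
  using fin_auts.zval_over_Fix[OF fin_normal_auts(1)[OF L] V] v unfolding fin_normal_auts(2)[OF L] by blast

lemma fin_normal_zval_ratfun:
  assumes L: "fin_normal kk L" and V: "vprime L V" shows "\<exists>w. zval L V w"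
  by (rule fin_normal_zval[OF L subset_refl vprimeD(1)[OF V] vprime_base_zval[OF V]])

lemma infinite_prime_var:
  fixes V :: "'a::field ac set"
  assumes V: "V \<inter> kk = infinite_prime" shows "var_T \<notin> V"
proof
  assume "var_T \<in> V"
  hence "var_T \<in> V \<inter> kk" using emb_ratfun by (rule IntI)
  hence "(var_T :: 'a ac) \<in> infinite_prime" unfolding V .
  then obtain a b :: "'a poly" where ab: "emb [:0, 1:] = emb a / emb b" "b \<noteq> 0" "pdeg a \<le> pdeg b"
    unfolding infinite_prime_def to_ac_Fract by blast
  hence "emb ([:0, 1:] * b) = emb a" using emb_eq_0_iff[of b] by (simp add: emb_simps del: mult_pCons_left)
  hence "[:0, 1:] * b = a" unfolding emb_eq_iff .
  hence "pdeg a = Suc (pdeg b)" using ab(2) by auto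
  thus False using ab(3) by simp
qed

lemma ram_index_one_restrict:
  assumes V: "vprime H V" and E: "tfield E" "K \<subseteq> E" "E \<subseteq> H"
  shows "ram_index_one K H V ==> ram_index_one K E (V \<inter> E)"
  unfolding ram_index_one_def
proof
  fix x assume r: "\<forall>x\<in>H - {0}. \<exists>y\<in>K - {0}. x * inverse y \<in> V \<and> y * inverse x \<in> V" and x: "x \<in> E - {0}"
  obtain y where y: "y \<in> K - {0}" "x * inverse y \<in> V" "y * inverse x \<in> V" using r x E(3) by blast
  have "x * inverse y \<in> E" "y * inverse x \<in> E"
    using tsubringD(5)[OF tfieldD(1)[OF E(1)]] tfieldD(2)[OF E(1)] x y(1) E(2) by blast+
  thus "\<exists>y\<in>K - {0}. x * inverse y \<in> V \<inter> E \<and> y * inverse x \<in> V \<inter> E" using y by blast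
qed

lemma res_degree_one_restrict:
  assumes V: "vprime H V" and E: "tfield E" "K \<subseteq> E" "E \<subseteq> H" and r: "res_degree_one K V"
  shows "res_degree_one K (V \<inter> E)"
  unfolding res_degree_one_def
proof
  fix x assume x: "x \<in> V \<inter> E"
  obtain y where y: "y \<in> V \<inter> K" "x - y \<in> mm V" using r x unfolding res_degree_one_def by blast
  have "x - y \<in> E" using tsubring_diff[OF tfieldD(1)[OF E(1)]] x y(1) E(2) by blast
  hence "x - y \<in> mm (V \<inter> E)" using y(2) vring_restrict(2)[OF vprimeD(1)[OF V] E(1,3)] by blast
  thus "\<exists>y\<in>V \<inter> E \<inter> K. x - y \<in> mm (V \<inter> E)" using y(1) E(2) by blast
qed

context
  fixes K :: "'a::{finite,field} ac set"
  assumes K: "fin_normal kk K"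
begin

lemmas nK = fin_normalD[OF K]
lemmas tK = normal_sepD(2)[OF nK] and kK = normal_sepD(3)[OF nK]

lemma relative_zval:
  assumes L: "fin_normal K L" and V: "vprime L V"
  shows "\<exists>w. zval L V w"
proof (rule fin_normal_zval[OF L kK vprimeD(1)[OF V]])
  have "vprime K (V \<inter> K)" by (rule vprime_restrict(1)[OF V tK kK normal_sepD(3)[OF fin_normalD[OF L]]])
  thus "\<exists>v. zval K (V \<inter> K) v" by (rule fin_normal_zval_ratfun[OF K])
qed

lemma inertia_trivial:
  assumes L: "fin_normal K L" and V: "vprime L V" and ram: "ram_index_one K L V"
    and s: "s \<in> auts K" "\<And>x. x \<in> V ==> s x - x \<in> mm V" and x: "x \<in> L"
  shows "s x = x"
proof -
  obtain v where v: "zval L V v" using relative_zval[OF L V] by blast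
  note n = fin_normalD[OF L]
  have p: "prime CHAR('a)" by (rule prime_CHAR_finite_field)
  show ?thesis
    by (rule unramified_imp_inertia_trivial[OF v tK normal_sepD(3)[OF n] ram p _ vprime_residue[OF V] autsD(1)[OF s(1)]
          normal_sepD(4)[OF n s(1)] autsD(3)[OF s(1)] s(2) x]) simp_all
qed

lemma decomposition_trivial:
  assumes L: "fin_normal K L" and V: "vprime L V" and ram: "ram_index_one K L V" "res_degree_one K V"
    and s: "s \<in> auts K" "\<And>x. x \<in> mm V ==> s x \<in> mm V" and x: "x \<in> L"
  shows "s x = x"
proof -
  obtain v where v: "zval L V v" using relative_zval[OF L V] by blast
  note n = fin_normalD[OF L]
  have p: "prime CHAR('a)" by (rule prime_CHAR_finite_field)
  show ?thesis
    by (rule split_imp_decomposition_trivial[OF v tK normal_sepD(3)[OF n] ram p _ vprime_residue[OF V] autsD(1)[OF s(1)]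
          normal_sepD(4)[OF n s(1)] autsD(3)[OF s(1)] s(2) x]) simp_all
qed

lemma unramifiedI:
  assumes fn: "fin_normal K L" and V: "vprime L V"
    and I: "\<And>s x. s \<in> auts K ==> \<forall>x\<in>V. s x - x \<in> mm V ==> x \<in> L ==> s x = x"
  shows "ram_index_one K L V"
proof -
  obtain v where v: "zval L V v" using relative_zval[OF fn V] by blast
  interpret fin_auts "auts K" L by (rule fin_normal_auts(1)[OF fn kK])
  interpret val_auts "auts K" L V v by unfold_locales (rule v)
  have "\<forall>s\<in>Ig. \<forall>x\<in>L. s x = x" using I unfolding Ig_def by blast
  thus ?thesis using inertia_trivial_imp_unramified fin_normal_auts(2)[OF fn kK] by simp
qed

lemma splitI:
  assumes fn: "fin_normal K L" and V: "vprime L V"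
    and D: "\<And>s x. s \<in> auts K ==> \<forall>x\<in>mm V. s x \<in> mm V ==> x \<in> L ==> s x = x"
  shows "ram_index_one K L V" "res_degree_one K V"
proof -
  obtain v where v: "zval L V v" using relative_zval[OF fn V] by blast
  interpret fin_auts "auts K" L by (rule fin_normal_auts(1)[OF fn kK])
  interpret val_auts "auts K" L V v by unfold_locales (rule v)
  have "\<forall>x\<in>L. s x = x" if s: "s \<in> Dg" for s
    using D[OF DgD(1)[OF s]] Dg_max_ideal[OF s] VL(2) by blast
  hence d: "\<forall>s\<in>Dg. \<forall>x\<in>L. s x = x" by blast
  show "ram_index_one K L V" "res_degree_one K V"
    using decomposition_trivial_imp_split[OF d] fin_normal_auts(2)[OF fn kK] by simp_all
qed

abbreviation "hilbert_ext L \<equiv> abelian_ext K L \<and> unramified_ext K L \<and> infinity_splits K L"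

lemma hilbert_ext_normal:
  assumes "hilbert_ext L" shows "normal_sep K L" "commuting K L" "kk \<subseteq> L" "K \<subseteq> L" "tfield L"
proof -
  show n: "normal_sep K L" "commuting K L" using abelian_ext_imp[OF tfield_ratfun alg_over_ratfun kK] assms by blast+
  show "kk \<subseteq> L" "K \<subseteq> L" "tfield L" using normal_sepD(2,3)[OF n(1)] kK by blast+
qed

lemma hilbert_ext_prime:
  assumes L: "hilbert_ext L" and V: "vprime L V"
  shows "ram_index_one K L V" "var_T \<notin> V ==> res_degree_one K V"
proof -
  have "is_prime_of L V" using is_prime_of_iff_vprime[OF hilbert_ext_normal(5,3)[OF L]] V by blast
  thus "ram_index_one K L V" "var_T \<notin> V ==> res_degree_one K V"
    using L vprime_infinite(1)[OF V] unfolding unramified_ext_def infinity_splits_def by blast+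
qed

text \<open>\<open>L\<close> may be infinite, so automorphisms are examined on a finite piece
  \<open>E\<close>, where the valuation is discrete. The two alternatives of the last assumption are
  the inertia condition at any prime and the decomposition condition at infinity.\<close>

lemma hilbert_ext_piece_trivial:
  assumes L: "hilbert_ext L" and E: "fin_normal K E" "E \<subseteq> L" and V: "vprime L V" and s: "s \<in> auts K" and x: "x \<in> E"
    and *: "(\<forall>x\<in>V \<inter> E. s x - x \<in> mm (V \<inter> E)) \<or> (var_T \<notin> V \<and> (\<forall>x\<in>mm (V \<inter> E). s x \<in> mm (V \<inter> E)))"
  shows "s x = x"
proof -
  note n = fin_normalD[OF E(1)]
  have kE: "kk \<subseteq> E" using kK normal_sepD(3)[OF n] by blast
  have VE: "vprime E (V \<inter> E)" by (rule vprime_restrict(1)[OF V normal_sepD(2)[OF n] kE E(2)])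
  note r = ram_index_one_restrict[OF V normal_sepD(2,3)[OF n] E(2) hilbert_ext_prime(1)[OF L V]]
  show ?thesis
    using *
  proof
    assume "\<forall>x\<in>V \<inter> E. s x - x \<in> mm (V \<inter> E)"
    thus ?thesis using inertia_trivial[OF E(1) VE r s _ x] by blast
  next
    assume d: "var_T \<notin> V \<and> (\<forall>x\<in>mm (V \<inter> E). s x \<in> mm (V \<inter> E))"
    hence "res_degree_one K (V \<inter> E)"
      using res_degree_one_restrict[OF V normal_sepD(2,3)[OF n] E(2) hilbert_ext_prime(2)[OF L V]] by blast
    thus ?thesis using decomposition_trivial[OF E(1) VE r _ s _ x] d by blast
  qed
qed

text \<open>The compositum of all competitors is again one. Ramification and residue degree are
  tested element by element on finite normal pieces, whose generators come from finitely many
  competitors; on each of these, inertia and decomposition at infinity act trivially.\<close>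

lemma hilbert_class_field_exists: "\<exists>H. is_hilbert_class_field K H"
proof -
  define H where "H = adjoin K (\<Union>{L. hilbert_ext L})"
  have LH: "L \<subseteq> H" if "hilbert_ext L" for L
    using adjoin_incl(2)[of "\<Union>{L. hilbert_ext L}" K] that unfolding H_def by blast
  have tH: "tfield H" and KH: "K \<subseteq> H" unfolding H_def by (rule tfield_adjoin, rule adjoin_incl(1))
  have nH: "normal_sep K H"
    unfolding H_def
  proof (rule normal_sep_adjoin[OF tfield_ratfun alg_over_ratfun kK tK])
    fix x assume "x \<in> \<Union>{L. hilbert_ext L}"
    then obtain L where L: "hilbert_ext L" "x \<in> L" by blast
    show "sep_elem K x" by (rule normal_sep_sep_elem[OF alg_over_ratfun kK hilbert_ext_normal(1)[OF L(1)] L(2)])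
    show "s x \<in> adjoin K (\<Union>{L. hilbert_ext L})" if s: "s \<in> auts K" for s
      using normal_sepD(4)[OF hilbert_ext_normal(1)[OF L(1)] s L(2)] LH[OF L(1)] unfolding H_def by blast
  qed
  have cH: "commuting K H"
    unfolding H_def
  proof (rule commuting_adjoin)
    fix s t x assume s: "s \<in> auts K" "t \<in> auts K" and "x \<in> \<Union>{L. hilbert_ext L}"
    then obtain L where L: "hilbert_ext L" "x \<in> L" by blast
    show "s (t x) = t (s x)" using hilbert_ext_normal(2)[OF L(1)] s L(2) unfolding commuting_def by blast
  qed
  have ab: "abelian_ext K H" by (rule abelian_extI[OF tfield_ratfun alg_over_ratfun kK nH cH])
  have kH: "kk \<subseteq> H" using kK KH by blast
  have piece: "\<exists>E. fin_normal K E \<and> E \<subseteq> H \<and> x \<in> E \<and> (\<forall>V. vprime H V --> ram_index_one K E (V \<inter> E) \<and>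
      (var_T \<notin> V --> res_degree_one K (V \<inter> E)))" if x: "x \<in> H" for x
  proof -
    obtain S where S: "finite S" "S \<subseteq> \<Union>{L. hilbert_ext L}" "x \<in> adjoin K S"
      using adjoin_finite_support[OF x[unfolded H_def]] by blast
    define S' where "S' = (\<Union>s\<in>S. orb K s)"
    define E where "E = adjoin K S'"
    have SH: "S \<subseteq> H" using S(2) LH by blast
    note oc = orbit_closure[OF tfield_ratfun alg_over_ratfun kK tK S(1) nH SH, folded S'_def E_def]
    have fE: "fin_normal K E" unfolding fin_normal_def using oc(1,4) E_def by blast
    have xE: "x \<in> E" using S(3) adjoin_mono[OF oc(2), of K] unfolding E_def by blast
    have kE: "kk \<subseteq> E" using kK normal_sepD(3)[OF oc(4)] by blast
    have triv: "s y = y" if V: "vprime H V" and s: "s \<in> auts K" and y: "y \<in> E"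
      and c: "(\<forall>x\<in>V \<inter> E. s x - x \<in> mm (V \<inter> E)) \<or> (var_T \<notin> V \<and> (\<forall>x\<in>mm (V \<inter> E). s x \<in> mm (V \<inter> E)))"
      for V s y
    proof -
      have mE: "mm (V \<inter> E) = mm V \<inter> E"
        by (rule vring_restrict(2)[OF vprimeD(1)[OF V] normal_sepD(2)[OF oc(4)] oc(5)])
      have gen: "s u = u" if "u \<in> S'" for u
      proof -
        obtain a where a: "a \<in> S" "u \<in> orb K a" using \<open>u \<in> S'\<close> by (auto simp: S'_def)
        obtain L where L: "hilbert_ext L" "a \<in> L" using S(2) a(1) by blast
        note hn = hilbert_ext_normal[OF L(1)]
        \<comment> \<open>The orbit of a single generator stays inside one competitor
          \<open>L\<close>, where triviality is known.\<close>
        define D where "D = adjoin K (\<Union>s\<in>{a}. orb K s)"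
        have aL: "{a} \<subseteq> L" using L(2) by blast
        note od = orbit_closure[OF tfield_ratfun alg_over_ratfun kK tK _ hn(1) aL, folded D_def]
        have fD: "fin_normal K D" unfolding fin_normal_def using od(1,4) D_def by blast
        have DE: "D \<subseteq> E" unfolding D_def E_def by (rule adjoin_mono) (use a(1) in "auto simp: S'_def")
        have uD: "u \<in> D" using a(2) adjoin_incl(2)[of "\<Union>s\<in>{a}. orb K s" K] unfolding D_def by blast
        have tD: "tfield D" unfolding D_def by (rule tfield_adjoin)
        have VL: "vprime L (V \<inter> L)" by (rule vprime_restrict(1)[OF V hn(5,3) LH[OF L(1)]])
        have e: "V \<inter> L \<inter> D = V \<inter> D" using od(5) by blast
        have mD: "mm (V \<inter> D) = mm V \<inter> D"
          by (rule vring_restrict(2)[OF vprimeD(1)[OF V] tD]) (use DE oc(5) in blast)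
        have sD: "s x \<in> D" if "x \<in> D" for x using normal_sepD(4)[OF fin_normalD[OF fD] s that] .
        have "(\<forall>x\<in>V \<inter> D. s x - x \<in> mm (V \<inter> D)) \<or> (var_T \<notin> V \<inter> L \<and> (\<forall>x\<in>mm (V \<inter> D). s x \<in> mm (V \<inter> D)))"
          using c
        proof
          assume "\<forall>x\<in>V \<inter> E. s x - x \<in> mm (V \<inter> E)"
          hence "\<forall>x\<in>V \<inter> D. s x - x \<in> mm (V \<inter> D)"
            unfolding mE mD using DE sD tsubring_diff[OF tfieldD(1)[OF tD]] by blast
          thus ?thesis ..
        next
          assume "var_T \<notin> V \<and> (\<forall>x\<in>mm (V \<inter> E). s x \<in> mm (V \<inter> E))"
          hence "var_T \<notin> V \<inter> L \<and> (\<forall>x\<in>mm (V \<inter> D). s x \<in> mm (V \<inter> D))"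
            unfolding mE mD using DE sD by blast
          thus ?thesis ..
        qed
        from hilbert_ext_piece_trivial[OF L(1) fD od(5) VL s uD, unfolded e, OF _ this] show ?thesis by simp
      qed
      show ?thesis
        using rhom_eq_adjoin[of s id K S' y] autsD(1)[OF s] autsD(1)[OF auts_id] autsD(3)[OF s] gen y
        unfolding E_def by simp
    qed
    have "ram_index_one K E (V \<inter> E) \<and> (var_T \<notin> V --> res_degree_one K (V \<inter> E))" if V: "vprime H V" for V
    proof -
      have VE: "vprime E (V \<inter> E)" by (rule vprime_restrict(1)[OF V normal_sepD(2)[OF oc(4)] kE oc(5)])
      have "ram_index_one K E (V \<inter> E)" by (rule unramifiedI[OF fE VE]) (use triv[OF V] in blast)
      moreover have "res_degree_one K (V \<inter> E)" if "var_T \<notin> V" by (rule splitI(2)[OF fE VE]) (use triv[OF V] that in blast)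
      ultimately show ?thesis by blast
    qed
    thus ?thesis using fE oc(5) xE by blast
  qed
  have ram: "ram_index_one K H V" if V: "vprime H V" for V
    unfolding ram_index_one_def
  proof
    fix x assume x: "x \<in> H - {0}"
    obtain E where "x \<in> E" "ram_index_one K E (V \<inter> E)" using piece x V by blast
    thus "\<exists>y\<in>K - {0}. x * inverse y \<in> V \<and> y * inverse x \<in> V" using x unfolding ram_index_one_def by blast
  qed
  have res: "res_degree_one K V" if V: "vprime H V" "var_T \<notin> V" for V
    unfolding res_degree_one_def
  proof
    fix x assume x: "x \<in> V"
    obtain E where E: "x \<in> E" "fin_normal K E" "E \<subseteq> H" "res_degree_one K (V \<inter> E)" using piece[of x] x V vringD(4)[OF vprimeD(1)[OF V(1)] x] by blast
    then obtain y where y: "y \<in> V \<inter> E \<inter> K" "x - y \<in> mm (V \<inter> E)" using x unfolding res_degree_one_def by blast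
    have "mm (V \<inter> E) = mm V \<inter> E"
      by (rule vring_restrict(2)[OF vprimeD(1)[OF V(1)] normal_sepD(2)[OF fin_normalD[OF E(2)]] E(3)])
    thus "\<exists>y\<in>V \<inter> K. x - y \<in> mm V" using y by blast
  qed
  have vp: "is_prime_of H V \<longleftrightarrow> vprime H V" for V by (rule is_prime_of_iff_vprime[OF tH kH])
  have "unramified_ext K H" unfolding unramified_ext_def vp using ram by blast
  moreover have "infinity_splits K H"
    unfolding infinity_splits_def vp
  proof (intro allI impI)
    fix V assume V: "vprime H V \<and> V \<inter> kk = infinite_prime"
    have "var_T \<notin> V" by (rule infinite_prime_var) (use V in blast)
    thus "ram_index_one K H V \<and> res_degree_one K V" using ram res V by blast
  qed
  ultimately have "is_hilbert_class_field K H" using ab LH unfolding is_hilbert_class_field_def Let_def by blast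
  thus ?thesis by blast
qed

end

section \<open>Products of groups of automorphisms\<close>

definition subgrp :: "('b => 'b) set => ('b => 'b) set => bool" where
  "subgrp A H \<longleftrightarrow> H \<subseteq> A \<and> id \<in> H \<and> (\<forall>s\<in>H. \<forall>t\<in>H. s \<circ> t \<in> H) \<and>
     (\<forall>s\<in>H. \<exists>t\<in>H. \<forall>x. t (s x) = x \<and> s (t x) = x)"

lemma subgrpD:
  assumes "subgrp A H"
  shows "s \<in> H ==> s \<in> A" "id \<in> H" "s \<in> H ==> t \<in> H ==> s \<circ> t \<in> H"
    "s \<in> H ==> \<exists>t\<in>H. \<forall>x. t (s x) = x \<and> s (t x) = x"
  using assms by (auto simp: subgrp_def)

lemma (in fin_auts) fin_auts_subgrp:
  assumes H: "subgrp A H" shows "fin_auts H L"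
proof
  show "finite ((\<lambda>s. restrict s L) ` H)" using finite_restr subgrpD(1)[OF H] by (meson finite_subset image_mono subsetI)
qed (use L rh stab subgrpD[OF H] in blast)+

context fin_auts
begin

text \<open>Products are formed modulo agreement on \<open>L\<close>: the empty product is the
  kernel of restriction to \<open>L\<close>, and the factors have to reproduce \<open>s\<close> on
  \<open>L\<close> only.\<close>

fun prods :: "('b => 'b) set list => ('b => 'b) set" where
  "prods [] = {s\<in>A. \<forall>x\<in>L. s x = x}" |
  "prods (H # Hs) = {s\<in>A. \<exists>i\<in>H. \<exists>t\<in>prods Hs. \<forall>x\<in>L. s x = i (t x)}"

lemma prods_sub: "prods Hs \<subseteq> A"
  by (cases Hs) auto

lemma prods_ConsI:
  "s \<in> A ==> i \<in> H ==> t \<in> prods Hs ==> \<forall>x\<in>L. s x = i (t x) ==> s \<in> prods (H # Hs)"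
  by auto

context
  assumes commute: "\<forall>s\<in>A. \<forall>t\<in>A. \<forall>x\<in>L. s (t x) = t (s x)"
begin

lemma prods_cong: "s \<in> A ==> t \<in> prods Hs ==> \<forall>x\<in>L. s x = t x ==> s \<in> prods Hs"
  by (cases Hs) auto

text \<open>Commutation is available only on \<open>L\<close>, so factors are moved past each other
  pointwise there; inverses on the whole field come from \<open>A\<close>.\<close>

lemma prods_subgrp: "\<forall>H\<in>set Hs. subgrp A H ==> subgrp A (prods Hs)"
proof (induction Hs)
  case Nil
  show ?case
    unfolding subgrp_def
  proof (intro conjI ballI)
    show "\<exists>t\<in>prods []. \<forall>x. t (s x) = x \<and> s (t x) = x" if s: "s \<in> prods []" for s
    proof -
      have sA: "s \<in> A" using s by simp
      obtain t where t: "t \<in> A" "\<forall>x. t (s x) = x \<and> s (t x) = x" using inv_A[OF sA] by blast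
      have "t x = x" if "x \<in> L" for x
      proof -
        have "s x = x" using s that by simp
        thus ?thesis using t(2) by metis
      qed
      thus ?thesis using t by auto
    qed
  qed (use id_A comp_A stab in auto)
next
  case (Cons H Hs)
  hence H: "subgrp A H" and P: "subgrp A (prods Hs)" by auto
  show ?case
    unfolding subgrp_def
  proof (intro conjI ballI)
    show "prods (H # Hs) \<subseteq> A" by (rule prods_sub)
    show "id \<in> prods (H # Hs)" by (rule prods_ConsI[OF id_A subgrpD(2)[OF H] subgrpD(2)[OF P]]) simp
  next
    fix s s' assume s: "s \<in> prods (H # Hs)" and s': "s' \<in> prods (H # Hs)"
    obtain i t where a: "s \<in> A" "i \<in> H" "t \<in> prods Hs" "\<forall>x\<in>L. s x = i (t x)" using s by auto
    obtain i' t' where b: "s' \<in> A" "i' \<in> H" "t' \<in> prods Hs" "\<forall>x\<in>L. s' x = i' (t' x)" using s' by auto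
    show "s \<circ> s' \<in> prods (H # Hs)"
    proof (rule prods_ConsI[OF comp_A[OF a(1) b(1)] subgrpD(3)[OF H a(2) b(2)] subgrpD(3)[OF P a(3) b(3)]], rule ballI)
      fix x assume x: "x \<in> L"
      have tx: "t' x \<in> L" by (rule stab[OF subgrpD(1)[OF P b(3)] x])
      have "t (i' (t' x)) = i' (t (t' x))" using commute subgrpD(1)[OF P a(3)] subgrpD(1)[OF H b(2)] tx by blast
      moreover have "s' x \<in> L" by (rule stab[OF b(1) x])
      ultimately show "(s \<circ> s') x = (i \<circ> i') ((t \<circ> t') x)" using a(4) b(4) x by simp
    qed
  next
    fix s assume s: "s \<in> prods (H # Hs)"
    obtain i t where a: "s \<in> A" "i \<in> H" "t \<in> prods Hs" "\<forall>x\<in>L. s x = i (t x)" using s by auto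
    obtain i' where i': "i' \<in> H" "\<forall>x. i' (i x) = x" using subgrpD(4)[OF H a(2)] by blast
    obtain t' where t': "t' \<in> prods Hs" "\<forall>x. t' (t x) = x" using subgrpD(4)[OF P a(3)] by blast
    obtain s' where s': "s' \<in> A" "\<forall>x. s' (s x) = x \<and> s (s' x) = x" using inv_A[OF a(1)] by blast
    have "s' \<in> prods (H # Hs)"
    proof (rule prods_ConsI[OF s'(1) i'(1) t'(1)], rule ballI)
      fix x assume x: "x \<in> L"
      have y: "s' x \<in> L" by (rule stab[OF s'(1) x])
      have "i' (t' x) = t' (i' x)" using commute subgrpD(1)[OF P t'(1)] subgrpD(1)[OF H i'(1)] x by metis
      moreover have "i (t (s' x)) = x" using a(4) y s'(2) by metis
      hence "t' (i' x) = s' x" using i'(2) t'(2) by metis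
      ultimately show "s' x = i' (t' x)" by simp
    qed
    thus "\<exists>t\<in>prods (H # Hs). \<forall>x. t (s x) = x \<and> s (t x) = x" using s'(2) by blast
  qed
qed

lemma prods_incl: "\<forall>H\<in>set Hs. subgrp A H ==> H \<in> set Hs ==> s \<in> H ==> s \<in> prods Hs"
proof (induction Hs)
  case (Cons H' Hs)
  have H': "subgrp A H'" and P: "subgrp A (prods Hs)" using Cons.prems(1) prods_subgrp by auto
  have sA: "s \<in> A" using Cons.prems subgrpD(1) by blast
  show ?case
  proof (cases "H = H'")
    case True
    hence "s \<in> H'" using Cons.prems(3) by simp
    thus ?thesis by (rule prods_ConsI[OF sA _ subgrpD(2)[OF P]]) simp
  next
    case False
    hence "s \<in> prods Hs" using Cons by simp
    thus ?thesis by (rule prods_ConsI[OF sA subgrpD(2)[OF H']]) simp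
  qed
qed simp

context
  fixes J :: "'i set" and H :: "'i => ('b => 'b) set" and Y :: "'i => 'b set"
  assumes H: "\<And>j. j \<in> J ==> subgrp A (H j)" and YL: "\<And>j. j \<in> J ==> Y j \<subseteq> L"
    and fixes_other: "\<forall>j\<in>J. \<forall>j'\<in>J. j' \<noteq> j --> (\<forall>i\<in>H j. \<forall>y\<in>Y j'. i y = y)"
begin

lemma prods_fix:
  "set js \<subseteq> J ==> j \<in> J ==> j \<notin> set js ==> t \<in> prods (map H js) ==> y \<in> Y j ==> t y = y"
proof (induction js arbitrary: t)
  case Nil
  thus ?case using YL by auto
next
  case (Cons j' js)
  obtain i \<rho> where a: "i \<in> H j'" "\<rho> \<in> prods (map H js)" "\<forall>x\<in>L. t x = i (\<rho> x)" using Cons.prems(4) by auto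
  have "\<rho> y = y" using Cons a(2) by simp
  moreover have "i y = y" using fixes_other a(1) Cons.prems by auto
  ultimately show ?case using a(3) YL[OF Cons.prems(2)] Cons.prems(5) by auto
qed

lemma prods_trivial:
  assumes triv: "\<And>j i x. j \<in> J ==> i \<in> H j ==> \<forall>j'\<in>J. \<forall>y\<in>Y j'. i y = y ==> x \<in> L ==> i x = x"
  shows "set js \<subseteq> J ==> distinct js ==> h \<in> prods (map H js) ==> \<forall>j\<in>J. \<forall>y\<in>Y j. h y = y ==> x \<in> L ==> h x = x"
proof (induction js arbitrary: h)
  case Nil
  thus ?case by simp
next
  case (Cons j js)
  obtain i t where a: "i \<in> H j" "t \<in> prods (map H js)" "\<forall>x\<in>L. h x = i (t x)" using Cons.prems(3) by auto
  have j: "j \<in> J" "j \<notin> set js" "set js \<subseteq> J" "distinct js" using Cons.prems by auto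
  have tA: "t \<in> A" using a(2) prods_sub by blast
  have "\<forall>j'\<in>J. \<forall>y\<in>Y j'. i y = y"
  proof (intro ballI)
    fix j' y assume j': "j' \<in> J" and y: "y \<in> Y j'"
    show "i y = y"
    proof (cases "j' = j")
      case True
      have "t y = y" by (rule prods_fix[OF j(3,1,2) a(2)]) (use y True in simp)
      moreover have "h y = y" using Cons.prems(4) j' y by blast
      moreover have "h y = i (t y)" using a(3) YL[OF j'] y by blast
      ultimately show ?thesis by simp
    next
      case False
      thus ?thesis using fixes_other j(1) j' a(1) y by blast
    qed
  qed
  hence ix: "i x = x" if "x \<in> L" for x using triv[OF j(1) a(1) _ that] by blast
  have ht: "h x = t x" if "x \<in> L" for x using a(3) ix stab[OF tA that] that by simp
  have "\<forall>j\<in>J. \<forall>y\<in>Y j. t y = y"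
  proof (intro ballI)
    fix j' y assume j': "j' \<in> J" and y: "y \<in> Y j'"
    have "h y = y" using Cons.prems(4) j' y by blast
    thus "t y = y" using ht[of y] YL[OF j'] y by auto
  qed
  hence "t x = x" by (rule Cons.IH[OF j(3,4) a(2) _ Cons.prems(5)])
  thus ?case using ht[OF Cons.prems(5)] by simp
qed

end
end
end

lemma (in val_auts) subgrp_Dg: "subgrp A Dg"
  unfolding subgrp_def
proof (intro conjI ballI)
  show "Dg \<subseteq> A" using DgD(1) by blast
  show "id \<in> Dg" using id_A by (simp add: Dg_def)
  show "s \<circ> t \<in> Dg" if "s \<in> Dg" "t \<in> Dg" for s t by (rule Dg_comp[OF that])
  fix s assume s: "s \<in> Dg"
  obtain t where t: "t \<in> A" "\<forall>x. t (s x) = x \<and> s (t x) = x" using inv_A[OF DgD(1)[OF s]] by blast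
  hence "t \<in> Dg" using Dg_inv[OF s t(1)] by blast
  thus "\<exists>t\<in>Dg. \<forall>x. t (s x) = x \<and> s (t x) = x" using t(2) by blast
qed

lemma (in val_auts) subgrp_Ig: "subgrp A Ig"
  unfolding subgrp_def
proof (intro conjI ballI)
  show "Ig \<subseteq> A" by (auto simp: Ig_def)
  show "id \<in> Ig" using id_A mmD(2)[OF V] by (simp add: Ig_def)
  have IgD: "s x - x \<in> m" "s x \<in> V" if "s \<in> Ig" "x \<in> V" for s x
  proof -
    show "s x - x \<in> m" using that by (simp add: Ig_def)
    thus "s x \<in> V" using vring_cong_in[OF V] that(2) by blast
  qed
  show "s \<circ> t \<in> Ig" if s: "s \<in> Ig" and t: "t \<in> Ig" for s t
  proof -
    have "(s \<circ> t) x - x \<in> m" if "x \<in> V" for x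
      using mm_cong_trans[OF V IgD(1)[OF s IgD(2)[OF t that]] IgD(1)[OF t that]] by simp
    moreover have "s \<circ> t \<in> A" using comp_A s t by (simp add: Ig_def)
    ultimately show ?thesis by (simp add: Ig_def)
  qed
  fix s assume s: "s \<in> Ig"
  obtain t where t: "t \<in> A" "\<forall>x. t (s x) = x \<and> s (t x) = x" using inv_A[OF DgD(1)[OF Ig_Dg[OF s]]] by blast
  hence tD: "t \<in> Dg" using Dg_inv[OF Ig_Dg[OF s] t(1)] by blast
  have "t x - x \<in> m" if x: "x \<in> V" for x
  proof -
    have "t x \<in> V" using DgD(2)[OF tD VL(1)[OF x]] x by blast
    hence "s (t x) - t x \<in> m" by (rule IgD(1)[OF s])
    thus ?thesis using mm_cong_sym[OF V] t(2) by simp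
  qed
  hence "t \<in> Ig" using t(1) by (simp add: Ig_def)
  thus "\<exists>t\<in>Ig. \<forall>x. t (s x) = x \<and> s (t x) = x" using t(2) by blast
qed

lemma map_foldr_witt_add:
  assumes h: "is_rhom h" and p: "prime p" and len: "\<forall>j\<in>set js. length (f j) = v" "length y = v"
  shows "map h (foldr (witt_add p) (map f js) y) = foldr (witt_add p) (map (\<lambda>j. map h (f j)) js) (map h y)"
  using len(1)
proof (induction js)
  case (Cons j js)
  have "length (foldr (witt_add p) (map f js) y) = v" using Cons.prems len(2) by (induction js) auto
  thus ?case using map_witt_add[OF p h, of "f j" "foldr (witt_add p) (map f js) y"] Cons by simp
qed simp

lemma asw_foldr_witt_add:
  fixes y :: "'b::field list"
  assumes p: "prime p" "p = CHAR('b)" and len: "\<forall>j\<in>set js. length (f j) = v" "length y = v"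
  shows "asw p (foldr (witt_add p) (map f js) y) = foldr (witt_add p) (map (\<lambda>j. asw p (f j)) js) (asw p y)"
  using len(1)
proof (induction js)
  case (Cons j js)
  have "length (foldr (witt_add p) (map f js) y) = v" using Cons.prems len(2) by (induction js) auto
  thus ?case using asw_add[OF p, of "f j" "foldr (witt_add p) (map f js) y"] Cons by simp
qed simp

lemma foldr_witt_add_closed:
  "prime p ==> tsubring R ==> \<forall>j\<in>set js. set (f j) \<subseteq> R ==> set y \<subseteq> R ==> set (foldr (witt_add p) (map f js) y) \<subseteq> R"
  by (induction js) (simp_all add: witt_add_closed)

section \<open>The genus field\<close>

text \<open>The data are restated over the closure, with every right-hand side expressed through
  \<open>asw\<close>. \<open>P\<close> lists the primes that may occur in denominators.\<close>

locale witt_data =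
  fixes p n r :: nat and K :: "'a::{finite,field} ac set" and P :: "nat => 'a poly"
    and w z :: "nat => 'a ac list" and w' :: "nat => nat => 'a ac list"
  assumes p: "p = CHAR('a)"
    and K: "abelian_ext kk K" "K = adjoin kk (\<Union>i\<in>{1..n}. set (w i))"
    and P: "inj_on P {1..r}" "\<And>j. j \<in> {1..r} ==> irred (P j) \<and> lcoeff (P j) = 1"
    and len: "\<And>i. i \<in> {1..n} ==> length (z i) = length (w i)"
      "\<And>i j. i \<in> {1..n} ==> j \<in> {1..r} ==> length (w' i j) = length (w i)"
    and sum: "\<And>i. i \<in> {1..n} ==> asw p (w i) = foldr (witt_add p) (map (\<lambda>j. asw p (w' i j)) [1..<Suc r]) (asw p (z i))"
    and delta: "\<And>i j u. i \<in> {1..n} ==> j \<in> {1..r} ==> u \<in> set (asw p (w' i j)) ==> \<exists>c. u = to_ac c \<and> proper_fraction_at (P j) c"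
    and gamma: "\<And>i u. i \<in> {1..n} ==> u \<in> set (asw p (z i)) ==> \<exists>c. u = to_ac c \<and> is_polynomial c"
begin

definition gens where "gens = (\<Union>i\<in>{1..n}. \<Union>j\<in>{1..r}. set (w' i j)) \<union> (\<Union>i\<in>{1..n}. set (z i))"

definition G where "G = adjoin kk gens"

definition js where "js = [1..<Suc r]"

lemma set_js: "set js = {1..r}" "distinct js"
  by (auto simp: js_def)

lemma pp: "prime p" "p = CHAR('a ac)"
  using prime_CHAR_finite_field[where ?'a = 'a] p by simp_all

lemma gens_G: "i \<in> {1..n} ==> j \<in> {1..r} ==> set (w' i j) \<subseteq> G" "i \<in> {1..n} ==> set (z i) \<subseteq> G"
  using adjoin_incl(2)[of gens kk] unfolding G_def gens_def by blast+

lemma tG: "tfield G" "kk \<subseteq> G"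
  unfolding G_def by (rule tfield_adjoin, rule adjoin_incl(1))

lemma asw_ratfun: "i \<in> {1..n} ==> j \<in> {1..r} ==> set (asw p (w' i j)) \<subseteq> kk"
  "i \<in> {1..n} ==> set (asw p (z i)) \<subseteq> kk"
  using delta gamma unfolding ratfun_field_def by blast+

lemma G_abelian: "normal_sep kk G" "commuting kk G"
proof -
  let ?Ws = "(\<lambda>(i, j). w' i j) ` ({1..n} \<times> {1..r}) \<union> z ` {1..n}"
  have e: "(\<Union>w\<in>?Ws. set w) = gens" by (auto simp: gens_def)
  have "set (asw p w) \<subseteq> kk" if w: "w \<in> ?Ws" for w
    using w
  proof
    assume "w \<in> (\<lambda>(i, j). w' i j) ` ({1..n} \<times> {1..r})"
    thus ?thesis using asw_ratfun(1) by (auto simp del: atLeastAtMost_iff)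
  next
    assume "w \<in> z ` {1..n}"
    thus ?thesis using asw_ratfun(2) by (auto simp del: atLeastAtMost_iff)
  qed
  from witt_extension[OF pp tfield_ratfun alg_over_ratfun _ this, of ?Ws]
  show "normal_sep kk G" "commuting kk G" unfolding e G_def by auto
qed

lemma K_fin: "fin_normal kk K" "kk \<subseteq> K" "tfield K"
proof -
  have n: "normal_sep kk K" by (rule abelian_ext_imp(1)[OF tfield_ratfun alg_over_ratfun subset_refl K(1)])
  thus "kk \<subseteq> K" "tfield K" using normal_sepD by blast+
  have "finite (\<Union>i\<in>{1..n}. set (w i))" by simp
  thus "fin_normal kk K" unfolding fin_normal_def using n K(2) by blast
qed

text \<open>A second solution of the equation of \<open>w i\<close>, with components in
  \<open>G\<close>.\<close>

definition t where "t i = foldr (witt_add p) (map (w' i) js) (z i)"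

lemma length_t: assumes "i \<in> {1..n}" shows "length (t i) = length (w i)"
proof -
  have "length (foldr (witt_add p) (map (w' i) js) (z i)) = length (w i)" if "set js \<subseteq> {1..r}" for js
    using that by (induction js) (simp_all add: len[OF assms])
  from this[of js] show ?thesis unfolding t_def set_js by simp
qed

lemma asw_t: assumes i: "i \<in> {1..n}" shows "asw p (t i) = asw p (w i)"
  unfolding t_def sum[OF i, folded js_def]
  by (rule asw_foldr_witt_add[OF pp, of _ _ "length (w i)"]) (use len[OF i] set_js in auto)

lemma t_G: assumes i: "i \<in> {1..n}" shows "set (t i) \<subseteq> G"
  unfolding t_def
proof (rule foldr_witt_add_closed[OF pp(1) tfieldD(1)[OF tG(1)] _ gens_G(2)[OF i]])
  show "\<forall>j\<in>set js. set (w' i j) \<subseteq> G" unfolding set_js using gens_G(1)[OF i] by blast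
qed

lemma KG: "K \<subseteq> G"
  unfolding K(2)
proof (rule adjoin_minimal[OF tG])
  have "set (w i) \<subseteq> G" if i: "i \<in> {1..n}" for i
  proof -
    obtain c where c: "set c \<subseteq> prime_field p" "w i = witt_add p c (t i)"
      using asw_fibre[OF pp, of "w i" "t i"] length_t[OF i] asw_t[OF i] by auto
    show ?thesis unfolding c(2) by (rule set_witt_add_prime_field[OF pp tfieldD(1)[OF tG(1)] c(1) t_G[OF i]])
  qed
  thus "(\<Union>i\<in>{1..n}. set (w i)) \<subseteq> G" by blast
qed

lemma t_fixed:
  assumes s: "s \<in> auts K" and i: "i \<in> {1..n}" shows "map s (t i) = t i"
proof -
  note h = autsD(1)[OF s]
  obtain c where c: "length c = length (w i)" "set c \<subseteq> prime_field p" "t i = witt_add p c (w i)"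
    using asw_fibre[OF pp, of "t i" "w i"] length_t[OF i] asw_t[OF i] by auto
  have "set (w i) \<subseteq> K" using adjoin_incl(2)[of "\<Union>i\<in>{1..n}. set (w i)" kk] i K(2) by blast
  hence "map s (w i) = w i" using autsD(3)[OF s] by (intro map_idI) blast
  moreover have "map s c = c" using c(2) prime_field_fixed[OF pp h] by (intro map_idI) blast
  ultimately show ?thesis unfolding c(3) using map_witt_add[OF pp(1) h c(1)] by simp
qed

lemma t_fixed_foldr:
  assumes s: "s \<in> auts K" and i: "i \<in> {1..n}"
  shows "foldr (witt_add p) (map (w' i) js) (z i) = foldr (witt_add p) (map (\<lambda>j. map s (w' i j)) js) (map s (z i))"
proof -
  have "map s (foldr (witt_add p) (map (w' i) js) (z i)) =
      foldr (witt_add p) (map (\<lambda>j. map s (w' i j)) js) (map s (z i))"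
    by (rule map_foldr_witt_add[OF autsD(1)[OF s] pp(1), of _ _ "length (w i)"]) (use len[OF i] set_js in auto)
  thus ?thesis using t_fixed[OF s i] unfolding t_def by simp
qed

text \<open>\<open>L\<close> is general because the lemma serves for \<open>G\<close> itself and for
  the larger field \<open>E\<close> in the proof of maximality.\<close>

lemma finite_fixes:
  assumes V: "vprime L V" "G \<subseteq> L" and Q: "irred Q" "lcoeff Q = 1" "V \<inter> kk = finite_prime Q"
    and s: "s \<in> auts kk" "\<And>x. x \<in> V ==> s x - x \<in> mm V" and i: "i \<in> {1..n}"
  shows "map s (z i) = z i" "j \<in> {1..r} ==> P j \<noteq> Q ==> map s (w' i j) = w' i j"
proof -
  have fp: "to_ac (Fract a b) \<in> V" if "b \<noteq> 0" "\<not> Q dvd b" for a b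
    using Q(3) that unfolding finite_prime_def by blast
  have fx: "map s u = u" if u: "set u \<subseteq> G" "set (asw p u) \<subseteq> kk" "set (asw p u) \<subseteq> V" for u
    by (rule inertia_fixes_witt[OF pp vprimeD(1)[OF V(1)] _ u(3) autsD(1,3)[OF s(1)] s(2)]) (use u V(2) in blast)+
  show "map s (z i) = z i"
  proof (rule fx[OF gens_G(2)[OF i] asw_ratfun(2)[OF i]])
    have "\<not> Q dvd 1" using Q(1) by (simp add: Factorial_Ring.irreducible_def)
    hence "to_ac (Fract a 1) \<in> V" for a using fp by simp
    thus "set (asw p (z i)) \<subseteq> V" using gamma[OF i] unfolding is_polynomial_def by blast
  qed
  show "map s (w' i j) = w' i j" if j: "j \<in> {1..r}" "P j \<noteq> Q"
  proof (rule fx[OF gens_G(1)[OF i j(1)] asw_ratfun(1)[OF i j(1)]])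
    show "set (asw p (w' i j)) \<subseteq> V"
    proof
      fix u assume "u \<in> set (asw p (w' i j))"
      then obtain c where c: "u = to_ac c" "proper_fraction_at (P j) c" using delta[OF i j(1)] by blast
      obtain a b where "b \<noteq> 0" "c = Fract a b"
        "{Q. irred Q \<and> lcoeff Q = 1 \<and> Q dvd b} \<subseteq> {P j}"
        using c(2) unfolding proper_fraction_at_def by blast
      hence ab: "b \<noteq> 0" "u = to_ac (Fract a b)"
        "{Q. irred Q \<and> lcoeff Q = 1 \<and> Q dvd b} \<subseteq> {P j}" using c(1) by simp_all
      hence "\<not> Q dvd b" using Q j(2) by blast
      thus "u \<in> V" using fp ab(1,2) by blast
    qed
  qed
qed

lemma infinite_fixes:
  assumes V: "vprime L V" "G \<subseteq> L" "var_T \<notin> V"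
    and s: "s \<in> auts kk" "\<And>x. x \<in> mm V ==> s x \<in> mm V" and i: "i \<in> {1..n}" and j: "j \<in> {1..r}"
  shows "map s (w' i j) = w' i j"
proof (rule decomposition_fixes_witt[OF pp vprimeD(1)[OF V(1)] _ _ autsD(1,3)[OF s(1)] s(2)])
  show "set (w' i j) \<subseteq> L" using gens_G(1)[OF i j] V(2) by blast
  show "u \<in> kk" if "u \<in> set (asw p (w' i j))" for u using asw_ratfun(1)[OF i j] that by blast
  show "set (asw p (w' i j)) \<subseteq> mm V"
  proof
    fix u assume "u \<in> set (asw p (w' i j))"
    then obtain c where c: "u = to_ac c" "proper_fraction_at (P j) c" using delta[OF i j] by blast
    obtain a b where ab: "b \<noteq> 0" "c = Fract a b" "a = 0 \<or> pdeg a < pdeg b"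
      using c(2) unfolding proper_fraction_at_def by blast
    have u: "u = emb a / emb b" using c(1) ab(2) to_ac_Fract by simp
    have "u \<in> mm (V \<inter> kk)"
      unfolding u by (rule proper_fraction_in_max_ideal[OF vprimeD(5,7)[OF V(1)] vprime_infinite(2)[OF V(1,3)] ab(1,3)])
    thus "u \<in> mm V" using vprimeD(6)[OF V(1)] by blast
  qed
qed

lemma G_fixed:
  assumes s: "is_rhom s" "\<And>x. x \<in> kk ==> s x = x"
    and w: "\<And>i j. i \<in> {1..n} ==> j \<in> {1..r} ==> map s (w' i j) = w' i j" "\<And>i. i \<in> {1..n} ==> map s (z i) = z i"
    and x: "x \<in> G"
  shows "s x = x"
proof -
  have fx: "s u = u" if "map s l = l" "u \<in> set l" for l u using that by (metis in_set_conv_nth nth_map)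
  have "s u = id u" if "u \<in> gens" for u
    using that fx[OF w(1)] fx[OF w(2)] unfolding gens_def by (auto simp del: atLeastAtMost_iff)
  hence "s x = id x"
    by (intro rhom_eq_adjoin[OF s(1) autsD(1)[OF auts_id] _ _ x[unfolded G_def]]) (simp_all add: s(2))
  thus ?thesis by simp
qed

lemma auts_K_k: "s \<in> auts K ==> s \<in> auts kk"
  using auts_mono[OF K_fin(2)] by blast

lemma G_decomposition_trivial:
  assumes V: "vprime G V" "var_T \<notin> V" and s: "s \<in> auts K" "\<forall>x\<in>mm V. s x \<in> mm V" and x: "x \<in> G"
  shows "s x = x"
proof (rule G_fixed[OF autsD(1)[OF s(1)] autsD(3)[OF auts_K_k[OF s(1)]] _ _ x])
  show w: "map s (w' i j) = w' i j" if "i \<in> {1..n}" "j \<in> {1..r}" for i j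
    by (rule infinite_fixes[OF V(1) subset_refl V(2) auts_K_k[OF s(1)] _ that]) (use s(2) in blast)
  show "map s (z i) = z i" if i: "i \<in> {1..n}" for i
  proof -
    have "map (\<lambda>j. map s (w' i j)) js = map (w' i) js" using w[OF i] by (intro map_cong) (auto simp: set_js)
    hence e: "foldr (witt_add p) (map (w' i) js) (z i) = foldr (witt_add p) (map (w' i) js) (map s (z i))"
      using t_fixed_foldr[OF s(1) i] by (simp only:)
    have "z i = map s (z i)"
      by (rule foldr_witt_add_cancel_end[where g = "w' i" and v = "length (w i)", OF pp(1) _ _ _ e]) (use len[OF i] set_js in auto)
    thus ?thesis by simp
  qed
qed

lemma G_inertia_trivial:
  assumes V: "vprime G V" and s: "s \<in> auts K" "\<forall>x\<in>V. s x - x \<in> mm V" and x: "x \<in> G"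
  shows "s x = x"
proof (cases "var_T \<in> V")
  case False
  have "\<forall>x\<in>mm V. s x \<in> mm V"
    using s(2) mm_cong_in[OF vprimeD(1)[OF V]] mmD(1)[OF vprimeD(1)[OF V]] by blast
  thus ?thesis by (rule G_decomposition_trivial[OF V False s(1) _ x])
next
  case True
  obtain Q where Q: "irred Q" "lcoeff Q = 1" "V \<inter> kk = finite_prime Q"
    using vprime_finite[OF V True] by blast
  note ff = finite_fixes[OF V subset_refl Q auts_K_k[OF s(1)]]
  show ?thesis
  proof (rule G_fixed[OF autsD(1)[OF s(1)] autsD(3)[OF auts_K_k[OF s(1)]] _ _ x])
    show zf: "map s (z i) = z i" if "i \<in> {1..n}" for i by (rule ff(1)[OF _ that]) (use s(2) in blast)
    have wf: "map s (w' i j) = w' i j" if "i \<in> {1..n}" "j \<in> {1..r}" "P j \<noteq> Q" for i j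
      by (rule ff(2)[OF _ that]) (use s(2) in blast)
    show "map s (w' i j) = w' i j" if i: "i \<in> {1..n}" and j: "j \<in> {1..r}" for i j
    proof (cases "P j = Q")
      \<comment> \<open>Injectivity of \<open>P\<close> ensures that \<open>j\<close> is the only
        index not covered by \<open>wf\<close>.\<close>
      case True
      have e: "foldr (witt_add p) (map (w' i) js) (z i) = foldr (witt_add p) (map (\<lambda>j. map s (w' i j)) js) (z i)"
        using t_fixed_foldr[OF s(1) i] zf[OF i] by simp
      have "w' i j = map s (w' i j)"
      proof (rule foldr_witt_add_cancel[where z' = "z i" and v = "length (w i)", OF pp(1) _ _ _ e])
        show "w' i j' = map s (w' i j')" if "j' \<in> set js" "j' \<noteq> j" for j'
        proof -
          have j': "j' \<in> {1..r}" using that(1) set_js by simp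
          hence "P j' \<noteq> Q" using inj_onD[OF P(1), of j' j] j that(2) True by auto
          thus ?thesis using wf[OF i j'] by simp
        qed
      qed (use len[OF i] j set_js in auto)
      thus ?thesis by simp
    qed (use wf i j in blast)
  qed
qed

lemma G_over_K: "fin_normal K G"
proof -
  have "normal_sep K G"
    by (rule normal_sep_intermediate[OF tfield_ratfun alg_over_ratfun subset_refl tfield_ratfun G_abelian(1) K_fin(3,2) KG])
  moreover have "adjoin K gens = G"
  proof
    show "adjoin K gens \<subseteq> G" using adjoin_minimal[OF tG(1) KG] adjoin_incl(2)[of gens kk] unfolding G_def by blast
    show "G \<subseteq> adjoin K gens" unfolding G_def
      by (rule adjoin_minimal[OF tfield_adjoin]) (use K_fin(2) adjoin_incl in blast)+
  qed
  moreover have "finite gens" by (simp add: gens_def)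
  ultimately show ?thesis unfolding fin_normal_def by blast
qed

lemma G_hilbert_ext: "abelian_ext K G" "unramified_ext K G" "infinity_splits K G"
proof -
  show "abelian_ext K G"
    by (rule abelian_extI[OF tfield_ratfun alg_over_ratfun K_fin(2) fin_normalD[OF G_over_K]
          commuting_mono[OF G_abelian(2) K_fin(2) subset_refl]])
  note vp = is_prime_of_iff_vprime[OF tG]
  show "unramified_ext K G"
    unfolding unramified_ext_def vp using unramifiedI[OF K_fin(1) G_over_K] G_inertia_trivial by blast
  show "infinity_splits K G"
    unfolding infinity_splits_def vp
    using splitI[OF K_fin(1) G_over_K] G_decomposition_trivial infinite_prime_var by blast
qed

end

section \<open>Generation by inertia groups and maximality of the genus field\<close>

lemma val_autsI: "fin_auts A L ==> zval L V v ==> val_auts A L V v"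
  by (simp add: val_auts_def val_auts_axioms_def)

text \<open>An automorphism that acts on the fixed field \<open>M\<close> of \<open>S\<close> like
  an inertia or decomposition automorphism already lies in \<open>S\<close>, hence acts trivially on
  \<open>M\<close>. So \<open>M\<close> satisfies \<open>everywhere_unramified\<close> and is the
  base field.\<close>

lemma generated_by_inertia:
  fixes E :: "'a::{finite,field} ac set"
  assumes E: "fin_normal kk E" "commuting kk E"
    and S: "subgrp (auts kk) S"
    and W: "\<And>Q. irred Q ==> lcoeff Q = 1 ==>
      place (W Q) (\<phi> Q) \<and> vprime UNIV (W Q) \<and> W Q \<inter> kk = finite_prime Q \<and>
      {s\<in>auts kk. \<forall>x\<in>W Q \<inter> E. s x - x \<in> mm (W Q \<inter> E)} \<subseteq> S"
    and U: "vprime UNIV U" "var_T \<notin> U" "{s\<in>auts kk. \<forall>x\<in>E. s x \<in> U \<inter> E \<longleftrightarrow> x \<in> U \<inter> E} \<subseteq> S"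
    and s: "s \<in> auts kk"
  shows "s \<in> S"
proof -
  let ?A = "auts (kk :: 'a ac set)" and ?k = "kk :: 'a ac set"
  note nE = fin_normalD[OF E(1)]
  note tE = normal_sepD(2)[OF nE] and kE = normal_sepD(3)[OF nE]
  have fE: "fin_auts ?A E" by (rule fin_normal_auts(1)[OF E(1) subset_refl])
  have fS: "fin_auts S E" by (rule fin_auts.fin_auts_subgrp[OF fE S])
  have SA: "S \<subseteq> ?A" using subgrpD(1)[OF S] by blast
  define M where "M = fin_auts.Fix S E"
  have MD: "x \<in> M \<longleftrightarrow> x \<in> E \<and> (\<forall>s\<in>S. s x = x)" for x by (simp add: M_def fin_auts.Fix_def[OF fS])
  have ME: "M \<subseteq> E" using MD by blast
  have kM: "?k \<subseteq> M"
  proof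
    fix x assume x: "x \<in> ?k"
    have "s x = x" if "s \<in> S" for s using autsD(3)[OF _ x] SA that by blast
    thus "x \<in> M" using subsetD[OF kE x] by (simp add: MD)
  qed
  have tM: "tfield M" unfolding M_def by (rule fin_auts.tfield_Fix[OF fS])
  \<comment> \<open>Commutativity enters here: it makes the fixed field of \<open>S\<close> stable
    under all automorphisms.\<close>
  have stM: "s x \<in> M" if s: "s \<in> ?A" and x: "x \<in> M" for s x
  proof -
    have "t (s x) = s x" if t: "t \<in> S" for t
    proof -
      have "t (s x) = s (t x)" using E(2) SA s t x ME unfolding commuting_def by blast
      moreover have "t x = x" using x t by (simp add: MD)
      ultimately show ?thesis by simp
    qed
    thus ?thesis using normal_sepD(4)[OF nE s] x by (simp add: MD)
  qed
  have fM: "fin_auts ?A M"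
  proof
    have "(\<lambda>s. restrict s M) ` ?A \<subseteq> (\<lambda>g. restrict g M) ` ((\<lambda>s. restrict s E) ` ?A)"
    proof (rule image_subsetI)
      fix s :: "'a ac => 'a ac" assume "s \<in> ?A"
      moreover have "restrict s M = restrict (restrict s E) M" using ME by (auto simp: fun_eq_iff)
      ultimately show "restrict s M \<in> (\<lambda>g. restrict g M) ` ((\<lambda>s. restrict s E) ` ?A)" by blast
    qed
    thus "finite ((\<lambda>s. restrict s M) ` ?A)" using fin_auts.finite_restr[OF fE] finite_subset by blast
    show "\<exists>t\<in>?A. \<forall>x. t (s x) = x \<and> s (t x) = x" if "s \<in> ?A" for s by (rule fin_auts.inv_A[OF fE that])
  qed (use tM stM auts_id auts_comp autsD(1) in blast)+
  have FM: "fin_auts.Fix ?A M = ?k"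
  proof -
    have "x \<in> ?k" if "x \<in> M" "\<forall>s\<in>?A. s x = x" for x using normal_sepD(5)[OF nE] ME that by blast
    thus ?thesis unfolding fin_auts.Fix_def[OF fM] using kM autsD(3) by blast
  qed
  have VE: "vprime E (V \<inter> E)" "mm (V \<inter> E) = mm V \<inter> E" and VM: "vprime M (V \<inter> M)"
    if "vprime UNIV V" for V
    using vprime_restrict[OF that tE kE] vprime_restrict(1)[OF that tM kM] by auto
  have zE: "\<exists>v. zval E (V \<inter> E) v" if "vprime UNIV V" for V
    by (rule fin_normal_zval_ratfun[OF E(1) VE(1)[OF that]])
  have zM: "\<exists>v. zval M (V \<inter> M) v" if V: "vprime UNIV V" for V
    using fin_auts.zval_over_Fix[OF fM vprimeD(1)[OF VM[OF V]]] vprime_base_zval[OF VM[OF V]] unfolding FM by blast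
  have absorb: "s \<in> S" if r: "r \<in> S" "s \<circ> r \<in> S" for s r
  proof -
    obtain t where t: "t \<in> S" "\<forall>x. r (t x) = x" using subgrpD(4)[OF S r(1)] by blast
    have "(s \<circ> r) \<circ> t \<in> S" by (rule subgrpD(3)[OF S r(2) t(1)])
    moreover have "(s \<circ> r) \<circ> t = s" using t(2) by (simp add: fun_eq_iff)
    ultimately show ?thesis by simp
  qed
  \<comment> \<open>The one-sided condition on \<open>M\<close> follows from the decomposition
    hypothesis and, at the end, holds for every \<open>s\<close> once \<open>M\<close> is the base
    field.\<close>
  have decomp: "s \<in> S" if s: "s \<in> ?A" and h: "\<And>x. x \<in> M ==> s x \<in> U ==> x \<in> U" for s
  proof -
    obtain v where v: "zval E (U \<inter> E) v" using zE[OF U(1)] by blast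
    interpret va: val_auts ?A E "U \<inter> E" v by (rule val_autsI[OF fE v])
    have h': "x \<in> U \<inter> E" if "x \<in> fin_auts.Fix S E" "s x \<in> U \<inter> E" for x
      using h[of x] that ME unfolding M_def by blast
    obtain s' where s': "s' \<in> S" "s \<circ> s' \<in> va.Dg" using va.contracts_to_decomposition[OF SA fS s h'] by blast
    have "va.Dg \<subseteq> S" using U(3) unfolding va.Dg_def .
    thus ?thesis using absorb[OF s'(1)] s'(2) by blast
  qed
  have "everywhere_unramified ?A M W U"
  proof (rule everywhere_unramified.intro[OF fM], rule everywhere_unramified_axioms.intro[OF kM FM])
    fix Q :: "'a poly" assume Q: "irred Q" "lcoeff Q = 1"
    note WQ = W[OF Q]
    show "vprime UNIV (W Q) \<and> W Q \<inter> kk = finite_prime Q \<and> (\<exists>v. zval M (W Q \<inter> M) v)"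
      using WQ zM by blast
  next
    fix Q s assume Q: "irred Q" "lcoeff Q = 1" and s: "s \<in> ?A"
      and h: "\<forall>x\<in>W Q \<inter> M. s x - x \<in> mm (W Q)"
    have W1: "place (W Q) (\<phi> Q)" and W2: "vprime UNIV (W Q)" using W[OF Q] by blast+
    note m = VE(2)[OF W2]
    obtain v where v: "zval E (W Q \<inter> E) v" using zE[OF W2] by blast
    interpret va: val_auts ?A E "W Q \<inter> E" v by (rule val_autsI[OF fE v])
    have IS: "va.Ig \<subseteq> S" using W[OF Q] unfolding va.Ig_def by blast
    have p: "prime CHAR('a)" "CHAR('a) = CHAR('a ac)" using prime_CHAR_finite_field by simp_all
    have "\<exists>a\<in>W Q \<inter> E. a \<notin> mm (W Q \<inter> E) \<and> (\<forall>\<gamma>\<in>va.Dg. \<gamma> a - a \<in> mm (W Q \<inter> E) --> \<gamma> \<in> va.Ig)"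
    proof (rule va.primitive_residue[OF p vprime_residue[OF VE(1)[OF W2]], of "\<phi> Q"])
      fix x y assume "x \<in> W Q \<inter> E" "y \<in> W Q \<inter> E"
      thus "\<phi> Q (x + y) = \<phi> Q x + \<phi> Q y" "\<phi> Q (x * y) = \<phi> Q x * \<phi> Q y" using W1 unfolding place_def by blast+
    next
      show "\<phi> Q 1 = 1" using W1 unfolding place_def by blast
      show "\<phi> Q x = 0 \<longleftrightarrow> x \<in> mm (W Q \<inter> E)" if "x \<in> W Q \<inter> E" for x
        using W1 that unfolding m place_def by blast
    qed
    then obtain a where a: "a \<in> W Q \<inter> E" "a \<notin> mm (W Q \<inter> E)"
      "\<forall>\<gamma>\<in>va.Dg. \<gamma> a - a \<in> mm (W Q \<inter> E) --> \<gamma> \<in> va.Ig" by blast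
    have "s \<in> S"
    proof (rule va.inertia_quotient[OF SA fS IS a s])
      fix x assume x: "x \<in> fin_auts.Fix S E" "x \<in> W Q \<inter> E"
      hence "s x - x \<in> mm (W Q)" using h unfolding M_def[symmetric] by blast
      moreover have "s x - x \<in> E" using tsubring_diff[OF tfieldD(1)[OF tE] normal_sepD(4)[OF nE s]] x(2) by blast
      ultimately show "s x - x \<in> mm (W Q \<inter> E)" unfolding m by blast
    qed
    thus "\<forall>x\<in>M. s x = x" by (simp add: MD)
  next
    show "vprime UNIV U" "var_T \<notin> U" "\<exists>v. zval M (U \<inter> M) v" using U(1,2) zM by auto
    fix s assume "s \<in> ?A" "\<forall>x\<in>M. s x \<in> U \<longleftrightarrow> x \<in> U"
    hence "s \<in> S" using decomp by blast
    thus "\<forall>x\<in>M. s x = x" by (simp add: MD)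
  qed
  hence Mk: "M = ?k" by (rule everywhere_unramified.everywhere_unramified_trivial)
  show ?thesis
  proof (rule decomp[OF s])
    show "x \<in> U" if "x \<in> M" "s x \<in> U" for x using that autsD(3)[OF s, of x] by (simp add: Mk)
  qed
qed

lemma map_fixD: "map f l = l ==> u \<in> set l ==> f u = u"
  by (metis in_set_conv_nth nth_map)

context witt_data
begin

text \<open>\<open>L\<close> may be infinite, so its elements are treated one at a time:
  \<open>E\<close> is generated by \<open>G\<close> and the orbit of \<open>x\<close>, is abelian
  over the base field because \<open>G\<close> and \<open>L\<close> are, and lies in
  \<open>H\<close>.\<close>

lemma G_maximal:
  assumes H: "abelian_ext K H \<and> unramified_ext K H \<and> infinity_splits K H" and GH: "G \<subseteq> H"
    and L: "abelian_ext kk L" "K \<subseteq> L" "L \<subseteq> H"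
  shows "L \<subseteq> G"
proof
  let ?k = "kk :: 'a ac set"
  fix x assume xL: "x \<in> L"
  note HN = hilbert_ext_normal[OF K_fin(1) H]
  have nL: "normal_sep ?k L" "commuting ?k L"
    using abelian_ext_imp[OF tfield_ratfun alg_over_ratfun subset_refl L(1)] by blast+
  define S0 where "S0 = gens \<union> orb ?k x"
  define E where "E = adjoin ?k S0"
  have fin0: "finite S0" unfolding S0_def gens_def using finite_orb[OF alg_over_ratfun subset_refl] by simp
  have gG: "gens \<subseteq> G" unfolding G_def by (rule adjoin_incl(2))
  have oL: "orb ?k x \<subseteq> L" unfolding orb_def using normal_sepD(4)[OF nL(1) _ xL] by blast
  have tE: "tfield E" unfolding E_def by (rule tfield_adjoin)
  have SE: "S0 \<subseteq> E" and kE: "?k \<subseteq> E" unfolding E_def by (rule adjoin_incl(2), rule adjoin_incl(1))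
  have GE: "G \<subseteq> E" unfolding G_def E_def by (rule adjoin_mono) (simp add: S0_def)
  have xE: "x \<in> E" using SE orb_self by (auto simp: S0_def)
  have EH: "E \<subseteq> H" unfolding E_def
    by (rule adjoin_minimal[OF HN(5,3)]) (use gG GH oL L(3) in "auto simp: S0_def")
  have KE: "K \<subseteq> E" using KG GE by blast
  have nE: "normal_sep ?k E"
    unfolding E_def
  proof (rule normal_sep_adjoin[OF tfield_ratfun alg_over_ratfun subset_refl tfield_ratfun])
    fix y assume y: "y \<in> S0"
    show "sep_elem ?k y"
      using y normal_sep_sep_elem[OF alg_over_ratfun subset_refl G_abelian(1)]
        normal_sep_sep_elem[OF alg_over_ratfun subset_refl nL(1)] gG oL unfolding S0_def by blast
    show "s y \<in> adjoin ?k S0" if s: "s \<in> auts ?k" for s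
    proof -
      consider "y \<in> G" | "y \<in> orb ?k x" using y gG unfolding S0_def by blast
      hence "s y \<in> E"
      proof cases
        case 1
        thus ?thesis using normal_sepD(4)[OF G_abelian(1) s] GE by blast
      next
        case 2
        hence "s y \<in> orb ?k x" using orb_aut[OF s, of x] by blast
        thus ?thesis using SE unfolding S0_def by blast
      qed
      thus ?thesis unfolding E_def .
    qed
  qed
  have fE: "fin_normal ?k E" unfolding fin_normal_def using nE fin0 E_def by blast
  have cE: "commuting ?k E"
    unfolding E_def
  proof (rule commuting_adjoin)
    fix s t y assume st: "s \<in> auts ?k" "t \<in> auts ?k" and "y \<in> S0"
    hence "y \<in> G \<or> y \<in> L" using gG oL unfolding S0_def by blast
    thus "s (t y) = t (s y)" using G_abelian(2) nL(2) st unfolding commuting_def by blast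
  qed
  have fKE: "fin_normal K E"
  proof -
    have "normal_sep K E"
      by (rule normal_sep_intermediate[OF tfield_ratfun alg_over_ratfun subset_refl tfield_ratfun nE K_fin(3,2) KE])
    moreover have "E = adjoin K S0"
    proof
      show "adjoin K S0 \<subseteq> E" by (rule adjoin_minimal[OF tE KE SE])
      show "E \<subseteq> adjoin K S0" unfolding E_def by (rule adjoin_minimal[OF tfield_adjoin]) (use K_fin(2) adjoin_incl in blast)+
    qed
    ultimately show ?thesis unfolding fin_normal_def using fin0 by blast
  qed
  interpret fa: fin_auts "auts ?k" E by (rule fin_normal_auts(1)[OF fE subset_refl])
  have com: "\<forall>s\<in>auts ?k. \<forall>t\<in>auts ?k. \<forall>x\<in>E. s (t x) = t (s x)" using cE unfolding commuting_def by blast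
  have "\<exists>V. \<exists>\<phi>. place V \<phi> \<and> vprime UNIV V \<and> V \<inter> kk = finite_prime Q"
    if "irred Q" "lcoeff Q = 1" for Q :: "'a poly"
    by (rule finite_place_exists[OF that])
  then obtain W where "\<forall>Q :: 'a poly. irred Q \<and> lcoeff Q = 1 -->
      (\<exists>\<phi>. place (W Q) \<phi> \<and> vprime UNIV (W Q) \<and> W Q \<inter> kk = finite_prime Q)" by metis
  then obtain \<phi> where W: "\<forall>Q :: 'a poly. irred Q \<and> lcoeff Q = 1 -->
      place (W Q) (\<phi> Q) \<and> vprime UNIV (W Q) \<and> W Q \<inter> kk = finite_prime Q" by metis
  obtain U :: "'a ac set" where U: "vprime UNIV U" "var_T \<notin> U" using infinite_place_exists by blast
  have VE: "vprime E (V \<inter> E)" "(V \<inter> E) \<inter> kk = V \<inter> kk" and VH: "vprime H (V \<inter> H)"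
    if "vprime UNIV V" for V
    using vprime_restrict(1,3)[OF that tE kE] vprime_restrict(1)[OF that HN(5,3)] by auto
  define I where "I V = {s\<in>auts ?k. \<forall>x\<in>V \<inter> E. s x - x \<in> mm (V \<inter> E)}" for V
  define D where "D = {s\<in>auts ?k. \<forall>x\<in>E. s x \<in> U \<inter> E \<longleftrightarrow> x \<in> U \<inter> E}"
  have gI: "subgrp (auts ?k) (I V)" if V: "vprime UNIV V" for V
  proof -
    obtain v where v: "zval E (V \<inter> E) v" using fin_normal_zval_ratfun[OF fE VE(1)[OF V]] by blast
    interpret va: val_auts "auts ?k" E "V \<inter> E" v by (rule val_autsI[OF fa.fin_auts_axioms v])
    show ?thesis using va.subgrp_Ig unfolding I_def va.Ig_def .
  qed
  have gD: "subgrp (auts ?k) D"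
    and Dm: "\<And>s x. s \<in> D ==> x \<in> mm (U \<inter> E) ==> s x \<in> mm (U \<inter> E)"
  proof -
    obtain v where v: "zval E (U \<inter> E) v" using fin_normal_zval_ratfun[OF fE VE(1)[OF U(1)]] by blast
    interpret va: val_auts "auts ?k" E "U \<inter> E" v by (rule val_autsI[OF fa.fin_auts_axioms v])
    have e: "D = va.Dg" unfolding D_def va.Dg_def ..
    show "subgrp (auts ?k) D" unfolding e by (rule va.subgrp_Dg)
    show "s x \<in> mm (U \<inter> E)" if "s \<in> D" "x \<in> mm (U \<inter> E)" for s x
      using va.Dg_max_ideal[of s x] va.VL(2)[OF that(2)] that unfolding e by blast
  qed
  have trivial: "s y = y" if s: "s \<in> auts ?k" "\<And>x. x \<in> K ==> s x = x" and V: "vprime UNIV V" and y: "y \<in> E"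
    and c: "s \<in> I V \<or> var_T \<notin> V \<and> (\<forall>x\<in>mm (V \<inter> E). s x \<in> mm (V \<inter> E))" for s V y
  proof -
    have sK: "s \<in> auts K" using s unfolding auts_def by blast
    have e: "V \<inter> H \<inter> E = V \<inter> E" using EH by blast
    have "var_T \<in> H" using subsetD[OF HN(3) emb_ratfun] .
    hence "(\<forall>x\<in>V \<inter> E. s x - x \<in> mm (V \<inter> E)) \<or>
        var_T \<notin> V \<inter> H \<and> (\<forall>x\<in>mm (V \<inter> E). s x \<in> mm (V \<inter> E))"
      using c unfolding I_def by blast
    thus ?thesis by (rule hilbert_ext_piece_trivial[OF K_fin(1) H fKE EH VH[OF V] sK y, unfolded e])
  qed
  have I_fixes: "map s (z i) = z i" "j \<in> {1..r} ==> P j \<noteq> Q ==> map s (w' i j) = w' i j"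
    if Q: "irred Q" "lcoeff Q = 1" and s: "s \<in> I (W Q)" and i: "i \<in> {1..n}" for Q s i j
  proof -
    have WQ: "vprime UNIV (W Q)" "W Q \<inter> ?k = finite_prime Q" using W Q by blast+
    have s': "s \<in> auts ?k" "\<And>x. x \<in> W Q \<inter> E ==> s x - x \<in> mm (W Q \<inter> E)" using s unfolding I_def by blast+
    note f = finite_fixes[OF VE(1)[OF WQ(1)] GE Q VE(2)[OF WQ(1), unfolded WQ(2)] s' i]
    show "map s (z i) = z i" by (rule f(1))
    show "j \<in> {1..r} ==> P j \<noteq> Q ==> map s (w' i j) = w' i j" by (rule f(2))
  qed
  have UE: "var_T \<notin> U \<inter> E" using U(2) by blast
  have D_fixes: "map s (w' i j) = w' i j" if s: "s \<in> D" and ij: "i \<in> {1..n}" "j \<in> {1..r}" for s i j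
  proof (rule infinite_fixes[OF VE(1)[OF U(1)] GE UE _ Dm[OF s] ij])
    show "s \<in> auts ?k" using s unfolding D_def by blast
  qed
  \<comment> \<open>Index \<open>0\<close> stands for the infinite prime, whose decomposition group
    moves only the vectors \<open>z i\<close>; an index \<open>j > 0\<close> stands for
    \<open>P j\<close>, whose inertia group moves only the vectors \<open>w' i j\<close>.\<close>
  define C where "C j = (if j = 0 then D else I (W (P j)))" for j
  define Y where "Y j = (\<Union>i\<in>{1..n}. set (if j = 0 then z i else w' i j))" for j :: nat
  have WP: "vprime UNIV (W (P j))" if "j \<in> {1..r}" for j using W P(2)[OF that] by blast
  have C: "subgrp (auts ?k) (C j)" if "j \<in> {0..r}" for j
    using gD gI[OF WP, of j] that by (simp add: C_def)
  have CA: "s \<in> auts ?k" if "s \<in> C j" for s j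
    using that unfolding C_def D_def I_def by (auto split: if_splits)
  have YG: "Y j \<subseteq> G" if "j \<in> {0..r}" for j
    unfolding Y_def using gens_G(1)[of _ j] gens_G(2) that by (cases "j = 0") (simp_all add: UN_subset_iff)
  have fixes_other: "\<forall>j\<in>{0..r}. \<forall>j'\<in>{0..r}. j' \<noteq> j --> (\<forall>s\<in>C j. \<forall>y\<in>Y j'. s y = y)"
  proof (intro ballI impI)
    fix j j' s y assume j: "j \<in> {0..r}" and j': "j' \<in> {0..r}" "j' \<noteq> j" and s: "s \<in> C j" and "y \<in> Y j'"
    then obtain i where i: "i \<in> {1..n}" "y \<in> set (if j' = 0 then z i else w' i j')" unfolding Y_def by blast
    have "map s (if j' = 0 then z i else w' i j') = (if j' = 0 then z i else w' i j')"
    proof (cases "j = 0")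
      case True
      thus ?thesis using D_fixes[OF _ i(1), of s j'] s j' by (simp add: C_def)
    next
      case False
      hence j1: "j \<in> {1..r}" using j by simp
      have *: "P j' \<noteq> P j" if "j' \<noteq> 0" using inj_onD[OF P(1), of j' j] j1 j' that by auto
      have "s \<in> I (W (P j))" using s False by (simp add: C_def)
      note f = I_fixes[OF conjunct1[OF P(2)[OF j1]] conjunct2[OF P(2)[OF j1]] this i(1)]
      show ?thesis using f(1) f(2)[of j'] * j'(1) by simp
    qed
    thus "s y = y" by (rule map_fixD[OF _ i(2)])
  qed
  have G_fixed': "s y = y" if s: "s \<in> auts ?k" "\<forall>j\<in>{0..r}. \<forall>u\<in>Y j. s u = u" and y: "y \<in> G" for s y
  proof (rule G_fixed[OF autsD(1,3)[OF s(1)] _ _ y])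
    show "map s (w' i j) = w' i j" if "i \<in> {1..n}" "j \<in> {1..r}" for i j
      by (rule map_idI) (use bspec[OF s(2), of j] that in "auto simp: Y_def")
    show "map s (z i) = z i" if "i \<in> {1..n}" for i
      by (rule map_idI) (use bspec[OF s(2), of 0] that in "auto simp: Y_def")
  qed
  have C_trivial: "s y = y" if j: "j \<in> {0..r}" and s: "s \<in> C j" "\<forall>j\<in>{0..r}. \<forall>u\<in>Y j. s u = u" and y: "y \<in> E" for j s y
  proof -
    have K: "s u = u" if "u \<in> K" for u by (rule G_fixed'[OF CA[OF s(1)] s(2)]) (use KG that in blast)
    show ?thesis
    proof (cases "j = 0")
      case True
      thus ?thesis using trivial[OF CA[OF s(1)] K U(1) y] Dm s(1) U(2) by (simp add: C_def)
    next
      case False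
      thus ?thesis using trivial[OF CA[OF s(1)] K WP y, of j] s(1) j by (simp add: C_def)
    qed
  qed
  define S where "S = fa.prods (map C [0..<Suc r])"
  have Cs: "\<forall>B\<in>set (map C [0..<Suc r]). subgrp (auts ?k) B" using C by auto
  have sS: "subgrp (auts ?k) S" unfolding S_def by (rule fa.prods_subgrp[OF com Cs])
  have CS: "C j \<subseteq> S" if "j \<in> {0..r}" for j
  proof -
    have "C j \<in> set (map C [0..<Suc r])" unfolding set_map set_upt using that by auto
    thus ?thesis unfolding S_def using fa.prods_incl[OF com Cs] by blast
  qed
  have IS: "I (W Q) \<subseteq> S" if Q: "irred Q" "lcoeff Q = 1" for Q
  proof (cases "\<exists>j\<in>{1..r}. P j = Q")
    case True
    then obtain j where "j \<in> {1..r}" "P j = Q" by blast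
    thus ?thesis using CS[of j] by (simp add: C_def)
  next
    \<comment> \<open>At a prime outside the list, inertia fixes all generators of \<open>G\<close>,
      hence \<open>K\<close>; as inertia over \<open>K\<close> inside \<open>H\<close> it is trivial
      on \<open>E\<close>.\<close>
    case False
    show ?thesis
    proof
      fix s assume s: "s \<in> I (W Q)"
      hence sA: "s \<in> auts ?k" unfolding I_def by blast
      have "s u = u" if "u \<in> G" for u
        by (rule G_fixed[OF autsD(1,3)[OF sA] _ _ that]) (use I_fixes[OF Q s] False in blast)+
      hence "s u = u" if "u \<in> K" for u using KG that by blast
      hence "\<forall>u\<in>E. s u = id u" using trivial[OF sA, of "W Q"] W Q s by simp
      thus "s \<in> S" unfolding S_def
        by (rule fa.prods_cong[OF com sA subgrpD(2)[OF sS, unfolded S_def]])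
    qed
  qed
  have AS: "s \<in> S" if "s \<in> auts ?k" for s
  proof (rule generated_by_inertia[OF fE cE sS _ U _ that])
    show "place (W Q) (\<phi> Q) \<and> vprime UNIV (W Q) \<and> W Q \<inter> ?k = finite_prime Q \<and>
        {s\<in>auts ?k. \<forall>x\<in>W Q \<inter> E. s x - x \<in> mm (W Q \<inter> E)} \<subseteq> S" if "irred Q" "lcoeff Q = 1" for Q
      using W IS[OF that] that unfolding I_def by blast
    show "{s\<in>auts ?k. \<forall>x\<in>E. s x \<in> U \<inter> E \<longleftrightarrow> x \<in> U \<inter> E} \<subseteq> S"
      using CS[of 0] unfolding C_def D_def by simp
  qed
  show "x \<in> G"
  proof (rule normal_sepD(5)[OF normal_sep_intermediate[OF tfield_ratfun alg_over_ratfun subset_refl tfield_ratfun nE tG GE] xE])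
    fix s assume "s \<in> auts G"
    hence s: "s \<in> auts ?k" and fx: "\<And>u. u \<in> G ==> s u = u" using auts_mono[OF tG(2)] autsD(3) by blast+
    have YE: "Y j \<subseteq> E" if "j \<in> {0..r}" for j using YG[OF that] GE by blast
    show "s x = x"
    proof (rule fa.prods_trivial[of "{0..r}" C Y "[0..<Suc r]" s x, OF com])
      show "s \<in> fa.prods (map C [0..<Suc r])" using AS[OF s] unfolding S_def .
      show "\<forall>j\<in>{0..r}. \<forall>y\<in>Y j. s y = y" using fx YG by blast
      show "t y = y" if "j \<in> {0..r}" "t \<in> C j" "\<forall>j'\<in>{0..r}. \<forall>y\<in>Y j'. t y = y" "y \<in> E" for j t y
        using that by (rule C_trivial)
      show "set [0..<Suc r] \<subseteq> {0..r}" by auto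
    qed (fact C YE fixes_other xE distinct_upt)+
  qed
qed

lemma genus_field: "is_genus_field K G"
proof -
  obtain H where H: "is_hilbert_class_field K H" using hilbert_class_field_exists[OF K_fin(1)] by blast
  hence h: "abelian_ext K H \<and> unramified_ext K H \<and> infinity_splits K H" and GH: "G \<subseteq> H"
    using G_hilbert_ext unfolding is_hilbert_class_field_def Let_def by blast+
  have "abelian_ext kk G"
    by (rule abelian_extI[OF tfield_ratfun alg_over_ratfun subset_refl G_abelian(1,2)])
  thus ?thesis
    unfolding is_genus_field_def Let_def using H GH KG G_maximal[OF h GH] by blast
qed

end

lemma is_rhom_to_ac: "is_rhom to_ac"
  by (simp add: is_rhom_def)

theorem corollary6p6:
  fixes p s r :: nat
    and K :: "'a::{finite, field} poly fract alg_closure set"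
    and K' :: "nat \<Rightarrow> 'a poly fract alg_closure set"
    and \<alpha> v :: "nat \<Rightarrow> nat"
    and P :: "nat \<Rightarrow> 'a poly"
    and \<xi> \<gamma> :: "nat \<Rightarrow> 'a poly fract list"
    and \<delta> :: "nat \<Rightarrow> nat \<Rightarrow> 'a poly fract list"
    and w z :: "nat \<Rightarrow> 'a poly fract alg_closure list"
    and w' :: "nat \<Rightarrow> nat \<Rightarrow> 'a poly fract alg_closure list"
  assumes "p = CHAR('a)"
    and "ring.finite_dimension ambient ratfun_field K"
    and "abelian_ext ratfun_field K"
    and "\<exists>n. Coset.order (galois_group ratfun_field K) = p ^ n"
    and "galois_group ratfun_field K \<cong>
           product_group {1..s} (\<lambda>i. integer_mod_group (p ^ \<alpha> i))"
    and "\<And>i. i \<in> {1..s} \<Longrightarrow>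
           galois_group ratfun_field (K' i) \<cong> integer_mod_group (p ^ \<alpha> i)"
    and "K = adjoin ratfun_field (\<Union>i\<in>{1..s}. K' i)"
    and "inj_on P {1..r}"
    and "P ` {1..r} = {Q. Factorial_Ring.irreducible Q \<and> Polynomial.lead_coeff Q = 1 \<and>
                          ramified_in Q K}"
    and "\<And>i. i \<in> {1..s} \<Longrightarrow> length (\<xi> i) = v i \<and> length (w i) = v i \<and>
                            length (\<gamma> i) = v i \<and> length (z i) = v i"
    and "\<And>i j. i \<in> {1..s} \<Longrightarrow> j \<in> {1..r} \<Longrightarrow>
                            length (\<delta> i j) = v i \<and> length (w' i j) = v i"
    and "\<And>i. i \<in> {1..s} \<Longrightarrow> K' i = adjoin ratfun_field (set (w i))"
    and "\<And>i. i \<in> {1..s} \<Longrightarrow> witt_diff p (witt_frob p (w i)) (w i) = map to_ac (\<xi> i)"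
    and "\<And>i. i \<in> {1..s} \<Longrightarrow> \<xi> i = foldr (witt_add p) (map (\<delta> i) [1..<Suc r]) (\<gamma> i)"
    and "\<And>i j c. i \<in> {1..s} \<Longrightarrow> j \<in> {1..r} \<Longrightarrow> c \<in> set (\<delta> i j) \<Longrightarrow>
                            proper_fraction_at (P j) c"
    and "\<And>i c. i \<in> {1..s} \<Longrightarrow> c \<in> set (\<gamma> i) \<Longrightarrow> is_polynomial c"
    and "\<And>i j. i \<in> {1..s} \<Longrightarrow> j \<in> {1..r} \<Longrightarrow>
           witt_diff p (witt_frob p (w' i j)) (w' i j) = map to_ac (\<delta> i j)"
    and "\<And>i. i \<in> {1..s} \<Longrightarrow> witt_diff p (witt_frob p (z i)) (z i) = map to_ac (\<gamma> i)"
  shows "is_genus_field K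
           (adjoin ratfun_field
              ((\<Union>i\<in>{1..s}. \<Union>j\<in>{1..r}. set (w' i j)) \<union> (\<Union>i\<in>{1..s}. set (z i))))"
proof -
  note [simp del] = atLeastAtMost_iff
  have len: "length (\<xi> i) = v i" "length (w i) = v i" "length (\<gamma> i) = v i" "length (z i) = v i"
    if "i \<in> {1..s}" for i
    using assms(10)[OF that] by blast+
  have len': "length (\<delta> i j) = v i" "length (w' i j) = v i" if "i \<in> {1..s}" "j \<in> {1..r}" for i j
    using assms(11)[OF that] by blast+
  have pp: "prime p" "p = CHAR('a ac)" using prime_CHAR_finite_field[where ?'a = 'a] assms(1) by simp_all
  note asw = asw_def[OF pp]
  have "K = adjoin kk (\<Union>i\<in>{1..s}. set (w i))"
    unfolding assms(7)
  proof
    show "adjoin kk (\<Union>i\<in>{1..s}. K' i) \<subseteq> adjoin kk (\<Union>i\<in>{1..s}. set (w i))"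
    proof (rule adjoin_minimal[OF tfield_adjoin adjoin_incl(1)], rule UN_least)
      fix i assume i: "i \<in> {1..s}"
      hence "set (w i) \<subseteq> (\<Union>i\<in>{1..s}. set (w i))" by blast
      thus "K' i \<subseteq> adjoin kk (\<Union>i\<in>{1..s}. set (w i))"
        unfolding assms(12)[OF i] by (rule adjoin_mono)
    qed
    have "set (w i) \<subseteq> K' i" if "i \<in> {1..s}" for i
      unfolding assms(12)[OF that] by (rule adjoin_incl(2))
    thus "adjoin kk (\<Union>i\<in>{1..s}. set (w i)) \<subseteq> adjoin kk (\<Union>i\<in>{1..s}. K' i)"
      by (intro adjoin_mono) blast
  qed
  moreover have "irred (P j) \<and> lcoeff (P j) = 1" if "j \<in> {1..r}" for j
    using assms(9) that by blast
  moreover have "asw p (w i) = foldr (witt_add p) (map (\<lambda>j. asw p (w' i j)) [1..<Suc r]) (asw p (z i))"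
    if i: "i \<in> {1..s}" for i
  proof -
    have r: "set [1..<Suc r] = {1..r}" by (auto simp: atLeastAtMost_iff)
    have "asw p (w i) = map to_ac (foldr (witt_add p) (map (\<delta> i) [1..<Suc r]) (\<gamma> i))"
      unfolding asw assms(14)[OF i, symmetric] by (rule assms(13)[OF i])
    also have "\<dots> = foldr (witt_add p) (map (\<lambda>j. map to_ac (\<delta> i j)) [1..<Suc r]) (map to_ac (\<gamma> i))"
      by (rule map_foldr_witt_add[OF is_rhom_to_ac pp(1) _ len(3)[OF i]]) (use len'(1)[OF i] r in blast)
    also have "map (\<lambda>j. map to_ac (\<delta> i j)) [1..<Suc r] = map (\<lambda>j. asw p (w' i j)) [1..<Suc r]"
      by (rule map_cong[OF refl]) (simp only: r asw assms(17)[OF i])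
    finally show ?thesis unfolding asw assms(18)[OF i] .
  qed
  moreover have "\<exists>c. u = to_ac c \<and> proper_fraction_at (P j) c"
    if "i \<in> {1..s}" "j \<in> {1..r}" "u \<in> set (asw p (w' i j))" for i j u
    using that(3) assms(15)[OF that(1,2)] unfolding asw assms(17)[OF that(1,2)] by auto
  moreover have "\<exists>c. u = to_ac c \<and> is_polynomial c" if "i \<in> {1..s}" "u \<in> set (asw p (z i))" for i u
    using that(2) assms(16)[OF that(1)] unfolding asw assms(18)[OF that(1)] by auto
  ultimately have d: "witt_data p s r K P w z w'"
    using assms(1,3,8) len len' by (intro witt_data.intro) simp_all
  show ?thesis
    using witt_data.genus_field[OF d] unfolding witt_data.G_def[OF d] witt_data.gens_def[OF d] .
qed

end
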